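(* Let $E_1,E_2,E_3$ be spectral measures on a Hilbert space $\mathcal H$ and let $\Psi\in L^\infty(E_1)\otimes_{\rm h}L^\infty(E_2)\otimes^{\rm h}L^\infty(E_3)$ (the Haagerup-like tensor product of the first kind). Suppose that $T\in\boldsymbol S_p$ and $R\in\boldsymbol S_q$, where $q\ge2$ and $\frac1r:=\frac1p+\frac1q\in[\frac12,1]$. Then the triple operator integral of the first kind $$W=\int\!\!\int\!\!\int\Psi(x_1,x_2,x_3)\,dE_1(x_1)T\,dE_2(x_2)R\,dE_3(x_3)$$ belongs to $\boldsymbol S_r$ and $$\|W\|_{\boldsymbol S_r}\le\|\Psi\|_{L^\infty\otimes_{\rm h}L^\infty\otimes^{\rm h}L^\infty}\,\|T\|_{\boldsymbol S_p}\,\|R\|_{\boldsymbol S_q}.$$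
   Context: $\boldsymbol S_p$ ($0<p<\infty$) is the Schatten--von Neumann class; $1/\infty=0$, $T\in\boldsymbol S_\infty$ means that $T$ is bounded, with the operator norm. For $r\ge1$, $1/r+1/r'=1$. $\mathcal B$ is the space of infinite matrices inducing bounded operators on $\ell^2$, with the operator norm. For a spectral measure $E$, the norm in $L^\infty_E(\ell^2)$ (respectively $L^\infty_E(\mathcal B)$) is the $E$-essential supremum of the $\ell^2$-norm of the sequence (respectively operator norm of the matrix). Haagerup tensor product and its triple operator integrals: for spectral measures $F_1,F_2,F_3$ on $\mathcal H$, $L^\infty(F_1)\otimes_{\rm h}L^\infty(F_2)\otimes_{\rm h}L^\infty(F_3)$ is the space of functions $\Phi(y_1,y_2,y_3)=\sum_{j,k\ge0}a_j(y_1)b_{jk}(y_2)c_k(y_3)$ with $\{a_j\}\in L^\infty_{F_1}(\ell^2)$, $\{b_{jk}\}\in L^\infty_{F_2}(\mathcal B)$, $\{c_k\}\in L^\infty_{F_3}(\ell^2)$, and for bounded operators $X,Y$ one defines $$\iiint\Phi\,dF_1X\,dF_2Y\,dF_3=\sum_{j,k\ge0}\Big(\int a_j\,dF_1\Big)X\Big(\int b_{jk}\,dF_2\Big)Y\Big(\int c_k\,dF_3\Big)$$ (limit of rectangular partial sums in the weak operator topology, independent of the representation of $\Phi$). Haagerup-like tensor product of the first kind: $\Psi\in L^\infty(E_1)\otimes_{\rm h}L^\infty(E_2)\otimes^{\rm h}L^\infty(E_3)$ if $$\Psi(x_1,x_2,x_3)=\sum_{j,k\ge0}\alpha_j(x_1)\beta_k(x_2)\gamma_{jk}(x_3)$$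 with $\{\alpha_j\}\in L^\infty_{E_1}(\ell^2)$, $\{\beta_k\}\in L^\infty_{E_2}(\ell^2)$, $\{\gamma_{jk}\}\in L^\infty_{E_3}(\mathcal B)$; the norm $\|\Psi\|_{L^\infty\otimes_{\rm h}L^\infty\otimes^{\rm h}L^\infty}$ is the infimum over all such representations of $\|\{\alpha_j\}\|_{L^\infty(\ell^2)}\|\{\beta_k\}\|_{L^\infty(\ell^2)}\|\{\gamma_{jk}\}\|_{L^\infty(\mathcal B)}$. In this case the function $(x_2,x_3,x_1)\mapsto\Psi(x_1,x_2,x_3)$ belongs to $L^\infty(E_2)\otimes_{\rm h}L^\infty(E_3)\otimes_{\rm h}L^\infty(E_1)$. The triple operator integral of the first kind $W$ is defined by duality: it is the continuous linear functional $$Q\mapsto\operatorname{trace}\left(\left(\iiint\Psi(x_1,x_2,x_3)\,dE_2(x_2)R\,dE_3(x_3)Q\,dE_1(x_1)\right)T\right)$$ on $\boldsymbol S_{r'}$ (on the class of compact operators if $r=1$), identified with an operator $W$ via $Q\mapsto\operatorname{trace}(WQ)$; the inner integral is the triple operator integral with integrand $(x_2,x_3,x_1)\mapsto\Psi(x_1,x_2,x_3)$ in the Haagerup tensor product. *)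

theory Defs
  imports "HOL-Analysis.Analysis"
begin

section \<open>Complex Hilbert spaces and bounded operators\<close>

text \<open>A complex Hilbert space is presented on top of its underlying real Hilbert space, so that norm,
  topology and completeness are those of the library. The inner product is linear in the
  first argument.\<close>

class chilbert_space = real_inner + complete_space +
  fixes scaleC :: "complex \<Rightarrow> 'a \<Rightarrow> 'a"  (infixr "*\<^sub>C" 75)
    and cinner :: "'a \<Rightarrow> 'a \<Rightarrow> complex"
  assumes scaleC_add_right: "c *\<^sub>C (x + y) = c *\<^sub>C x + c *\<^sub>C y"
    and scaleC_add_left: "(c + d) *\<^sub>C x = c *\<^sub>C x + d *\<^sub>C x"
    and scaleC_scaleC: "c *\<^sub>C (d *\<^sub>C x) = (c * d) *\<^sub>C x"
    and scaleR_scaleC: "t *\<^sub>R x = complex_of_real t *\<^sub>C x"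
    and cinner_add_left: "cinner (x + y) z = cinner x z + cinner y z"
    and cinner_scaleC_left: "cinner (c *\<^sub>C x) y = c * cinner x y"
    and cinner_commute: "cinner x y = cnj (cinner y x)"
    and inner_eq_Re_cinner: "inner x y = Re (cinner x y)"

definition bounded_op :: "('h::chilbert_space \<Rightarrow> 'h) \<Rightarrow> bool" where
  "bounded_op A \<longleftrightarrow> bounded_linear A \<and> (\<forall>c x. A (c *\<^sub>C x) = c *\<^sub>C A x)"

definition compact_op :: "('h::chilbert_space \<Rightarrow> 'h) \<Rightarrow> bool" where
  "compact_op A \<longleftrightarrow> bounded_op A \<and> compact (closure (A ` cball 0 1))"

definition rank_le :: "('h::chilbert_space \<Rightarrow> 'h) \<Rightarrow> nat \<Rightarrow> bool" where
  "rank_le K n \<longleftrightarrow> (\<exists>B. finite B \<and> card B \<le> n \<and> range K \<subseteq> module.span scaleC B)"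

definition orthonormal_basis :: "'h::chilbert_space set \<Rightarrow> bool" where
  "orthonormal_basis B \<longleftrightarrow>
     (\<forall>e\<in>B. \<forall>f\<in>B. cinner e f = (if e = f then 1 else 0)) \<and> closure (module.span scaleC B) = UNIV"

text \<open>Only meaningful for operators of trace class, where the sum does not depend on the basis.\<close>

definition op_trace :: "('h::chilbert_space \<Rightarrow> 'h) \<Rightarrow> complex" where
  "op_trace A = (THE t. \<forall>B. orthonormal_basis B \<longrightarrow> ((\<lambda>e. cinner (A e) e) has_sum t) B)"


section \<open>Schatten--von Neumann classes\<close>

definition singular_value :: "('h::chilbert_space \<Rightarrow> 'h) \<Rightarrow> nat \<Rightarrow> real" where
  "singular_value A n = Inf {onorm (\<lambda>x. A x - K x) | K. bounded_op K \<and> rank_le K n}"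

text \<open>The exponent ranges over \<open>(0, \<infinity>]\<close>; for \<open>\<infinity>\<close> one gets all bounded operators with the
  operator norm.\<close>

definition schatten :: "ennreal \<Rightarrow> ('h::chilbert_space \<Rightarrow> 'h) set" where
  "schatten p = {A. bounded_op A \<and>
     (p < \<infinity> \<longrightarrow> summable (\<lambda>n. singular_value A n powr enn2real p))}"

definition schatten_norm :: "ennreal \<Rightarrow> ('h::chilbert_space \<Rightarrow> 'h) \<Rightarrow> real" where
  "schatten_norm p A =
     (if p = \<infinity> then onorm A
      else (\<Sum>n. singular_value A n powr enn2real p) powr (1 / enn2real p))"

text \<open>The space on which the functional defining the triple operator integral acts: the Schatten
  class with the conjugate exponent of \<open>r\<close>, and the compact operators for \<open>r = 1\<close>.\<close>

definition schatten_predual :: "ennreal \<Rightarrow> ('h::chilbert_space \<Rightarrow> 'h) set" where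
  "schatten_predual r = (if r = 1 then {Q. compact_op Q} else schatten (1 / (1 - 1 / r)))"


section \<open>The sequence space and bounded infinite matrices\<close>

definition ell2 :: "(nat \<Rightarrow> complex) set" where
  "ell2 = {x. summable (\<lambda>n. (cmod (x n))\<^sup>2)}"

definition ell2_norm :: "(nat \<Rightarrow> complex) \<Rightarrow> real" where
  "ell2_norm x = sqrt (\<Sum>n. (cmod (x n))\<^sup>2)"

definition mat_bound :: "(nat \<Rightarrow> nat \<Rightarrow> complex) \<Rightarrow> real \<Rightarrow> bool" where
  "mat_bound b C \<longleftrightarrow> 0 \<le> C \<and>
     (\<forall>x\<in>ell2. (\<forall>j. summable (\<lambda>k. b j k * x k)) \<and>
        (\<lambda>j. \<Sum>k. b j k * x k) \<in> ell2 \<and>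
        ell2_norm (\<lambda>j. \<Sum>k. b j k * x k) \<le> C * ell2_norm x)"

definition bounded_mat :: "(nat \<Rightarrow> nat \<Rightarrow> complex) set" where
  "bounded_mat = {b. \<exists>C. mat_bound b C}"

definition mat_norm :: "(nat \<Rightarrow> nat \<Rightarrow> complex) \<Rightarrow> real" where
  "mat_norm b = Inf {C. mat_bound b C}"


section \<open>Spectral measures\<close>

text \<open>The library type \<open>measure\<close> only supplies the \<open>\<sigma>\<close>-algebra on which a spectral measure \<open>E\<close> is
  defined; its own measure plays no role.\<close>

definition spectral_measure :: "'x measure \<Rightarrow> ('x set \<Rightarrow> 'h::chilbert_space \<Rightarrow> 'h) \<Rightarrow> bool" where
  "spectral_measure M E \<longleftrightarrow>
     (\<forall>A\<in>sets M. bounded_op (E A) \<and> (\<forall>u v. cinner (E A u) v = cinner u (E A v))) \<and>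
     (\<forall>A\<in>sets M. \<forall>B\<in>sets M. \<forall>u. E (A \<inter> B) u = E A (E B u)) \<and>
     (\<forall>u. E {} u = 0) \<and> (\<forall>u. E (space M) u = u) \<and>
     (\<forall>A. range A \<subseteq> sets M \<longrightarrow> disjoint_family A \<longrightarrow>
        (\<forall>u. (\<lambda>n. E (A n) u) sums E (\<Union>n. A n) u))"

definition null_sets_spec :: "'x measure \<Rightarrow> ('x set \<Rightarrow> 'h::chilbert_space \<Rightarrow> 'h) \<Rightarrow> 'x set set" where
  "null_sets_spec M E = {N \<in> sets M. \<forall>u. E N u = 0}"

definition AE_spec :: "'x measure \<Rightarrow> ('x set \<Rightarrow> 'h::chilbert_space \<Rightarrow> 'h) \<Rightarrow> ('x \<Rightarrow> bool) \<Rightarrow> bool" where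
  "AE_spec M E P \<longleftrightarrow> (\<exists>N\<in>null_sets_spec M E. \<forall>x\<in>space M - N. P x)"

text \<open>Essential supremum of a nonnegative function.\<close>

definition esssup_spec :: "'x measure \<Rightarrow> ('x set \<Rightarrow> 'h::chilbert_space \<Rightarrow> 'h) \<Rightarrow> ('x \<Rightarrow> real) \<Rightarrow> real" where
  "esssup_spec M E f = Inf {C. 0 \<le> C \<and> AE_spec M E (\<lambda>x. f x \<le> C)}"

text \<open>The finite positive measure \<open>A \<mapsto> (E(A)u, u)\<close>.\<close>

definition spec_vec_measure ::
    "'x measure \<Rightarrow> ('x set \<Rightarrow> 'h::chilbert_space \<Rightarrow> 'h) \<Rightarrow> 'h \<Rightarrow> 'x measure" where
  "spec_vec_measure M E u =
     measure_of (space M) (sets M) (\<lambda>A. ennreal (Re (cinner (E A u) u)))"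

text \<open>\<open>\<integral> f dE\<close> for an essentially bounded measurable \<open>f\<close>. The operator is determined by its
  quadratic form, since the scalars are complex.\<close>

definition spec_integral ::
    "'x measure \<Rightarrow> ('x set \<Rightarrow> 'h::chilbert_space \<Rightarrow> 'h) \<Rightarrow> ('x \<Rightarrow> complex) \<Rightarrow> 'h \<Rightarrow> 'h" where
  "spec_integral M E f =
     (THE A. bounded_op A \<and> (\<forall>u. cinner (A u) u = (LINT x|spec_vec_measure M E u. f x)))"

text \<open>A sequence of functions \<open>a\<close> stands for the function \<open>x \<mapsto> {a\<^sub>j(x)}\<close>, and similarly for
  matrices.\<close>

definition Linf_ell2 ::
    "'x measure \<Rightarrow> ('x set \<Rightarrow> 'h::chilbert_space \<Rightarrow> 'h) \<Rightarrow> (nat \<Rightarrow> 'x \<Rightarrow> complex) set" where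
  "Linf_ell2 M E = {a. (\<forall>j. a j \<in> borel_measurable M) \<and>
     (\<exists>C. AE_spec M E (\<lambda>x. (\<lambda>j. a j x) \<in> ell2 \<and> ell2_norm (\<lambda>j. a j x) \<le> C))}"

definition Linf_ell2_norm ::
    "'x measure \<Rightarrow> ('x set \<Rightarrow> 'h::chilbert_space \<Rightarrow> 'h) \<Rightarrow> (nat \<Rightarrow> 'x \<Rightarrow> complex) \<Rightarrow> real" where
  "Linf_ell2_norm M E a = esssup_spec M E (\<lambda>x. ell2_norm (\<lambda>j. a j x))"

definition Linf_mat ::
    "'x measure \<Rightarrow> ('x set \<Rightarrow> 'h::chilbert_space \<Rightarrow> 'h) \<Rightarrow> (nat \<Rightarrow> nat \<Rightarrow> 'x \<Rightarrow> complex) set" where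
  "Linf_mat M E = {b. (\<forall>j k. b j k \<in> borel_measurable M) \<and>
     (\<exists>C. AE_spec M E (\<lambda>x. (\<lambda>j k. b j k x) \<in> bounded_mat \<and> mat_norm (\<lambda>j k. b j k x) \<le> C))}"

definition Linf_mat_norm ::
    "'x measure \<Rightarrow> ('x set \<Rightarrow> 'h::chilbert_space \<Rightarrow> 'h) \<Rightarrow> (nat \<Rightarrow> nat \<Rightarrow> 'x \<Rightarrow> complex) \<Rightarrow> real" where
  "Linf_mat_norm M E b = esssup_spec M E (\<lambda>x. mat_norm (\<lambda>j k. b j k x))"


section \<open>Triple operator integrals with integrand in the Haagerup tensor product\<close>

text \<open>Double series are limits of rectangular partial sums: they need not converge absolutely.\<close>

definition double_sums :: "(nat \<Rightarrow> nat \<Rightarrow> complex) \<Rightarrow> complex \<Rightarrow> bool" where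
  "double_sums f s \<longleftrightarrow>
     ((\<lambda>(m, n). \<Sum>j<m. \<Sum>k<n. f j k) \<longlongrightarrow> s) (sequentially \<times>\<^sub>F sequentially)"

text \<open>The components of a representation are defined up to null sets only, so the representing
  identity is required off a null set in each of the three variables.\<close>

definition haagerup_rep ::
    "'a measure \<Rightarrow> ('a set \<Rightarrow> 'h::chilbert_space \<Rightarrow> 'h) \<Rightarrow>
     'b measure \<Rightarrow> ('b set \<Rightarrow> 'h \<Rightarrow> 'h) \<Rightarrow>
     'c measure \<Rightarrow> ('c set \<Rightarrow> 'h \<Rightarrow> 'h) \<Rightarrow> ('a \<Rightarrow> 'b \<Rightarrow> 'c \<Rightarrow> complex) \<Rightarrow>
     (nat \<Rightarrow> 'a \<Rightarrow> complex) \<Rightarrow> (nat \<Rightarrow> nat \<Rightarrow> 'b \<Rightarrow> complex) \<Rightarrow> (nat \<Rightarrow> 'c \<Rightarrow> complex) \<Rightarrow> bool" where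
  "haagerup_rep M1 F1 M2 F2 M3 F3 \<Phi> a b c \<longleftrightarrow>
     a \<in> Linf_ell2 M1 F1 \<and> b \<in> Linf_mat M2 F2 \<and> c \<in> Linf_ell2 M3 F3 \<and>
     (\<exists>N1\<in>null_sets_spec M1 F1. \<exists>N2\<in>null_sets_spec M2 F2. \<exists>N3\<in>null_sets_spec M3 F3.
        \<forall>y1\<in>space M1 - N1. \<forall>y2\<in>space M2 - N2. \<forall>y3\<in>space M3 - N3.
          double_sums (\<lambda>j k. a j y1 * b j k y2 * c k y3) (\<Phi> y1 y2 y3))"

text \<open>\<open>J = \<integral>\<integral>\<integral> \<Phi> dF\<^sub>1 X dF\<^sub>2 Y dF\<^sub>3\<close>: the integrand has a representation, and for every
  representation the rectangular partial sums converge to \<open>J\<close> in the weak operator topology.\<close>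

definition has_haagerup_integral ::
    "'a measure \<Rightarrow> ('a set \<Rightarrow> 'h::chilbert_space \<Rightarrow> 'h) \<Rightarrow>
     'b measure \<Rightarrow> ('b set \<Rightarrow> 'h \<Rightarrow> 'h) \<Rightarrow>
     'c measure \<Rightarrow> ('c set \<Rightarrow> 'h \<Rightarrow> 'h) \<Rightarrow> ('a \<Rightarrow> 'b \<Rightarrow> 'c \<Rightarrow> complex) \<Rightarrow>
     ('h \<Rightarrow> 'h) \<Rightarrow> ('h \<Rightarrow> 'h) \<Rightarrow> ('h \<Rightarrow> 'h) \<Rightarrow> bool" where
  "has_haagerup_integral M1 F1 M2 F2 M3 F3 \<Phi> X Y J \<longleftrightarrow>
     bounded_op J \<and>
     (\<exists>a b c. haagerup_rep M1 F1 M2 F2 M3 F3 \<Phi> a b c) \<and>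
     (\<forall>a b c. haagerup_rep M1 F1 M2 F2 M3 F3 \<Phi> a b c \<longrightarrow>
        (\<forall>u v. double_sums
           (\<lambda>j k. cinner (spec_integral M1 F1 (a j) (X (spec_integral M2 F2 (b j k)
                            (Y (spec_integral M3 F3 (c k) u))))) v)
           (cinner (J u) v)))"


section \<open>The Haagerup-like tensor product and triple operator integrals of the first kind\<close>

definition haagerup_first_rep ::
    "'a measure \<Rightarrow> ('a set \<Rightarrow> 'h::chilbert_space \<Rightarrow> 'h) \<Rightarrow>
     'b measure \<Rightarrow> ('b set \<Rightarrow> 'h \<Rightarrow> 'h) \<Rightarrow>
     'c measure \<Rightarrow> ('c set \<Rightarrow> 'h \<Rightarrow> 'h) \<Rightarrow> ('a \<Rightarrow> 'b \<Rightarrow> 'c \<Rightarrow> complex) \<Rightarrow>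
     (nat \<Rightarrow> 'a \<Rightarrow> complex) \<Rightarrow> (nat \<Rightarrow> 'b \<Rightarrow> complex) \<Rightarrow> (nat \<Rightarrow> nat \<Rightarrow> 'c \<Rightarrow> complex) \<Rightarrow> bool" where
  "haagerup_first_rep M1 E1 M2 E2 M3 E3 \<Psi> \<alpha> \<beta> \<gamma> \<longleftrightarrow>
     \<alpha> \<in> Linf_ell2 M1 E1 \<and> \<beta> \<in> Linf_ell2 M2 E2 \<and> \<gamma> \<in> Linf_mat M3 E3 \<and>
     (\<exists>N1\<in>null_sets_spec M1 E1. \<exists>N2\<in>null_sets_spec M2 E2. \<exists>N3\<in>null_sets_spec M3 E3.
        \<forall>x1\<in>space M1 - N1. \<forall>x2\<in>space M2 - N2. \<forall>x3\<in>space M3 - N3.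
          double_sums (\<lambda>j k. \<alpha> j x1 * \<beta> k x2 * \<gamma> j k x3) (\<Psi> x1 x2 x3))"

definition haagerup_first ::
    "'a measure \<Rightarrow> ('a set \<Rightarrow> 'h::chilbert_space \<Rightarrow> 'h) \<Rightarrow>
     'b measure \<Rightarrow> ('b set \<Rightarrow> 'h \<Rightarrow> 'h) \<Rightarrow>
     'c measure \<Rightarrow> ('c set \<Rightarrow> 'h \<Rightarrow> 'h) \<Rightarrow> ('a \<Rightarrow> 'b \<Rightarrow> 'c \<Rightarrow> complex) set" where
  "haagerup_first M1 E1 M2 E2 M3 E3 =
     {\<Psi>. \<exists>\<alpha> \<beta> \<gamma>. haagerup_first_rep M1 E1 M2 E2 M3 E3 \<Psi> \<alpha> \<beta> \<gamma>}"

definition haagerup_first_norm ::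
    "'a measure \<Rightarrow> ('a set \<Rightarrow> 'h::chilbert_space \<Rightarrow> 'h) \<Rightarrow>
     'b measure \<Rightarrow> ('b set \<Rightarrow> 'h \<Rightarrow> 'h) \<Rightarrow>
     'c measure \<Rightarrow> ('c set \<Rightarrow> 'h \<Rightarrow> 'h) \<Rightarrow> ('a \<Rightarrow> 'b \<Rightarrow> 'c \<Rightarrow> complex) \<Rightarrow> real" where
  "haagerup_first_norm M1 E1 M2 E2 M3 E3 \<Psi> =
     Inf {Linf_ell2_norm M1 E1 \<alpha> * Linf_ell2_norm M2 E2 \<beta> * Linf_mat_norm M3 E3 \<gamma> | \<alpha> \<beta> \<gamma>.
            haagerup_first_rep M1 E1 M2 E2 M3 E3 \<Psi> \<alpha> \<beta> \<gamma>}"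

text \<open>\<open>W\<close> represents, through \<open>Q \<mapsto> trace (W Q)\<close>, the functional
  \<open>Q \<mapsto> trace ((\<integral>\<integral>\<integral> \<Psi> dE\<^sub>2 R dE\<^sub>3 Q dE\<^sub>1) T)\<close>. The operators whose traces are
  compared are required to be of trace class.\<close>

definition has_first_kind_integral ::
    "'a measure \<Rightarrow> ('a set \<Rightarrow> 'h::chilbert_space \<Rightarrow> 'h) \<Rightarrow>
     'b measure \<Rightarrow> ('b set \<Rightarrow> 'h \<Rightarrow> 'h) \<Rightarrow>
     'c measure \<Rightarrow> ('c set \<Rightarrow> 'h \<Rightarrow> 'h) \<Rightarrow> ('a \<Rightarrow> 'b \<Rightarrow> 'c \<Rightarrow> complex) \<Rightarrow>
     ennreal \<Rightarrow> ('h \<Rightarrow> 'h) \<Rightarrow> ('h \<Rightarrow> 'h) \<Rightarrow> ('h \<Rightarrow> 'h) \<Rightarrow> bool" where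
  "has_first_kind_integral M1 E1 M2 E2 M3 E3 \<Psi> r T R W \<longleftrightarrow>
     bounded_op W \<and>
     (\<forall>Q\<in>schatten_predual r.
        \<exists>J. has_haagerup_integral M2 E2 M3 E3 M1 E1 (\<lambda>x2 x3 x1. \<Psi> x1 x2 x3) R Q J \<and>
            J \<circ> T \<in> schatten 1 \<and> W \<circ> Q \<in> schatten 1 \<and>
            op_trace (J \<circ> T) = op_trace (W \<circ> Q))"

definition first_kind_integral ::
    "'a measure \<Rightarrow> ('a set \<Rightarrow> 'h::chilbert_space \<Rightarrow> 'h) \<Rightarrow>
     'b measure \<Rightarrow> ('b set \<Rightarrow> 'h \<Rightarrow> 'h) \<Rightarrow>
     'c measure \<Rightarrow> ('c set \<Rightarrow> 'h \<Rightarrow> 'h) \<Rightarrow> ('a \<Rightarrow> 'b \<Rightarrow> 'c \<Rightarrow> complex) \<Rightarrow>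
     ennreal \<Rightarrow> ('h \<Rightarrow> 'h) \<Rightarrow> ('h \<Rightarrow> 'h) \<Rightarrow> 'h \<Rightarrow> 'h" where
  "first_kind_integral M1 E1 M2 E2 M3 E3 \<Psi> r T R =
     (THE W. has_first_kind_integral M1 E1 M2 E2 M3 E3 \<Psi> r T R W)"

end

theory Submission
  imports Defs
begin

text \<open>By Riesz representation, \<open>W\<close> is determined by the functional \<open>Q \<mapsto> trace (J\<^sub>Q T)\<close> on operators of
  rank one, where \<open>J\<^sub>Q = \<Sum> B\<^sub>k R \<Gamma>\<^sub>j\<^sub>k Q A\<^sub>j\<close> and \<open>A\<^sub>j, B\<^sub>k, \<Gamma>\<^sub>j\<^sub>k\<close> are the spectral integrals of the
  components of a representation of \<open>\<Psi>\<close>. So the theorem amounts to the bound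
  \<open>\<bar>trace (J\<^sub>Q T)\<bar> \<le> \<parallel>\<Psi>\<parallel> \<parallel>T\<parallel>\<^sub>p \<parallel>R\<parallel>\<^sub>q \<parallel>Q\<parallel>\<^sub>r\<^sub>'\<close>. In a basis of right singular vectors \<open>e\<close> of \<open>T\<close>, the trace is
  \<open>\<Sum>\<^sub>e (J\<^sub>Q T e, e)\<close>, and each term is at most
  \<open>\<parallel>\<Gamma>\<parallel> (\<Sum>\<^sub>j \<parallel>Q A\<^sub>j T e\<parallel>\<^sup>2)\<^sup>1\<^sup>/\<^sup>2 (\<Sum>\<^sub>k \<parallel>R\<^sup>* B\<^sub>k\<^sup>* e\<parallel>\<^sup>2)\<^sup>1\<^sup>/\<^sup>2\<close>. For exponents \<open>s \<ge> 2\<close> the sequence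
  \<open>(\<Sum>\<^sub>j \<parallel>Q A\<^sub>j x\<^sub>i\<parallel>\<^sup>2)\<^sup>1\<^sup>/\<^sup>2\<close> over an orthonormal system \<open>x\<close> has \<open>\<ell>\<^sup>s\<close>-norm at most \<open>\<parallel>A\<parallel> \<parallel>Q\<parallel>\<^sub>s\<close> (this is where
  \<open>q \<ge> 2\<close> and \<open>r' \<ge> 2\<close> enter), and Hoelder's inequality concludes. All norms are increased by \<open>\<epsilon>\<close>
  and \<open>\<epsilon> \<rightarrow> 0\<close> at the end.\<close>

section \<open>Geometry of complex Hilbert spaces\<close>

text \<open>What shapes the argument is that the sharp constant and the trace class statements are
  proved separately. The constant comes from duality alone: \<open>W\<close> is defined through the
  functional on operators of rank one, and its singular values are tested against finite diagonal
  operators with prescribed weights. For this the functional has to be linear in \<open>Q\<close>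
  before anything is known to be of trace class, so the trace is written as a sum over one basis
  that depends on \<open>T\<close> but not on \<open>Q\<close>. Operators \<open>Q\<close> enter
  only through a domination of \<open>norm (Q x)\<close> by a diagonal quadratic form, a condition
  that can be checked for test operators and for tails of expansions without computing singular
  values. That \<open>J \<circ> T\<close> and \<open>W \<circ> Q\<close> are of trace class carries
  no constant, and a lossy inequality for singular values of products suffices. Exponents are
  replaced by their reciprocals, with 0 for an infinite exponent; for \<open>p = \<infinity>\<close>
  the operator \<open>T\<close> need not be compact, so there may be no singular vectors to start
  from, and \<open>T\<close> is absorbed into the columns \<open>A j\<close> instead.\<close>

interpretation cvec: vector_space "scaleC :: complex \<Rightarrow> 'h \<Rightarrow> 'h::chilbert_space"
proof
  show "1 *\<^sub>C x = x" for x :: 'h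
    using scaleR_scaleC[of 1 x] by simp
qed (simp_all add: scaleC_add_right scaleC_add_left scaleC_scaleC)

lemma cinner_add_right: "cinner x (y + z) = cinner x y + cinner x z"
  for x :: "'h::chilbert_space"
  by (metis cinner_add_left cinner_commute complex_cnj_add)

lemma cinner_scaleC_right: "cinner x (c *\<^sub>C y) = cnj c * cinner x y"
  for x :: "'h::chilbert_space"
  by (metis cinner_commute cinner_scaleC_left complex_cnj_mult)

lemma cinner_zero [simp]: "cinner 0 x = 0" "cinner x 0 = 0"
  for x :: "'h::chilbert_space"
  using cinner_add_left[of 0 0 x] cinner_add_right[of x 0 0] by simp_all

lemma cinner_minus [simp]: "cinner (- x) y = - cinner x y" "cinner x (- y) = - cinner x y"
  for x :: "'h::chilbert_space"
  using cinner_add_left[of x "-x" y] cinner_add_right[of x y "-y"]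
  by (simp_all add: eq_neg_iff_add_eq_0 add.commute)

lemma cinner_diff_left: "cinner (x - y) z = cinner x z - cinner y z"
  for x :: "'h::chilbert_space"
  using cinner_add_left[of x "-y" z] by simp

lemma cinner_diff_right: "cinner x (y - z) = cinner x y - cinner x z"
  for x :: "'h::chilbert_space"
  using cinner_add_right[of x y "-z"] by simp

lemma cinner_sum_left: "cinner (\<Sum>i\<in>I. f i) y = (\<Sum>i\<in>I. cinner (f i) y)"
  for y :: "'h::chilbert_space"
  by (induction I rule: infinite_finite_induct) (simp_all add: cinner_add_left)

lemma cinner_sum_right: "cinner y (\<Sum>i\<in>I. f i) = (\<Sum>i\<in>I. cinner y (f i))"
  for y :: "'h::chilbert_space"
  by (induction I rule: infinite_finite_induct) (simp_all add: cinner_add_right)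

lemma cinner_self: "cinner x x = complex_of_real ((norm x)\<^sup>2)"
  for x :: "'h::chilbert_space"
proof -
  have "Im (cinner x x) = 0"
    using arg_cong[OF cinner_commute[of x x], of Im] by simp
  then show ?thesis
    by (simp add: complex_eq_iff inner_eq_Re_cinner[symmetric] dot_square_norm)
qed

lemma norm_scaleC: "norm (c *\<^sub>C x) = cmod c * norm x"
  for x :: "'h::chilbert_space"
proof -
  have "complex_of_real ((norm (c *\<^sub>C x))\<^sup>2) = c * cnj c * complex_of_real ((norm x)\<^sup>2)"
    by (simp add: cinner_self[symmetric] cinner_scaleC_left cinner_scaleC_right mult_ac del: of_real_power)
  also have "\<dots> = complex_of_real ((cmod c * norm x)\<^sup>2)"
    by (simp only: complex_norm_square[symmetric] of_real_mult power_mult_distrib)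
  finally have "(norm (c *\<^sub>C x))\<^sup>2 = (cmod c * norm x)\<^sup>2"
    by (simp only: of_real_eq_iff)
  then show ?thesis
    by (simp add: power2_eq_iff_nonneg)
qed

text \<open>Multiplying \<open>x\<close> by a unimodular scalar turns \<open>cinner x y\<close> into
  its modulus, hence into the real inner product, to which the real Cauchy-Schwarz inequality
  applies.\<close>

lemma cinner_bound: "cmod (cinner x y) \<le> norm x * norm y"
  for x :: "'h::chilbert_space"
proof (cases "cinner x y = 0")
  case False
  define c where "c = cnj (sgn (cinner x y))"
  have "cmod c = 1"
    using False by (simp add: c_def norm_sgn)
  have "c * cinner x y = complex_of_real (cmod (cinner x y))"
    using False
    by (simp add: c_def sgn_eq field_simps complex_norm_square[symmetric] power2_eq_square)
  then have "cmod (cinner x y) = inner (c *\<^sub>C x) y"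
    by (simp add: inner_eq_Re_cinner cinner_scaleC_left)
  also have "\<dots> \<le> norm (c *\<^sub>C x) * norm y"
    by (rule norm_cauchy_schwarz)
  finally show ?thesis
    by (simp add: norm_scaleC \<open>cmod c = 1\<close>)
qed simp

lemma cinner_cmod_commute: "cmod (cinner x y) = cmod (cinner y x)"
  for x :: "'h::chilbert_space"
  by (metis cinner_commute complex_mod_cnj)

lemma bounded_bilinear_cinner: "bounded_bilinear (cinner :: 'h::chilbert_space \<Rightarrow> 'h \<Rightarrow> complex)"
proof (unfold_locales, goal_cases)
  case (3 r a b)
  then show ?case by (simp add: scaleR_scaleC[of r a] cinner_scaleC_left scaleR_conv_of_real)
next
  case (4 a r b)
  then show ?case by (simp add: scaleR_scaleC[of r b] cinner_scaleC_right scaleR_conv_of_real)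
next
  case 5
  then show ?case by (intro exI[of _ 1]) (simp add: cinner_bound)
qed (simp_all add: cinner_add_left cinner_add_right)

lemmas tendsto_cinner [tendsto_intros] = bounded_bilinear.tendsto[OF bounded_bilinear_cinner]
lemmas bounded_linear_cinner_left = bounded_bilinear.bounded_linear_left[OF bounded_bilinear_cinner]

lemma cinner_ext_left: "x = y" if "\<And>z. cinner x z = cinner y z"
  for x :: "'h::chilbert_space"
proof -
  have "cinner (x - y) (x - y) = 0"
    using that by (simp add: cinner_diff_left)
  then show ?thesis by (simp add: cinner_self)
qed

lemma norm_le_cinner: "norm x \<le> C" if "\<And>z. cmod (cinner x z) \<le> C * norm z" and "0 \<le> C"
  for x :: "'h::chilbert_space"
proof (cases "x = 0")
  case False
  have "norm x * norm x \<le> C * norm x"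
    using that(1)[of x] unfolding cinner_self norm_of_real by (simp add: power2_eq_square)
  then show ?thesis using False by simp
qed (use that in simp)


subsection \<open>Bounded operators\<close>

lemma bounded_opI:
  assumes "\<And>x y. A (x + y) = A x + A y" and "\<And>c x. A (c *\<^sub>C x) = c *\<^sub>C A x"
    and "\<And>x. norm (A x) \<le> K * norm x"
  shows "bounded_op A"
  unfolding bounded_op_def
  by (intro conjI bounded_linear_intro[where K=K])
     (use assms in \<open>simp_all add: scaleR_scaleC mult.commute\<close>)

lemma bounded_op_linear: "bounded_op A \<Longrightarrow> bounded_linear A"
  by (simp add: bounded_op_def)

lemma bounded_op_simps:
  assumes "bounded_op A"
  shows "A (x + y) = A x + A y" "A (x - y) = A x - A y" "A 0 = 0" "A (c *\<^sub>C x) = c *\<^sub>C A x"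
    "A (- x) = - A x" "A (\<Sum>i\<in>I. f i) = (\<Sum>i\<in>I. A (f i))"
proof -
  interpret bounded_linear A using assms by (rule bounded_op_linear)
  show "A (x + y) = A x + A y" "A (x - y) = A x - A y" "A 0 = 0" "A (c *\<^sub>C x) = c *\<^sub>C A x"
    "A (- x) = - A x" "A (\<Sum>i\<in>I. f i) = (\<Sum>i\<in>I. A (f i))"
    using assms by (simp_all add: bounded_op_def add diff zero neg sum)
qed

lemma bounded_op_onorm: "bounded_op A \<Longrightarrow> norm (A x) \<le> onorm A * norm x"
  by (intro onorm bounded_op_linear)

lemma bounded_op_onorm_nonneg: "bounded_op A \<Longrightarrow> 0 \<le> onorm A"
  by (intro onorm_pos_le bounded_op_linear)

lemma bounded_op_add: "bounded_op A \<Longrightarrow> bounded_op B \<Longrightarrow> bounded_op (\<lambda>x. A x + B x)"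
  unfolding bounded_op_def by (auto intro: bounded_linear_add simp: scaleC_add_right)

lemma bounded_op_diff: "bounded_op A \<Longrightarrow> bounded_op B \<Longrightarrow> bounded_op (\<lambda>x. A x - B x)"
  unfolding bounded_op_def by (auto intro: bounded_linear_sub simp: cvec.scale_right_diff_distrib)

lemma bounded_op_comp: "bounded_op A \<Longrightarrow> bounded_op B \<Longrightarrow> bounded_op (\<lambda>x. A (B x))"
  unfolding bounded_op_def by (auto intro: bounded_linear_compose)

lemma bounded_op_zero: "bounded_op (\<lambda>x. 0)"
  by (rule bounded_opI[where K=0]) simp_all

lemma bounded_op_id: "bounded_op (\<lambda>x. x)"
  by (rule bounded_opI[where K=1]) simp_all

lemma bounded_op_scaleC: "bounded_op A \<Longrightarrow> bounded_op (\<lambda>x. c *\<^sub>C A x)"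
proof -
  assume A: "bounded_op A"
  have "norm (c *\<^sub>C A x) \<le> cmod c * onorm A * norm x" for x
    unfolding norm_scaleC mult.assoc by (intro mult_left_mono bounded_op_onorm[OF A]) simp
  then show ?thesis
    by (intro bounded_opI[where K="cmod c * onorm A"])
       (simp_all add: bounded_op_simps[OF A] scaleC_add_right scaleC_scaleC mult.commute)
qed

lemma bounded_op_sum: "(\<And>i. i \<in> I \<Longrightarrow> bounded_op (A i)) \<Longrightarrow> bounded_op (\<lambda>x. \<Sum>i\<in>I. A i x)"
  by (induction I rule: infinite_finite_induct) (simp_all add: bounded_op_zero bounded_op_add)

lemma bounded_op_rank1: "bounded_op (\<lambda>x. cinner x v *\<^sub>C u)"
  by (rule bounded_opI[where K="norm v * norm u"])
     (simp_all add: cinner_add_left scaleC_add_left cinner_scaleC_left scaleC_scaleC norm_scaleC,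
      metis cinner_bound mult.assoc mult.commute mult_left_mono norm_ge_zero)


subsection \<open>Orthogonal systems\<close>

text \<open>Allowing short (in particular zero) vectors keeps index sets uniform when a decomposition
  terminates; Bessel's inequality survives.\<close>

definition osys :: "'i set \<Rightarrow> ('i \<Rightarrow> 'h::chilbert_space) \<Rightarrow> bool" where
  "osys I e \<longleftrightarrow> (\<forall>i\<in>I. \<forall>j\<in>I. i \<noteq> j \<longrightarrow> cinner (e i) (e j) = 0) \<and> (\<forall>i\<in>I. norm (e i) \<le> 1)"

lemma osys_subset: "osys I e \<Longrightarrow> J \<subseteq> I \<Longrightarrow> osys J e"
  unfolding osys_def by blast

lemma osys_orth: "osys I e \<Longrightarrow> i \<in> I \<Longrightarrow> j \<in> I \<Longrightarrow> i \<noteq> j \<Longrightarrow> cinner (e i) (e j) = 0"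
  unfolding osys_def by blast

lemma osys_norm: "osys I e \<Longrightarrow> i \<in> I \<Longrightarrow> norm (e i) \<le> 1"
  unfolding osys_def by blast

lemma osys_cinner_sum:
  assumes "osys I e" "finite F" "F \<subseteq> I" "i \<in> I"
  shows "cinner (\<Sum>j\<in>F. c j *\<^sub>C e j) (e i) = (if i \<in> F then c i * complex_of_real ((norm (e i))\<^sup>2) else 0)"
proof -
  have "cinner (\<Sum>j\<in>F. c j *\<^sub>C e j) (e i)
      = (\<Sum>j\<in>F. if j = i then c i * complex_of_real ((norm (e i))\<^sup>2) else 0)"
    unfolding cinner_sum_left
    by (rule sum.cong) (use assms in \<open>auto simp: cinner_scaleC_left cinner_self osys_def\<close>)
  then show ?thesis using assms by simp
qed

lemma osys_norm_sum:
  assumes "osys F e" "finite F"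
  shows "(norm (\<Sum>j\<in>F. c j *\<^sub>C e j))\<^sup>2 = (\<Sum>j\<in>F. (cmod (c j))\<^sup>2 * (norm (e j))\<^sup>2)"
proof -
  have "complex_of_real ((norm (\<Sum>j\<in>F. c j *\<^sub>C e j))\<^sup>2)
     = (\<Sum>j\<in>F. cnj (c j) * (c j * complex_of_real ((norm (e j))\<^sup>2)))"
    unfolding cinner_self[symmetric] cinner_sum_right cinner_scaleC_right
    by (intro sum.cong refl, subst osys_cinner_sum[OF assms(1,2)]) (auto simp: cinner_self simp del: of_real_power)
  also have "\<dots> = complex_of_real (\<Sum>j\<in>F. (cmod (c j))\<^sup>2 * (norm (e j))\<^sup>2)"
    by (simp add: complex_norm_square mult_ac del: of_real_power)
  finally show ?thesis by (simp only: of_real_eq_iff)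
qed

lemma osys_norm_sum_le:
  assumes "osys F e" "finite F"
  shows "(norm (\<Sum>j\<in>F. c j *\<^sub>C e j))\<^sup>2 \<le> (\<Sum>j\<in>F. (cmod (c j))\<^sup>2)"
  unfolding osys_norm_sum[OF assms]
proof (intro sum_mono)
  fix j assume "j \<in> F"
  then have "(norm (e j))\<^sup>2 \<le> 1"
    using assms(1) by (simp add: osys_norm power_le_one)
  then show "(cmod (c j))\<^sup>2 * (norm (e j))\<^sup>2 \<le> (cmod (c j))\<^sup>2"
    by (simp add: mult_left_le)
qed

text \<open>The cross term contributes the factor 2 and the norm of the sum contributes
  \<open>(norm (e j))\<^sup>2\<close>. The factor in brackets is 1 for unit vectors and at least 1
  for short ones, so Bessel's inequality survives.\<close>

lemma bessel_identity:
  assumes "osys F e" "finite F"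
  shows "(norm (x - (\<Sum>j\<in>F. cinner x (e j) *\<^sub>C e j)))\<^sup>2
    = (norm x)\<^sup>2 - (\<Sum>j\<in>F. (cmod (cinner x (e j)))\<^sup>2 * (2 - (norm (e j))\<^sup>2))"
proof -
  define s where "s = (\<Sum>j\<in>F. cinner x (e j) *\<^sub>C e j)"
  have "cinner x s = (\<Sum>j\<in>F. complex_of_real ((cmod (cinner x (e j)))\<^sup>2))"
    unfolding s_def cinner_sum_right cinner_scaleC_right
    by (simp add: complex_norm_square mult.commute del: of_real_power)
  then have xs: "inner x s = (\<Sum>j\<in>F. (cmod (cinner x (e j)))\<^sup>2)"
    by (simp add: inner_eq_Re_cinner)
  have "(norm (x - s))\<^sup>2 = (norm x)\<^sup>2 - 2 * inner x s + (norm s)\<^sup>2"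
    by (simp add: power2_norm_eq_inner inner_diff_left inner_diff_right inner_commute)
  then show ?thesis
    unfolding s_def[symmetric] xs
    by (simp add: s_def osys_norm_sum[OF assms] right_diff_distrib sum_subtractf sum_distrib_right[symmetric])
qed

lemma bessel:
  assumes "osys F e" "finite F"
  shows "(\<Sum>j\<in>F. (cmod (cinner x (e j)))\<^sup>2) \<le> (norm x)\<^sup>2"
proof -
  have "(\<Sum>j\<in>F. (cmod (cinner x (e j)))\<^sup>2) \<le> (\<Sum>j\<in>F. (cmod (cinner x (e j)))\<^sup>2 * (2 - (norm (e j))\<^sup>2))"
  proof (intro sum_mono)
    fix j assume "j \<in> F"
    then have "(norm (e j))\<^sup>2 \<le> 1"
      using assms(1) by (simp add: osys_norm power_le_one)
    then show "(cmod (cinner x (e j)))\<^sup>2 \<le> (cmod (cinner x (e j)))\<^sup>2 * (2 - (norm (e j))\<^sup>2)"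
      by (simp add: mult_left_le mult_le_cancel_left1)
  qed
  moreover have "0 \<le> (norm (x - (\<Sum>j\<in>F. cinner x (e j) *\<^sub>C e j)))\<^sup>2"
    by simp
  ultimately show ?thesis
    unfolding bessel_identity[OF assms] by linarith
qed

lemma bessel_summable:
  assumes "osys (UNIV :: nat set) e"
  shows "summable (\<lambda>n. (cmod (cinner x (e n)))\<^sup>2)" "(\<Sum>n. (cmod (cinner x (e n)))\<^sup>2) \<le> (norm x)\<^sup>2"
proof -
  have le: "(\<Sum>j<n. (cmod (cinner x (e j)))\<^sup>2) \<le> (norm x)\<^sup>2" for n
    by (intro bessel) (auto intro: osys_subset[OF assms])
  show "summable (\<lambda>n. (cmod (cinner x (e n)))\<^sup>2)"
    by (rule summableI_nonneg_bounded[where x="(norm x)\<^sup>2"]) (use le in auto)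
  then show "(\<Sum>n. (cmod (cinner x (e n)))\<^sup>2) \<le> (norm x)\<^sup>2"
    by (intro suminf_le_const le)
qed


subsection \<open>Riesz representation and adjoints\<close>

text \<open>The representing vector minimises \<open>(norm x)\<^sup>2 - 2 * f x\<close> over
  \<open>S\<close>: minimising sequences are Cauchy by the parallelogram law, and the first
  variation at the minimum is the claim. With \<open>S = UNIV\<close> this is Riesz representation,
  with \<open>f = inner x\<close> it is orthogonal projection onto \<open>S\<close>.\<close>

lemma riesz_closed_subspace:
  fixes f :: "'h::{real_inner,complete_space} \<Rightarrow> real"
  assumes "bounded_linear f" "subspace S" "closed S"
  shows "\<exists>z\<in>S. \<forall>h\<in>S. f h = inner h z"
proof -
  interpret f: bounded_linear f by fact
  obtain K where K: "\<And>x. norm (f x) \<le> norm x * K"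
    using f.bounded by blast
  define g where "g x = (norm x)\<^sup>2 - 2 * f x" for x
  have g_lower: "- K\<^sup>2 \<le> g x" for x
  proof -
    have "f x \<le> norm x * K" using K[of x] by simp
    moreover have "0 \<le> (norm x - K)\<^sup>2" by simp
    ultimately show ?thesis by (simp add: g_def power2_eq_square algebra_simps)
  qed
  define m where "m = Inf (g ` S)"
  have bdd: "bdd_below (g ` S)" using g_lower by (auto intro!: bdd_belowI2)
  have "0 \<in> S" using \<open>subspace S\<close> by (rule subspace_0)
  have m_le: "m \<le> g x" if "x \<in> S" for x
    unfolding m_def using bdd that by (intro cInf_lower) auto
  have par: "g x + g y - 2 * g ((1/2) *\<^sub>R (x + y)) = (norm (x - y))\<^sup>2 / 2" for x y
    by (simp add: g_def power2_norm_eq_inner f.scaleR f.add algebra_simps inner_commute)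
  have "\<exists>x\<in>S. g x < m + 1 / real (Suc n)" for n
  proof -
    have "Inf (g ` S) < m + 1 / real (Suc n)" unfolding m_def by simp
    then show ?thesis using cInf_lessD[of "g ` S"] \<open>0 \<in> S\<close> by blast
  qed
  then obtain X where X: "\<And>n. X n \<in> S" "\<And>n. g (X n) < m + 1 / real (Suc n)"
    by metis
  have dist_bound: "(norm (X i - X j))\<^sup>2 \<le> 2 / real (Suc i) + 2 / real (Suc j)" for i j
  proof -
    have "m \<le> g ((1/2) *\<^sub>R (X i + X j))"
      by (intro m_le subspace_scale subspace_add \<open>subspace S\<close> X)
    then show ?thesis using par[of "X i" "X j"] X(2)[of i] X(2)[of j] by simp
  qed
  have "Cauchy X"
  proof (rule CauchyI)
    fix e :: real assume "e > 0"
    then obtain N :: nat where "4 / e\<^sup>2 < real N"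
      using reals_Archimedean2 by blast
    with \<open>e > 0\<close> have N: "4 / real (Suc N) < e\<^sup>2"
      by (simp add: field_simps) (smt (verit) zero_less_power)
    have "norm (X i - X j) < e" if "i \<ge> N" "j \<ge> N" for i j
    proof -
      have "2 / real (Suc i) \<le> 2 / real (Suc N)" "2 / real (Suc j) \<le> 2 / real (Suc N)"
        using that by (auto intro!: divide_left_mono)
      then have "(norm (X i - X j))\<^sup>2 < e\<^sup>2"
        using dist_bound[of i j] N by simp
      then show ?thesis using \<open>e > 0\<close> by (simp add: power_less_imp_less_base)
    qed
    then show "\<exists>M. \<forall>m\<ge>M. \<forall>n\<ge>M. norm (X m - X n) < e" by blast
  qed
  then obtain z where z: "X \<longlonglongrightarrow> z" using Cauchy_convergent convergent_def by blast
  have "z \<in> S" using closed_sequentially[OF \<open>closed S\<close> X(1) z] .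
  have "(\<lambda>n. g (X n)) \<longlonglongrightarrow> g z"
    unfolding g_def by (intro tendsto_intros f.tendsto z)
  moreover have "(\<lambda>n. m + 1 / real (Suc n)) \<longlonglongrightarrow> m + 0"
    by (intro tendsto_intros LIMSEQ_Suc[OF lim_1_over_n])
  ultimately have "g z \<le> m + 0"
    by (rule LIMSEQ_le) (use X(2) less_imp_le in blast)
  have "f h = inner h z" if "h \<in> S" for h
  proof -
    have *: "0 \<le> 2 * t * (inner h z - f h) + t\<^sup>2 * (norm h)\<^sup>2" for t
    proof -
      have "m \<le> g (z + t *\<^sub>R h)"
        by (intro m_le subspace_add subspace_scale \<open>subspace S\<close> \<open>z \<in> S\<close> that)
      with \<open>g z \<le> m + 0\<close> have "g z \<le> g (z + t *\<^sub>R h)" by simp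
      then show ?thesis
        unfolding g_def power2_norm_eq_inner
        by (simp add: f.scaleR f.add algebra_simps inner_commute power2_eq_square)
    qed
    show ?thesis
    proof (rule ccontr)
      define d where "d = inner h z - f h"
      define N where "N = (norm h)\<^sup>2 + 1"
      assume "f h \<noteq> inner h z"
      then have "d \<noteq> 0" "N > 0" "N - (norm h)\<^sup>2 > 0" by (simp_all add: d_def N_def add_nonneg_pos)
      \<comment> \<open>The choice \<open>t = - d / N\<close> nearly minimises the quadratic in
        \<open>t\<close>; the summand 1 in \<open>N\<close> keeps the denominator positive when
        \<open>h = 0\<close>.\<close>
      have "0 \<le> 2 * (- d / N) * d + (- d / N)\<^sup>2 * (norm h)\<^sup>2"
        using *[of "- d / N"] by (simp add: d_def)
      also have "\<dots> \<le> 2 * (- d / N) * d + (- d / N)\<^sup>2 * N"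
        by (intro add_left_mono mult_left_mono) (simp_all add: N_def)
      also have "\<dots> = - (d\<^sup>2 / N)"
        using \<open>N > 0\<close> by (simp add: power2_eq_square field_simps)
      also have "\<dots> < 0" using \<open>d \<noteq> 0\<close> \<open>N > 0\<close> by simp
      finally show False by simp
    qed
  qed
  with \<open>z \<in> S\<close> show ?thesis by blast
qed

text \<open>The real Riesz vector of \<open>Re (f x)\<close> also represents the imaginary part,
  because \<open>Re (f (\<i> *\<^sub>C h)) = - Im (f h)\<close>.\<close>

lemma riesz_complex:
  fixes f :: "'h::chilbert_space \<Rightarrow> complex"
  assumes "\<And>x y. f (x + y) = f x + f y" "\<And>c x. f (c *\<^sub>C x) = c * f x"
    "\<And>x. cmod (f x) \<le> K * norm x"
  shows "\<exists>z. \<forall>h. f h = cinner h z"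
proof -
  have "bounded_linear (\<lambda>x. Re (f x))"
  proof (rule bounded_linear_intro[where K=K])
    show "norm (Re (f x)) \<le> norm x * K" for x
      using abs_Re_le_cmod[of "f x"] assms(3)[of x] by (simp add: mult.commute)
  qed (simp_all add: assms(1,2) scaleR_scaleC)
  then obtain z where z: "\<And>h. Re (f h) = inner h z"
    using riesz_closed_subspace[of "\<lambda>x. Re (f x)" UNIV] by auto
  have "f h = cinner h z" for h
  proof (rule complex_eqI)
    show "Re (f h) = Re (cinner h z)" by (simp add: z inner_eq_Re_cinner)
    have "Re (f (\<i> *\<^sub>C h)) = Re (cinner (\<i> *\<^sub>C h) z)" by (simp add: z inner_eq_Re_cinner)
    then show "Im (f h) = Im (cinner h z)"
      by (simp add: assms(2) cinner_scaleC_left)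
  qed
  then show ?thesis by blast
qed

text \<open>For fixed \<open>u\<close> the conjugate of \<open>b u\<close> is linear and bounded in
  \<open>v\<close>, so Riesz representation supplies \<open>A u\<close>. Adjoints, weak limits and
  the operator \<open>W\<close> all arise in this way.\<close>

lemma bounded_form_op:
  fixes b :: "'h::chilbert_space \<Rightarrow> 'h \<Rightarrow> complex"
  assumes "\<And>u u' v. b (u + u') v = b u v + b u' v" "\<And>c u v. b (c *\<^sub>C u) v = c * b u v"
    and "\<And>u v v'. b u (v + v') = b u v + b u v'" "\<And>c u v. b u (c *\<^sub>C v) = cnj c * b u v"
    and bd: "\<And>u v. cmod (b u v) \<le> C * norm u * norm v" and "0 \<le> C"
  obtains A where "bounded_op A" "\<And>u v. cinner (A u) v = b u v" "\<And>u. norm (A u) \<le> C * norm u"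
proof -
  have "\<exists>z. \<forall>v. cnj (b u v) = cinner v z" for u
    by (rule riesz_complex[where K="C * norm u"]) (simp_all add: assms)
  then obtain A where "\<And>u v. cnj (b u v) = cinner v (A u)" by metis
  then have A: "cinner (A u) v = b u v" for u v
    by (metis cinner_commute complex_cnj_cnj)
  have nA: "norm (A u) \<le> C * norm u" for u
    by (rule norm_le_cinner) (use bd in \<open>simp_all add: A \<open>0 \<le> C\<close>\<close>)
  have "bounded_op A"
    by (rule bounded_opI[OF _ _ nA]; rule cinner_ext_left)
       (simp_all add: A cinner_add_left cinner_scaleC_left assms)
  then show thesis using A nA that by blast
qed

lemma wot_limit_op:
  fixes A :: "'i \<Rightarrow> 'h::chilbert_space \<Rightarrow> 'h"
  assumes A: "\<And>i. bounded_op (A i)"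
    and lim: "\<And>u v. ((\<lambda>i. cinner (A i u) v) \<longlongrightarrow> b u v) F" and F: "F \<noteq> bot"
    and bd: "\<And>u v. cmod (b u v) \<le> C * norm u * norm v" and "0 \<le> C"
  obtains L where "bounded_op L" "\<And>u v. cinner (L u) v = b u v" "\<And>u. norm (L u) \<le> C * norm u"
proof (rule bounded_form_op[of b C])
  note uniq = tendsto_unique[OF F lim]
  show "b (u + u') v = b u v + b u' v" for u u' v
    by (rule uniq) (simp add: bounded_op_simps[OF A] cinner_add_left tendsto_add lim)
  show "b (c *\<^sub>C u) v = c * b u v" for c u v
    by (rule uniq) (simp add: bounded_op_simps[OF A] cinner_scaleC_left tendsto_mult lim)
  show "b u (v + v') = b u v + b u v'" for u v v'
    by (rule uniq) (simp add: cinner_add_right tendsto_add lim)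
  show "b u (c *\<^sub>C v) = cnj c * b u v" for c u v
    by (rule uniq) (simp add: cinner_scaleC_right tendsto_mult lim)
qed (use bd \<open>0 \<le> C\<close> that in auto)

definition adj :: "('h::chilbert_space \<Rightarrow> 'h) \<Rightarrow> 'h \<Rightarrow> 'h" where
  "adj A = (SOME B. bounded_op B \<and> (\<forall>u v. cinner (B u) v = cinner u (A v)) \<and>
     (\<forall>u. norm (B u) \<le> onorm A * norm u))"

lemma adj_props:
  assumes A: "bounded_op A"
  shows "bounded_op (adj A)" "cinner (adj A u) v = cinner u (A v)"
    "norm (adj A u) \<le> onorm A * norm u"
proof -
  have "cmod (cinner u (A v)) \<le> onorm A * norm u * norm v" for u v
  proof -
    have "cmod (cinner u (A v)) \<le> norm u * norm (A v)" by (rule cinner_bound)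
    also have "\<dots> \<le> norm u * (onorm A * norm v)"
      by (intro mult_left_mono bounded_op_onorm A) simp
    finally show ?thesis by (simp add: mult_ac)
  qed
  then obtain B where "bounded_op B" "\<And>u v. cinner (B u) v = cinner u (A v)"
    "\<And>u. norm (B u) \<le> onorm A * norm u"
    by (rule bounded_form_op[of "\<lambda>u v. cinner u (A v)" "onorm A", rotated 4])
       (simp_all add: bounded_op_simps[OF A] bounded_op_onorm_nonneg[OF A] cinner_add_left
        cinner_add_right cinner_scaleC_left cinner_scaleC_right)
  then have "\<exists>B. bounded_op B \<and> (\<forall>u v. cinner (B u) v = cinner u (A v)) \<and>
     (\<forall>u. norm (B u) \<le> onorm A * norm u)" by blast
  from someI_ex[OF this, folded adj_def]
  show "bounded_op (adj A)" "cinner (adj A u) v = cinner u (A v)"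
    "norm (adj A u) \<le> onorm A * norm u" by blast+
qed

lemma cinner_adj_right: "bounded_op A \<Longrightarrow> cinner u (adj A v) = cinner (A u) v"
  by (metis adj_props(2) cinner_commute)


subsection \<open>Orthonormal bases\<close>

definition orthonormal :: "'h::chilbert_space set \<Rightarrow> bool" where
  "orthonormal B \<longleftrightarrow> (\<forall>e\<in>B. \<forall>f\<in>B. cinner e f = (if e = f then 1 else 0))"

lemma orthonormal_norm:
  assumes "orthonormal B" "e \<in> B"
  shows "norm e = 1"
proof -
  have "complex_of_real ((norm e)\<^sup>2) = complex_of_real 1"
    using assms cinner_self[of e] unfolding orthonormal_def by simp
  then have "(norm e)\<^sup>2 = 1" by (simp only: of_real_eq_iff)
  then show ?thesis using norm_ge_zero[of e] by (auto simp: power2_eq_1_iff simp del: norm_ge_zero)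
qed

lemma orthonormal_osys: "orthonormal B \<Longrightarrow> osys B (\<lambda>e. e)"
  using orthonormal_norm[of B] unfolding osys_def orthonormal_def by (auto split: if_splits)

lemma subspace_cspan: "subspace (cvec.span (B :: 'h::chilbert_space set))"
  by (auto simp: subspace_def cvec.span_zero cvec.span_add scaleR_scaleC cvec.span_scale)

lemma subspace_closure:
  fixes S :: "'a::real_normed_vector set"
  assumes "subspace S"
  shows "subspace (closure S)"
proof (rule subspaceI)
  show "0 \<in> closure S" using subspace_0[OF assms] closure_subset by blast
next
  fix x y assume "x \<in> closure S" "y \<in> closure S"
  then obtain X Y where "\<forall>n. X n \<in> S" "X \<longlonglongrightarrow> x" "\<forall>n. Y n \<in> S" "Y \<longlonglongrightarrow> y"
    unfolding closure_sequential by blast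
  then show "x + y \<in> closure S" unfolding closure_sequential
    by (intro exI[of _ "\<lambda>n. X n + Y n"]) (simp add: subspace_add[OF assms] tendsto_add)
next
  fix c x assume "x \<in> closure S"
  then obtain X where "\<forall>n. X n \<in> S" "X \<longlonglongrightarrow> x"
    unfolding closure_sequential by blast
  then show "c *\<^sub>R x \<in> closure S" unfolding closure_sequential
    by (intro exI[of _ "\<lambda>n. c *\<^sub>R X n"]) (simp add: subspace_scale[OF assms] tendsto_scaleR)
qed

lemma orthonormal_insert:
  assumes "orthonormal B" and "w \<noteq> 0" and "\<And>b. b \<in> B \<Longrightarrow> cinner w b = 0"
  shows "orthonormal (insert (complex_of_real (1 / norm w) *\<^sub>C w) B)"
proof -
  let ?w = "complex_of_real (1 / norm w) *\<^sub>C w"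
  have "cinner ?w ?w = 1"
    using assms(2) unfolding cinner_self norm_scaleC norm_of_real by simp
  moreover have "cinner ?w b = 0" "cinner b ?w = 0" if "b \<in> B" for b
    using assms(3)[OF that] cinner_commute[of b w]
    by (simp_all add: cinner_scaleC_left cinner_scaleC_right)
  moreover from this calculation(1) have "?w \<notin> B" by force
  ultimately show ?thesis using assms(1) unfolding orthonormal_def by auto
qed

text \<open>Zorn's lemma gives a maximal orthonormal set; if its closed span missed a vector, the
  vector minus its projection could be normalised and added.\<close>

lemma orthonormal_basis_extension:
  assumes "orthonormal (S :: 'h::chilbert_space set)"
  obtains B where "orthonormal_basis B" "S \<subseteq> B"
proof -
  let ?A = "{B. orthonormal B \<and> S \<subseteq> B}"
  have "\<exists>M\<in>?A. \<forall>X\<in>?A. M \<subseteq> X \<longrightarrow> X = M"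
  proof (rule subset_Zorn_nonempty)
    show "?A \<noteq> {}" using assms by blast
    fix C assume C: "C \<noteq> {}" "subset.chain ?A C"
    have "orthonormal (\<Union>C)" unfolding orthonormal_def
    proof (intro ballI)
      fix e f assume "e \<in> \<Union>C" "f \<in> \<Union>C"
      then obtain X Y where "X \<in> C" "e \<in> X" "Y \<in> C" "f \<in> Y" by blast
      moreover have "X \<subseteq> Y \<or> Y \<subseteq> X"
        using C(2) \<open>X \<in> C\<close> \<open>Y \<in> C\<close> unfolding subset_chain_def by blast
      ultimately obtain Z where "Z \<in> C" "e \<in> Z" "f \<in> Z" by blast
      moreover have "orthonormal Z" using C(2) \<open>Z \<in> C\<close> unfolding subset_chain_def by blast
      ultimately show "cinner e f = (if e = f then 1 else 0)" unfolding orthonormal_def by blast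
    qed
    then show "\<Union>C \<in> ?A" using C unfolding subset_chain_def by blast
  qed
  then obtain B where "B \<in> ?A" and max0: "\<forall>X\<in>?A. B \<subseteq> X \<longrightarrow> X = B"
    by (elim bexE)
  then have B: "orthonormal B" "S \<subseteq> B" by simp_all
  have max: "X = B" if "orthonormal X" "B \<subseteq> X" for X
    using max0[rule_format, of X] that B(2) by auto
  have "x \<in> closure (cvec.span B)" for x
  proof (rule ccontr)
    assume x: "x \<notin> closure (cvec.span B)"
    have sub: "subspace (closure (cvec.span B))"
      by (intro subspace_closure subspace_cspan)
    from riesz_closed_subspace[OF bounded_linear_inner_right sub closed_closure, of x]
    obtain z where z: "z \<in> closure (cvec.span B)" "\<And>h. h \<in> closure (cvec.span B) \<Longrightarrow> inner x h = inner h z"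
      by blast
    have "cinner (x - z) b = 0" if "b \<in> B" for b
    proof -
      have in_cl: "h \<in> closure (cvec.span B)" if "h \<in> cvec.span B" for h
        using that closure_subset by blast
      \<comment> \<open>The projection gives orthogonality for the real inner product only; testing
        with \<open>\<i> *\<^sub>C b\<close> as well recovers the imaginary part of the complex
        one.\<close>
      have "inner (x - z) b = 0" "inner (x - z) (\<i> *\<^sub>C b) = 0"
        using z(2)[OF in_cl, of b] z(2)[OF in_cl, of "\<i> *\<^sub>C b"] that
        by (simp_all add: cvec.span_base cvec.span_scale inner_diff_left inner_commute[of z])
      then show ?thesis
        by (simp add: inner_eq_Re_cinner cinner_scaleC_right complex_eq_iff)
    qed
    moreover have "x - z \<noteq> 0" using x z(1) by auto
    ultimately have "orthonormal (insert (complex_of_real (1 / norm (x - z)) *\<^sub>C (x - z)) B)"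
      by (intro orthonormal_insert B)
    from max[OF this] have "complex_of_real (1 / norm (x - z)) *\<^sub>C (x - z) \<in> B" by blast
    then have "complex_of_real (norm (x - z)) *\<^sub>C complex_of_real (1 / norm (x - z)) *\<^sub>C (x - z) \<in> cvec.span B"
      by (intro cvec.span_scale cvec.span_base)
    then have "x - z \<in> closure (cvec.span B)"
      using \<open>x - z \<noteq> 0\<close> closure_subset by (auto simp: scaleC_scaleC)
    then have "x - z + z \<in> closure (cvec.span B)"
      by (intro subspace_add[OF sub] z)
    then show False using x by simp
  qed
  then have "closure (cvec.span B) = UNIV" by blast
  then show thesis using that[of B] B by (simp add: orthonormal_basis_def orthonormal_def)
qed

lemma orthonormal_basis_orthonormal: "orthonormal_basis B \<Longrightarrow> orthonormal B"
  by (simp add: orthonormal_basis_def orthonormal_def)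

text \<open>Once a finite set \<open>Y\<close> carries a combination close to \<open>x\<close>, the
  sum over \<open>Y\<close> is at least as close, being the best approximation in the span of
  \<open>Y\<close> by Pythagoras.\<close>

lemma basis_expansion:
  assumes B: "orthonormal_basis (B :: 'h::chilbert_space set)"
  shows "((\<lambda>e. cinner x e *\<^sub>C e) has_sum x) B"
  unfolding has_sum_def tendsto_iff eventually_finite_subsets_at_top
proof (intro allI impI)
  fix r :: real assume "r > 0"
  have "x \<in> closure (cvec.span B)" using B by (simp add: orthonormal_basis_def)
  then obtain y where y: "y \<in> cvec.span B" "dist y x < r"
    using \<open>r > 0\<close> unfolding closure_approachable by blast
  then obtain X c where X: "finite X" "X \<subseteq> B" "y = (\<Sum>a\<in>X. c a *\<^sub>C a)"
    unfolding cvec.span_explicit by blast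
  have "dist (\<Sum>e\<in>Y. cinner x e *\<^sub>C e) x < r" if Y: "finite Y" "X \<subseteq> Y" "Y \<subseteq> B" for Y
  proof -
    note on = orthonormal_basis_orthonormal[OF B]
    have os: "osys Y (\<lambda>e. e)" using orthonormal_osys[OF on] Y by (blast intro: osys_subset)
    have n1: "norm e = 1" if "e \<in> Y" for e using orthonormal_norm[OF on] that Y by blast
    define d where "d a = (if a \<in> X then c a else 0)" for a
    have yY: "y = (\<Sum>a\<in>Y. d a *\<^sub>C a)"
      unfolding X(3) by (rule sum.mono_neutral_cong_left) (use Y in \<open>auto simp: d_def\<close>)
    let ?z = "x - (\<Sum>e\<in>Y. cinner x e *\<^sub>C e)" and ?w = "\<Sum>e\<in>Y. (cinner x e - d e) *\<^sub>C e"
    have "cinner ?z e = 0" if "e \<in> Y" for e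
      using osys_cinner_sum[OF os Y(1) order_refl that] n1[OF that] that by (simp add: cinner_diff_left)
    then have "cinner ?z ?w = 0"
      by (simp only: cinner_sum_right cinner_scaleC_right) simp
    then have "inner ?z ?w = 0" by (simp add: inner_eq_Re_cinner)
    then have "(norm (?z + ?w))\<^sup>2 = (norm ?z)\<^sup>2 + (norm ?w)\<^sup>2"
      by (simp add: power2_norm_eq_inner inner_add_left inner_add_right inner_commute)
    moreover have "?z + ?w = x - y"
      unfolding yY by (simp add: cvec.scale_left_diff_distrib sum_subtractf)
    ultimately have "(norm ?z)\<^sup>2 \<le> (norm (x - y))\<^sup>2" by simp
    then have "norm ?z \<le> norm (x - y)" by (rule power2_le_imp_le) simp
    then show ?thesis using y(2) by (simp add: dist_norm norm_minus_commute)
  qed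
  then show "\<exists>X. finite X \<and> X \<subseteq> B \<and> (\<forall>Y. finite Y \<and> X \<subseteq> Y \<and> Y \<subseteq> B \<longrightarrow>
      dist (\<Sum>e\<in>Y. cinner x e *\<^sub>C e) x < r)"
    using X by blast
qed

lemma parseval_cinner:
  assumes B: "orthonormal_basis (B :: 'h::chilbert_space set)"
  shows "((\<lambda>e. cinner x e * cinner e y) has_sum cinner x y) B"
  using has_sum_bounded_linear[OF bounded_linear_cinner_left[of y] basis_expansion[OF B, of x]]
  by (simp add: cinner_scaleC_left)

lemma parseval_norm:
  assumes B: "orthonormal_basis (B :: 'h::chilbert_space set)"
  shows "((\<lambda>e. (cmod (cinner x e))\<^sup>2) has_sum (norm x)\<^sup>2) B"
proof -
  have "((\<lambda>e. Re (cinner x e * cinner e x)) has_sum Re (cinner x x)) B"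
    by (intro has_sum_bounded_linear[OF bounded_linear_Re] parseval_cinner B)
  moreover have "cinner x e * cinner e x = complex_of_real ((cmod (cinner x e))\<^sup>2)" for e
    unfolding complex_norm_square by (simp add: cinner_commute[of e x])
  ultimately show ?thesis by (simp add: cinner_self del: of_real_power)
qed


section \<open>Approximation numbers and singular value decomposition\<close>

lemma le_at_right_0_limit:
  fixes f :: "real \<Rightarrow> real"
  assumes "(f \<longlongrightarrow> L) (at_right 0)" "\<And>e. e > 0 \<Longrightarrow> x \<le> f e"
  shows "x \<le> L"
  using assms(1) by (rule tendsto_lowerbound)
    (auto simp: eventually_at_filter assms(2) intro: always_eventually)

lemma rank_le_zero: "rank_le (\<lambda>x. 0) n"
  unfolding rank_le_def by (intro exI[of _ "{}"]) (simp add: cvec.span_empty image_subset_iff)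

lemma rank_le_mono: "rank_le K m \<Longrightarrow> m \<le> n \<Longrightarrow> rank_le K n"
  unfolding rank_le_def by (meson order_trans)

lemma singular_value_le:
  assumes "bounded_op A" "bounded_op K" "rank_le K n"
  shows "singular_value A n \<le> onorm (\<lambda>x. A x - K x)"
  unfolding singular_value_def
proof (rule cInf_lower)
  show "bdd_below {onorm (\<lambda>x. A x - K x) |K. bounded_op K \<and> rank_le K n}"
    using assms(1) by (intro bdd_belowI[of _ 0]) (auto intro!: bounded_op_onorm_nonneg bounded_op_diff)
qed (use assms in blast)

lemma singular_value_nonneg: "bounded_op A \<Longrightarrow> 0 \<le> singular_value A n"
  unfolding singular_value_def using bounded_op_zero rank_le_zero
  by (intro cInf_greatest) (blast, auto intro!: bounded_op_onorm_nonneg bounded_op_diff)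

lemma singular_value_approx:
  assumes "bounded_op A" "0 < e"
  obtains K where "bounded_op K" "rank_le K n" "onorm (\<lambda>x. A x - K x) < singular_value A n + e"
proof -
  have "Inf {onorm (\<lambda>x. A x - K x) |K. bounded_op K \<and> rank_le K n} < singular_value A n + e"
    using assms(2) by (simp add: singular_value_def)
  then show thesis
    using cInf_lessD[of "{onorm (\<lambda>x. A x - K x) |K. bounded_op K \<and> rank_le K n}"] that
      bounded_op_zero rank_le_zero by blast
qed

lemma singular_value_le_onorm: "bounded_op A \<Longrightarrow> singular_value A n \<le> onorm A"
  using singular_value_le[OF _ bounded_op_zero rank_le_zero, of A n] by simp

lemma singular_value_antimono:
  assumes "bounded_op A" "m \<le> n"
  shows "singular_value A n \<le> singular_value A m"
proof (rule field_le_epsilon)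
  fix e :: real assume "0 < e"
  then obtain K where K: "bounded_op K" "rank_le K m" "onorm (\<lambda>x. A x - K x) < singular_value A m + e"
    using singular_value_approx[OF assms(1)] by blast
  then have "singular_value A n \<le> onorm (\<lambda>x. A x - K x)"
    by (intro singular_value_le assms rank_le_mono[OF _ assms(2)])
  then show "singular_value A n \<le> singular_value A m + e" using K(3) by simp
qed

lemma span_image:
  assumes "bounded_op A" "x \<in> cvec.span S"
  shows "A x \<in> cvec.span (A ` S)"
  using assms(2)
proof (induction rule: cvec.span_induct_alt)
  case base
  then show ?case by (simp add: bounded_op_simps[OF assms(1)] cvec.span_zero)
next
  case (step c x y)
  then show ?case
    by (simp add: bounded_op_simps[OF assms(1)] cvec.span_add cvec.span_scale cvec.span_base)
qed

text \<open>If \<open>K\<close> and \<open>L\<close> approximate \<open>A\<close> and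
  \<open>B\<close> with ranks at most \<open>m\<close> and \<open>n\<close>, then
  \<open>A B - M = (A - K) (B - L)\<close> for \<open>M = K (B - L) + A L\<close>, which has rank at
  most \<open>m + n\<close>.\<close>

lemma singular_value_comp:
  assumes A: "bounded_op A" and B: "bounded_op B"
  shows "singular_value (A \<circ> B) (m + n) \<le> singular_value A m * singular_value B n"
proof -
  have AB: "bounded_op (A \<circ> B)" using bounded_op_comp[OF A B] by (simp add: comp_def)
  have *: "singular_value (A \<circ> B) (m + n) \<le> (singular_value A m + e) * (singular_value B n + e)"
    if "0 < e" for e
  proof -
    obtain K where K: "bounded_op K" "rank_le K m" "onorm (\<lambda>x. A x - K x) < singular_value A m + e"
      using singular_value_approx[OF A \<open>0 < e\<close>] by blast
    obtain L where L: "bounded_op L" "rank_le L n" "onorm (\<lambda>x. B x - L x) < singular_value B n + e"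
      using singular_value_approx[OF B \<open>0 < e\<close>] by blast
    obtain S where S: "finite S" "card S \<le> m" "range K \<subseteq> cvec.span S"
      using K(2) unfolding rank_le_def by blast
    obtain S' where S': "finite S'" "card S' \<le> n" "range L \<subseteq> cvec.span S'"
      using L(2) unfolding rank_le_def by blast
    define M where "M x = K (B x - L x) + A (L x)" for x
    have M: "bounded_op M" unfolding M_def
      by (intro bounded_op_add bounded_op_comp[OF K(1)] bounded_op_diff bounded_op_comp[OF A] B L(1))
    have "rank_le M (m + n)" unfolding rank_le_def
    proof (intro exI conjI)
      show "finite (S \<union> A ` S')" using S S' by simp
      show "card (S \<union> A ` S') \<le> m + n"
        using card_Un_le[of S "A ` S'"] card_image_le[OF S'(1), of A] S(2) S'(2) by simp
      have "K y \<in> cvec.span (S \<union> A ` S')" "A (L x) \<in> cvec.span (S \<union> A ` S')" for x y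
        using S(3) span_image[OF A, of "L x" S'] S'(3) cvec.span_mono[of S "S \<union> A ` S'"]
          cvec.span_mono[of "A ` S'" "S \<union> A ` S'"] by blast+
      then show "range M \<subseteq> cvec.span (S \<union> A ` S')" by (auto simp: M_def intro: cvec.span_add)
    qed
    from singular_value_le[OF AB M this]
    have "singular_value (A \<circ> B) (m + n) \<le> onorm (\<lambda>x. (A \<circ> B) x - M x)" .
    also have "\<dots> \<le> onorm (\<lambda>x. A x - K x) * onorm (\<lambda>x. B x - L x)"
    proof (rule onorm_bound)
      show "0 \<le> onorm (\<lambda>x. A x - K x) * onorm (\<lambda>x. B x - L x)"
        by (intro mult_nonneg_nonneg bounded_op_onorm_nonneg bounded_op_diff A B K L)
      fix x
      have "(A \<circ> B) x - M x = A (B x - L x) - K (B x - L x)"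
        by (simp add: M_def bounded_op_simps[OF A])
      moreover have "norm (A (B x - L x) - K (B x - L x))
        \<le> onorm (\<lambda>x. A x - K x) * norm (B x - L x)"
        by (rule bounded_op_onorm[OF bounded_op_diff[OF A K(1)]])
      moreover have "\<dots> \<le> onorm (\<lambda>x. A x - K x) * (onorm (\<lambda>x. B x - L x) * norm x)"
        by (intro mult_left_mono bounded_op_onorm[OF bounded_op_diff[OF B L(1)]]
            bounded_op_onorm_nonneg bounded_op_diff A K)
      ultimately show "norm ((A \<circ> B) x - M x)
        \<le> onorm (\<lambda>x. A x - K x) * onorm (\<lambda>x. B x - L x) * norm x" by (simp add: mult.assoc)
    qed
    also have "\<dots> \<le> (singular_value A m + e) * (singular_value B n + e)"
      using K(3) L(3) singular_value_nonneg[OF A, of m] \<open>0 < e\<close>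
      by (intro mult_mono) (auto intro!: bounded_op_onorm_nonneg bounded_op_diff B L)
    finally show ?thesis .
  qed
  have "((\<lambda>e. (singular_value A m + e) * (singular_value B n + e)) \<longlongrightarrow>
      (singular_value A m + 0) * (singular_value B n + 0)) (at_right 0)"
    by (intro tendsto_intros)
  from le_at_right_0_limit[OF this *] show ?thesis by simp
qed


subsection \<open>Compactness\<close>

text \<open>Gram-Schmidt. In an orthonormal system the coefficients of a vector are bounded by its
  norm, on which the compactness of finite-rank images relies.\<close>

lemma finite_orthonormal_span:
  "finite B \<Longrightarrow> \<exists>C. finite C \<and> orthonormal C \<and> cvec.span B \<subseteq> cvec.span (C :: 'h::chilbert_space set)"
proof (induction B rule: finite_induct)
  case empty
  then show ?case by (intro exI[of _ "{}"]) (simp add: orthonormal_def)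
next
  case (insert b B)
  then obtain C where C: "finite C" "orthonormal C" "cvec.span B \<subseteq> cvec.span C" by blast
  define p where "p = (\<Sum>c\<in>C. cinner b c *\<^sub>C c)"
  have p: "p \<in> cvec.span C" unfolding p_def
    by (intro cvec.span_sum cvec.span_scale cvec.span_base)
  have span_insert: "cvec.span (insert b B) \<subseteq> cvec.span D" if "C \<subseteq> D" "b \<in> cvec.span D" for D
    using that C(3) cvec.span_mono[OF that(1)] cvec.span_superset[of B]
    by (intro cvec.span_minimal cvec.subspace_span) auto
  show ?case
  proof (cases "b - p = 0")
    case True
    then show ?thesis using C p span_insert[of C] by (intro exI[of _ C]) simp
  next
    case False
    let ?w = "complex_of_real (1 / norm (b - p)) *\<^sub>C (b - p)"
    have "cinner (b - p) c = 0" if "c \<in> C" for c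
      using osys_cinner_sum[OF orthonormal_osys[OF C(2)] C(1) order_refl that, of "cinner b"] that
        orthonormal_norm[OF C(2) that] by (simp add: p_def cinner_diff_left)
    then have "orthonormal (insert ?w C)" by (intro orthonormal_insert C False)
    moreover have "b \<in> cvec.span (insert ?w C)"
    proof -
      have "complex_of_real (norm (b - p)) *\<^sub>C ?w \<in> cvec.span (insert ?w C)"
        by (intro cvec.span_scale cvec.span_base) simp
      moreover have "p \<in> cvec.span (insert ?w C)"
        using p cvec.span_mono[of C "insert ?w C"] by blast
      ultimately have "complex_of_real (norm (b - p)) *\<^sub>C ?w + p \<in> cvec.span (insert ?w C)"
        by (rule cvec.span_add)
      then show ?thesis using False by (simp add: scaleC_scaleC)
    qed
    ultimately show ?thesis
      using C(1) span_insert[of "insert ?w C"] by (intro exI[of _ "insert ?w C"]) auto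
  qed
qed

lemma compact_bounded_combinations:
  "finite C \<Longrightarrow> compact {(\<Sum>c\<in>C. f c *\<^sub>C c) | f. \<forall>c\<in>C. cmod (f c) \<le> M}"
  for C :: "'h::chilbert_space set"
proof (induction C rule: finite_induct)
  case empty
  then show ?case by simp
next
  case (insert b C)
  let ?S = "{(\<Sum>c\<in>C. f c *\<^sub>C c) | f. \<forall>c\<in>C. cmod (f c) \<le> M}"
  have "bounded_linear (\<lambda>z. z *\<^sub>C b)"
    by (rule bounded_linear_intro[where K="norm b"])
       (simp_all add: scaleC_add_left scaleR_scaleC scaleC_scaleC norm_scaleC scaleR_conv_of_real)
  then have "compact ((\<lambda>z. z *\<^sub>C b) ` cball 0 M)"
    by (intro compact_continuous_image linear_continuous_on compact_cball)
  from compact_sums[OF this insert.IH]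
  have "compact {x + y | x y. x \<in> (\<lambda>z. z *\<^sub>C b) ` cball 0 M \<and> y \<in> ?S}" .
  moreover have "{x + y | x y. x \<in> (\<lambda>z. z *\<^sub>C b) ` cball 0 M \<and> y \<in> ?S}
    = {(\<Sum>c\<in>insert b C. f c *\<^sub>C c) | f. \<forall>c\<in>insert b C. cmod (f c) \<le> M}" (is "?L = ?R")
  proof (intro equalityI subsetI)
    fix w assume "w \<in> ?L"
    then obtain z f where "w = z *\<^sub>C b + (\<Sum>c\<in>C. f c *\<^sub>C c)" "cmod z \<le> M" "\<forall>c\<in>C. cmod (f c) \<le> M"
      by auto
    moreover have "(\<Sum>c\<in>C. f c *\<^sub>C c) = (\<Sum>c\<in>C. (f(b := z)) c *\<^sub>C c)"
      using insert.hyps by (intro sum.cong) auto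
    ultimately show "w \<in> ?R" using insert.hyps by (auto intro!: exI[of _ "f(b := z)"])
  next
    fix w assume "w \<in> ?R"
    then obtain f where "w = f b *\<^sub>C b + (\<Sum>c\<in>C. f c *\<^sub>C c)" "\<forall>c\<in>insert b C. cmod (f c) \<le> M"
      using insert.hyps by auto
    then show "w \<in> ?L" by fastforce
  qed
  ultimately show ?case by simp
qed

lemma finite_rank_compact_image:
  assumes "bounded_op K" "rank_le K n"
  obtains S where "compact S" "K ` cball 0 1 \<subseteq> S"
proof -
  obtain B where B: "finite B" "range K \<subseteq> cvec.span B" using assms(2) unfolding rank_le_def by blast
  obtain C where C: "finite C" "orthonormal C" "cvec.span B \<subseteq> cvec.span C"
    using finite_orthonormal_span[OF B(1)] by blast
  have "K ` cball 0 1 \<subseteq> {(\<Sum>c\<in>C. f c *\<^sub>C c) | f. \<forall>c\<in>C. cmod (f c) \<le> onorm K}"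
  proof (clarify)
    fix x :: 'a assume "x \<in> cball 0 1"
    then have Kx: "norm (K x) \<le> onorm K"
      using bounded_op_onorm[OF assms(1), of x] bounded_op_onorm_nonneg[OF assms(1)]
      by (simp add: mult_left_le order_trans)
    have "K x \<in> cvec.span C" using B(2) C(3) by blast
    then obtain g where g: "K x = (\<Sum>c\<in>C. g c *\<^sub>C c)"
      unfolding cvec.span_finite[OF C(1)] by blast
    have "cmod (g c) \<le> onorm K" if "c \<in> C" for c
    proof -
      have "g c = cinner (K x) c"
        unfolding g osys_cinner_sum[OF orthonormal_osys[OF C(2)] C(1) order_refl that]
        using that orthonormal_norm[OF C(2) that] by simp
      then show ?thesis
        using cinner_bound[of "K x" c] Kx orthonormal_norm[OF C(2) that] by simp
    qed
    then show "\<exists>f. K x = (\<Sum>c\<in>C. f c *\<^sub>C c) \<and> (\<forall>c\<in>C. cmod (f c) \<le> onorm K)"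
      using g by blast
  qed
  then show thesis using compact_bounded_combinations[OF C(1)] that by blast
qed

lemma compact_op_singular_values:
  assumes A: "bounded_op A" and lim: "singular_value A \<longlonglongrightarrow> 0"
  shows "compact_op A"
proof -
  have "\<exists>k. finite k \<and> closure (A ` cball 0 1) \<subseteq> (\<Union>x\<in>k. ball x e)" if "e > 0" for e
  proof -
    obtain n where "singular_value A n < e / 4"
      using eventually_happens'[OF sequentially_bot order_tendstoD(2)[OF lim, of "e/4"]] \<open>e > 0\<close>
      by auto
    obtain K where K: "bounded_op K" "rank_le K n"
      "onorm (\<lambda>x. A x - K x) < singular_value A n + e / 4"
      using singular_value_approx[OF A, of "e/4"] \<open>e > 0\<close> by auto
    then have AK: "onorm (\<lambda>x. A x - K x) < e / 2" using \<open>singular_value A n < e / 4\<close> by simp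
    obtain S where S: "compact S" "K ` cball 0 1 \<subseteq> S" using finite_rank_compact_image[OF K(1,2)] .
    then obtain k where k: "finite k" "S \<subseteq> (\<Union>x\<in>k. ball x (e/4))"
      using \<open>e > 0\<close> unfolding compact_eq_totally_bounded by (meson divide_pos_pos zero_less_numeral)
    \<comment> \<open>A net of radius \<open>e / 4\<close> and an approximation error of
      \<open>e / 2\<close> give \<open>3 * e / 4\<close>; closed balls of this smaller radius
      survive the closure and fit into open balls of radius \<open>e\<close>.\<close>
    have "A ` cball 0 1 \<subseteq> (\<Union>x\<in>k. cball x (3*e/4))"
    proof (clarify)
      fix x :: 'a assume x: "x \<in> cball 0 1"
      then obtain y where y: "y \<in> k" "dist y (K x) < e / 4" using S(2) k(2) by force
      have "norm (A x - K x) \<le> e / 2 * norm x"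
        using bounded_op_onorm[OF bounded_op_diff[OF A K(1)], of x] AK
        by (meson less_imp_le mult_right_mono norm_ge_zero order_trans)
      also have "\<dots> \<le> e / 2" using x \<open>e > 0\<close> by (simp add: mult_left_le)
      finally have "dist (K x) (A x) \<le> e / 2" by (simp add: dist_norm norm_minus_commute)
      then have "dist y (A x) \<le> 3 * e / 4"
        using y(2) dist_triangle[of y "A x" "K x"] by simp
      then show "A x \<in> (\<Union>x\<in>k. cball x (3*e/4))" using y(1) by auto
    qed
    then have "closure (A ` cball 0 1) \<subseteq> (\<Union>x\<in>k. cball x (3*e/4))"
      using k(1) by (intro closure_minimal closed_UN) auto
    also have "\<dots> \<subseteq> (\<Union>x\<in>k. ball x e)" using \<open>e > 0\<close> by (auto simp: subset_iff) force
    finally show ?thesis using k(1) by blast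
  qed
  moreover have "complete (closure (A ` cball 0 1))" by (simp add: complete_eq_closed)
  ultimately show ?thesis using A unfolding compact_op_def compact_eq_totally_bounded by blast
qed

text \<open>Compactness in sequential form passes at once to \<open>A\<close> preceded by a
  contraction, and the remainders of the singular value decomposition are of this kind.\<close>

definition seq_compact_op :: "('h::chilbert_space \<Rightarrow> 'h) \<Rightarrow> bool" where
  "seq_compact_op A \<longleftrightarrow> bounded_op A \<and>
     (\<forall>x. (\<forall>n. norm (x n) \<le> 1) \<longrightarrow> (\<exists>l \<phi>. strict_mono (\<phi> :: nat \<Rightarrow> nat) \<and> (\<lambda>n. A (x (\<phi> n))) \<longlonglongrightarrow> l))"

lemma compact_op_seq:
  assumes "compact_op A"
  shows "seq_compact_op A"
  unfolding seq_compact_op_def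
proof (intro conjI allI impI)
  show "bounded_op A" using assms by (simp add: compact_op_def)
  fix x :: "nat \<Rightarrow> 'a" assume "\<forall>n. norm (x n) \<le> 1"
  then have "\<forall>n. A (x n) \<in> closure (A ` cball 0 1)"
    by (auto intro!: subsetD[OF closure_subset])
  moreover have "seq_compact (closure (A ` cball 0 1))"
    using assms by (simp add: compact_op_def compact_imp_seq_compact)
  ultimately show "\<exists>l \<phi>. strict_mono (\<phi> :: nat \<Rightarrow> nat) \<and> (\<lambda>n. A (x (\<phi> n))) \<longlonglongrightarrow> l"
    by (elim seq_compactE) (auto simp: comp_def)
qed

lemma seq_compact_op_comp:
  assumes "seq_compact_op A" "bounded_op P" "\<And>x. norm (P x) \<le> norm x"
  shows "seq_compact_op (\<lambda>x. A (P x))"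
  unfolding seq_compact_op_def
proof (intro conjI allI impI)
  show "bounded_op (\<lambda>x. A (P x))"
    using assms(1,2) by (intro bounded_op_comp[of A P]) (simp_all add: seq_compact_op_def)
  fix x :: "nat \<Rightarrow> 'a" assume "\<forall>n. norm (x n) \<le> 1"
  then have "\<forall>n. norm (P (x n)) \<le> 1" using assms(3) order_trans by blast
  with assms(1) show "\<exists>l \<phi>. strict_mono (\<phi> :: nat \<Rightarrow> nat) \<and> (\<lambda>n. A (P (x (\<phi> n)))) \<longlonglongrightarrow> l"
    unfolding seq_compact_op_def by (elim conjE allE[of _ "\<lambda>n. P (x n)"] impE)
qed


subsection \<open>Singular value decomposition\<close>

lemma unit_vector_near_onorm:
  assumes A: "bounded_op A" and "0 \<le> t" "t < onorm A"
  obtains x where "norm x = 1" "t < norm (A x)"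
proof -
  have "\<exists>x. norm x = 1 \<and> t < norm (A x)"
  proof (rule ccontr)
    assume "\<not> ?thesis"
    then have le: "norm (A x) \<le> t" if "norm x = 1" for x using that by force
    have "norm (A x) \<le> t * norm x" for x
    proof (cases "x = 0")
      case False
      have "norm (complex_of_real (1 / norm x) *\<^sub>C x) = 1" using False by (simp only: norm_scaleC norm_of_real) simp
      from le[OF this] have "norm (A x) / norm x \<le> t"
        by (simp only: bounded_op_simps[OF A] norm_scaleC norm_of_real) simp
      then show ?thesis using False by (simp add: field_simps)
    qed (simp add: bounded_op_simps[OF A])
    then have "onorm A \<le> t" using \<open>0 \<le> t\<close> by (intro onorm_bound)
    then show False using assms by simp
  qed
  then show thesis using that by blast
qed

text \<open>The condition is \<open>A* A e = s^2 e\<close> with \<open>s = onorm A\<close>, written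
  in weak form: \<open>e\<close> is a singular vector for the largest singular value.\<close>

definition norming :: "('h::chilbert_space \<Rightarrow> 'h) \<Rightarrow> 'h \<Rightarrow> bool" where
  "norming A e \<longleftrightarrow> norm e = 1 \<and>
     (\<forall>y. cinner (A e) (A y) = complex_of_real ((onorm A)\<^sup>2) * cinner e y)"

text \<open>For unit vectors \<open>y\<close> with \<open>norm (A y)\<close> close to
  \<open>s = onorm A\<close>, the vector \<open>adj A (A y) - s\<^sup>2 *\<^sub>R y\<close> is
  small. Along a subsequence \<open>A y\<close> converges by compactness, so \<open>y\<close> itself
  converges, and the limit is norming.\<close>

lemma norming_exists:
  assumes "seq_compact_op A" and "onorm A \<noteq> 0"
  shows "\<exists>e. norming A e"
proof -
  have A: "bounded_op A" using assms(1) by (simp add: seq_compact_op_def)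
  define s where "s = onorm A"
  have "s > 0" using bounded_op_onorm_nonneg[OF A] assms(2) by (simp add: s_def)
  have "\<exists>x. norm x = 1 \<and> max 0 (s - 1 / real (Suc n)) < norm (A x)" for n
    using unit_vector_near_onorm[OF A, of "max 0 (s - 1 / real (Suc n))"] \<open>s > 0\<close>
    by (auto simp: s_def)
  then obtain X where X: "\<And>n. norm (X n) = 1" "\<And>n. max 0 (s - 1 / real (Suc n)) < norm (A (X n))"
    by metis
  obtain l \<phi> where \<phi>: "strict_mono (\<phi> :: nat \<Rightarrow> nat)" "(\<lambda>n. A (X (\<phi> n))) \<longlonglongrightarrow> l"
    using assms(1) X(1) unfolding seq_compact_op_def by (metis order_refl)
  define Y where "Y n = X (\<phi> n)" for n
  have nA: "norm (A x) \<le> s * norm x" for x unfolding s_def by (rule bounded_op_onorm[OF A])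
  have "(\<lambda>n. norm (A (X n))) \<longlonglongrightarrow> s"
  proof (rule tendsto_sandwich)
    show "\<forall>\<^sub>F n in sequentially. s - 1 / real (Suc n) \<le> norm (A (X n))"
      using X(2) by (intro always_eventually) (auto simp: less_imp_le)
    show "\<forall>\<^sub>F n in sequentially. norm (A (X n)) \<le> s"
      using nA X(1) by (intro always_eventually) (metis mult.right_neutral)
    show "(\<lambda>n. s - 1 / real (Suc n)) \<longlonglongrightarrow> s"
      using tendsto_diff[OF tendsto_const LIMSEQ_Suc[OF lim_1_over_n], of s] by simp
  qed simp
  then have nAY: "(\<lambda>n. norm (A (Y n))) \<longlonglongrightarrow> s"
    unfolding Y_def using \<phi>(1) by (rule LIMSEQ_subseq_LIMSEQ[unfolded comp_def])
  let ?s2 = "complex_of_real (s\<^sup>2)"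
  have est: "(norm (adj A (A y) - s\<^sup>2 *\<^sub>R y))\<^sup>2 \<le> s\<^sup>2 * (s\<^sup>2 - (norm (A y))\<^sup>2)" if "norm y = 1" for y
  proof -
    have "cinner (adj A (A y)) y = complex_of_real ((norm (A y))\<^sup>2)"
      unfolding adj_props(2)[OF A] cinner_self ..
    then have i: "inner (adj A (A y)) y = (norm (A y))\<^sup>2"
      by (simp add: inner_eq_Re_cinner)
    have "(norm (adj A (A y)))\<^sup>2 \<le> (s * norm (A y))\<^sup>2"
      using adj_props(3)[OF A, of "A y"] by (intro power_mono) (simp_all add: s_def)
    moreover have "(norm (adj A (A y) - s\<^sup>2 *\<^sub>R y))\<^sup>2
       = (norm (adj A (A y)))\<^sup>2 - 2 * s\<^sup>2 * inner (adj A (A y)) y + s\<^sup>2 * s\<^sup>2 * (norm y)\<^sup>2"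
      by (simp add: power2_norm_eq_inner inner_diff_left inner_diff_right inner_commute algebra_simps)
    ultimately show ?thesis by (simp add: i that power_mult_distrib algebra_simps)
  qed
  have "(\<lambda>n. (norm (adj A (A (Y n)) - s\<^sup>2 *\<^sub>R Y n))\<^sup>2) \<longlonglongrightarrow> 0"
  proof (rule tendsto_sandwich[OF _ _ tendsto_const])
    show "\<forall>\<^sub>F n in sequentially. (norm (adj A (A (Y n)) - s\<^sup>2 *\<^sub>R Y n))\<^sup>2 \<le> s\<^sup>2 * (s\<^sup>2 - (norm (A (Y n)))\<^sup>2)"
      by (intro always_eventually allI est) (simp add: Y_def X)
    have "(\<lambda>n. s\<^sup>2 * (s\<^sup>2 - (norm (A (Y n)))\<^sup>2)) \<longlonglongrightarrow> s\<^sup>2 * (s\<^sup>2 - s\<^sup>2)"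
      by (intro tendsto_intros nAY)
    then show "(\<lambda>n. s\<^sup>2 * (s\<^sup>2 - (norm (A (Y n)))\<^sup>2)) \<longlonglongrightarrow> 0" by simp
  qed simp
  from tendsto_real_sqrt[OF this]
  have "(\<lambda>n. adj A (A (Y n)) - s\<^sup>2 *\<^sub>R Y n) \<longlonglongrightarrow> 0"
    by (simp add: tendsto_norm_zero_iff)
  moreover have "(\<lambda>n. adj A (A (Y n))) \<longlonglongrightarrow> adj A l"
    using \<phi>(2) unfolding Y_def
    by (intro bounded_linear.tendsto[OF bounded_op_linear[OF adj_props(1)[OF A]]])
  ultimately have "(\<lambda>n. (1 / s\<^sup>2) *\<^sub>R (adj A (A (Y n)) - (adj A (A (Y n)) - s\<^sup>2 *\<^sub>R Y n)))
      \<longlonglongrightarrow> (1 / s\<^sup>2) *\<^sub>R (adj A l - 0)"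
    by (intro tendsto_intros)
  then have Y: "Y \<longlonglongrightarrow> (1 / s\<^sup>2) *\<^sub>R adj A l" using \<open>s > 0\<close> by simp
  define e where "e = (1 / s\<^sup>2) *\<^sub>R adj A l"
  have "(\<lambda>n. A (Y n)) \<longlonglongrightarrow> A e"
    unfolding e_def by (intro bounded_linear.tendsto[OF bounded_op_linear[OF A]] Y)
  then have "l = A e" using \<phi>(2) LIMSEQ_unique unfolding Y_def by blast
  have "(\<lambda>n. norm (Y n)) \<longlonglongrightarrow> norm e" unfolding e_def by (intro tendsto_norm Y)
  then have "norm e = 1" by (simp add: Y_def X(1) LIMSEQ_const_iff)
  moreover have "adj A (A e) = ?s2 *\<^sub>C e"
    using \<open>s > 0\<close> \<open>l = A e\<close> by (simp add: e_def scaleR_scaleC[symmetric] del: of_real_power)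
  then have "cinner (A e) (A y) = ?s2 * cinner e y" for y
    by (metis adj_props(2)[OF A] cinner_scaleC_left)
  ultimately show ?thesis unfolding norming_def s_def by blast
qed

text \<open>The decomposition is obtained greedily: split off a norming vector and continue with the
  operator restricted to its orthogonal complement.\<close>

definition norming_vec :: "('h::chilbert_space \<Rightarrow> 'h) \<Rightarrow> 'h" where
  "norming_vec A = (if onorm A = 0 then 0 else SOME e. norming A e)"

primrec svd_rest :: "('h::chilbert_space \<Rightarrow> 'h) \<Rightarrow> nat \<Rightarrow> 'h \<Rightarrow> 'h" where
  "svd_rest A 0 = A"
| "svd_rest A (Suc n) = (\<lambda>x. svd_rest A n
     (x - cinner x (norming_vec (svd_rest A n)) *\<^sub>C norming_vec (svd_rest A n)))"

abbreviation svd_vec :: "('h::chilbert_space \<Rightarrow> 'h) \<Rightarrow> nat \<Rightarrow> 'h" where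
  "svd_vec A n \<equiv> norming_vec (svd_rest A n)"

abbreviation svd_val :: "('h::chilbert_space \<Rightarrow> 'h) \<Rightarrow> nat \<Rightarrow> real" where
  "svd_val A n \<equiv> onorm (svd_rest A n)"

lemma norming_vec:
  assumes "seq_compact_op A"
  shows "cinner (A (norming_vec A)) (A y) = complex_of_real ((onorm A)\<^sup>2) * cinner (norming_vec A) y"
    and "onorm A \<noteq> 0 \<Longrightarrow> norm (norming_vec A) = 1"
    and "onorm A = 0 \<Longrightarrow> norming_vec A = 0"
    and "norm (norming_vec A) \<le> 1"
proof -
  have A: "bounded_op A" using assms by (simp add: seq_compact_op_def)
  have *: "norming A (norming_vec A)" if "onorm A \<noteq> 0"
    using someI_ex[OF norming_exists[OF assms that]] that by (simp add: norming_vec_def)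
  show "cinner (A (norming_vec A)) (A y) = complex_of_real ((onorm A)\<^sup>2) * cinner (norming_vec A) y"
    using * by (cases "onorm A = 0") (auto simp: norming_def norming_vec_def bounded_op_simps[OF A])
  show "onorm A \<noteq> 0 \<Longrightarrow> norm (norming_vec A) = 1" using * by (simp add: norming_def)
  show "onorm A = 0 \<Longrightarrow> norming_vec A = 0" by (simp add: norming_vec_def)
  show "norm (norming_vec A) \<le> 1"
    using * by (cases "onorm A = 0") (auto simp: norming_def norming_vec_def)
qed

lemma norm_minus_projection_le:
  assumes "norm e \<le> 1"
  shows "norm (x - cinner x e *\<^sub>C e) \<le> norm x"
proof -
  have "osys {()} (\<lambda>_. e)" using assms by (simp add: osys_def)
  from bessel_identity[OF this, of x]
  have "(norm (x - cinner x e *\<^sub>C e))\<^sup>2 = (norm x)\<^sup>2 - (cmod (cinner x e))\<^sup>2 * (2 - (norm e)\<^sup>2)" by simp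
  moreover have "(norm e)\<^sup>2 \<le> 1" using assms by (simp add: power_le_one)
  ultimately have "(norm (x - cinner x e *\<^sub>C e))\<^sup>2 \<le> (norm x)\<^sup>2" by simp
  then show ?thesis by (rule power2_le_imp_le) simp
qed

lemma svd_rest_seq_compact: "seq_compact_op A \<Longrightarrow> seq_compact_op (svd_rest A n)"
proof (induction n)
  case (Suc n)
  let ?e = "norming_vec (svd_rest A n)"
  have "seq_compact_op (svd_rest A n)" using Suc by simp
  moreover have "bounded_op (\<lambda>x. x - cinner x ?e *\<^sub>C ?e)"
    by (rule bounded_op_diff[OF bounded_op_id bounded_op_rank1])
  ultimately show ?case
    using seq_compact_op_comp[OF _ _ norm_minus_projection_le[OF norming_vec(4)]] by simp
qed simp

context
  fixes A :: "'h::chilbert_space \<Rightarrow> 'h"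
  assumes cA: "seq_compact_op A"
begin

private lemma bA: "bounded_op A" using cA by (simp add: seq_compact_op_def)

private lemma bT: "bounded_op (svd_rest A n)"
  using svd_rest_seq_compact[OF cA] by (simp add: seq_compact_op_def)

private lemmas nv = norming_vec[OF svd_rest_seq_compact[OF cA]]

private lemma svd_rest_self: "svd_rest A (Suc n) (svd_vec A n) = 0"
proof (cases "svd_val A n = 0")
  case True
  then show ?thesis using nv(3)[of n] by (simp add: bounded_op_simps[OF bT])
next
  case False
  then show ?thesis using nv(2)[of n] by (simp add: cinner_self bounded_op_simps[OF bT])
qed

text \<open>For \<open>z\<close> in the kernel the norming equation reads
  \<open>0 = s\<^sup>2 * cinner e z\<close>. Earlier vectors lie in the kernel of later remainders,
  which is how orthogonality of the whole sequence comes about.\<close>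

private lemma svd_orth_step:
  assumes "svd_rest A n z = 0"
  shows "cinner (svd_vec A n) z = 0" "cinner z (svd_vec A n) = 0"
proof -
  show "cinner (svd_vec A n) z = 0"
    using nv(1)[of n z] nv(3)[of n] assms by (cases "svd_val A n = 0") simp_all
  then show "cinner z (svd_vec A n) = 0" by (subst cinner_commute) simp
qed

private lemma svd_rest_vec: "i < n \<Longrightarrow> svd_rest A n (svd_vec A i) = 0"
proof (induction n)
  case (Suc n)
  show ?case
  proof (cases "i = n")
    case True
    then show ?thesis using svd_rest_self[of n] by simp
  next
    case False
    then have "svd_rest A n (svd_vec A i) = 0" using Suc by simp
    then show ?thesis using svd_orth_step(2) by simp
  qed
qed simp

private lemma svd_vec_orth: "i \<noteq> j \<Longrightarrow> cinner (svd_vec A i) (svd_vec A j) = 0"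
  using svd_orth_step[OF svd_rest_vec, of i j] svd_orth_step[OF svd_rest_vec, of j i]
  by (cases "i < j") auto

private lemma svd_rest_eq: "svd_rest A n x = A x - (\<Sum>i<n. cinner x (svd_vec A i) *\<^sub>C A (svd_vec A i))"
proof (induction n arbitrary: x)
  case (Suc n)
  have "(\<Sum>i<n. cinner (x - cinner x (svd_vec A n) *\<^sub>C svd_vec A n) (svd_vec A i) *\<^sub>C A (svd_vec A i))
    = (\<Sum>i<n. cinner x (svd_vec A i) *\<^sub>C A (svd_vec A i))"
    by (intro sum.cong refl) (simp add: cinner_diff_left cinner_scaleC_left svd_vec_orth)
  then show ?case by (simp add: Suc bounded_op_simps[OF bA])
qed simp

private lemma svd_rest_vec_ge: "n \<le> m \<Longrightarrow> svd_rest A n (svd_vec A m) = A (svd_vec A m)"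
  by (subst svd_rest_eq) (simp add: svd_vec_orth)

private lemma svd_val_nonneg: "0 \<le> svd_val A n" by (rule bounded_op_onorm_nonneg[OF bT])

private lemma svd_image_cinner:
  "n \<le> m \<Longrightarrow> cinner (A (svd_vec A n)) (A (svd_vec A m)) =
     (if n = m then complex_of_real ((svd_val A n)\<^sup>2) else 0)"
proof -
  assume "n \<le> m"
  then have *: "cinner (A (svd_vec A n)) (A (svd_vec A m))
      = complex_of_real ((svd_val A n)\<^sup>2) * cinner (svd_vec A n) (svd_vec A m)"
    using nv(1)[of n "svd_vec A m"] svd_rest_vec_ge[of n m] svd_rest_vec_ge[of n n] by simp
  show ?thesis
  proof (cases "svd_val A n = 0")
    case True
    then show ?thesis using * by auto
  next
    case False
    then show ?thesis using * nv(2)[OF False] svd_vec_orth[of n m] cinner_self[of "svd_vec A n"]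
      by (cases "n = m") auto
  qed
qed

private lemma svd_image_orth:
  "n \<noteq> m \<Longrightarrow> cinner (A (svd_vec A n)) (A (svd_vec A m)) = 0"
  using svd_image_cinner[of n m] svd_image_cinner[of m n]
    cinner_cmod_commute[of "A (svd_vec A n)" "A (svd_vec A m)"] by (cases "n \<le> m") auto

private lemma svd_image_norm: "norm (A (svd_vec A n)) = svd_val A n"
proof -
  have "complex_of_real ((norm (A (svd_vec A n)))\<^sup>2) = complex_of_real ((svd_val A n)\<^sup>2)"
    using svd_image_cinner[of n n] unfolding cinner_self by simp
  then have "(norm (A (svd_vec A n)))\<^sup>2 = (svd_val A n)\<^sup>2" by (simp only: of_real_eq_iff)
  then show ?thesis using svd_val_nonneg by (simp add: power2_eq_iff_nonneg)
qed

private lemma svd_val_antimono: "m \<le> n \<Longrightarrow> svd_val A n \<le> svd_val A m"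
proof (induction n rule: dec_induct)
  case (step n)
  have "svd_val A (Suc n) \<le> svd_val A n"
  proof (rule onorm_bound)
    fix x
    have "norm (svd_rest A (Suc n) x) \<le> svd_val A n * norm (x - cinner x (svd_vec A n) *\<^sub>C svd_vec A n)"
      by (simp add: bounded_op_onorm[OF bT])
    also have "\<dots> \<le> svd_val A n * norm x"
      by (intro mult_left_mono norm_minus_projection_le nv(4) svd_val_nonneg)
    finally show "norm (svd_rest A (Suc n) x) \<le> svd_val A n * norm x" .
  qed (rule svd_val_nonneg)
  then show ?case using step by simp
qed simp

text \<open>The images \<open>A (svd_vec A n)\<close> are pairwise orthogonal of norm
  \<open>svd_val A n\<close>. If these norms stayed above some \<open>r > 0\<close>, no subsequence
  of the images would be Cauchy.\<close>

private lemma svd_val_tendsto: "svd_val A \<longlonglongrightarrow> 0"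
proof -
  have "\<exists>n. svd_val A n < r" if "r > 0" for r
  proof (rule ccontr)
    assume "\<not> ?thesis"
    then have ge: "svd_val A n \<ge> r" for n by (meson not_le)
    obtain l \<phi> where \<phi>: "strict_mono (\<phi> :: nat \<Rightarrow> nat)" "(\<lambda>n. A (svd_vec A (\<phi> n))) \<longlonglongrightarrow> l"
      using cA nv(4) unfolding seq_compact_op_def by meson
    have "Cauchy (\<lambda>n. A (svd_vec A (\<phi> n)))" using \<phi>(2) by (rule LIMSEQ_imp_Cauchy)
    then obtain N where N: "\<And>m n. m \<ge> N \<Longrightarrow> n \<ge> N \<Longrightarrow> dist (A (svd_vec A (\<phi> m))) (A (svd_vec A (\<phi> n))) < r"
      using \<open>r > 0\<close> unfolding Cauchy_def by blast
    let ?x = "A (svd_vec A (\<phi> N))" and ?y = "A (svd_vec A (\<phi> (Suc N)))"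
    have "\<phi> N \<noteq> \<phi> (Suc N)" using strict_monoD[OF \<phi>(1), of N "Suc N"] by simp
    then have "inner ?x ?y = 0" using svd_image_orth by (simp add: inner_eq_Re_cinner)
    then have "(norm (?x - ?y))\<^sup>2 = (norm ?x)\<^sup>2 + (norm ?y)\<^sup>2"
      by (simp add: power2_norm_eq_inner inner_diff_left inner_diff_right inner_commute)
    then have "r\<^sup>2 \<le> (norm (?x - ?y))\<^sup>2"
      using power_mono[OF ge[of "\<phi> N"], of 2] \<open>r > 0\<close> by (simp add: svd_image_norm add_increasing2)
    then have "r \<le> norm (?x - ?y)" by (rule power2_le_imp_le) simp
    then show False using N[of N "Suc N"] by (simp add: dist_norm)
  qed
  then show ?thesis
    by (intro LIMSEQ_I) (metis abs_of_nonneg diff_zero le_less_trans real_norm_def svd_val_antimono svd_val_nonneg)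
qed

text \<open>Dimension count: \<open>K\<close> has rank at most \<open>n\<close>, so it annihilates a
  nontrivial combination \<open>x\<close> of the \<open>n + 1\<close> vectors with indices up to
  \<open>n\<close>, and there \<open>norm (A x) \<ge> svd_val A n * norm x\<close>.\<close>

private lemma svd_val_le_approx:
  assumes K: "bounded_op K" "rank_le K n"
  shows "svd_val A n \<le> onorm (\<lambda>x. A x - K x)"
proof (cases "svd_val A n = 0")
  case True
  then show ?thesis by (simp add: bounded_op_onorm_nonneg bounded_op_diff bA K)
next
  case False
  let ?e = "svd_vec A" and ?I = "{..n}"
  have pos: "svd_val A i \<noteq> 0" if "i \<le> n" for i
    using svd_val_antimono[OF that] svd_val_nonneg[of n] False by linarith
  have n1: "norm (?e i) = 1" if "i \<le> n" for i using nv(2) pos[OF that] by blast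
  have os: "osys ?I ?e" using svd_vec_orth nv(4) by (auto simp: osys_def)
  obtain S where S: "finite S" "card S \<le> n" "range K \<subseteq> cvec.span S"
    using K(2) unfolding rank_le_def by blast
  have "\<exists>c. (\<exists>i\<le>n. c i \<noteq> 0) \<and> (\<Sum>i\<le>n. c i *\<^sub>C K (?e i)) = 0"
  \<comment> \<open>\<open>cvec.dependent\<close> speaks about sets, so coinciding images, for which
    the set of images is smaller than the index set, are treated separately.\<close>
  proof (cases "inj_on (\<lambda>i. K (?e i)) ?I")
    case False
    then obtain i j where ij: "i \<le> n" "j \<le> n" "i \<noteq> j" "K (?e i) = K (?e j)"
      unfolding inj_on_def by auto
    define c where "c k = (if k = i then 1 else if k = j then -1 else 0 :: complex)" for k
    have "(\<Sum>k\<le>n. c k *\<^sub>C K (?e k)) = (\<Sum>k\<in>{i, j}. c k *\<^sub>C K (?e k))"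
      by (rule sum.mono_neutral_right) (use ij in \<open>auto simp: c_def\<close>)
    also have "\<dots> = 0" using ij by (simp add: c_def)
    finally show ?thesis using ij by (intro exI[of _ c]) (auto simp: c_def)
  next
    case True
    have "card ((\<lambda>i. K (?e i)) ` ?I) = Suc n" using card_image[OF True] by simp
    then have "cvec.dependent ((\<lambda>i. K (?e i)) ` ?I)"
      using cvec.independent_span_bound[OF S(1), of "(\<lambda>i. K (?e i)) ` ?I"] S(2,3)
      by fastforce
    then obtain u where u: "\<exists>v\<in>(\<lambda>i. K (?e i)) ` ?I. u v \<noteq> 0"
      "(\<Sum>v\<in>(\<lambda>i. K (?e i)) ` ?I. u v *\<^sub>C v) = 0"
      using cvec.dependent_finite[of "(\<lambda>i. K (?e i)) ` ?I"] by auto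
    then show ?thesis using sum.reindex[OF True, of "\<lambda>v. u v *\<^sub>C v"]
      by (intro exI[of _ "\<lambda>i. u (K (?e i))"]) (auto simp: comp_def)
  qed
  then obtain c where c: "\<exists>i\<le>n. c i \<noteq> 0" "(\<Sum>i\<le>n. c i *\<^sub>C K (?e i)) = 0" by blast
  define x where "x = (\<Sum>i\<le>n. c i *\<^sub>C ?e i)"
  have "(norm x)\<^sup>2 = (\<Sum>i\<le>n. (cmod (c i))\<^sup>2)"
    unfolding x_def using osys_norm_sum[OF os, of c] n1 by simp
  then have nx: "(norm x)\<^sup>2 = (\<Sum>i\<le>n. (cmod (c i))\<^sup>2)" .
  have "x \<noteq> 0"
  proof
    assume "x = 0"
    then have "(\<Sum>i\<le>n. (cmod (c i))\<^sup>2) = 0" using nx by simp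
    then show False using c(1) by (subst (asm) sum_nonneg_eq_0_iff) auto
  qed
  have "K x = 0" using c(2) by (simp add: x_def bounded_op_simps[OF K(1)])
  define g where "g i = complex_of_real (1 / svd_val A i) *\<^sub>C A (?e i)" for i
  have "osys ?I g"
    unfolding osys_def g_def norm_scaleC norm_of_real svd_image_norm
    using svd_image_orth svd_val_nonneg pos by (auto simp: cinner_scaleC_left cinner_scaleC_right)
  have Ax: "A x = (\<Sum>i\<le>n. (c i * complex_of_real (svd_val A i)) *\<^sub>C g i)"
    unfolding x_def bounded_op_simps[OF bA] g_def scaleC_scaleC
    by (intro sum.cong refl) (use pos in simp)
  have ng: "norm (g i) = 1" if "i \<le> n" for i
    unfolding g_def norm_scaleC norm_of_real svd_image_norm using pos[OF that] svd_val_nonneg[of i] by simp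
  have "(svd_val A n * norm x)\<^sup>2 = (\<Sum>i\<le>n. (svd_val A n)\<^sup>2 * (cmod (c i))\<^sup>2)"
    by (simp add: power_mult_distrib nx sum_distrib_left)
  also have "\<dots> \<le> (\<Sum>i\<le>n. (cmod (c i * complex_of_real (svd_val A i)))\<^sup>2 * (norm (g i))\<^sup>2)"
  proof (intro sum_mono)
    fix i assume i: "i \<in> {..n}"
    then have "(svd_val A n)\<^sup>2 \<le> (svd_val A i)\<^sup>2"
      by (intro power_mono svd_val_antimono svd_val_nonneg) simp
    then show "(svd_val A n)\<^sup>2 * (cmod (c i))\<^sup>2
      \<le> (cmod (c i * complex_of_real (svd_val A i)))\<^sup>2 * (norm (g i))\<^sup>2"
      using ng[of i] i by (simp add: norm_mult power_mult_distrib mult.commute mult_left_mono)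
  qed
  also have "\<dots> = (norm (A x))\<^sup>2" unfolding Ax by (rule osys_norm_sum[OF \<open>osys ?I g\<close>, symmetric]) simp
  finally have "svd_val A n * norm x \<le> norm (A x)" by (rule power2_le_imp_le) simp
  also have "\<dots> = norm (A x - K x)" using \<open>K x = 0\<close> by simp
  also have "\<dots> \<le> onorm (\<lambda>x. A x - K x) * norm x"
    by (rule bounded_op_onorm[OF bounded_op_diff[OF bA K(1)]])
  finally show ?thesis using \<open>x \<noteq> 0\<close> by simp
qed

text \<open>The remainder after \<open>n\<close> steps is the error of an approximation of rank at
  most \<open>n\<close>, which gives one inequality; the dimension count gives the other.\<close>

private lemma svd_val_eq: "svd_val A n = singular_value A n"
proof (rule antisym)
  show "svd_val A n \<le> singular_value A n"
    unfolding singular_value_def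
    using bounded_op_zero rank_le_zero svd_val_le_approx by (intro cInf_greatest) (blast, auto)
  let ?K = "\<lambda>x. \<Sum>i<n. cinner x (svd_vec A i) *\<^sub>C A (svd_vec A i)"
  have "rank_le ?K n" unfolding rank_le_def
  proof (intro exI conjI)
    show "card ((\<lambda>i. A (svd_vec A i)) ` {..<n}) \<le> n" using card_image_le[of "{..<n}"] by simp
    show "range ?K \<subseteq> cvec.span ((\<lambda>i. A (svd_vec A i)) ` {..<n})"
    proof (clarify)
      show "?K x \<in> cvec.span ((\<lambda>i. A (svd_vec A i)) ` {..<n})" for x
        by (intro cvec.span_sum cvec.span_scale cvec.span_base) simp
    qed
  qed simp
  from singular_value_le[OF bA _ this]
  show "singular_value A n \<le> svd_val A n"
    by (simp add: bounded_op_sum bounded_op_rank1 svd_rest_eq[symmetric])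
qed

text \<open>Past the rank of \<open>A\<close> the norming vector has the default value 0, so a
  single infinite sequence of short vectors covers operators of finite rank too.\<close>

lemma svd_exists:
  "\<exists>e f. osys UNIV e \<and> osys UNIV f \<and> (\<forall>n. A (e n) = complex_of_real (singular_value A n) *\<^sub>C f n) \<and>
     (\<forall>n. singular_value A n \<noteq> 0 \<longrightarrow> norm (e n) = 1 \<and> norm (f n) = 1) \<and>
     (\<forall>n. singular_value A n = 0 \<longrightarrow> e n = 0) \<and> singular_value A \<longlonglongrightarrow> 0 \<and>
     (\<forall>x. (\<lambda>n. (complex_of_real (singular_value A n) * cinner x (e n)) *\<^sub>C f n) sums A x)"
proof (intro exI conjI)
  let ?e = "svd_vec A" and ?s = "singular_value A"
  \<comment> \<open>Division by zero yields 0, so \<open>?f n\<close> vanishes together with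
    \<open>?s n\<close>.\<close>
  let ?f = "\<lambda>n. complex_of_real (1 / ?s n) *\<^sub>C A (?e n)"
  show "osys UNIV ?e" using svd_vec_orth nv(4) by (auto simp: osys_def)
  have nf: "norm (?f n) = (if ?s n = 0 then 0 else 1)" for n
    unfolding norm_scaleC norm_of_real svd_image_norm
    using singular_value_nonneg[OF bA, of n] by (simp add: svd_val_eq)
  show "osys UNIV ?f"
    using nf svd_image_orth by (auto simp: osys_def cinner_scaleC_left cinner_scaleC_right)
  have A0: "A (?e n) = 0" if "?s n = 0" for n
    using svd_image_norm[of n] that by (simp add: svd_val_eq)
  show Ae: "\<forall>n. A (?e n) = complex_of_real (?s n) *\<^sub>C ?f n"
  proof
    show "A (?e n) = complex_of_real (?s n) *\<^sub>C ?f n" for n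
      using A0 by (cases "?s n = 0") (auto simp: scaleC_scaleC)
  qed
  show "\<forall>n. ?s n \<noteq> 0 \<longrightarrow> norm (?e n) = 1 \<and> norm (?f n) = 1"
    using nv(2) nf by (simp only: svd_val_eq) simp
  show "\<forall>n. ?s n = 0 \<longrightarrow> ?e n = 0"
    using nv(3) by (simp only: svd_val_eq) simp
  show "?s \<longlonglongrightarrow> 0" using svd_val_tendsto by (simp only: svd_val_eq)
  show "\<forall>x. (\<lambda>n. (complex_of_real (?s n) * cinner x (?e n)) *\<^sub>C ?f n) sums A x"
  proof
    fix x
    have eq: "(complex_of_real (?s n) * cinner x (?e n)) *\<^sub>C ?f n = cinner x (?e n) *\<^sub>C A (?e n)" for n
      using Ae by (metis (no_types, lifting) mult.commute scaleC_scaleC)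
    have "(\<lambda>n. svd_rest A n x) \<longlonglongrightarrow> 0"
    proof (rule tendsto_0_le[where K=1])
      show "(\<lambda>n. svd_val A n * norm x) \<longlonglongrightarrow> 0"
        using tendsto_mult_right[OF svd_val_tendsto, of "norm x"] by simp
      show "\<forall>\<^sub>F n in sequentially. norm (svd_rest A n x) \<le> norm (svd_val A n * norm x) * 1"
        by (intro always_eventually) (auto intro: order_trans[OF bounded_op_onorm[OF bT]])
    qed
    then have "(\<lambda>n. A x - svd_rest A n x) \<longlonglongrightarrow> A x - 0" by (intro tendsto_intros)
    then show "(\<lambda>n. (complex_of_real (?s n) * cinner x (?e n)) *\<^sub>C ?f n) sums A x"
      unfolding sums_def eq by (subst (asm) svd_rest_eq) simp
  qed
qed

end


section \<open>Diagonal operators and the trace\<close>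

text \<open>The weights are arbitrary nonnegative numbers rather than singular values, so that the
  tail of a decomposition, with its first weights replaced by 0, is again of this form.\<close>

definition diag_op :: "('h::chilbert_space \<Rightarrow> 'h) \<Rightarrow> (nat \<Rightarrow> real) \<Rightarrow> (nat \<Rightarrow> 'h) \<Rightarrow> (nat \<Rightarrow> 'h) \<Rightarrow> bool" where
  "diag_op A q e f \<longleftrightarrow> osys UNIV e \<and> osys UNIV f \<and> (\<forall>n. 0 \<le> q n) \<and>
     (\<forall>x. (\<lambda>n. (complex_of_real (q n) * cinner x (e n)) *\<^sub>C f n) sums A x)"

lemma compact_op_svd:
  assumes "compact_op A"
  obtains e f where "diag_op A (singular_value A) e f" "singular_value A \<longlonglongrightarrow> 0"
    "\<And>n. A (e n) = complex_of_real (singular_value A n) *\<^sub>C f n"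
    "\<And>n. singular_value A n \<noteq> 0 \<Longrightarrow> norm (e n) = 1 \<and> norm (f n) = 1"
    "\<And>n. singular_value A n = 0 \<Longrightarrow> e n = 0"
proof -
  have "0 \<le> singular_value A n" for n
    using assms by (simp add: singular_value_nonneg compact_op_def)
  then show thesis
    using svd_exists[OF compact_op_seq[OF assms]] that unfolding diag_op_def by blast
qed

lemma weighted_cauchy_schwarz:
  fixes a b :: "nat \<Rightarrow> real"
  assumes "summable (\<lambda>n. (a n)\<^sup>2)" "summable (\<lambda>n. (b n)\<^sup>2)"
  shows "summable (\<lambda>n. \<bar>a n * b n\<bar>)"
    "(\<Sum>n. \<bar>a n * b n\<bar>) \<le> sqrt (\<Sum>n. (a n)\<^sup>2) * sqrt (\<Sum>n. (b n)\<^sup>2)"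
proof -
  have le: "(\<Sum>n<N. \<bar>a n * b n\<bar>) \<le> sqrt (\<Sum>n. (a n)\<^sup>2) * sqrt (\<Sum>n. (b n)\<^sup>2)" for N
  proof -
    have "(\<Sum>n<N. \<bar>a n * b n\<bar>) \<le> L2_set a {..<N} * L2_set b {..<N}"
      unfolding abs_mult by (rule L2_set_mult_ineq)
    also have "\<dots> \<le> sqrt (\<Sum>n. (a n)\<^sup>2) * sqrt (\<Sum>n. (b n)\<^sup>2)"
      unfolding L2_set_def using assms
      by (intro mult_mono real_sqrt_le_mono sum_le_suminf) (auto intro: suminf_nonneg sum_nonneg)
    finally show ?thesis .
  qed
  show "summable (\<lambda>n. \<bar>a n * b n\<bar>)"
    by (rule summableI_nonneg_bounded[OF _ le]) simp
  then show "(\<Sum>n. \<bar>a n * b n\<bar>) \<le> sqrt (\<Sum>n. (a n)\<^sup>2) * sqrt (\<Sum>n. (b n)\<^sup>2)"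
    by (intro suminf_le_const le)
qed

section \<open>Norm estimates for diagonal operators and their adjoints\<close>

lemma osys_weighted_summable:
  assumes "osys (UNIV :: nat set) e" "\<And>n. 0 \<le> q n" "\<And>n. q n \<le> M"
  shows "summable (\<lambda>n. (q n)\<^sup>2 * (cmod (cinner x (e n)))\<^sup>2)"
proof (rule summable_comparison_test')
  show "summable (\<lambda>n. M\<^sup>2 * (cmod (cinner x (e n)))\<^sup>2)"
    by (intro summable_mult bessel_summable assms)
  show "norm ((q n)\<^sup>2 * (cmod (cinner x (e n)))\<^sup>2) \<le> M\<^sup>2 * (cmod (cinner x (e n)))\<^sup>2" if "n \<ge> 0" for n
    using assms(2,3)[of n] by (simp add: mult_right_mono power_mono)
qed

lemma diag_op_cinner:
  assumes "diag_op A q e f"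
  shows "(\<lambda>n. complex_of_real (q n) * cinner x (e n) * cinner (f n) y) sums cinner (A x) y"
proof -
  have "(\<lambda>n. (complex_of_real (q n) * cinner x (e n)) *\<^sub>C f n) sums A x"
    using assms by (simp add: diag_op_def)
  from bounded_linear.sums[OF bounded_linear_cinner_left[of y] this]
  show ?thesis by (simp add: cinner_scaleC_left)
qed

lemma diag_op_norm_le:
  assumes d: "diag_op A q e f" and q: "\<And>n. q n \<le> M"
  shows "(norm (A x))\<^sup>2 \<le> (\<Sum>n. (q n)\<^sup>2 * (cmod (cinner x (e n)))\<^sup>2)"
proof (rule LIMSEQ_le_const2)
  note D = d[unfolded diag_op_def]
  show "(\<lambda>N. (norm (\<Sum>n<N. (complex_of_real (q n) * cinner x (e n)) *\<^sub>C f n))\<^sup>2) \<longlonglongrightarrow> (norm (A x))\<^sup>2"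
    using D by (intro tendsto_intros) (auto simp: sums_def)
  have "(norm (\<Sum>n<N. (complex_of_real (q n) * cinner x (e n)) *\<^sub>C f n))\<^sup>2
      \<le> (\<Sum>n. (q n)\<^sup>2 * (cmod (cinner x (e n)))\<^sup>2)" for N
  proof -
    have "(norm (\<Sum>n<N. (complex_of_real (q n) * cinner x (e n)) *\<^sub>C f n))\<^sup>2
      \<le> (\<Sum>n<N. (cmod (complex_of_real (q n) * cinner x (e n)))\<^sup>2)"
      using D by (intro osys_norm_sum_le) (auto intro: osys_subset)
    also have "\<dots> = (\<Sum>n<N. (q n)\<^sup>2 * (cmod (cinner x (e n)))\<^sup>2)"
      by (simp add: norm_mult power_mult_distrib)
    also have "\<dots> \<le> (\<Sum>n. (q n)\<^sup>2 * (cmod (cinner x (e n)))\<^sup>2)"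
      using D q by (intro sum_le_suminf osys_weighted_summable) auto
    finally show ?thesis .
  qed
  then show "\<exists>N. \<forall>n\<ge>N. (norm (\<Sum>n<n. (complex_of_real (q n) * cinner x (e n)) *\<^sub>C f n))\<^sup>2
      \<le> (\<Sum>n. (q n)\<^sup>2 * (cmod (cinner x (e n)))\<^sup>2)" by blast
qed

text \<open>The adjoint has the same expansion with \<open>e\<close> and \<open>f\<close> exchanged.
  The bound is obtained weakly, by Cauchy-Schwarz between the coefficients of \<open>x\<close>,
  controlled by Bessel's inequality for \<open>e\<close>, and the weighted coefficients of
  \<open>y\<close>.\<close>

lemma diag_op_adj_norm_le:
  assumes A: "bounded_op A" and d: "diag_op A q e f" and q: "\<And>n. q n \<le> M"
  shows "(norm (adj A y))\<^sup>2 \<le> (\<Sum>n. (q n)\<^sup>2 * (cmod (cinner y (f n)))\<^sup>2)"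
proof -
  note D = d[unfolded diag_op_def]
  let ?S = "\<Sum>n. (q n)\<^sup>2 * (cmod (cinner y (f n)))\<^sup>2"
  have sm: "summable (\<lambda>n. (q n)\<^sup>2 * (cmod (cinner y (f n)))\<^sup>2)"
    using D q by (intro osys_weighted_summable) auto
  have "norm (adj A y) \<le> sqrt ?S"
  proof (rule norm_le_cinner)
    show "0 \<le> sqrt ?S" by (simp add: suminf_nonneg[OF sm])
    fix x
    let ?a = "\<lambda>n. cmod (cinner x (e n))" and ?b = "\<lambda>n. q n * cmod (cinner y (f n))"
    have sa: "summable (\<lambda>n. (?a n)\<^sup>2)" using D by (intro bessel_summable) auto
    have sb: "summable (\<lambda>n. (?b n)\<^sup>2)" using sm by (simp add: power_mult_distrib)
    have eq: "norm (complex_of_real (q n) * cinner x (e n) * cinner (f n) y) = \<bar>?a n * ?b n\<bar>" for n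
      using D by (simp add: norm_mult cinner_cmod_commute[of y] abs_mult)
    have "cmod (cinner (adj A y) x) = cmod (cinner (A x) y)"
      by (simp add: adj_props(2)[OF A] cinner_cmod_commute[of y])
    also have "\<dots> = cmod (\<Sum>n. complex_of_real (q n) * cinner x (e n) * cinner (f n) y)"
      using sums_unique[OF diag_op_cinner[OF d]] by simp
    also have "\<dots> \<le> (\<Sum>n. \<bar>?a n * ?b n\<bar>)"
      unfolding eq[symmetric]
      by (rule summable_norm) (simp only: eq weighted_cauchy_schwarz(1)[OF sa sb])
    also have "\<dots> \<le> sqrt (\<Sum>n. (?a n)\<^sup>2) * sqrt (\<Sum>n. (?b n)\<^sup>2)"
      by (rule weighted_cauchy_schwarz(2)[OF sa sb])
    also have "\<dots> \<le> norm x * sqrt ?S"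
    proof (rule mult_mono)
      show "sqrt (\<Sum>n. (?a n)\<^sup>2) \<le> norm x"
        using D bessel_summable(2)[of e x] by (simp add: real_le_lsqrt)
      show "sqrt (\<Sum>n. (?b n)\<^sup>2) \<le> sqrt ?S" by (simp add: power_mult_distrib)
      show "0 \<le> sqrt (\<Sum>n. (?b n)\<^sup>2)" by (simp add: suminf_nonneg[OF sb])
    qed simp
    finally show "cmod (cinner (adj A y) x) \<le> sqrt ?S * norm x" by (simp add: mult.commute)
  qed
  then have "(norm (adj A y))\<^sup>2 \<le> (sqrt ?S)\<^sup>2" by (rule power_mono) simp
  then show ?thesis by (simp add: suminf_nonneg[OF sm])
qed

text \<open>In the double family with entries \<open>s n * (f n, b) * (b, e n)\<close> the sum of
  the moduli over \<open>b\<close> is at most \<open>s n\<close>, so the family is absolutely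
  summable. Summing over \<open>n\<close> first gives the diagonal entries of \<open>A\<close>;
  summing over \<open>b\<close> first gives \<open>s n * (f n, e n)\<close>, which does not refer to
  the basis.\<close>

lemma trace_summable_exists:
  assumes A: "bounded_op A" and s: "summable (singular_value A)"
  shows "\<exists>t. \<forall>B. orthonormal_basis B \<longrightarrow> ((\<lambda>e. cinner (A e) e) has_sum t) B"
proof -
  let ?s = "singular_value A"
  have "compact_op A"
    by (rule compact_op_singular_values[OF A summable_LIMSEQ_zero[OF s]])
  then obtain e f where d: "diag_op A ?s e f" by (rule compact_op_svd)
  note D = d[unfolded diag_op_def]
  have s0: "0 \<le> ?s n" for n by (rule singular_value_nonneg[OF A])
  have n1: "norm (e n) \<le> 1" "norm (f n) \<le> 1" for n using D by (auto simp: osys_def)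
  have "((\<lambda>b. cinner (A b) b) has_sum infsum (\<lambda>n. complex_of_real (?s n) * cinner (f n) (e n)) UNIV) B"
    if B: "orthonormal_basis B" for B
  proof -
    let ?g = "\<lambda>n b. complex_of_real (?s n) * (cinner (f n) b * cinner b (e n))"
    have inner_abs: "(\<lambda>b. cmod (?g n b)) summable_on B"
      and inner_le: "infsum (\<lambda>b. cmod (?g n b)) B \<le> ?s n" for n
    proof -
      let ?h = "\<lambda>b. ?s n * ((cmod (cinner (f n) b))\<^sup>2 + (cmod (cinner (e n) b))\<^sup>2) / 2"
      have "((\<lambda>b. (?s n / 2) * ((cmod (cinner (f n) b))\<^sup>2 + (cmod (cinner (e n) b))\<^sup>2)) has_sum
          (?s n / 2) * ((norm (f n))\<^sup>2 + (norm (e n))\<^sup>2)) B"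
        by (intro has_sum_cmult_right has_sum_add parseval_norm B)
      then have h: "(?h has_sum (?s n / 2) * ((norm (f n))\<^sup>2 + (norm (e n))\<^sup>2)) B" by simp
      have le: "cmod (?g n b) \<le> ?h b" for b
      proof -
        have "2 * (cmod (cinner (f n) b) * cmod (cinner (e n) b))
          \<le> (cmod (cinner (f n) b))\<^sup>2 + (cmod (cinner (e n) b))\<^sup>2"
          using sum_squares_bound[of "cmod (cinner (f n) b)" "cmod (cinner (e n) b)"] by simp
        from mult_left_mono[OF this s0[of n]] show ?thesis
          by (simp add: norm_mult s0 cinner_cmod_commute[of b])
      qed
      show sm: "(\<lambda>b. cmod (?g n b)) summable_on B"
        by (rule summable_on_comparison_test[of ?h]) (use h le in \<open>auto simp: summable_on_def\<close>)
      have "infsum (\<lambda>b. cmod (?g n b)) B \<le> (?s n / 2) * ((norm (f n))\<^sup>2 + (norm (e n))\<^sup>2)"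
        using infsum_mono[OF sm, of ?h] h le infsumI[OF h] by (auto simp: summable_on_def)
      also have "\<dots> \<le> (?s n / 2) * (1 + 1)"
        by (intro mult_left_mono add_mono) (use s0[of n] n1 in \<open>auto simp: power_le_one\<close>)
      finally show "infsum (\<lambda>b. cmod (?g n b)) B \<le> ?s n" by simp
    qed
    have "(\<lambda>(n, b). cmod (?g n b)) summable_on (UNIV \<times> B)"
    proof (rule summable_on_SigmaI)
      show "((\<lambda>b. case (n, b) of (n, b) \<Rightarrow> cmod (?g n b)) has_sum infsum (\<lambda>b. cmod (?g n b)) B) B" for n
        using inner_abs[of n] by simp
      have "summable (\<lambda>n. infsum (\<lambda>b. cmod (?g n b)) B)"
        by (rule summable_comparison_test'[OF s]) (simp add: inner_le infsum_nonneg)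
      then show "(\<lambda>n. infsum (\<lambda>b. cmod (?g n b)) B) summable_on UNIV"
        by (intro summable_nonneg_imp_summable_on) (simp_all add: infsum_nonneg)
    qed auto
    then have "(\<lambda>p. cmod (case p of (n, b) \<Rightarrow> ?g n b)) summable_on (UNIV \<times> B)"
      by (simp add: case_prod_unfold)
    then have "(\<lambda>(n, b). ?g n b) summable_on (UNIV \<times> B)"
      by (rule abs_summable_summable)
    then obtain S where S: "((\<lambda>(n, b). ?g n b) has_sum S) (UNIV \<times> B)"
      by (auto simp: summable_on_def)
    have "((\<lambda>n. complex_of_real (?s n) * cinner (f n) (e n)) has_sum S) UNIV"
    proof (rule has_sum_SigmaD[OF S])
      show "((\<lambda>b. case (n, b) of (n, b) \<Rightarrow> ?g n b) has_sum complex_of_real (?s n) * cinner (f n) (e n)) B" for n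
        using has_sum_cmult_right[OF parseval_cinner[OF B]] by simp
    qed
    then have S_eq: "infsum (\<lambda>n. complex_of_real (?s n) * cinner (f n) (e n)) UNIV = S"
      by (rule infsumI)
    have swapped: "((\<lambda>(b, n). ?g n b) has_sum S) (B \<times> UNIV)"
      using S by (subst (asm) has_sum_swap) (simp add: case_prod_unfold)
    then show ?thesis unfolding S_eq
    proof (rule has_sum_SigmaD)
      fix b assume "b \<in> B"
      have "(\<lambda>n. ?g n b) sums cinner (A b) b"
        using diag_op_cinner[OF d, of b b] by (simp add: mult_ac)
      moreover have "(\<lambda>n. ?g n b) summable_on UNIV"
        using swapped \<open>b \<in> B\<close> summable_on_SigmaD1[of "\<lambda>b n. ?g n b" B "\<lambda>_. UNIV" b]
        by (auto simp: summable_on_def)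
      ultimately show "((\<lambda>n. case (b, n) of (b, n) \<Rightarrow> ?g n b) has_sum cinner (A b) b) UNIV"
        using sums_unique2[OF has_sum_imp_sums] by (auto simp: summable_on_def)
    qed
  qed
  then show ?thesis by blast
qed

lemma orthonormal_empty: "orthonormal {}"
  by (simp add: orthonormal_def)

lemma op_trace_eqI:
  assumes "\<And>B. orthonormal_basis B \<Longrightarrow> ((\<lambda>e. cinner (A e) e) has_sum t) B"
  shows "op_trace A = t"
  unfolding op_trace_def
proof (rule the_equality)
  obtain B :: "'a set" where "orthonormal_basis B"
    using orthonormal_basis_extension[OF orthonormal_empty] by blast
  then show "t' = t" if "\<forall>B. orthonormal_basis B \<longrightarrow> ((\<lambda>e. cinner (A e) e) has_sum t') B" for t'
    using assms that has_sum_unique by blast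
qed (use assms in blast)

lemma op_trace_has_sum:
  assumes "bounded_op A" "summable (singular_value A)" "orthonormal_basis B"
  shows "((\<lambda>e. cinner (A e) e) has_sum op_trace A) B"
proof -
  obtain t where t: "\<And>B. orthonormal_basis B \<Longrightarrow> ((\<lambda>e. cinner (A e) e) has_sum t) B"
    using trace_summable_exists[OF assms(1,2)] by blast
  then show ?thesis using op_trace_eqI[OF t] assms(3) by simp
qed

lemma op_trace_rank1:
  "op_trace (\<lambda>x. cinner x v *\<^sub>C w) = cinner w v"
proof (rule op_trace_eqI)
  fix B :: "'a set" assume "orthonormal_basis B"
  from parseval_cinner[OF this, of w v]
  show "((\<lambda>e. cinner (cinner e v *\<^sub>C w) e) has_sum cinner w v) B"
    by (simp add: cinner_scaleC_left mult.commute)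
qed


subsection \<open>A criterion for decay of the approximation numbers\<close>

text \<open>Compressing \<open>A\<close> to the complements of the vectors already chosen changes it
  by rank at most \<open>2 * N\<close>, so the compression still has norm at least \<open>r\<close>.
  A unit vector whose image has norm above \<open>r / 2\<close> supplies the next pair.\<close>

lemma greedy_systems:
  fixes A :: "'h::chilbert_space \<Rightarrow> 'h" and N :: nat
  assumes A: "bounded_op A" and "0 < r" and ge: "\<And>n. r \<le> singular_value A n"
  shows "\<exists>x y. osys {..<N} x \<and> osys {..<N} y \<and>
    (\<forall>i<N. norm (x i) = 1 \<and> norm (y i) = 1 \<and> r / 2 \<le> cmod (cinner (A (x i)) (y i)))"
proof (induction N)
  case 0
  then show ?case by (simp add: osys_def)
next
  case (Suc N)
  then obtain x y where xy: "osys {..<N} x" "osys {..<N} y"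
    "\<And>i. i < N \<Longrightarrow> norm (x i) = 1" "\<And>i. i < N \<Longrightarrow> norm (y i) = 1"
    "\<And>i. i < N \<Longrightarrow> r / 2 \<le> cmod (cinner (A (x i)) (y i))" by blast
  define P where "P u = u - (\<Sum>i<N. cinner u (x i) *\<^sub>C x i)" for u
  define P' where "P' u = u - (\<Sum>i<N. cinner u (y i) *\<^sub>C y i)" for u
  have bP: "bounded_op P" "bounded_op P'" unfolding P_def P'_def
    by (intro bounded_op_diff bounded_op_id bounded_op_sum bounded_op_rank1)+
  have orth: "cinner (P u) (x i) = 0" "cinner (P' u) (y i) = 0" if "i < N" for u i
    using osys_cinner_sum[OF xy(1), of "{..<N}" i "\<lambda>i. cinner u (x i)"]
      osys_cinner_sum[OF xy(2), of "{..<N}" i "\<lambda>i. cinner u (y i)"] that xy(3,4)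
    by (simp_all add: P_def P'_def cinner_diff_left)
  have nP: "norm (P u) \<le> norm u" for u
  proof -
    have "(norm (P u))\<^sup>2 = (norm u)\<^sup>2 - (\<Sum>i<N. (cmod (cinner u (x i)))\<^sup>2 * (2 - (norm (x i))\<^sup>2))"
      unfolding P_def by (rule bessel_identity[OF xy(1)]) simp
    moreover have "0 \<le> (\<Sum>i<N. (cmod (cinner u (x i)))\<^sup>2 * (2 - (norm (x i))\<^sup>2))"
      by (intro sum_nonneg) (simp add: xy)
    ultimately have "(norm (P u))\<^sup>2 \<le> (norm u)\<^sup>2" by simp
    then show ?thesis by (rule power2_le_imp_le) simp
  qed
  define A' where "A' u = P' (A (P u))" for u
  have bA': "bounded_op A'" unfolding A'_def
    by (rule bounded_op_comp[OF bP(2) bounded_op_comp[OF A bP(1)]])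
  define K where "K u = A u - A' u" for u
  have bK: "bounded_op K" unfolding K_def by (rule bounded_op_diff[OF A bA'])
  have K_eq: "K u = (\<Sum>i<N. cinner u (x i) *\<^sub>C A (x i)) + (\<Sum>i<N. cinner (A (P u)) (y i) *\<^sub>C y i)" for u
    unfolding K_def A'_def P'_def by (simp add: P_def bounded_op_simps[OF A])
  have "rank_le K (2 * N)" unfolding rank_le_def
  proof (intro exI conjI)
    let ?S = "(\<lambda>i. A (x i)) ` {..<N} \<union> y ` {..<N}"
    have "card ((\<lambda>i. A (x i)) ` {..<N}) \<le> N" "card (y ` {..<N}) \<le> N"
      using card_image_le[of "{..<N}"] by (metis card_lessThan finite_lessThan)+
    then show "card ?S \<le> 2 * N"
      using card_Un_le[of "(\<lambda>i. A (x i)) ` {..<N}" "y ` {..<N}"] by simp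
    show "range K \<subseteq> cvec.span ?S"
    proof (clarify)
      show "K u \<in> cvec.span ?S" for u unfolding K_eq
        by (intro cvec.span_add cvec.span_sum cvec.span_scale cvec.span_base) auto
    qed
  qed simp
  from singular_value_le[OF A bK this] have "r \<le> onorm A'"
    using ge[of "2 * N"] by (simp add: K_def)
  then obtain u where u: "norm u = 1" "r / 2 < norm (A' u)"
    using unit_vector_near_onorm[OF bA', of "r/2"] \<open>0 < r\<close> by auto
  define p where "p = P u"
  define w where "w = A' u"
  have "w \<noteq> 0" using u(2) \<open>0 < r\<close> by (auto simp: w_def)
  then have "p \<noteq> 0" by (auto simp: w_def A'_def p_def bounded_op_simps[OF A] bounded_op_simps[OF bP(2)])
  have np: "norm p \<le> 1" using nP[of u] u(1) by (simp add: p_def)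
  \<comment> \<open>\<open>A p\<close> and \<open>w\<close> differ by a combination of the old
    \<open>y i\<close>, all orthogonal to \<open>w\<close>; hence pairing \<open>A p\<close> with
    \<open>w\<close> gives the full \<open>(norm w)\<^sup>2\<close>.\<close>
  have "A p = w + (\<Sum>i<N. cinner (A p) (y i) *\<^sub>C y i)" by (simp add: w_def A'_def P'_def p_def)
  then have "cinner (A p) w = cinner (w + (\<Sum>i<N. cinner (A p) (y i) *\<^sub>C y i)) w" by simp
  then have "cinner (A p) w = cinner w w + (\<Sum>i<N. cinner (A p) (y i) * cinner (y i) w)"
    by (simp only: cinner_add_left cinner_scaleC_left cinner_sum_left)
  moreover have wy: "cinner w (y i) = 0" "cinner (y i) w = 0" if "i < N" for i
    using orth(2)[OF that] cinner_commute[of "y i" w] by (simp_all add: w_def A'_def)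
  ultimately have Apw: "cinner (A p) w = complex_of_real ((norm w)\<^sup>2)"
    by (simp add: cinner_self del: of_real_power)
  have px: "cinner p (x i) = 0" "cinner (x i) p = 0" if "i < N" for i
    using orth(1)[OF that] cinner_commute[of "x i" p] by (simp_all add: p_def)
  define x' where "x' i = (if i = N then complex_of_real (1 / norm p) *\<^sub>C p else x i)" for i
  define y' where "y' i = (if i = N then complex_of_real (1 / norm w) *\<^sub>C w else y i)" for i
  have nx': "norm (x' i) = 1" "norm (y' i) = 1" if "i < Suc N" for i
    using that xy(3,4)[of i] \<open>p \<noteq> 0\<close> \<open>w \<noteq> 0\<close>
    unfolding x'_def y'_def by (auto simp: less_Suc_eq norm_scaleC norm_divide)
  have "osys {..<Suc N} x'" "osys {..<Suc N} y'"
    using xy(1,2) nx' px wy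
    by (auto simp: osys_def x'_def y'_def less_Suc_eq cinner_scaleC_left cinner_scaleC_right)
  moreover have "r / 2 \<le> cmod (cinner (A (x' N)) (y' N))"
  proof -
    have "cmod (cinner (A (x' N)) (y' N)) = norm w / norm p"
      unfolding x'_def y'_def using \<open>w \<noteq> 0\<close>
      by (simp add: bounded_op_simps[OF A] cinner_scaleC_left cinner_scaleC_right Apw norm_mult
          norm_divide norm_power power2_eq_square)
    \<comment> \<open>Normalising \<open>p\<close> can only help, since
      \<open>norm p \<le> 1\<close>.\<close>
    moreover have "norm w \<le> norm w / norm p"
      using np \<open>p \<noteq> 0\<close> by (simp add: field_simps mult_left_le_one_le)
    ultimately show ?thesis using u(2) unfolding w_def[symmetric] by linarith
  qed
  moreover have "r / 2 \<le> cmod (cinner (A (x' i)) (y' i))" if "i < N" for i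
    using xy(5)[OF that] that by (simp add: x'_def y'_def)
  ultimately show ?case using nx' by (intro exI[of _ x'] exI[of _ y']) (auto simp: less_Suc_eq)
qed


section \<open>Hoelder's inequality and interpolation\<close>

text \<open>\<open>lbd \<theta> I a C\<close> says that the \<open>\<ell>\<^sup>p\<close>-norm of \<open>a\<close> over \<open>I\<close> is at most \<open>C\<close>, where \<open>p = 1/\<theta>\<close> and
  \<open>\<theta> = 0\<close> stands for \<open>p = \<infinity>\<close>.\<close>

definition lbd :: "real \<Rightarrow> 'i set \<Rightarrow> ('i \<Rightarrow> real) \<Rightarrow> real \<Rightarrow> bool" where
  "lbd \<theta> I a C \<longleftrightarrow> 0 \<le> C \<and> (\<forall>i\<in>I. 0 \<le> a i) \<and>
     (if \<theta> = 0 then \<forall>i\<in>I. a i \<le> C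
      else \<forall>F. finite F \<longrightarrow> F \<subseteq> I \<longrightarrow> (\<Sum>i\<in>F. a i powr (1 / \<theta>)) \<le> C powr (1 / \<theta>))"

lemma lbd_nonneg: "lbd \<theta> I a C \<Longrightarrow> 0 \<le> C" "lbd \<theta> I a C \<Longrightarrow> i \<in> I \<Longrightarrow> 0 \<le> a i"
  by (auto simp: lbd_def)

lemma lbd_sum: "lbd \<theta> I a C \<Longrightarrow> \<theta> \<noteq> 0 \<Longrightarrow> finite F \<Longrightarrow> F \<subseteq> I \<Longrightarrow>
    (\<Sum>i\<in>F. a i powr (1 / \<theta>)) \<le> C powr (1 / \<theta>)"
  by (auto simp: lbd_def)

lemma lbd_mono:
  assumes "lbd \<theta> I a C" "0 \<le> \<theta>" "C \<le> D" "J \<subseteq> I" "\<And>i. i \<in> J \<Longrightarrow> 0 \<le> b i" "\<And>i. i \<in> J \<Longrightarrow> b i \<le> a i"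
  shows "lbd \<theta> J b D"
proof (cases "\<theta> = 0")
  case True
  have "b i \<le> D" if "i \<in> J" for i
  proof -
    have "a i \<le> C" using assms that True by (auto simp: lbd_def)
    then show ?thesis using assms(3) assms(6)[OF that] by linarith
  qed
  then show ?thesis using True assms(3,5) lbd_nonneg(1)[OF assms(1)] by (simp add: lbd_def)
next
  case False
  have "(\<Sum>i\<in>F. b i powr (1 / \<theta>)) \<le> D powr (1 / \<theta>)" if F: "finite F" "F \<subseteq> J" for F
  proof -
    have "(\<Sum>i\<in>F. b i powr (1 / \<theta>)) \<le> (\<Sum>i\<in>F. a i powr (1 / \<theta>))"
      using assms F by (intro sum_mono powr_mono2) auto
    also have "\<dots> \<le> C powr (1 / \<theta>)" using assms(4) F by (intro lbd_sum[OF assms(1) False]) auto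
    also have "\<dots> \<le> D powr (1 / \<theta>)"
      using assms(2,3) lbd_nonneg(1)[OF assms(1)] by (intro powr_mono2) auto
    finally show ?thesis .
  qed
  then show ?thesis using False assms(3,5) lbd_nonneg(1)[OF assms(1)] by (simp add: lbd_def)
qed

lemma lbd_elem:
  assumes "lbd \<theta> I a C" "0 \<le> \<theta>" "i \<in> I"
  shows "a i \<le> C"
proof (cases "\<theta> = 0")
  case False
  have "a i powr (1 / \<theta>) \<le> C powr (1 / \<theta>)"
    using lbd_sum[OF assms(1) False, of "{i}"] assms(3) by simp
  then have "(a i powr (1 / \<theta>)) powr \<theta> \<le> (C powr (1 / \<theta>)) powr \<theta>"
    using assms(2) by (rule powr_mono2[rotated 2]) auto
  then show ?thesis using False lbd_nonneg(1)[OF assms(1)] lbd_nonneg(2)[OF assms(1,3)] by (simp add: powr_powr)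
qed (use assms in \<open>auto simp: lbd_def\<close>)

lemma lbd_const: "0 \<le> C \<Longrightarrow> lbd 0 I (\<lambda>_. C) C"
  by (simp add: lbd_def)

lemma lbd_1:
  assumes "lbd 1 I a C" "finite F" "F \<subseteq> I"
  shows "(\<Sum>i\<in>F. a i) \<le> C"
proof -
  have "(\<Sum>i\<in>F. a i) = (\<Sum>i\<in>F. a i powr (1 / 1))"
    using assms lbd_nonneg(2)[OF assms(1)] by (intro sum.cong) (auto simp: subset_iff)
  then show ?thesis using lbd_sum[OF assms(1) _ assms(2,3)] lbd_nonneg(1)[OF assms(1)] by simp
qed

lemma weighted_am_gm:
  fixes x y :: real
  assumes "0 \<le> x" "0 \<le> y" "0 < \<alpha>" "0 < \<beta>" "\<alpha> + \<beta> = 1"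
  shows "x powr \<alpha> * y powr \<beta> \<le> \<alpha> * x + \<beta> * y"
  using Youngs_inequality_0[of \<alpha> \<beta> x y] assms
  by (cases "x = 0 \<or> y = 0") auto

lemma lbd_mult:
  assumes a: "lbd \<theta>1 I a A" and b: "lbd \<theta>2 I b B" and "0 \<le> \<theta>1" "0 \<le> \<theta>2"
  shows "lbd (\<theta>1 + \<theta>2) I (\<lambda>i. a i * b i) (A * B)"
proof -
  have pos: "0 \<le> A * B" "\<And>i. i \<in> I \<Longrightarrow> 0 \<le> a i * b i"
    using lbd_nonneg[OF a] lbd_nonneg[OF b] by auto
  consider "\<theta>1 = 0" "\<theta>2 = 0" | "\<theta>1 = 0" "\<theta>2 > 0" | "\<theta>1 > 0" "\<theta>2 = 0"
    | "A = 0 \<or> B = 0" | "\<theta>1 > 0" "\<theta>2 > 0" "A > 0" "B > 0"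
    using assms(3,4) lbd_nonneg(1)[OF a] lbd_nonneg(1)[OF b] by fastforce
  then show ?thesis
  proof cases
    case 1
    then show ?thesis using pos lbd_elem[OF a] lbd_elem[OF b] lbd_nonneg[OF a] lbd_nonneg[OF b]
      by (auto simp: lbd_def intro!: mult_mono)
  next
    case 2
    have "(\<Sum>i\<in>F. (a i * b i) powr (1 / \<theta>2)) \<le> (A * B) powr (1 / \<theta>2)" if F: "finite F" "F \<subseteq> I" for F
    proof -
      have "(\<Sum>i\<in>F. (a i * b i) powr (1 / \<theta>2)) \<le> (\<Sum>i\<in>F. A powr (1 / \<theta>2) * b i powr (1 / \<theta>2))"
      proof (intro sum_mono)
        fix i assume "i \<in> F"
        then have "i \<in> I" using F by blast
        then have "(a i * b i) powr (1 / \<theta>2) \<le> (A * b i) powr (1 / \<theta>2)"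
          using 2 lbd_elem[OF a _ \<open>i \<in> I\<close>] lbd_nonneg(2)[OF b] pos(2)
          by (intro powr_mono2 mult_right_mono) auto
        then show "(a i * b i) powr (1 / \<theta>2) \<le> A powr (1 / \<theta>2) * b i powr (1 / \<theta>2)"
          using lbd_nonneg[OF a] lbd_nonneg(2)[OF b \<open>i \<in> I\<close>] by (simp add: powr_mult)
      qed
      also have "\<dots> \<le> A powr (1 / \<theta>2) * B powr (1 / \<theta>2)"
        unfolding sum_distrib_left[symmetric] using 2 F by (intro mult_left_mono lbd_sum[OF b]) auto
      finally show ?thesis using lbd_nonneg(1)[OF a] lbd_nonneg(1)[OF b] by (simp add: powr_mult)
    qed
    then show ?thesis using 2 pos by (simp add: lbd_def)
  next
    case 3
    have "(\<Sum>i\<in>F. (a i * b i) powr (1 / \<theta>1)) \<le> (A * B) powr (1 / \<theta>1)" if F: "finite F" "F \<subseteq> I" for F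
    proof -
      have "(\<Sum>i\<in>F. (a i * b i) powr (1 / \<theta>1)) \<le> (\<Sum>i\<in>F. a i powr (1 / \<theta>1) * B powr (1 / \<theta>1))"
      proof (intro sum_mono)
        fix i assume "i \<in> F"
        then have "i \<in> I" using F by blast
        then have "(a i * b i) powr (1 / \<theta>1) \<le> (a i * B) powr (1 / \<theta>1)"
          using 3 lbd_elem[OF b _ \<open>i \<in> I\<close>] lbd_nonneg(2)[OF a] pos(2)
          by (intro powr_mono2 mult_left_mono) auto
        then show "(a i * b i) powr (1 / \<theta>1) \<le> a i powr (1 / \<theta>1) * B powr (1 / \<theta>1)"
          using lbd_nonneg[OF b] lbd_nonneg(2)[OF a \<open>i \<in> I\<close>] by (simp add: powr_mult)
      qed
      also have "\<dots> \<le> A powr (1 / \<theta>1) * B powr (1 / \<theta>1)"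
        unfolding sum_distrib_right[symmetric] using 3 F by (intro mult_right_mono lbd_sum[OF a]) auto
      finally show ?thesis using lbd_nonneg(1)[OF a] lbd_nonneg(1)[OF b] by (simp add: powr_mult)
    qed
    then show ?thesis using 3 pos by (simp add: lbd_def)
  next
    case 4
    have z: "a i * b i = 0" if "i \<in> I" for i
      using 4 lbd_elem[OF a assms(3) that] lbd_elem[OF b assms(4) that]
        lbd_nonneg(2)[OF a that] lbd_nonneg(2)[OF b that] by auto
    have z': "0 \<le> a i * b i \<and> a i * b i \<le> 0" if "i \<in> I" for i
      unfolding z[OF that] by simp
    have "(\<Sum>i\<in>F. (a i * b i) powr c) = 0" if "F \<subseteq> I" for F c
      using that z by (intro sum.neutral) (auto simp del: mult_eq_0_iff)
    then have "lbd (\<theta>1 + \<theta>2) I (\<lambda>i. a i * b i) 0"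
      using z' by (auto simp: lbd_def simp del: mult_eq_0_iff)
    then show ?thesis using 4 by auto
  next
    case 5
    let ?\<theta> = "\<theta>1 + \<theta>2"
    have "(\<Sum>i\<in>F. (a i * b i) powr (1 / ?\<theta>)) \<le> (A * B) powr (1 / ?\<theta>)" if F: "finite F" "F \<subseteq> I" for F
    proof -
      have le: "(a i * b i) powr (1 / ?\<theta>) \<le> (A * B) powr (1 / ?\<theta>) *
        ((\<theta>1 / ?\<theta>) * (a i powr (1 / \<theta>1) / A powr (1 / \<theta>1)) + (\<theta>2 / ?\<theta>) * (b i powr (1 / \<theta>2) / B powr (1 / \<theta>2)))"
        if "i \<in> F" for i
      proof -
        have i: "0 \<le> a i" "0 \<le> b i" using that F lbd_nonneg(2)[OF a] lbd_nonneg(2)[OF b] by auto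
        have "((a i / A) powr (1 / \<theta>1)) powr (\<theta>1 / ?\<theta>) * ((b i / B) powr (1 / \<theta>2)) powr (\<theta>2 / ?\<theta>)
          \<le> (\<theta>1 / ?\<theta>) * (a i / A) powr (1 / \<theta>1) + (\<theta>2 / ?\<theta>) * (b i / B) powr (1 / \<theta>2)"
          using 5 by (intro weighted_am_gm) (auto simp: add_divide_distrib[symmetric])
        moreover have "((a i / A) powr (1 / \<theta>1)) powr (\<theta>1 / ?\<theta>) * ((b i / B) powr (1 / \<theta>2)) powr (\<theta>2 / ?\<theta>)
          = (a i * b i) powr (1 / ?\<theta>) / (A * B) powr (1 / ?\<theta>)"
          using 5 i by (simp add: powr_powr powr_mult powr_divide)
        ultimately have "(a i * b i) powr (1 / ?\<theta>) / (A * B) powr (1 / ?\<theta>)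
          \<le> (\<theta>1 / ?\<theta>) * (a i / A) powr (1 / \<theta>1) + (\<theta>2 / ?\<theta>) * (b i / B) powr (1 / \<theta>2)"
          by linarith
        moreover have "(a i / A) powr (1 / \<theta>1) = a i powr (1 / \<theta>1) / A powr (1 / \<theta>1)"
          "(b i / B) powr (1 / \<theta>2) = b i powr (1 / \<theta>2) / B powr (1 / \<theta>2)" "0 < (A * B) powr (1 / ?\<theta>)"
          using 5 i by (simp_all add: powr_divide)
        ultimately show ?thesis by (simp only: pos_divide_le_eq mult.commute[of "(A * B) powr (1 / ?\<theta>)"])
      qed
      have "(\<Sum>i\<in>F. (a i * b i) powr (1 / ?\<theta>)) \<le> (\<Sum>i\<in>F. (A * B) powr (1 / ?\<theta>) *
        ((\<theta>1 / ?\<theta>) * (a i powr (1 / \<theta>1) / A powr (1 / \<theta>1)) + (\<theta>2 / ?\<theta>) * (b i powr (1 / \<theta>2) / B powr (1 / \<theta>2))))"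
        by (intro sum_mono le)
      also have "\<dots> = (A * B) powr (1 / ?\<theta>) *
        ((\<theta>1 / ?\<theta>) * ((\<Sum>i\<in>F. a i powr (1 / \<theta>1)) / A powr (1 / \<theta>1)) +
         (\<theta>2 / ?\<theta>) * ((\<Sum>i\<in>F. b i powr (1 / \<theta>2)) / B powr (1 / \<theta>2)))"
        by (simp only: sum_distrib_left[symmetric] sum.distrib sum_divide_distrib[symmetric])
      also have "\<dots> \<le> (A * B) powr (1 / ?\<theta>) * ((\<theta>1 / ?\<theta>) * 1 + (\<theta>2 / ?\<theta>) * 1)"
        using 5 lbd_sum[OF a _ F] lbd_sum[OF b _ F]
        by (intro mult_left_mono add_mono) auto
      also have "\<dots> = (A * B) powr (1 / ?\<theta>)"
        using 5 by (simp add: add_divide_distrib[symmetric])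
      finally show ?thesis .
    qed
    then show ?thesis using 5 pos by (simp add: lbd_def)
  qed
qed

text \<open>Converse of Hoelder's inequality: the extremal test sequence for the exponent
  \<open>p = 1 / \<theta>\<close> is \<open>a\<close> to the power \<open>p - 1\<close>. Only tests
  supported on a finite set occur, so that they can be realised by operators of finite rank.\<close>

lemma lbd_dual:
  assumes "0 < \<theta>" "\<theta> \<le> 1" "0 \<le> C" and a: "\<And>i. i \<in> I \<Longrightarrow> 0 \<le> a i"
    and dual: "\<And>b D F. finite F \<Longrightarrow> F \<subseteq> I \<Longrightarrow> lbd (1 - \<theta>) UNIV b D \<Longrightarrow> (\<And>i. i \<notin> F \<Longrightarrow> b i = 0) \<Longrightarrow>
      (\<Sum>i\<in>F. b i * a i) \<le> C * D"
  shows "lbd \<theta> I a C"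
proof -
  have "(\<Sum>i\<in>F. a i powr (1 / \<theta>)) \<le> C powr (1 / \<theta>)" if F: "finite F" "F \<subseteq> I" for F
  proof -
    define S where "S = (\<Sum>i\<in>F. a i powr (1 / \<theta>))"
    have "S \<ge> 0" unfolding S_def by (intro sum_nonneg) simp
    define b where "b i = (if i \<in> F then a i powr (1 / \<theta> - 1) else 0)" for i
    \<comment> \<open>Since \<open>(1 / \<theta> - 1) / (1 - \<theta>) = 1 / \<theta>\<close>, the
      conjugate norm of \<open>b\<close> is \<open>S powr (1 - \<theta>)\<close>; the pairing with
      \<open>a\<close> is \<open>S\<close>, and \<open>S powr \<theta> \<le> C\<close>
      follows.\<close>
    have "lbd (1 - \<theta>) UNIV b (S powr (1 - \<theta>))"
    proof (cases "\<theta> = 1")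
      case True
      \<comment> \<open>Here the exponents are 0, and \<open>0 powr 0 = 0\<close>: on
        \<open>F\<close> the value \<open>b i\<close> is 1 exactly when
        \<open>a i \<noteq> 0\<close>, which forces \<open>S > 0\<close> and makes the right side
        1.\<close>
      have "b i \<le> S powr (1 - \<theta>)" for i
      proof (cases "i \<in> F \<and> a i \<noteq> 0")
        case True
        then have "0 < S"
          unfolding S_def using F by (intro sum_pos2[of F i]) auto
        then show ?thesis using True \<open>\<theta> = 1\<close> by (simp add: b_def)
      qed (auto simp: b_def \<open>\<theta> = 1\<close>)
      then show ?thesis using True by (simp add: lbd_def b_def)
    next
      case False
      have "(\<Sum>i\<in>G. b i powr (1 / (1 - \<theta>))) \<le> S" if "finite G" for G
      proof -
        have eq: "(1 / \<theta> - 1) * (1 / (1 - \<theta>)) = 1 / \<theta>"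
          using False assms(1,2) by (simp add: field_simps)
        have "(\<Sum>i\<in>G. b i powr (1 / (1 - \<theta>))) = (\<Sum>i\<in>G \<inter> F. b i powr (1 / (1 - \<theta>)))"
          using that by (intro sum.mono_neutral_right) (auto simp: b_def)
        also have "\<dots> = (\<Sum>i\<in>G \<inter> F. a i powr (1 / \<theta>))"
          by (intro sum.cong refl) (simp only: b_def IntD2 if_True powr_powr eq)
        also have "\<dots> \<le> S" unfolding S_def using F by (intro sum_mono2) auto
        finally show ?thesis .
      qed
      moreover have "(S powr (1 - \<theta>)) powr (1 / (1 - \<theta>)) = S"
        using False \<open>S \<ge> 0\<close> by (simp add: powr_powr)
      ultimately show ?thesis using False by (simp add: lbd_def b_def)
    qed
    from dual[OF F this] have "(\<Sum>i\<in>F. b i * a i) \<le> C * S powr (1 - \<theta>)" by (simp add: b_def)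
    moreover have "(\<Sum>i\<in>F. b i * a i) = S" unfolding S_def
    proof (intro sum.cong refl)
      fix i assume "i \<in> F"
      then show "b i * a i = a i powr (1 / \<theta>)"
        using powr_add[of "a i" "1 / \<theta> - 1" 1] a[of i] F by (auto simp: b_def)
    qed
    ultimately have le: "S \<le> C * S powr (1 - \<theta>)" by simp
    have "S powr \<theta> \<le> C"
    proof (cases "S = 0")
      case False
      then have "S powr \<theta> * S powr (1 - \<theta>) \<le> C * S powr (1 - \<theta>)"
        using le \<open>S \<ge> 0\<close> by (simp add: powr_add[symmetric])
      then show ?thesis using False \<open>S \<ge> 0\<close> by simp
    qed (use assms in simp)
    then have "(S powr \<theta>) powr (1 / \<theta>) \<le> C powr (1 / \<theta>)"
      using assms(1) by (intro powr_mono2) auto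
    then show ?thesis using \<open>S \<ge> 0\<close> assms(1) by (simp add: powr_powr S_def)
  qed
  then show ?thesis using assms by (simp add: lbd_def)
qed

text \<open>Jensen's inequality, where \<open>m\<close> may exceed the total weight. The tangent
  inequality for the power at \<open>c = S / m\<close>, itself a case of weighted AM-GM, is summed;
  its constant term is not positive, so enlarging the total weight to \<open>m\<close> is
  harmless.\<close>

lemma power_mean_suminf:
  fixes w t :: "nat \<Rightarrow> real"
  assumes w: "\<And>n. 0 \<le> w n" "summable w" "suminf w \<le> m" and t: "\<And>n. 0 \<le> t n" and "1 \<le> \<sigma>" "0 < m"
    and sm: "summable (\<lambda>n. t n * w n)" "summable (\<lambda>n. t n powr \<sigma> * w n)"
  shows "(\<Sum>n. t n * w n) powr \<sigma> \<le> m powr (\<sigma> - 1) * (\<Sum>n. t n powr \<sigma> * w n)"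
proof -
  define S where "S = (\<Sum>n. t n * w n)"
  define U where "U = (\<Sum>n. t n powr \<sigma> * w n)"
  have "0 \<le> S" unfolding S_def using w t by (intro suminf_nonneg sm) simp
  have "0 \<le> U" unfolding U_def using w t by (intro suminf_nonneg sm) simp
  show ?thesis
  proof (cases "S = 0 \<or> \<sigma> = 1")
    case True
    then show ?thesis using \<open>0 \<le> U\<close> t \<open>0 < m\<close> \<open>0 \<le> S\<close> by (auto simp: S_def[symmetric] U_def[symmetric])
        (simp_all add: S_def U_def)
  next
    case False
    then have "1 < \<sigma>" "0 < S" using assms(5) \<open>0 \<le> S\<close> by auto
    define c where "c = S / m"
    have "0 < c" using \<open>0 < S\<close> \<open>0 < m\<close> by (simp add: c_def)
    have tangent: "\<sigma> * c powr (\<sigma> - 1) * t n - (\<sigma> - 1) * c powr \<sigma> \<le> t n powr \<sigma>" for n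
    proof -
      have "(t n powr \<sigma>) powr (1 / \<sigma>) * (c powr \<sigma>) powr (1 - 1 / \<sigma>)
        \<le> (1 / \<sigma>) * t n powr \<sigma> + (1 - 1 / \<sigma>) * c powr \<sigma>"
        using \<open>1 < \<sigma>\<close> by (intro weighted_am_gm) auto
      moreover have "\<sigma> * (1 - 1 / \<sigma>) = \<sigma> - 1" using \<open>1 < \<sigma>\<close> by (simp add: field_simps)
      ultimately have "t n * c powr (\<sigma> - 1) \<le> (1 / \<sigma>) * t n powr \<sigma> + (1 - 1 / \<sigma>) * c powr \<sigma>"
        using \<open>1 < \<sigma>\<close> t[of n] by (simp only: powr_powr) simp
      from mult_left_mono[OF this, of \<sigma>]
      have "\<sigma> * (t n * c powr (\<sigma> - 1)) \<le> t n powr \<sigma> + (\<sigma> * (1 - 1 / \<sigma>)) * c powr \<sigma>"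
        using \<open>1 < \<sigma>\<close> by (simp add: distrib_left)
      then show ?thesis unfolding \<open>\<sigma> * (1 - 1 / \<sigma>) = \<sigma> - 1\<close> by (simp add: mult_ac)
    qed
    have "(\<sigma> * c powr (\<sigma> - 1)) * (t n * w n) - ((\<sigma> - 1) * c powr \<sigma>) * w n \<le> t n powr \<sigma> * w n" for n
      using mult_right_mono[OF tangent[of n] w(1)[of n]] by (simp add: left_diff_distrib mult.assoc)
    then have "(\<Sum>n. (\<sigma> * c powr (\<sigma> - 1)) * (t n * w n) - ((\<sigma> - 1) * c powr \<sigma>) * w n) \<le> U"
      unfolding U_def by (intro suminf_le summable_diff summable_mult sm w)
    moreover have "(\<Sum>n. (\<sigma> * c powr (\<sigma> - 1)) * (t n * w n) - ((\<sigma> - 1) * c powr \<sigma>) * w n)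
      = (\<sigma> * c powr (\<sigma> - 1)) * S - ((\<sigma> - 1) * c powr \<sigma>) * suminf w"
      unfolding S_def by (simp only: suminf_diff[symmetric] suminf_mult[symmetric] summable_mult sm w)
    moreover have "((\<sigma> - 1) * c powr \<sigma>) * suminf w \<le> ((\<sigma> - 1) * c powr \<sigma>) * m"
      using \<open>1 < \<sigma>\<close> by (intro mult_left_mono w) auto
    moreover have "c powr \<sigma> * m = c powr (\<sigma> - 1) * S"
      using \<open>0 < c\<close> \<open>0 < m\<close> \<open>0 < S\<close> powr_add[of c "\<sigma> - 1" 1] by (simp add: c_def)
    ultimately have "(\<sigma> * c powr (\<sigma> - 1)) * S - (\<sigma> - 1) * (c powr (\<sigma> - 1) * S) \<le> U"
      by (metis (no_types, lifting) diff_left_mono mult.assoc order_trans)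
    then have "c powr (\<sigma> - 1) * S \<le> U" by (simp add: left_diff_distrib mult.assoc)
    then have "m powr (\<sigma> - 1) * (c powr (\<sigma> - 1) * S) \<le> m powr (\<sigma> - 1) * U"
      by (intro mult_left_mono) auto
    moreover have "m powr (\<sigma> - 1) * (c powr (\<sigma> - 1) * S) = S powr \<sigma>"
      using \<open>0 < m\<close> \<open>0 < S\<close> powr_add[of S "\<sigma> - 1" 1] by (simp add: c_def powr_divide)
    ultimately show ?thesis by (simp add: S_def U_def)
  qed
qed


subsection \<open>Column operators\<close>

text \<open>A one-sided substitute for a Schatten bound with exponent \<open>1 / \<theta>\<close>:
  \<open>Q* Q\<close> is dominated by a diagonal form. It can be verified for test operators and for
  tails without knowing their singular values.\<close>

definition opb :: "real \<Rightarrow> ('h::chilbert_space \<Rightarrow> 'h) \<Rightarrow> real \<Rightarrow> bool" where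
  "opb \<theta> Q K \<longleftrightarrow> bounded_op Q \<and> 0 \<le> K \<and>
     (if \<theta> = 0 then \<forall>x. norm (Q x) \<le> K * norm x
      else \<exists>q e. osys UNIV e \<and> lbd \<theta> UNIV q K \<and>
        (\<forall>x. (norm (Q x))\<^sup>2 \<le> (\<Sum>n. (q n)\<^sup>2 * (cmod (cinner x (e n)))\<^sup>2)))"

definition column_norm :: "('h::chilbert_space \<Rightarrow> 'h) \<Rightarrow> (nat \<Rightarrow> 'h \<Rightarrow> 'h) \<Rightarrow> 'h \<Rightarrow> real" where
  "column_norm Q D u = sqrt (\<Sum>j. (norm (Q (D j u)))\<^sup>2)"

text \<open>Both the column of the \<open>D j\<close> and the column of their adjoints are bounded:
  these are the two bounds behind the row sums and the column sums in the interpolation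
  argument.\<close>

definition column_bound :: "(nat \<Rightarrow> 'h::chilbert_space \<Rightarrow> 'h) \<Rightarrow> real \<Rightarrow> bool" where
  "column_bound D d \<longleftrightarrow> (\<forall>j. bounded_op (D j)) \<and> 0 \<le> d \<and>
     (\<forall>u J. (\<Sum>j<J. (norm (D j u))\<^sup>2) \<le> (d * norm u)\<^sup>2) \<and>
     (\<forall>u J. (\<Sum>j<J. (norm (adj (D j) u))\<^sup>2) \<le> (d * norm u)\<^sup>2)"

lemma column_summable:
  assumes D: "column_bound D d" and Q: "bounded_op Q"
  shows "summable (\<lambda>j. (norm (Q (D j u)))\<^sup>2)" "column_norm Q D u \<le> onorm Q * (d * norm u)"
    "0 \<le> column_norm Q D u"
proof -
  have le: "(\<Sum>j<J. (norm (Q (D j u)))\<^sup>2) \<le> (onorm Q * (d * norm u))\<^sup>2" for J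
  proof -
    have "(\<Sum>j<J. (norm (Q (D j u)))\<^sup>2) \<le> (\<Sum>j<J. (onorm Q)\<^sup>2 * (norm (D j u))\<^sup>2)"
      unfolding power_mult_distrib[symmetric] by (intro sum_mono power_mono bounded_op_onorm Q) simp
    also have "\<dots> \<le> (onorm Q)\<^sup>2 * (d * norm u)\<^sup>2"
      unfolding sum_distrib_left[symmetric] using D by (intro mult_left_mono) (auto simp: column_bound_def)
    finally show ?thesis by (simp add: power_mult_distrib)
  qed
  show sm: "summable (\<lambda>j. (norm (Q (D j u)))\<^sup>2)"
    by (rule summableI_nonneg_bounded[OF _ le]) simp
  have "(\<Sum>j. (norm (Q (D j u)))\<^sup>2) \<le> (onorm Q * (d * norm u))\<^sup>2"
    by (rule suminf_le_const[OF sm le])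
  moreover have "0 \<le> onorm Q * (d * norm u)"
    using bounded_op_onorm_nonneg[OF Q] D by (simp add: column_bound_def)
  ultimately show "column_norm Q D u \<le> onorm Q * (d * norm u)"
    unfolding column_norm_def by (intro real_le_lsqrt)
  show "0 \<le> column_norm Q D u" unfolding column_norm_def by (intro real_sqrt_ge_zero suminf_nonneg sm) simp
qed

text \<open>Interpolation between \<open>\<ell>\<^sup>2\<close> and \<open>\<ell>\<^sup>\<infinity>\<close>: the matrix \<open>\<Sum>\<^sub>j \<bar>(D\<^sub>j x\<^sub>i, e\<^sub>n)\<bar>\<^sup>2\<close> has row and column sums at
  most \<open>d\<^sup>2\<close>, so Jensen's inequality applies row by row.\<close>

lemma lbd_column_norm:
  assumes D: "column_bound D d" and "0 < d" and Q: "opb \<theta> Q K" and "0 \<le> \<theta>" "\<theta> \<le> 1 / 2"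
    and x: "osys I x"
  shows "lbd \<theta> I (\<lambda>i. column_norm Q D (x i)) (d * K)"
proof (cases "\<theta> = 0")
  case True
  have Qb: "bounded_op Q" "0 \<le> K" "\<And>x. norm (Q x) \<le> K * norm x" using Q True by (auto simp: opb_def)
  have "column_norm Q D (x i) \<le> d * K" if "i \<in> I" for i
  proof -
    have "column_norm Q D (x i) \<le> onorm Q * (d * norm (x i))" by (rule column_summable(2)[OF D Qb(1)])
    also have "\<dots> \<le> K * (d * 1)"
      using Qb osys_norm[OF x that] \<open>0 < d\<close> by (intro mult_mono onorm_bound) auto
    finally show ?thesis by (simp add: mult.commute)
  qed
  then show ?thesis using True column_summable(3)[OF D Qb(1)] Qb(2) \<open>0 < d\<close> by (simp add: lbd_def)
next
  case False
  then have "\<theta> > 0" using assms(4) by simp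
  obtain q e where e: "osys UNIV e" and q: "lbd \<theta> UNIV q K"
    and Qx: "\<And>x. (norm (Q x))\<^sup>2 \<le> (\<Sum>n. (q n)\<^sup>2 * (cmod (cinner x (e n)))\<^sup>2)"
    and Qb: "bounded_op Q" "0 \<le> K"
    using Q False by (auto simp: opb_def)
  have q0: "0 \<le> q n" "q n \<le> K" for n using lbd_nonneg(2)[OF q] lbd_elem[OF q assms(4)] by auto
  \<comment> \<open>Squaring the column norms halves the exponent \<open>1 / \<theta>\<close>;
    \<open>\<sigma> \<ge> 1\<close>, which Jensen's inequality requires, is the condition
    \<open>\<theta> \<le> 1 / 2\<close>.\<close>
  define \<sigma> where "\<sigma> = 1 / (2 * \<theta>)"
  have "1 \<le> \<sigma>" using assms(5) \<open>\<theta> > 0\<close> by (simp add: \<sigma>_def field_simps)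
  have \<sigma>2: "1 / \<theta> = 2 * \<sigma>" using \<open>\<theta> > 0\<close> by (simp add: \<sigma>_def)
  have sq: "(q n)\<^sup>2 powr \<sigma> = q n powr (1 / \<theta>)" for n
    using powr_powr[of "q n" 2 \<sigma>] q0(1)[of n] unfolding \<sigma>2 by (cases "q n = 0") (simp_all add: powr_numeral)
  have sm_q: "summable (\<lambda>n. q n powr (1 / \<theta>))"
    and le_q: "(\<Sum>n. q n powr (1 / \<theta>)) \<le> K powr (1 / \<theta>)"
  proof -
    have le: "(\<Sum>n<N. q n powr (1 / \<theta>)) \<le> K powr (1 / \<theta>)" for N using lbd_sum[OF q False] by simp
    show "summable (\<lambda>n. q n powr (1 / \<theta>))" by (rule summableI_nonneg_bounded[OF _ le]) simp
    then show "(\<Sum>n. q n powr (1 / \<theta>)) \<le> K powr (1 / \<theta>)" by (intro suminf_le_const le)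
  qed
  note bD = D[unfolded column_bound_def]
  \<comment> \<open>Truncating the columns at \<open>J\<close> keeps the weights \<open>w\<close>
    finite sums; the bound does not depend on \<open>J\<close>, which tends to infinity at the
    end.\<close>
  have fin: "(\<Sum>i\<in>F. (\<Sum>j<J. (norm (Q (D j (x i))))\<^sup>2) powr \<sigma>) \<le> (d * K) powr (1 / \<theta>)"
    if F: "finite F" "F \<subseteq> I" for F J
  proof -
    define w where "w i n = (\<Sum>j<J. (cmod (cinner (D j (x i)) (e n)))\<^sup>2)" for i n
    have w0: "0 \<le> w i n" for i n unfolding w_def by (intro sum_nonneg) simp
    have sm_w: "summable (w i)" for i
      unfolding w_def by (intro summable_sum bessel_summable e)
    have w_row: "suminf (w i) \<le> d\<^sup>2" if "i \<in> F" for i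
    proof -
      have "suminf (w i) = (\<Sum>j<J. \<Sum>n. (cmod (cinner (D j (x i)) (e n)))\<^sup>2)"
        unfolding w_def by (intro suminf_sum bessel_summable e)
      also have "\<dots> \<le> (\<Sum>j<J. (norm (D j (x i)))\<^sup>2)" by (intro sum_mono bessel_summable e)
      also have "\<dots> \<le> (d * norm (x i))\<^sup>2" using bD by blast
      also have "\<dots> \<le> d\<^sup>2"
        using osys_norm[OF x, of i] that F \<open>0 < d\<close> by (intro power_mono) (auto simp: mult_left_le)
      finally show ?thesis .
    qed
    have w_col: "(\<Sum>i\<in>F. w i n) \<le> d\<^sup>2" for n
    proof -
      have "(\<Sum>i\<in>F. w i n) = (\<Sum>j<J. \<Sum>i\<in>F. (cmod (cinner (adj (D j) (e n)) (x i)))\<^sup>2)"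
        unfolding w_def using bD by (subst sum.swap) (simp add: adj_props cinner_cmod_commute[of "e n"])
      also have "\<dots> \<le> (\<Sum>j<J. (norm (adj (D j) (e n)))\<^sup>2)"
        by (intro sum_mono bessel osys_subset[OF x] F)
      also have "\<dots> \<le> (d * norm (e n))\<^sup>2" using bD by blast
      also have "\<dots> \<le> d\<^sup>2"
        using osys_norm[OF e, of n] \<open>0 < d\<close> by (intro power_mono) (auto simp: mult_left_le)
      finally show ?thesis .
    qed
    have w_le: "w i n \<le> d\<^sup>2" if "i \<in> F" for i n
      using member_le_sum[of i F "\<lambda>i. w i n"] that F w0 w_col[of n] by force
    have sm_qw: "summable (\<lambda>n. q n powr (1 / \<theta>) * w i n)" if "i \<in> F" for i
      by (rule summable_comparison_test'[OF summable_mult2[OF sm_q, of "d\<^sup>2"]])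
         (use w_le[OF that] w0 in \<open>auto intro!: mult_left_mono\<close>)
    have row: "(\<Sum>j<J. (norm (Q (D j (x i))))\<^sup>2) powr \<sigma>
      \<le> (d\<^sup>2) powr (\<sigma> - 1) * (\<Sum>n. q n powr (1 / \<theta>) * w i n)" if "i \<in> F" for i
    proof -
      have sm1: "summable (\<lambda>n. (q n)\<^sup>2 * (cmod (cinner y (e n)))\<^sup>2)" for y
        by (rule osys_weighted_summable[OF e q0])
      have "(\<Sum>j<J. (norm (Q (D j (x i))))\<^sup>2)
        \<le> (\<Sum>j<J. \<Sum>n. (q n)\<^sup>2 * (cmod (cinner (D j (x i)) (e n)))\<^sup>2)" by (intro sum_mono Qx)
      also have "\<dots> = (\<Sum>n. (q n)\<^sup>2 * w i n)"
        unfolding w_def sum_distrib_left by (intro suminf_sum[symmetric] sm1)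
      finally have "(\<Sum>j<J. (norm (Q (D j (x i))))\<^sup>2) powr \<sigma> \<le> (\<Sum>n. (q n)\<^sup>2 * w i n) powr \<sigma>"
        using \<open>1 \<le> \<sigma>\<close> by (intro powr_mono2 sum_nonneg) auto
      also have "\<dots> \<le> (d\<^sup>2) powr (\<sigma> - 1) * (\<Sum>n. ((q n)\<^sup>2) powr \<sigma> * w i n)"
      proof (rule power_mean_suminf[OF w0 sm_w w_row[OF that] _ \<open>1 \<le> \<sigma>\<close>])
        show "summable (\<lambda>n. (q n)\<^sup>2 * w i n)"
          unfolding w_def sum_distrib_left by (intro summable_sum sm1)
        show "summable (\<lambda>n. ((q n)\<^sup>2) powr \<sigma> * w i n)" unfolding sq by (rule sm_qw[OF that])
      qed (use \<open>0 < d\<close> in auto)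
      finally show ?thesis unfolding sq .
    qed
    have "(\<Sum>i\<in>F. (\<Sum>j<J. (norm (Q (D j (x i))))\<^sup>2) powr \<sigma>)
      \<le> (\<Sum>i\<in>F. (d\<^sup>2) powr (\<sigma> - 1) * (\<Sum>n. q n powr (1 / \<theta>) * w i n))" by (intro sum_mono row)
    also have "\<dots> = (d\<^sup>2) powr (\<sigma> - 1) * (\<Sum>n. \<Sum>i\<in>F. q n powr (1 / \<theta>) * w i n)"
      using sm_qw by (subst suminf_sum) (auto simp: sum_distrib_left)
    also have "\<dots> \<le> (d\<^sup>2) powr (\<sigma> - 1) * (\<Sum>n. q n powr (1 / \<theta>) * d\<^sup>2)"
      unfolding sum_distrib_left[symmetric]
      by (intro mult_left_mono suminf_le mult_left_mono w_col summable_mult2 sm_q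
          summable_comparison_test'[OF summable_mult2[OF sm_q, of "d\<^sup>2"]])
         (use w_col w0 in \<open>auto intro!: mult_left_mono sum_nonneg simp: abs_mult abs_of_nonneg[OF sum_nonneg]\<close>)
    also have "\<dots> \<le> (d\<^sup>2) powr (\<sigma> - 1) * (K powr (1 / \<theta>) * d\<^sup>2)"
      unfolding suminf_mult2[OF sm_q, symmetric] by (intro mult_left_mono mult_right_mono le_q) auto
    also have "\<dots> = (d\<^sup>2) powr \<sigma> * K powr (1 / \<theta>)"
      using \<open>0 < d\<close> powr_add[of "d\<^sup>2" "\<sigma> - 1" 1] by simp
    also have "\<dots> = (d * K) powr (1 / \<theta>)"
      using \<open>0 < d\<close> \<open>0 \<le> K\<close> powr_powr[of d 2 \<sigma>] by (simp add: powr_mult \<sigma>2 powr_numeral)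
    finally show ?thesis .
  qed
  have "(\<Sum>i\<in>F. column_norm Q D (x i) powr (1 / \<theta>)) \<le> (d * K) powr (1 / \<theta>)"
    if F: "finite F" "F \<subseteq> I" for F
  proof (rule LIMSEQ_le_const2)
    have s0: "0 \<le> (\<Sum>j. (norm (Q (D j (x i))))\<^sup>2)" for i
      by (intro suminf_nonneg column_summable(1)[OF D Qb(1)]) simp
    have eq: "column_norm Q D (x i) powr (1 / \<theta>) = (\<Sum>j. (norm (Q (D j (x i))))\<^sup>2) powr \<sigma>" for i
      using s0[of i] unfolding column_norm_def \<sigma>2
      by (simp add: powr_half_sqrt[symmetric] powr_powr)
    show "(\<lambda>J. \<Sum>i\<in>F. (\<Sum>j<J. (norm (Q (D j (x i))))\<^sup>2) powr \<sigma>)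
        \<longlonglongrightarrow> (\<Sum>i\<in>F. column_norm Q D (x i) powr (1 / \<theta>))"
      unfolding eq
      by (intro tendsto_sum tendsto_powr' summable_LIMSEQ column_summable(1)[OF D Qb(1)] tendsto_const)
         (use \<open>1 \<le> \<sigma>\<close> in \<open>auto intro!: always_eventually sum_nonneg\<close>)
  qed (use fin[OF F] in blast)
  then show ?thesis using False column_summable(3)[OF D Qb(1)] Qb(2) \<open>0 < d\<close> by (simp add: lbd_def)
qed


section \<open>Spectral integrals\<close>

lemma polarization:
  fixes A :: "'h::chilbert_space \<Rightarrow> 'h"
  assumes A: "bounded_op A"
  shows "4 * cinner (A u) v = cinner (A (u + v)) (u + v) - cinner (A (u - v)) (u - v)
    + \<i> * cinner (A (u + \<i> *\<^sub>C v)) (u + \<i> *\<^sub>C v) - \<i> * cinner (A (u - \<i> *\<^sub>C v)) (u - \<i> *\<^sub>C v)"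
  by (simp add: bounded_op_simps[OF A] cinner_add_left cinner_add_right cinner_diff_left
      cinner_diff_right cinner_scaleC_left cinner_scaleC_right algebra_simps)

lemma op_eq_quadratic:
  assumes A: "bounded_op A" and B: "bounded_op B" and eq: "\<And>u. cinner (A u) u = cinner (B u) u"
  shows "A = B"
proof
  fix u
  have "4 * cinner (A u) v = 4 * cinner (B u) v" for v
    unfolding polarization[OF A] polarization[OF B] eq ..
  then show "A u = B u" by (intro cinner_ext_left) simp
qed

lemma tendsto_cinner_quadratic:
  assumes A: "\<And>i. bounded_op (A i)" and lim: "\<And>u. ((\<lambda>i. cinner (A i u) u) \<longlongrightarrow> q u) F"
  shows "((\<lambda>i. cinner (A i u) v) \<longlongrightarrow>
    (q (u + v) - q (u - v) + \<i> * q (u + \<i> *\<^sub>C v) - \<i> * q (u - \<i> *\<^sub>C v)) / 4) F"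
proof -
  have eq: "cinner (A i u) v = (cinner (A i (u + v)) (u + v) - cinner (A i (u - v)) (u - v)
    + \<i> * cinner (A i (u + \<i> *\<^sub>C v)) (u + \<i> *\<^sub>C v) - \<i> * cinner (A i (u - \<i> *\<^sub>C v)) (u - \<i> *\<^sub>C v)) / 4" for i
    by (simp only: polarization[OF A[of i], of u v, symmetric]) simp
  show ?thesis unfolding eq by (intro tendsto_intros lim) simp
qed


subsection \<open>Finite matrices with a bilinear bound\<close>

text \<open>An operator norm bound for the upper left \<open>m\<close> by \<open>n\<close> corner.
  The form is bilinear, without conjugation, so that transposing \<open>b\<close> just exchanges the
  two vectors.\<close>

definition bil_bound :: "nat \<Rightarrow> nat \<Rightarrow> real \<Rightarrow> (nat \<Rightarrow> nat \<Rightarrow> complex) \<Rightarrow> bool" where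
  "bil_bound m n C b \<longleftrightarrow> (\<forall>\<xi> \<eta>. cmod (\<Sum>j<m. \<Sum>k<n. b j k * (\<xi> k * \<eta> j))
     \<le> C * (sqrt (\<Sum>k<n. (cmod (\<xi> k))\<^sup>2) * sqrt (\<Sum>j<m. (cmod (\<eta> j))\<^sup>2)))"

lemma bil_bound_entry:
  assumes "bil_bound m n C b" "j < m" "k < n"
  shows "cmod (b j k) \<le> C"
proof -
  let ?\<xi> = "\<lambda>l. if l = k then 1 else 0 :: complex" and ?\<eta> = "\<lambda>l. if l = j then 1 else 0 :: complex"
  have "(\<Sum>l<m. \<Sum>l'<n. b l l' * (?\<xi> l' * ?\<eta> l)) = (\<Sum>l<m. if l = j then b j k else 0)"
    using assms(3) by (intro sum.cong refl) (simp add: if_distrib[of "\<lambda>x. _ * x"] cong: if_cong)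
  also have "\<dots> = b j k" using assms(2) by simp
  finally have 1: "(\<Sum>l<m. \<Sum>l'<n. b l l' * (?\<xi> l' * ?\<eta> l)) = b j k" .
  have "(\<Sum>l<n. (cmod (?\<xi> l))\<^sup>2) = (\<Sum>l<n. if l = k then 1 else 0)"
    "(\<Sum>l<m. (cmod (?\<eta> l))\<^sup>2) = (\<Sum>l<m. if l = j then 1 else 0)"
    by (intro sum.cong refl; simp)+
  then have "(\<Sum>l<n. (cmod (?\<xi> l))\<^sup>2) = 1" "(\<Sum>l<m. (cmod (?\<eta> l))\<^sup>2) = 1"
    using assms(2,3) by simp_all
  then show ?thesis
    using assms(1)[unfolded bil_bound_def, rule_format, of ?\<xi> ?\<eta>] unfolding 1 by simp
qed

lemma bil_bound_zero: "0 \<le> C \<Longrightarrow> bil_bound m n C (\<lambda>j k. 0)"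
  by (simp add: bil_bound_def sum_nonneg)

lemma bil_bound_perturb:
  assumes b: "bil_bound m n C b" and d: "\<And>j k. j < m \<Longrightarrow> k < n \<Longrightarrow> cmod (b' j k - b j k) \<le> \<delta>" and "0 \<le> \<delta>"
  shows "bil_bound m n (C + \<delta> * (real m * real n)) b'"
  unfolding bil_bound_def
proof (intro allI)
  fix \<xi> \<eta> :: "nat \<Rightarrow> complex"
  let ?x = "sqrt (\<Sum>k<n. (cmod (\<xi> k))\<^sup>2)" and ?y = "sqrt (\<Sum>j<m. (cmod (\<eta> j))\<^sup>2)"
  have le: "cmod (\<xi> k) \<le> ?x" if "k < n" for k
    using that by (intro real_le_rsqrt member_le_sum[where f="\<lambda>k. (cmod (\<xi> k))\<^sup>2"]) auto
  have le': "cmod (\<eta> j) \<le> ?y" if "j < m" for j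
    using that by (intro real_le_rsqrt member_le_sum[where f="\<lambda>k. (cmod (\<eta> k))\<^sup>2"]) auto
  have "(\<Sum>j<m. \<Sum>k<n. b' j k * (\<xi> k * \<eta> j))
    = (\<Sum>j<m. \<Sum>k<n. b j k * (\<xi> k * \<eta> j)) + (\<Sum>j<m. \<Sum>k<n. (b' j k - b j k) * (\<xi> k * \<eta> j))"
    by (simp add: sum.distrib[symmetric] left_diff_distrib)
  moreover have "cmod (\<Sum>j<m. \<Sum>k<n. b j k * (\<xi> k * \<eta> j)) \<le> C * (?x * ?y)"
    using b unfolding bil_bound_def by blast
  moreover have "cmod (\<Sum>j<m. \<Sum>k<n. (b' j k - b j k) * (\<xi> k * \<eta> j)) \<le> (\<Sum>j<m. \<Sum>k<n. \<delta> * (?x * ?y))"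
    by (intro sum_norm_le) (use d le le' \<open>0 \<le> \<delta>\<close> in \<open>auto simp: norm_mult intro!: mult_mono sum_nonneg\<close>)
  moreover have "(\<Sum>j<m. \<Sum>k<n. \<delta> * (?x * ?y)) = \<delta> * (real m * real n) * (?x * ?y)"
    by (simp only: sum_constant card_lessThan mult.assoc mult.left_commute)
  ultimately show "cmod (\<Sum>j<m. \<Sum>k<n. b' j k * (\<xi> k * \<eta> j))
    \<le> (C + \<delta> * (real m * real n)) * (?x * ?y)"
    by (simp only: distrib_right) (rule norm_triangle_mono)
qed

lemma L2_cauchy_schwarz:
  "(\<Sum>i\<in>F. sqrt (a i) * sqrt (b i)) \<le> sqrt (\<Sum>i\<in>F. a i) * sqrt (\<Sum>i\<in>F. b i)"
  if "\<And>i. i \<in> F \<Longrightarrow> 0 \<le> a i" "\<And>i. i \<in> F \<Longrightarrow> 0 \<le> b i"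
proof -
  have "(\<Sum>i\<in>F. \<bar>sqrt (a i)\<bar> * \<bar>sqrt (b i)\<bar>) \<le> L2_set (\<lambda>i. sqrt (a i)) F * L2_set (\<lambda>i. sqrt (b i)) F"
    by (rule L2_set_mult_ineq)
  then show ?thesis using that by (simp add: L2_set_def)
qed

lemma has_sum_finite_sum:
  fixes f :: "'i \<Rightarrow> 'a \<Rightarrow> 'b::topological_comm_monoid_add"
  assumes "\<And>i. i \<in> I \<Longrightarrow> (f i has_sum s i) A"
  shows "((\<lambda>x. \<Sum>i\<in>I. f i x) has_sum (\<Sum>i\<in>I. s i)) A"
  using assms by (induction I rule: infinite_finite_induct) (auto intro: has_sum_add has_sum_0)

text \<open>A scalar matrix keeps its norm when it acts on tuples of vectors: expand in an
  orthonormal basis, use the scalar bound for each basis vector, and sum by Cauchy-Schwarz and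
  Bessel.\<close>

lemma bil_bound_vectors:
  fixes u v :: "nat \<Rightarrow> 'h::chilbert_space"
  assumes b: "bil_bound m n C b" and "0 \<le> C"
  shows "cmod (\<Sum>j<m. \<Sum>k<n. b j k * cinner (u k) (v j))
    \<le> C * (sqrt (\<Sum>k<n. (norm (u k))\<^sup>2) * sqrt (\<Sum>j<m. (norm (v j))\<^sup>2))" (is "_ \<le> ?R")
proof -
  obtain B :: "'h set" where B: "orthonormal_basis B"
    using orthonormal_basis_extension[OF orthonormal_empty] by blast
  note os = orthonormal_osys[OF orthonormal_basis_orthonormal[OF B]]
  let ?g = "\<lambda>e. \<Sum>j<m. \<Sum>k<n. b j k * (cinner (u k) e * cinner e (v j))"
  have "(?g has_sum (\<Sum>j<m. \<Sum>k<n. b j k * cinner (u k) (v j))) B"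
    by (intro has_sum_finite_sum has_sum_cmult_right parseval_cinner B)
  moreover have "cmod (\<Sum>e\<in>F. ?g e) \<le> ?R" if F: "finite F" "F \<subseteq> B" for F
  proof -
    let ?a = "\<lambda>e. \<Sum>k<n. (cmod (cinner (u k) e))\<^sup>2" and ?b = "\<lambda>e. \<Sum>j<m. (cmod (cinner e (v j)))\<^sup>2"
    have "cmod (\<Sum>e\<in>F. ?g e) \<le> (\<Sum>e\<in>F. C * (sqrt (?a e) * sqrt (?b e)))"
      by (intro sum_norm_le) (use b in \<open>simp add: bil_bound_def\<close>)
    also have "\<dots> \<le> C * (sqrt (\<Sum>e\<in>F. ?a e) * sqrt (\<Sum>e\<in>F. ?b e))"
      unfolding sum_distrib_left[symmetric]
      by (intro mult_left_mono L2_cauchy_schwarz \<open>0 \<le> C\<close> sum_nonneg) auto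
    also have "\<dots> \<le> ?R"
    proof (intro mult_left_mono mult_mono real_sqrt_le_mono \<open>0 \<le> C\<close>)
      show "(\<Sum>e\<in>F. ?a e) \<le> (\<Sum>k<n. (norm (u k))\<^sup>2)"
        by (subst sum.swap) (intro sum_mono bessel[OF osys_subset[OF os]] F)
      show "(\<Sum>e\<in>F. ?b e) \<le> (\<Sum>j<m. (norm (v j))\<^sup>2)"
        unfolding cinner_cmod_commute[of _ "v _"]
        by (subst sum.swap) (intro sum_mono bessel[OF osys_subset[OF os]] F)
    qed (auto intro!: sum_nonneg)
    finally show ?thesis .
  qed
  then have "\<forall>\<^sub>F F in finite_subsets_at_top B. cmod (\<Sum>e\<in>F. ?g e) \<le> ?R"
    by (intro eventually_finite_subsets_at_top_weakI) auto
  ultimately show ?thesis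
    unfolding has_sum_def by (intro Lim_norm_ubound[OF finite_subsets_at_top_neq_bot])
qed


subsection \<open>The scalar measures of a spectral measure\<close>

definition is_spec_integral ::
    "'x measure \<Rightarrow> ('x set \<Rightarrow> 'h::chilbert_space \<Rightarrow> 'h) \<Rightarrow> ('x \<Rightarrow> complex) \<Rightarrow> ('h \<Rightarrow> 'h) \<Rightarrow> bool" where
  "is_spec_integral M E f A \<longleftrightarrow>
     bounded_op A \<and> (\<forall>u. cinner (A u) u = (LINT x|spec_vec_measure M E u. f x))"

text \<open>Rounding down to a lattice of mesh \<open>1 / (N + 1)\<close>: a bounded measurable
  function becomes simple with an error uniform in the point, so matrix bounds are preserved up to a
  small term.\<close>

definition grid :: "nat \<Rightarrow> complex \<Rightarrow> complex" where
  "grid N z = Complex (real_of_int \<lfloor>real (Suc N) * Re z\<rfloor> / real (Suc N)) (real_of_int \<lfloor>real (Suc N) * Im z\<rfloor> / real (Suc N))"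

lemma grid_dist: "cmod (grid N z - z) \<le> 2 / real (Suc N)"
proof -
  have *: "\<bar>real_of_int \<lfloor>real (Suc N) * t\<rfloor> / real (Suc N) - t\<bar> \<le> 1 / real (Suc N)" for t
  proof -
    have "\<bar>real_of_int \<lfloor>real (Suc N) * t\<rfloor> - real (Suc N) * t\<bar> \<le> 1" by linarith
    then have "\<bar>(real_of_int \<lfloor>real (Suc N) * t\<rfloor> - real (Suc N) * t) / real (Suc N)\<bar> \<le> 1 / real (Suc N)"
      by (simp only: abs_divide) (simp add: divide_right_mono)
    then show ?thesis by (simp add: diff_divide_distrib)
  qed
  show ?thesis
    using cmod_le[of "grid N z - z"] *[of "Re z"] *[of "Im z"] unfolding grid_def by simp
qed

context
  fixes M :: "'x measure" and E :: "'x set \<Rightarrow> 'h::chilbert_space \<Rightarrow> 'h"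
  assumes sm: "spectral_measure M E"
begin

lemma spectral_bounded: "A \<in> sets M \<Longrightarrow> bounded_op (E A)"
  using sm by (simp add: spectral_measure_def)

lemma spectral_selfadj: "A \<in> sets M \<Longrightarrow> cinner (E A u) v = cinner u (E A v)"
  using sm by (simp add: spectral_measure_def)

lemma spectral_inter: "A \<in> sets M \<Longrightarrow> B \<in> sets M \<Longrightarrow> E A (E B u) = E (A \<inter> B) u"
  using sm by (simp add: spectral_measure_def)

lemma spectral_cinner:
  assumes "A \<in> sets M"
  shows "cinner (E A u) v = cinner (E A u) (E A v)"
  using spectral_selfadj[OF assms, of "E A u" v] spectral_inter[OF assms assms, of u] by simp

lemma spectral_quadratic: "A \<in> sets M \<Longrightarrow> cinner (E A u) u = complex_of_real ((norm (E A u))\<^sup>2)"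
  by (subst spectral_cinner) (simp_all add: cinner_self)

abbreviation "\<mu> \<equiv> spec_vec_measure M E"

lemma sets_spec_vec [simp]: "sets (\<mu> u) = sets M" "space (\<mu> u) = space M"
  by (simp_all add: spec_vec_measure_def)

lemma measurable_spec_vec [simp]: "borel_measurable (\<mu> u) = borel_measurable M"
  by (intro measurable_cong_sets) simp_all

text \<open>\<open>E A\<close> is an orthogonal projection, so \<open>cinner (E A u) u\<close> is a
  squared norm; this provides the nonnegativity that a measure needs, while countable additivity is
  inherited from \<open>E\<close>.\<close>

lemma emeasure_spec_vec:
  assumes "A \<in> sets M"
  shows "emeasure (\<mu> u) A = ennreal ((norm (E A u))\<^sup>2)"
proof -
  have "emeasure (\<mu> u) A = ennreal (Re (cinner (E A u) u))"
  proof (rule emeasure_measure_of[OF spec_vec_measure_def])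
    show "sets M \<subseteq> Pow (space M)" by (rule sets.space_closed)
    show "positive (sets (\<mu> u)) (\<lambda>A. ennreal (Re (cinner (E A u) u)))"
      using sm by (simp add: positive_def spectral_measure_def)
    show "countably_additive (sets (\<mu> u)) (\<lambda>A. ennreal (Re (cinner (E A u) u)))"
    proof (rule countably_additiveI)
      fix X :: "nat \<Rightarrow> 'x set"
      assume X: "range X \<subseteq> sets (\<mu> u)" "disjoint_family X" "\<Union> (range X) \<in> sets (\<mu> u)"
      then have "(\<lambda>n. E (X n) u) sums E (\<Union>n. X n) u"
        using sm by (simp add: spectral_measure_def)
      from bounded_linear.sums[OF bounded_linear_Re
          bounded_linear.sums[OF bounded_linear_cinner_left[of u] this]]
      have s: "(\<lambda>n. Re (cinner (E (X n) u) u)) sums Re (cinner (E (\<Union>n. X n) u) u)" .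
      have "Re (cinner (E (X n) u) u) \<ge> 0" for n
        using X(1) by (subst spectral_quadratic) auto
      then show "(\<Sum>n. ennreal (Re (cinner (E (X n) u) u))) = ennreal (Re (cinner (E (\<Union> (range X)) u) u))"
        using s by (simp add: suminf_ennreal2 sums_iff)
    qed
    show "A \<in> sets (\<mu> u)" using assms by simp
  qed
  then show ?thesis using spectral_quadratic[OF assms, of u] by simp
qed

lemma spectral_space: "E (space M) u = u"
  using sm by (simp add: spectral_measure_def)

lemma finite_spec_vec: "finite_measure (\<mu> u)"
  by (rule finite_measureI) (simp add: emeasure_spec_vec)

lemma measure_spec_vec: "A \<in> sets M \<Longrightarrow> measure (\<mu> u) A = (norm (E A u))\<^sup>2"
  by (simp add: measure_def emeasure_spec_vec)

lemma null_sets_specI: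
  assumes "N \<in> sets M" "\<And>u. emeasure (\<mu> u) N = 0"
  shows "N \<in> null_sets_spec M E"
proof -
  have "E N u = 0" for u
    using assms(2)[of u] emeasure_spec_vec[OF assms(1), of u] by (simp add: ennreal_eq_0_iff)
  then show ?thesis using assms(1) by (simp add: null_sets_spec_def)
qed

lemma null_sets_spec_vec: "N \<in> null_sets_spec M E \<Longrightarrow> N \<in> null_sets (\<mu> u)"
  by (simp add: null_sets_spec_def null_sets_def emeasure_spec_vec)

lemma null_sets_spec_UN:
  assumes "\<And>i::nat. N i \<in> null_sets_spec M E"
  shows "(\<Union>i. N i) \<in> null_sets_spec M E"
proof (rule null_sets_specI)
  show "(\<Union>i. N i) \<in> sets M" using assms by (auto simp: null_sets_spec_def)
  have "(\<Union>i. N i) \<in> null_sets (\<mu> u)" for u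
    using null_sets_spec_vec[OF assms] by (rule null_sets_UN)
  then show "emeasure (\<mu> u) (\<Union>i. N i) = 0" for u by auto
qed

lemma null_sets_spec_empty: "{} \<in> null_sets_spec M E"
  using sm by (simp add: null_sets_spec_def spectral_measure_def)

lemma null_sets_spec_Un:
  assumes "N \<in> null_sets_spec M E" "N' \<in> null_sets_spec M E"
  shows "N \<union> N' \<in> null_sets_spec M E"
proof -
  have "(\<Union>i. if i = (0::nat) then N else N') = N \<union> N'" by (auto split: if_splits intro: exI[of _ 1])
  moreover have "(\<Union>i. if i = (0::nat) then N else N') \<in> null_sets_spec M E"
    by (rule null_sets_spec_UN) (use assms in simp)
  ultimately show ?thesis by simp
qed

lemma AE_spec_conj: "AE_spec M E P \<Longrightarrow> AE_spec M E Q \<Longrightarrow> AE_spec M E (\<lambda>x. P x \<and> Q x)"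
  unfolding AE_spec_def
proof (elim bexE)
  fix N N' assume "N \<in> null_sets_spec M E" "N' \<in> null_sets_spec M E"
    "\<forall>x\<in>space M - N. P x" "\<forall>x\<in>space M - N'. Q x"
  then show "\<exists>N\<in>null_sets_spec M E. \<forall>x\<in>space M - N. P x \<and> Q x"
    by (intro bexI[of _ "N \<union> N'"] null_sets_spec_Un) auto
qed

lemma AE_spec_mono: "AE_spec M E P \<Longrightarrow> (\<And>x. x \<in> space M \<Longrightarrow> P x \<Longrightarrow> Q x) \<Longrightarrow> AE_spec M E Q"
  unfolding AE_spec_def by (elim bexE, rule bexI) auto

lemma AE_spec_imp_AE: "AE_spec M E P \<Longrightarrow> AE x in \<mu> u. P x"
  unfolding AE_spec_def by (auto intro!: AE_I'[OF null_sets_spec_vec])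

lemma integrable_spec_vec:
  assumes "f \<in> borel_measurable M" "AE_spec M E (\<lambda>x. cmod (f x) \<le> C)"
  shows "integrable (\<mu> u) f"
  by (rule finite_measure.integrable_const_bound[OF finite_spec_vec AE_spec_imp_AE[OF assms(2)]])
     (use assms in simp)

lemma integral_spec_vec_bound:
  assumes "f \<in> borel_measurable M" "AE_spec M E (\<lambda>x. cmod (f x) \<le> C)"
  shows "cmod (LINT x|\<mu> u. f x) \<le> C * (norm u)\<^sup>2"
proof -
  have "cmod (LINT x|\<mu> u. f x) \<le> (LINT x|\<mu> u. cmod (f x))" by (rule integral_norm_bound)
  also have "\<dots> \<le> (LINT x|\<mu> u. C)"
    by (intro integral_mono_AE integrable_norm integrable_spec_vec[OF assms]
        finite_measure.integrable_const[OF finite_spec_vec] AE_spec_imp_AE assms)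
  also have "\<dots> = C * (norm u)\<^sup>2" by (simp add: measure_spec_vec spectral_space)
  finally show ?thesis .
qed


subsection \<open>Integrals of simple and bounded functions\<close>

lemma spec_integral_eqI: "is_spec_integral M E f A \<Longrightarrow> spec_integral M E f = A"
  unfolding spec_integral_def is_spec_integral_def
  by (intro the_equality) (auto intro: op_eq_quadratic)

text \<open>Common refinement: all the functions factor through the list of their values. The map
  \<open>p\<close> picks a point in each level set, so the value on a level set is attained at a
  point of the space, where pointwise hypotheses can be applied.\<close>

lemma simple_functions_common_level:
  fixes g :: "'i \<Rightarrow> 'x \<Rightarrow> complex"
  assumes "\<And>i. i \<in> set xs \<Longrightarrow> simple_function M (g i)"
  obtains h :: "'x \<Rightarrow> complex list" and p where "simple_function M h"
    "\<And>x. x \<in> space M \<Longrightarrow> p (h x) \<in> space M"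
    "\<And>x i. x \<in> space M \<Longrightarrow> i \<in> set xs \<Longrightarrow> g i (p (h x)) = g i x"
proof
  let ?h = "\<lambda>x. map (\<lambda>i. g i x) xs" and ?p = "\<lambda>z. SOME x. x \<in> space M \<and> map (\<lambda>i. g i x) xs = z"
  show "simple_function M ?h"
    using assms by (induction xs) (auto intro: simple_function_compose2[where h="(#)"])
  have *: "?p (?h x) \<in> space M \<and> ?h (?p (?h x)) = ?h x" if "x \<in> space M" for x
    by (rule someI[of "\<lambda>y. y \<in> space M \<and> ?h y = ?h x" x]) (use that in simp)
  show "?p (?h x) \<in> space M" if "x \<in> space M" for x using *[OF that] by blast
  show "g i (?p (?h x)) = g i x" if "x \<in> space M" "i \<in> set xs" for x i
    using *[OF that(1)] that(2) by simp
qed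

text \<open>On each level set \<open>S z\<close> the matrix is constant, and its bound is applied to
  the vectors \<open>E (S z) (u k)\<close> and \<open>E (S z) (v j)\<close>. Summing over
  \<open>z\<close> by Cauchy-Schwarz loses nothing, because the projections \<open>E (S z)\<close>
  split \<open>(norm u)\<^sup>2\<close>.\<close>

lemma simple_matrix_integral:
  fixes g :: "nat \<Rightarrow> nat \<Rightarrow> 'x \<Rightarrow> complex"
  assumes g: "\<And>j k. j < m \<Longrightarrow> k < n \<Longrightarrow> simple_function M (g j k)" and "0 \<le> C"
    and bd: "\<And>x. x \<in> space M \<Longrightarrow> bil_bound m n C (\<lambda>j k. g j k x)"
  shows "\<exists>A. (\<forall>j<m. \<forall>k<n. is_spec_integral M E (g j k) (A j k)) \<and>
    (\<forall>u v. cmod (\<Sum>j<m. \<Sum>k<n. cinner (A j k (u k)) (v j))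
      \<le> C * (sqrt (\<Sum>k<n. (norm (u k))\<^sup>2) * sqrt (\<Sum>j<m. (norm (v j))\<^sup>2)))"
proof -
  obtain h :: "'x \<Rightarrow> complex list" and p where h: "simple_function M h"
    and p: "\<And>x. x \<in> space M \<Longrightarrow> p (h x) \<in> space M"
    and gp: "\<And>x i. x \<in> space M \<Longrightarrow> i \<in> set (List.product [0..<m] [0..<n]) \<Longrightarrow>
        (\<lambda>(j, k). g j k) i (p (h x)) = (\<lambda>(j, k). g j k) i x"
    by (rule simple_functions_common_level[of "List.product [0..<m] [0..<n]" "\<lambda>(j, k). g j k"])
       (use g in auto)
  define Z where "Z = h ` space M"
  define S where "S z = h -` {z} \<inter> space M" for z
  have "finite Z" using h by (simp add: Z_def simple_function_def)
  have S: "S z \<in> sets M" for z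
    using h simple_functionD(2)[OF h] by (simp add: S_def)
  have Sdisj: "S z \<inter> S z' = {}" if "z \<noteq> z'" for z z' using that by (auto simp: S_def)
  define A where "A j k u = (\<Sum>z\<in>Z. g j k (p z) *\<^sub>C E (S z) u)" for j k u
  have parts: "(\<Sum>z\<in>Z. (norm (E (S z) u))\<^sup>2) = (norm u)\<^sup>2" for u
  proof -
    have "measure (\<mu> u) (\<Union>z\<in>Z. S z) = (\<Sum>z\<in>Z. measure (\<mu> u) (S z))"
      using \<open>finite Z\<close> S Sdisj
      by (intro measure_finite_Union) (auto simp: disjoint_family_on_def emeasure_spec_vec)
    moreover have "(\<Union>z\<in>Z. S z) = space M" by (auto simp: Z_def S_def)
    ultimately show ?thesis using measure_spec_vec[OF S] measure_spec_vec[OF sets.top, of u]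
      by (simp add: spectral_space)
  qed
  have bA: "bounded_op (A j k)" for j k
    unfolding A_def by (intro bounded_op_sum bounded_op_scaleC spectral_bounded S)
  have "is_spec_integral M E (g j k) (A j k)" if jk: "j < m" "k < n" for j k
    unfolding is_spec_integral_def
  proof (intro conjI allI bA)
    fix u
    have "(LINT x|\<mu> u. g j k x) = (LINT x|\<mu> u. (\<Sum>z\<in>Z. indicator (S z) x *\<^sub>R g j k (p z)))"
    proof (intro Bochner_Integration.integral_cong refl)
      fix x assume "x \<in> space (\<mu> u)"
      then have x: "x \<in> space M" by simp
      have "(\<Sum>z\<in>Z. indicator (S z) x *\<^sub>R g j k (p z)) = (\<Sum>z\<in>Z. if z = h x then g j k (p z) else 0)"
        by (intro sum.cong refl) (use x in \<open>auto simp: S_def indicator_def\<close>)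
      also have "\<dots> = g j k (p (h x))" using \<open>finite Z\<close> x by (simp add: Z_def)
      finally show "g j k x = (\<Sum>z\<in>Z. indicator (S z) x *\<^sub>R g j k (p z))"
        using gp[OF x, of "(j, k)"] jk by simp
    qed
    also have "\<dots> = (\<Sum>z\<in>Z. measure (\<mu> u) (S z) *\<^sub>R g j k (p z))"
      using S by (subst Bochner_Integration.integral_sum)
        (auto intro!: integrable_scaleR_left simp: emeasure_spec_vec less_top[symmetric])
    also have "\<dots> = cinner (A j k u) u"
      by (simp add: A_def cinner_sum_left cinner_scaleC_left spectral_quadratic[OF S]
          measure_spec_vec[OF S] scaleR_conv_of_real mult.commute)
    finally show "cinner (A j k u) u = (LINT x|\<mu> u. g j k x)" by simp
  qed
  moreover have "cmod (\<Sum>j<m. \<Sum>k<n. cinner (A j k (u k)) (v j))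
      \<le> C * (sqrt (\<Sum>k<n. (norm (u k))\<^sup>2) * sqrt (\<Sum>j<m. (norm (v j))\<^sup>2))" for u v
  proof -
    have "(\<Sum>j<m. \<Sum>k<n. cinner (A j k (u k)) (v j))
      = (\<Sum>j<m. \<Sum>k<n. \<Sum>z\<in>Z. g j k (p z) * cinner (E (S z) (u k)) (E (S z) (v j)))"
      by (simp add: A_def cinner_sum_left cinner_scaleC_left spectral_cinner[OF S, of _ _ "v _", symmetric])
    also have "\<dots> = (\<Sum>z\<in>Z. \<Sum>j<m. \<Sum>k<n. g j k (p z) * cinner (E (S z) (u k)) (E (S z) (v j)))"
      by (simp only: sum.swap[of _ Z])
    also have "cmod \<dots> \<le> (\<Sum>z\<in>Z. C * (sqrt (\<Sum>k<n. (norm (E (S z) (u k)))\<^sup>2) * sqrt (\<Sum>j<m. (norm (E (S z) (v j)))\<^sup>2)))"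
      by (intro sum_norm_le bil_bound_vectors \<open>0 \<le> C\<close> bd) (auto simp: Z_def p)
    also have "\<dots> \<le> C * (sqrt (\<Sum>z\<in>Z. \<Sum>k<n. (norm (E (S z) (u k)))\<^sup>2) * sqrt (\<Sum>z\<in>Z. \<Sum>j<m. (norm (E (S z) (v j)))\<^sup>2))"
      unfolding sum_distrib_left[symmetric]
      by (intro mult_left_mono L2_cauchy_schwarz \<open>0 \<le> C\<close> sum_nonneg) auto
    also have "\<dots> = C * (sqrt (\<Sum>k<n. (norm (u k))\<^sup>2) * sqrt (\<Sum>j<m. (norm (v j))\<^sup>2))"
      by (simp only: sum.swap[of _ _ Z] parts)
    finally show ?thesis .
  qed
  ultimately show ?thesis by blast
qed

lemma grid_simple:
  assumes f: "f \<in> borel_measurable M" and C: "\<And>x. x \<in> space M \<Longrightarrow> cmod (f x) \<le> C"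
  shows "simple_function M (\<lambda>x. grid N (f x))"
proof (rule simple_function_borel_measurable)
  have "grid N z = complex_of_real (real_of_int \<lfloor>real (Suc N) * Re z\<rfloor> / real (Suc N)) +
      \<i> * complex_of_real (real_of_int \<lfloor>real (Suc N) * Im z\<rfloor> / real (Suc N))" for z
    by (simp add: grid_def complex_eq_iff)
  then show "(\<lambda>x. grid N (f x)) \<in> borel_measurable M"
    using f by simp
  let ?K = "\<lceil>real (Suc N) * \<bar>C\<bar>\<rceil> + 1"
  have "(\<lambda>x. grid N (f x)) ` space M \<subseteq>
    (\<lambda>(a, b). Complex (real_of_int a / real (Suc N)) (real_of_int b / real (Suc N))) ` ({- ?K..?K} \<times> {- ?K..?K})"
  proof
    fix w assume "w \<in> (\<lambda>x. grid N (f x)) ` space M"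
    then obtain x where x: "x \<in> space M" "w = grid N (f x)" by blast
    have fl: "\<lfloor>real (Suc N) * t\<rfloor> \<in> {- ?K..?K}" if "\<bar>t\<bar> \<le> \<bar>C\<bar>" for t
    proof -
      have "\<bar>real (Suc N) * t\<bar> \<le> real (Suc N) * \<bar>C\<bar>"
        unfolding abs_mult using that by (intro mult_mono) auto
      then have "- ?K \<le> \<lfloor>real (Suc N) * t\<rfloor> \<and> \<lfloor>real (Suc N) * t\<rfloor> \<le> ?K" by linarith
      then show ?thesis by simp
    qed
    have "\<bar>Re (f x)\<bar> \<le> \<bar>C\<bar>" "\<bar>Im (f x)\<bar> \<le> \<bar>C\<bar>"
      using C[OF x(1)] abs_Re_le_cmod[of "f x"] abs_Im_le_cmod[of "f x"] by linarith+
    then show "w \<in> (\<lambda>(a, b). Complex (real_of_int a / real (Suc N)) (real_of_int b / real (Suc N))) ` ({- ?K..?K} \<times> {- ?K..?K})"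
      unfolding x(2) grid_def
      by (intro image_eqI[where x="(\<lfloor>real (Suc N) * Re (f x)\<rfloor>, \<lfloor>real (Suc N) * Im (f x)\<rfloor>)"])
         (simp_all only: mem_Times_iff fst_conv snd_conv prod.case fl simp_thms)
  qed
  then show "finite ((\<lambda>x. grid N (f x)) ` space M)"
    by (rule finite_subset) simp
qed

lemma grid_integral_tendsto:
  assumes f: "f \<in> borel_measurable M" and C: "\<And>x. x \<in> space M \<Longrightarrow> cmod (f x) \<le> C"
  shows "(\<lambda>N. LINT x|\<mu> u. grid N (f x)) \<longlonglongrightarrow> (LINT x|\<mu> u. f x)"
proof (rule LIM_zero_cancel, rule tendsto_0_le[where K=1])
  have AE: "AE_spec M E (\<lambda>x. cmod (g x) \<le> D)" if "\<And>x. x \<in> space M \<Longrightarrow> cmod (g x) \<le> D"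
    for g :: "'x \<Rightarrow> complex" and D
    unfolding AE_spec_def using null_sets_spec_empty that by auto
  have mg: "(\<lambda>x. grid N (f x)) \<in> borel_measurable M" for N
    by (rule borel_measurable_simple_function[OF grid_simple[OF f C]])
  have bg: "cmod (grid N (f x)) \<le> C + 2 / real (Suc N)" if "x \<in> space M" for x N
    using norm_triangle_ineq2[of "grid N (f x)" "f x"] grid_dist[of N "f x"] C[OF that] by linarith
  have "cmod ((LINT x|\<mu> u. grid N (f x)) - (LINT x|\<mu> u. f x)) \<le> 2 / real (Suc N) * (norm u)\<^sup>2" for N
  proof -
    have "(LINT x|\<mu> u. grid N (f x)) - (LINT x|\<mu> u. f x) = (LINT x|\<mu> u. grid N (f x) - f x)"
      by (rule Bochner_Integration.integral_diff[symmetric])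
         (intro integrable_spec_vec[OF mg AE[OF bg]] integrable_spec_vec[OF f AE[OF C]]; assumption)+
    also have "cmod \<dots> \<le> 2 / real (Suc N) * (norm u)\<^sup>2"
      by (intro integral_spec_vec_bound AE grid_dist) (use mg f in simp)
    finally show ?thesis .
  qed
  then show "\<forall>\<^sub>F N in sequentially. norm ((LINT x|\<mu> u. grid N (f x)) - (LINT x|\<mu> u. f x))
      \<le> norm (2 / real (Suc N) * (norm u)\<^sup>2) * 1"
    by (intro always_eventually) (auto intro: order_trans)
  have "(\<lambda>N. 2 * (1 / real (Suc N)) * (norm u)\<^sup>2) \<longlonglongrightarrow> 2 * 0 * (norm u)\<^sup>2"
    by (intro tendsto_intros LIMSEQ_Suc[OF lim_1_over_n])
  then show "(\<lambda>N. 2 / real (Suc N) * (norm u)\<^sup>2) \<longlonglongrightarrow> 0" by simp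
qed

text \<open>Grid approximation changes every entry by at most \<open>2 / (N + 1)\<close> and so
  costs at most \<open>2 * m * n / (N + 1)\<close> in the bound, whence \<open>D N\<close>. The
  quadratic forms converge, polarization yields weak limits, and the bound passes to them.\<close>

lemma bounded_matrix_integral:
  fixes f :: "nat \<Rightarrow> nat \<Rightarrow> 'x \<Rightarrow> complex"
  assumes f: "\<And>j k. j < m \<Longrightarrow> k < n \<Longrightarrow> f j k \<in> borel_measurable M" and "0 \<le> C"
    and bd: "\<And>x. x \<in> space M \<Longrightarrow> bil_bound m n C (\<lambda>j k. f j k x)"
  shows "\<exists>A. (\<forall>j<m. \<forall>k<n. is_spec_integral M E (f j k) (A j k)) \<and>
    (\<forall>u v. cmod (\<Sum>j<m. \<Sum>k<n. cinner (A j k (u k)) (v j))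
      \<le> C * (sqrt (\<Sum>k<n. (norm (u k))\<^sup>2) * sqrt (\<Sum>j<m. (norm (v j))\<^sup>2)))"
proof -
  define D where "D N = C + 2 / real (Suc N) * (real m * real n)" for N
  have D0: "0 \<le> D N" for N using \<open>0 \<le> C\<close> by (simp add: D_def)
  have "(\<lambda>N. C + 2 * (1 / real (Suc N)) * (real m * real n)) \<longlonglongrightarrow> C + 2 * 0 * (real m * real n)"
    by (intro tendsto_intros LIMSEQ_Suc[OF lim_1_over_n])
  then have D_lim: "D \<longlonglongrightarrow> C" by (simp add: D_def[abs_def])
  have entry: "cmod (f j k x) \<le> C" if "x \<in> space M" "j < m" "k < n" for j k x
    using bil_bound_entry[OF bd[OF that(1)] that(2,3)] .
  have ex0: "\<forall>N. \<exists>A. (\<forall>j<m. \<forall>k<n. is_spec_integral M E (\<lambda>x. grid N (f j k x)) (A j k)) \<and>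
    (\<forall>u v. cmod (\<Sum>j<m. \<Sum>k<n. cinner (A j k (u k)) (v j))
      \<le> D N * (sqrt (\<Sum>k<n. (norm (u k))\<^sup>2) * sqrt (\<Sum>j<m. (norm (v j))\<^sup>2)))"
  proof (rule allI, rule simple_matrix_integral[OF _ D0])
    fix N
    show "simple_function M (\<lambda>x. grid N (f j k x))" if "j < m" "k < n" for j k
      by (rule grid_simple[OF f[OF that] entry[OF _ that]])
    show "bil_bound m n (D N) (\<lambda>j k. grid N (f j k x))" if "x \<in> space M" for x
      unfolding D_def by (rule bil_bound_perturb[OF bd[OF that] grid_dist]) simp
  qed
  from choice[OF ex0]
  obtain A where A: "\<And>N j k. j < m \<Longrightarrow> k < n \<Longrightarrow> is_spec_integral M E (\<lambda>x. grid N (f j k x)) (A N j k)"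
    and A_bd: "\<And>N u v. cmod (\<Sum>j<m. \<Sum>k<n. cinner (A N j k (u k)) (v j))
      \<le> D N * (sqrt (\<Sum>k<n. (norm (u k))\<^sup>2) * sqrt (\<Sum>j<m. (norm (v j))\<^sup>2))"
    by blast
  define b where "b j k u v = ((LINT x|\<mu> (u + v). f j k x) - (LINT x|\<mu> (u - v). f j k x)
    + \<i> * (LINT x|\<mu> (u + \<i> *\<^sub>C v). f j k x) - \<i> * (LINT x|\<mu> (u - \<i> *\<^sub>C v). f j k x)) / 4" for j k u v
  have lim: "(\<lambda>N. cinner (A N j k u) v) \<longlonglongrightarrow> b j k u v" if "j < m" "k < n" for j k u v
    unfolding b_def
    by (rule tendsto_cinner_quadratic[where q="\<lambda>u. LINT x|\<mu> u. f j k x"])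
       (use A[OF that] grid_integral_tendsto[OF f[OF that] entry[OF _ that]] in \<open>auto simp: is_spec_integral_def\<close>)
  have "\<exists>L. is_spec_integral M E (f j k) L \<and> (\<forall>u v. cinner (L u) v = b j k u v)" if jk: "j < m" "k < n" for j k
  proof -
    have "cmod (b j k u v) \<le> C * norm u * norm v" for u v
    proof (rule LIMSEQ_le)
      show "(\<lambda>N. cmod (cinner (A N j k u) v)) \<longlonglongrightarrow> cmod (b j k u v)" by (intro tendsto_norm lim jk)
      show "(\<lambda>N. D N * norm u * norm v) \<longlonglongrightarrow> C * norm u * norm v" by (intro tendsto_intros D_lim)
      have "cmod (cinner (A N j k u) v) \<le> D N * norm u * norm v" for N
      proof -
        \<comment> \<open>Tuples supported on a single index isolate the entry \<open>(j, k)\<close>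
          in the matrix bound.\<close>
        let ?u = "\<lambda>i. if i = k then u else 0" and ?v = "\<lambda>i. if i = j then v else 0"
        have zero: "A N j k' 0 = 0" if "k' < n" "j < m" for j k'
          using A[OF that(2,1), of N] by (simp add: is_spec_integral_def bounded_op_simps)
        have "(\<Sum>i<m. \<Sum>i'<n. cinner (A N i i' (?u i')) (?v i)) = (\<Sum>i<m. if i = j then cinner (A N j k u) v else 0)"
        proof (intro sum.cong refl)
          fix i assume "i \<in> {..<m}"
          have "(\<Sum>i'<n. cinner (A N i i' (?u i')) (?v i)) = (\<Sum>i'<n. if i' = k then cinner (A N i k u) (?v i) else 0)"
            by (intro sum.cong refl) (use zero \<open>i \<in> {..<m}\<close> in auto)
          then show "(\<Sum>i'<n. cinner (A N i i' (?u i')) (?v i)) = (if i = j then cinner (A N j k u) v else 0)"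
            using jk by simp
        qed
        then have 1: "(\<Sum>i<m. \<Sum>i'<n. cinner (A N i i' (?u i')) (?v i)) = cinner (A N j k u) v"
          using jk by simp
        have "(\<Sum>i<n. (norm (?u i))\<^sup>2) = (\<Sum>i<n. if i = k then (norm u)\<^sup>2 else 0)"
          "(\<Sum>i<m. (norm (?v i))\<^sup>2) = (\<Sum>i<m. if i = j then (norm v)\<^sup>2 else 0)"
          by (intro sum.cong refl; simp)+
        then have "(\<Sum>i<n. (norm (?u i))\<^sup>2) = (norm u)\<^sup>2" "(\<Sum>i<m. (norm (?v i))\<^sup>2) = (norm v)\<^sup>2"
          using jk by simp_all
        then show ?thesis using A_bd[where N=N and u="?u" and v="?v"] unfolding 1 by (simp add: mult.assoc)
      qed
      then show "\<exists>N0. \<forall>N\<ge>N0. cmod (cinner (A N j k u) v) \<le> D N * norm u * norm v" by blast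
    qed
    note bb = this
    have bN: "bounded_op (A N j k)" for N using A[OF jk] by (simp add: is_spec_integral_def)
    obtain L where L: "bounded_op L" "\<And>u v. cinner (L u) v = b j k u v"
      "\<And>u. norm (L u) \<le> C * norm u"
      by (rule wot_limit_op[OF bN lim[OF jk] sequentially_bot bb \<open>0 \<le> C\<close>], rule that)
    have "cinner (L u) u = (LINT x|\<mu> u. f j k x)" for u
    proof (rule LIMSEQ_unique)
      show "(\<lambda>N. cinner (A N j k u) u) \<longlonglongrightarrow> cinner (L u) u" by (simp only: L(2) lim[OF jk])
      show "(\<lambda>N. cinner (A N j k u) u) \<longlonglongrightarrow> (LINT x|\<mu> u. f j k x)"
        using A[OF jk] grid_integral_tendsto[OF f[OF jk] entry[OF _ jk]] by (simp add: is_spec_integral_def)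
    qed
    then show ?thesis using L by (auto simp: is_spec_integral_def)
  qed
  note ex = this
  define L where "L j k = (SOME L. is_spec_integral M E (f j k) L \<and> (\<forall>u v. cinner (L u) v = b j k u v))" for j k
  have L: "is_spec_integral M E (f j k) (L j k)"
    and Lb: "\<And>u v. cinner (L j k u) v = b j k u v" if "j < m" "k < n" for j k
    using someI_ex[OF ex[OF that], folded L_def] by simp_all
  have "cmod (\<Sum>j<m. \<Sum>k<n. cinner (L j k (u k)) (v j))
      \<le> C * (sqrt (\<Sum>k<n. (norm (u k))\<^sup>2) * sqrt (\<Sum>j<m. (norm (v j))\<^sup>2))" for u v
  proof (rule LIMSEQ_le)
    show "(\<lambda>N. cmod (\<Sum>j<m. \<Sum>k<n. cinner (A N j k (u k)) (v j)))
      \<longlonglongrightarrow> cmod (\<Sum>j<m. \<Sum>k<n. cinner (L j k (u k)) (v j))"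
      by (intro tendsto_norm tendsto_sum) (simp add: Lb lim)
    show "(\<lambda>N. D N * (sqrt (\<Sum>k<n. (norm (u k))\<^sup>2) * sqrt (\<Sum>j<m. (norm (v j))\<^sup>2)))
      \<longlonglongrightarrow> C * (sqrt (\<Sum>k<n. (norm (u k))\<^sup>2) * sqrt (\<Sum>j<m. (norm (v j))\<^sup>2))"
      by (intro tendsto_intros D_lim)
    show "\<exists>N0. \<forall>N\<ge>N0. cmod (\<Sum>j<m. \<Sum>k<n. cinner (A N j k (u k)) (v j))
      \<le> D N * (sqrt (\<Sum>k<n. (norm (u k))\<^sup>2) * sqrt (\<Sum>j<m. (norm (v j))\<^sup>2))"
      using A_bd by (intro exI[of _ 0] allI impI)
  qed
  then show ?thesis using L by (intro exI[of _ L]) simp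
qed

text \<open>The constant is the same for all corners. On the exceptional null set the entries are
  replaced by 0, which changes none of the scalar integrals, and the everywhere bounded case
  applies.\<close>

lemma spec_integral_matrix:
  fixes f :: "nat \<Rightarrow> nat \<Rightarrow> 'x \<Rightarrow> complex"
  assumes f: "\<And>j k. j < m \<Longrightarrow> k < n \<Longrightarrow> f j k \<in> borel_measurable M" and "0 \<le> C"
    and bd: "AE_spec M E (\<lambda>x. bil_bound m n C (\<lambda>j k. f j k x))"
  shows "\<And>j k. j < m \<Longrightarrow> k < n \<Longrightarrow> is_spec_integral M E (f j k) (spec_integral M E (f j k))"
    and "cmod (\<Sum>j<m. \<Sum>k<n. cinner (spec_integral M E (f j k) (u k)) (v j))
      \<le> C * (sqrt (\<Sum>k<n. (norm (u k))\<^sup>2) * sqrt (\<Sum>j<m. (norm (v j))\<^sup>2))"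
proof -
  obtain N where N: "N \<in> null_sets_spec M E" "\<And>x. x \<in> space M - N \<Longrightarrow> bil_bound m n C (\<lambda>j k. f j k x)"
    using bd unfolding AE_spec_def by blast
  have NM: "N \<in> sets M" using N(1) by (simp add: null_sets_spec_def)
  define f' where "f' j k x = (if x \<in> N then 0 else f j k x)" for j k x
  have f': "f' j k \<in> borel_measurable M" if "j < m" "k < n" for j k
    unfolding f'_def by (rule measurable_If_set) (use f[OF that] NM in simp_all)
  have ae: "AE_spec M E (\<lambda>x. f j k x = f' j k x)" for j k
    unfolding AE_spec_def using N(1) by (auto simp: f'_def)
  have "bil_bound m n C (\<lambda>j k. f' j k x)" if "x \<in> space M" for x
    using N(2)[of x] that \<open>0 \<le> C\<close> by (cases "x \<in> N") (auto simp: f'_def bil_bound_zero)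
  from bounded_matrix_integral[of m n f', OF f' \<open>0 \<le> C\<close> this]
  obtain A where A: "\<And>j k. j < m \<Longrightarrow> k < n \<Longrightarrow> is_spec_integral M E (f' j k) (A j k)"
    and A_bd: "\<And>u v. cmod (\<Sum>j<m. \<Sum>k<n. cinner (A j k (u k)) (v j))
      \<le> C * (sqrt (\<Sum>k<n. (norm (u k))\<^sup>2) * sqrt (\<Sum>j<m. (norm (v j))\<^sup>2))" by blast
  have A': "is_spec_integral M E (f j k) (A j k)" if "j < m" "k < n" for j k
  proof -
    have "(LINT x|\<mu> u. f j k x) = (LINT x|\<mu> u. f' j k x)" for u
      by (intro integral_cong_AE AE_spec_imp_AE ae) (use f[OF that] f'[OF that] in simp_all)
    then show ?thesis using A[OF that] by (simp add: is_spec_integral_def)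
  qed
  show "is_spec_integral M E (f j k) (spec_integral M E (f j k))" if "j < m" "k < n" for j k
    using A'[OF that] spec_integral_eqI[OF A'[OF that]] by simp
  show "cmod (\<Sum>j<m. \<Sum>k<n. cinner (spec_integral M E (f j k) (u k)) (v j))
      \<le> C * (sqrt (\<Sum>k<n. (norm (u k))\<^sup>2) * sqrt (\<Sum>j<m. (norm (v j))\<^sup>2))"
    using A_bd[where u=u and v=v] spec_integral_eqI[OF A'] by simp
qed

lemma spec_integral_bounded:
  assumes f: "f \<in> borel_measurable M" and C: "AE_spec M E (\<lambda>x. cmod (f x) \<le> C)"
  shows "is_spec_integral M E f (spec_integral M E f)"
proof -
  have "AE_spec M E (\<lambda>x. bil_bound 1 1 \<bar>C\<bar> (\<lambda>j k. f x))"
  proof (rule AE_spec_mono[OF C])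
    fix x assume "cmod (f x) \<le> C"
    then show "bil_bound 1 1 \<bar>C\<bar> (\<lambda>j k. f x)"
      by (auto simp: bil_bound_def norm_mult intro!: mult_right_mono)
  qed
  from spec_integral_matrix(1)[of 1 1 "\<lambda>_ _. f", OF _ _ this, of 0 0] f show ?thesis by simp
qed

lemma spec_integral_sum:
  assumes f: "\<And>i. i \<in> I \<Longrightarrow> f i \<in> borel_measurable M" "\<And>i. i \<in> I \<Longrightarrow> AE_spec M E (\<lambda>x. cmod (f i x) \<le> C i)"
  shows "spec_integral M E (\<lambda>x. \<Sum>i\<in>I. c i * f i x) = (\<lambda>u. \<Sum>i\<in>I. c i *\<^sub>C spec_integral M E (f i) u)"
proof (rule spec_integral_eqI)
  have F: "is_spec_integral M E (f i) (spec_integral M E (f i))" if "i \<in> I" for i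
    using spec_integral_bounded[OF f[OF that]] .
  have "(LINT x|\<mu> u. (\<Sum>i\<in>I. c i * f i x)) = (\<Sum>i\<in>I. c i * (LINT x|\<mu> u. f i x))" for u
    by (subst Bochner_Integration.integral_sum)
       (use integrable_spec_vec[OF f] in auto)
  then show "is_spec_integral M E (\<lambda>x. \<Sum>i\<in>I. c i * f i x) (\<lambda>u. \<Sum>i\<in>I. c i *\<^sub>C spec_integral M E (f i) u)"
    using F by (auto simp: is_spec_integral_def cinner_sum_left cinner_scaleC_left
        intro!: bounded_op_sum bounded_op_scaleC)
qed

lemma adj_spec_integral:
  assumes f: "f \<in> borel_measurable M" and C: "AE_spec M E (\<lambda>x. cmod (f x) \<le> C)"
  shows "adj (spec_integral M E f) = spec_integral M E (\<lambda>x. cnj (f x))"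
proof (rule spec_integral_eqI[symmetric])
  note F = spec_integral_bounded[OF f C, unfolded is_spec_integral_def]
  have "cinner (adj (spec_integral M E f) u) u = (LINT x|\<mu> u. cnj (f x))" for u
    using F adj_props(2)[of "spec_integral M E f" u u] cinner_commute[of u "spec_integral M E f u"]
    by simp
  then show "is_spec_integral M E (\<lambda>x. cnj (f x)) (adj (spec_integral M E f))"
    using F adj_props(1) by (auto simp: is_spec_integral_def)
qed

text \<open>Dominated convergence in each scalar measure handles the quadratic forms, and
  polarization transfers the limit to the sesquilinear ones.\<close>

lemma spec_integral_tendsto_0:
  assumes f: "\<And>i. f i \<in> borel_measurable M" and C: "\<And>i. AE_spec M E (\<lambda>x. cmod (f i x) \<le> C)"
    and lim: "AE_spec M E (\<lambda>x. (\<lambda>i::nat. f i x) \<longlonglongrightarrow> 0)"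
  shows "(\<lambda>i. cinner (spec_integral M E (f i) u) v) \<longlonglongrightarrow> 0"
proof -
  have F: "is_spec_integral M E (f i) (spec_integral M E (f i))" for i
    using spec_integral_bounded[OF f C] .
  have "(\<lambda>i. cinner (spec_integral M E (f i) u) u) \<longlonglongrightarrow> 0" for u
  proof -
    have "(\<lambda>i. LINT x|\<mu> u. f i x) \<longlonglongrightarrow> (LINT x|\<mu> u. 0)"
    proof (rule integral_dominated_convergence[where w="\<lambda>_. C"])
      show "AE x in \<mu> u. (\<lambda>i. f i x) \<longlonglongrightarrow> 0" by (rule AE_spec_imp_AE[OF lim])
      show "AE x in \<mu> u. norm (f i x) \<le> C" for i by (rule AE_spec_imp_AE[OF C])
      show "integrable (\<mu> u) (\<lambda>_. C)" by (rule finite_measure.integrable_const[OF finite_spec_vec])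
    qed (use f in simp_all)
    then show ?thesis using F by (simp add: is_spec_integral_def)
  qed
  then show ?thesis
    using tendsto_cinner_quadratic[of "\<lambda>i. spec_integral M E (f i)" "\<lambda>_. 0"] F
    by (simp add: is_spec_integral_def)
qed

end


section \<open>Essentially bounded sequences and matrices\<close>

lemma ell2_norm_nonneg: "x \<in> ell2 \<Longrightarrow> 0 \<le> ell2_norm x"
  by (simp add: ell2_norm_def ell2_def suminf_nonneg)

section \<open>Infinite matrices, their finite corners and transposition\<close>

lemma bil_bound_transpose: "bil_bound m n C b \<Longrightarrow> bil_bound n m C (\<lambda>j k. b k j)"
  unfolding bil_bound_def
proof (intro allI)
  fix \<xi> \<eta> :: "nat \<Rightarrow> complex"
  assume b: "\<forall>\<xi> \<eta>. cmod (\<Sum>j<m. \<Sum>k<n. b j k * (\<xi> k * \<eta> j))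
    \<le> C * (sqrt (\<Sum>k<n. (cmod (\<xi> k))\<^sup>2) * sqrt (\<Sum>j<m. (cmod (\<eta> j))\<^sup>2))"
  have "(\<Sum>j<n. \<Sum>k<m. b k j * (\<xi> k * \<eta> j)) = (\<Sum>j<m. \<Sum>k<n. b j k * (\<eta> k * \<xi> j))"
    by (subst sum.swap) (simp only: mult.commute)
  then show "cmod (\<Sum>j<n. \<Sum>k<m. b k j * (\<xi> k * \<eta> j))
    \<le> C * (sqrt (\<Sum>k<m. (cmod (\<xi> k))\<^sup>2) * sqrt (\<Sum>j<n. (cmod (\<eta> j))\<^sup>2))"
    using b[rule_format, of \<eta> \<xi>] by (simp only: mult.commute)
qed

lemma mat_bound_imp_bil_bound:
  assumes b: "mat_bound b C"
  shows "bil_bound m n C b"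
  unfolding bil_bound_def
proof (intro allI)
  fix \<xi> \<eta> :: "nat \<Rightarrow> complex"
  define x where "x k = (if k < n then \<xi> k else 0)" for k
  have sx: "(\<lambda>k. (cmod (x k))\<^sup>2) sums (\<Sum>k<n. (cmod (\<xi> k))\<^sup>2)"
    using sums_finite[of "{..<n}" "\<lambda>k. (cmod (x k))\<^sup>2"] by (simp add: x_def)
  then have "x \<in> ell2" by (auto simp: ell2_def sums_iff)
  have y: "(\<Sum>k. b j k * x k) = (\<Sum>k<n. b j k * \<xi> k)" for j
    using suminf_finite[of "{..<n}" "\<lambda>k. b j k * x k"] by (simp add: x_def)
  let ?y = "\<lambda>j. \<Sum>k<n. b j k * \<xi> k"
  have ym: "?y \<in> ell2" "ell2_norm ?y \<le> C * ell2_norm x"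
    using b[unfolded mat_bound_def, THEN conjunct2, rule_format, OF \<open>x \<in> ell2\<close>] unfolding y by blast+
  have nx: "ell2_norm x = sqrt (\<Sum>k<n. (cmod (\<xi> k))\<^sup>2)"
    using sx by (simp add: ell2_norm_def sums_iff)
  have "cmod (\<Sum>j<m. \<Sum>k<n. b j k * (\<xi> k * \<eta> j)) = cmod (\<Sum>j<m. ?y j * \<eta> j)"
    by (simp add: sum_distrib_right mult.assoc)
  also have "\<dots> \<le> (\<Sum>j<m. \<bar>cmod (?y j)\<bar> * \<bar>cmod (\<eta> j)\<bar>)"
    by (rule sum_norm_le) (simp add: norm_mult)
  also have "\<dots> \<le> L2_set (\<lambda>j. cmod (?y j)) {..<m} * L2_set (\<lambda>j. cmod (\<eta> j)) {..<m}"
    by (rule L2_set_mult_ineq)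
  also have "\<dots> \<le> ell2_norm ?y * L2_set (\<lambda>j. cmod (\<eta> j)) {..<m}"
  proof (rule mult_right_mono)
    show "L2_set (\<lambda>j. cmod (?y j)) {..<m} \<le> ell2_norm ?y"
      using ym(1) unfolding L2_set_def ell2_norm_def ell2_def
      by (intro real_sqrt_le_mono sum_le_suminf) auto
  qed (rule L2_set_nonneg)
  also have "\<dots> \<le> C * ell2_norm x * L2_set (\<lambda>j. cmod (\<eta> j)) {..<m}"
    by (intro mult_right_mono ym L2_set_nonneg)
  finally show "cmod (\<Sum>j<m. \<Sum>k<n. b j k * (\<xi> k * \<eta> j))
    \<le> C * (sqrt (\<Sum>k<n. (cmod (\<xi> k))\<^sup>2) * sqrt (\<Sum>j<m. (cmod (\<eta> j))\<^sup>2))"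
    unfolding nx L2_set_def by (simp add: mult.assoc)
qed

lemma sqrt_le_if_le_mult_sqrt:
  fixes S c :: real
  assumes "S \<le> c * sqrt S" "0 \<le> S" "0 \<le> c"
  shows "sqrt S \<le> c"
proof (cases "S = 0")
  case False
  have "sqrt S * sqrt S \<le> c * sqrt S" using assms by simp
  then show ?thesis by (rule mult_right_le_imp_le) (use False assms(2) in simp)
qed (use assms in simp)

lemma bil_bound_apply:
  assumes b: "bil_bound m n C b" and "0 \<le> C"
  shows "(\<Sum>j<m. (cmod (\<Sum>k<n. b j k * x k))\<^sup>2) \<le> C\<^sup>2 * (\<Sum>k<n. (cmod (x k))\<^sup>2)"
proof -
  define y where "y j = (\<Sum>k<n. b j k * x k)" for j
  define S where "S = (\<Sum>j<m. (cmod (y j))\<^sup>2)"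
  have "S \<ge> 0" unfolding S_def by (intro sum_nonneg) simp
  have "(\<Sum>j<m. \<Sum>k<n. b j k * (x k * cnj (y j))) = (\<Sum>j<m. y j * cnj (y j))"
    unfolding y_def sum_distrib_right mult.assoc ..
  also have "\<dots> = complex_of_real S" by (simp add: S_def complex_norm_square del: of_real_power)
  finally have "cmod (complex_of_real S) \<le> C * (sqrt (\<Sum>k<n. (cmod (x k))\<^sup>2) * sqrt (\<Sum>j<m. (cmod (cnj (y j)))\<^sup>2))"
    using b[unfolded bil_bound_def, rule_format, of x "\<lambda>j. cnj (y j)"] by simp
  then have le: "S \<le> C * sqrt (\<Sum>k<n. (cmod (x k))\<^sup>2) * sqrt S"
    using \<open>S \<ge> 0\<close> by (simp only: norm_of_real abs_of_nonneg complex_mod_cnj S_def[symmetric] mult.assoc)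
  have "sqrt S \<le> C * sqrt (\<Sum>k<n. (cmod (x k))\<^sup>2)"
    by (rule sqrt_le_if_le_mult_sqrt[OF le \<open>S \<ge> 0\<close>]) (use \<open>0 \<le> C\<close> in \<open>simp add: sum_nonneg\<close>)
  then have "(sqrt S)\<^sup>2 \<le> (C * sqrt (\<Sum>k<n. (cmod (x k))\<^sup>2))\<^sup>2"
    using \<open>S \<ge> 0\<close> by (intro power_mono) auto
  then show ?thesis using \<open>S \<ge> 0\<close> by (simp add: power_mult_distrib sum_nonneg S_def y_def)
qed

text \<open>Together with the converse this makes boundedness of an infinite matrix a property of
  its finite corners, in which form it is invariant under transposition.\<close>

lemma bil_bound_imp_mat_bound:
  assumes b: "\<And>m n. bil_bound m n C b" and "0 \<le> C"
  shows "mat_bound b C"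
  unfolding mat_bound_def
proof (intro conjI ballI allI \<open>0 \<le> C\<close>)
  fix x assume "x \<in> ell2"
  then have sx: "summable (\<lambda>k. (cmod (x k))\<^sup>2)" by (simp add: ell2_def)
  show row: "summable (\<lambda>k. b j k * x k)" for j
  proof -
    have le: "(\<Sum>k<n. (cmod (b j k))\<^sup>2) \<le> C\<^sup>2" for n
    proof -
      \<comment> \<open>The transposed corner with \<open>Suc j\<close> columns, applied to the last
        unit vector, returns the beginning of row \<open>j\<close>; hence rows are square summable
        and the series converge.\<close>
      have "(\<Sum>k<n. (cmod (\<Sum>i<Suc j. b i k * (if i = j then 1 else 0)))\<^sup>2)
          \<le> C\<^sup>2 * (\<Sum>i<Suc j. (cmod (if i = j then 1 else 0))\<^sup>2)"
        by (rule bil_bound_apply[OF bil_bound_transpose[OF b] \<open>0 \<le> C\<close>])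
      then show ?thesis by simp
    qed
    have sb: "summable (\<lambda>k. (cmod (b j k))\<^sup>2)"
      by (rule summableI_nonneg_bounded[OF _ le]) simp
    have "summable (\<lambda>k. \<bar>cmod (b j k) * cmod (x k)\<bar>)"
      by (rule weighted_cauchy_schwarz(1)[OF sb sx])
    then show ?thesis by (intro summable_norm_cancel[of "\<lambda>k. b j k * x k"]) (simp add: norm_mult)
  qed
  have le: "(\<Sum>j<m. (cmod (\<Sum>k. b j k * x k))\<^sup>2) \<le> (C * ell2_norm x)\<^sup>2" for m
  proof (rule LIMSEQ_le_const2)
    show "(\<lambda>n. \<Sum>j<m. (cmod (\<Sum>k<n. b j k * x k))\<^sup>2) \<longlonglongrightarrow> (\<Sum>j<m. (cmod (\<Sum>k. b j k * x k))\<^sup>2)"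
      by (intro tendsto_intros summable_LIMSEQ row)
    have "(\<Sum>j<m. (cmod (\<Sum>k<n. b j k * x k))\<^sup>2) \<le> (C * ell2_norm x)\<^sup>2" for n
    proof -
      have "(\<Sum>j<m. (cmod (\<Sum>k<n. b j k * x k))\<^sup>2) \<le> C\<^sup>2 * (\<Sum>k<n. (cmod (x k))\<^sup>2)"
        by (rule bil_bound_apply[OF b \<open>0 \<le> C\<close>])
      also have "\<dots> \<le> C\<^sup>2 * (\<Sum>k. (cmod (x k))\<^sup>2)"
        by (intro mult_left_mono sum_le_suminf sx) auto
      finally show ?thesis by (simp add: ell2_norm_def power_mult_distrib suminf_nonneg[OF sx])
    qed
    then show "\<exists>N. \<forall>n\<ge>N. (\<Sum>j<m. (cmod (\<Sum>k<n. b j k * x k))\<^sup>2) \<le> (C * ell2_norm x)\<^sup>2" by blast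
  qed
  have sy: "summable (\<lambda>j. (cmod (\<Sum>k. b j k * x k))\<^sup>2)"
    by (rule summableI_nonneg_bounded[OF _ le]) simp
  then show "(\<lambda>j. \<Sum>k. b j k * x k) \<in> ell2" by (simp add: ell2_def)
  have "(\<Sum>j. (cmod (\<Sum>k. b j k * x k))\<^sup>2) \<le> (C * ell2_norm x)\<^sup>2" by (rule suminf_le_const[OF sy le])
  then show "ell2_norm (\<lambda>j. \<Sum>k. b j k * x k) \<le> C * ell2_norm x"
    using \<open>0 \<le> C\<close> ell2_norm_nonneg[OF \<open>x \<in> ell2\<close>]
    unfolding ell2_norm_def[of "\<lambda>j. \<Sum>k. b j k * x k"] by (intro real_le_lsqrt) auto
qed

lemma mat_bound_mono: "mat_bound b C \<Longrightarrow> C \<le> D \<Longrightarrow> mat_bound b D"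
  unfolding mat_bound_def
proof (intro conjI ballI)
  assume b: "0 \<le> C \<and> (\<forall>x\<in>ell2. (\<forall>j. summable (\<lambda>k. b j k * x k)) \<and>
    (\<lambda>j. \<Sum>k. b j k * x k) \<in> ell2 \<and> ell2_norm (\<lambda>j. \<Sum>k. b j k * x k) \<le> C * ell2_norm x)" and "C \<le> D"
  show "0 \<le> D" using b \<open>C \<le> D\<close> by simp
  fix x assume x: "x \<in> ell2"
  note bx = b[THEN conjunct2, rule_format, OF x]
  show "\<forall>j. summable (\<lambda>k. b j k * x k)" "(\<lambda>j. \<Sum>k. b j k * x k) \<in> ell2" using bx by simp_all
  have "C * ell2_norm x \<le> D * ell2_norm x"
    by (intro mult_right_mono \<open>C \<le> D\<close> ell2_norm_nonneg x)
  then show "ell2_norm (\<lambda>j. \<Sum>k. b j k * x k) \<le> D * ell2_norm x" using bx by linarith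
qed

section \<open>From essential suprema to bounds off a null set\<close>

lemma mat_norm_less_imp_bound:
  assumes "b \<in> bounded_mat" "mat_norm b < C"
  shows "mat_bound b C"
proof -
  have "{C. mat_bound b C} \<noteq> {}" using assms(1) by (auto simp: bounded_mat_def)
  then obtain C' where "mat_bound b C'" "C' < C"
    using cInf_lessD[of "{C. mat_bound b C}" C] assms(2) unfolding mat_norm_def by blast
  then show ?thesis using mat_bound_mono[of b C' C] by simp
qed

lemma mat_norm_le: "mat_bound b C \<Longrightarrow> mat_norm b \<le> C"
  unfolding mat_norm_def by (rule cInf_lower) (auto intro!: bdd_belowI[of _ 0] simp: mat_bound_def)

text \<open>A constant strictly above the infimum exceeds an admissible one, so the question whether
  the infimum is attained does not arise. This is one source of the \<open>\<epsilon>\<close> added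
  to the norms.\<close>

lemma esssup_spec_less:
  assumes "AE_spec M E (\<lambda>x. f x \<le> C0)" "esssup_spec M E f < C"
  shows "AE_spec M E (\<lambda>x. f x \<le> C)" "0 < C"
proof -
  have mono: "AE_spec M E (\<lambda>x. f x \<le> D)" if le: "AE_spec M E (\<lambda>x. f x \<le> C)" "C \<le> D" for C D
  proof -
    obtain N where "N \<in> null_sets_spec M E" "\<forall>x\<in>space M - N. f x \<le> C"
      using le(1) unfolding AE_spec_def by blast
    moreover have "f x \<le> D" if "f x \<le> C" for x using that le(2) by simp
    ultimately show ?thesis unfolding AE_spec_def by blast
  qed
  have "AE_spec M E (\<lambda>x. f x \<le> \<bar>C0\<bar>)"
    by (rule mono[OF assms(1)]) simp
  then have "\<bar>C0\<bar> \<in> {C. 0 \<le> C \<and> AE_spec M E (\<lambda>x. f x \<le> C)}" by simp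
  then have "{C. 0 \<le> C \<and> AE_spec M E (\<lambda>x. f x \<le> C)} \<noteq> {}" by (metis empty_iff)
  from cInf_lessD[OF this assms(2)[unfolded esssup_spec_def]]
   obtain C' where "0 \<le> C'" "AE_spec M E (\<lambda>x. f x \<le> C')" "C' < C" by blast
  then show "0 < C" "AE_spec M E (\<lambda>x. f x \<le> C)"
    using mono[of C' C] by simp_all
qed

definition opmat_bound :: "(nat \<Rightarrow> nat \<Rightarrow> 'h::chilbert_space \<Rightarrow> 'h) \<Rightarrow> real \<Rightarrow> bool" where
  "opmat_bound B b \<longleftrightarrow> (\<forall>j k. bounded_op (B j k)) \<and> 0 \<le> b \<and>
     (\<forall>m n u v. cmod (\<Sum>j<m. \<Sum>k<n. cinner (B j k (u k)) (v j))
        \<le> b * (sqrt (\<Sum>k<n. (norm (u k))\<^sup>2) * sqrt (\<Sum>j<m. (norm (v j))\<^sup>2)))"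

context
  fixes M :: "'x measure" and E :: "'x set \<Rightarrow> 'h::chilbert_space \<Rightarrow> 'h"
  assumes sm: "spectral_measure M E"
begin

lemma Linf_ell2_AE:
  assumes a: "a \<in> Linf_ell2 M E" and C: "Linf_ell2_norm M E a < C"
  shows "AE_spec M E (\<lambda>x. \<forall>J. (\<Sum>j<J. (cmod (a j x))\<^sup>2) \<le> C\<^sup>2)" "0 < C"
proof -
  obtain C0 where C0: "AE_spec M E (\<lambda>x. (\<lambda>j. a j x) \<in> ell2 \<and> ell2_norm (\<lambda>j. a j x) \<le> C0)"
    using a by (auto simp: Linf_ell2_def)
  have "AE_spec M E (\<lambda>x. ell2_norm (\<lambda>j. a j x) \<le> C0)"
    by (rule AE_spec_mono[OF sm C0]) simp
  from esssup_spec_less[OF this C[unfolded Linf_ell2_norm_def]]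
  have 1: "AE_spec M E (\<lambda>x. ell2_norm (\<lambda>j. a j x) \<le> C)" and "0 < C" .
  show "0 < C" by fact
  show "AE_spec M E (\<lambda>x. \<forall>J. (\<Sum>j<J. (cmod (a j x))\<^sup>2) \<le> C\<^sup>2)"
  proof (rule AE_spec_mono[OF sm AE_spec_conj[OF sm C0 1]], intro allI)
    fix x J
    assume x: "((\<lambda>j. a j x) \<in> ell2 \<and> ell2_norm (\<lambda>j. a j x) \<le> C0) \<and> ell2_norm (\<lambda>j. a j x) \<le> C"
    then have s: "summable (\<lambda>j. (cmod (a j x))\<^sup>2)" by (simp add: ell2_def)
    have "(\<Sum>j<J. (cmod (a j x))\<^sup>2) \<le> (\<Sum>j. (cmod (a j x))\<^sup>2)" by (intro sum_le_suminf s) auto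
    also have "\<dots> \<le> C\<^sup>2" using x by (auto simp: ell2_norm_def intro: sqrt_le_D)
    finally show "(\<Sum>j<J. (cmod (a j x))\<^sup>2) \<le> C\<^sup>2" .
  qed
qed

lemma Linf_ell2_norm_nonneg: "a \<in> Linf_ell2 M E \<Longrightarrow> 0 \<le> Linf_ell2_norm M E a"
  using Linf_ell2_AE(2)[of a 0] by (cases "Linf_ell2_norm M E a < 0") simp_all

lemma Linf_mat_AE:
  assumes b: "b \<in> Linf_mat M E" and C: "Linf_mat_norm M E b < C"
  shows "AE_spec M E (\<lambda>x. mat_bound (\<lambda>j k. b j k x) C)" "0 < C"
proof -
  obtain C0 where C0: "AE_spec M E (\<lambda>x. (\<lambda>j k. b j k x) \<in> bounded_mat \<and> mat_norm (\<lambda>j k. b j k x) \<le> C0)"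
    using b by (auto simp: Linf_mat_def)
  have C0': "AE_spec M E (\<lambda>x. mat_norm (\<lambda>j k. b j k x) \<le> C0)"
    by (rule AE_spec_mono[OF sm C0]) simp
  obtain C' where C': "Linf_mat_norm M E b < C'" "C' < C" using dense[OF C] by blast
  from esssup_spec_less[OF C0' C'(1)[unfolded Linf_mat_norm_def]]
  have 1: "AE_spec M E (\<lambda>x. mat_norm (\<lambda>j k. b j k x) \<le> C')" and "0 < C'" .
  show "0 < C" using C'(2) \<open>0 < C'\<close> by simp
  show "AE_spec M E (\<lambda>x. mat_bound (\<lambda>j k. b j k x) C)"
    by (rule AE_spec_mono[OF sm AE_spec_conj[OF sm C0 1]])
       (use C'(2) in \<open>auto intro!: mat_norm_less_imp_bound\<close>)
qed

lemma Linf_mat_transpose: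
  assumes b: "b \<in> Linf_mat M E"
  shows "(\<lambda>j k. b k j) \<in> Linf_mat M E"
proof -
  let ?C = "Linf_mat_norm M E b + 1"
  have "AE_spec M E (\<lambda>x. (\<lambda>j k. b k j x) \<in> bounded_mat \<and> mat_norm (\<lambda>j k. b k j x) \<le> ?C)"
  proof (rule AE_spec_mono[OF sm Linf_mat_AE(1)[OF b, of ?C]])
    fix x assume m: "mat_bound (\<lambda>j k. b j k x) ?C"
    have "mat_bound (\<lambda>j k. b k j x) ?C"
      using bil_bound_transpose[OF mat_bound_imp_bil_bound[OF m]] m
      by (intro bil_bound_imp_mat_bound) (auto simp: mat_bound_def)
    then show "(\<lambda>j k. b k j x) \<in> bounded_mat \<and> mat_norm (\<lambda>j k. b k j x) \<le> ?C"
      by (auto simp: bounded_mat_def intro: mat_norm_le)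
  qed simp
  then show ?thesis using b by (auto simp: Linf_mat_def)
qed

lemma Linf_mat_opmat_bound:
  assumes b: "b \<in> Linf_mat M E" and C: "Linf_mat_norm M E b < C"
  shows "opmat_bound (\<lambda>j k. spec_integral M E (b j k)) C"
proof -
  note AE = Linf_mat_AE[OF b C]
  have bd: "AE_spec M E (\<lambda>x. bil_bound m n C (\<lambda>j k. b j k x))" for m n
    by (rule AE_spec_mono[OF sm AE(1) mat_bound_imp_bil_bound])
  have bm: "b j k \<in> borel_measurable M" for j k using b by (simp add: Linf_mat_def)
  have "bounded_op (spec_integral M E (b j k))" for j k
    using spec_integral_matrix(1)[OF sm bm _ bd, of j "Suc j" k "Suc k"] AE(2)
    by (simp add: is_spec_integral_def)
  then show ?thesis
    unfolding opmat_bound_def using spec_integral_matrix(2)[OF sm bm _ bd] AE(2) by simp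
qed

text \<open>The sequence is a matrix with one column. Testing the matrix bound with the integrals
  applied to \<open>u\<close> themselves gives \<open>S \<le> C * norm u * sqrt S\<close> for the
  sum of squares \<open>S\<close>.\<close>

lemma spec_integral_square_sum:
  fixes a :: "nat \<Rightarrow> 'x \<Rightarrow> complex"
  assumes a: "\<And>j. a j \<in> borel_measurable M" and "0 \<le> C"
    and bd: "AE_spec M E (\<lambda>x. \<forall>J. (\<Sum>j<J. (cmod (a j x))\<^sup>2) \<le> C\<^sup>2)"
  shows "(\<Sum>j<J. (norm (spec_integral M E (a j) u))\<^sup>2) \<le> (C * norm u)\<^sup>2"
    and "bounded_op (spec_integral M E (a j))" and "AE_spec M E (\<lambda>x. cmod (a j x) \<le> C)"
proof -
  have bil: "AE_spec M E (\<lambda>x. bil_bound J 1 C (\<lambda>j k. a j x))" for J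
  proof (rule AE_spec_mono[OF sm bd])
    fix x assume x: "\<forall>J. (\<Sum>j<J. (cmod (a j x))\<^sup>2) \<le> C\<^sup>2"
    show "bil_bound J 1 C (\<lambda>j k. a j x)"
      unfolding bil_bound_def
    proof (intro allI)
      fix \<xi> \<eta> :: "nat \<Rightarrow> complex"
      have "cmod (\<Sum>j<J. \<Sum>k<1. a j x * (\<xi> k * \<eta> j)) = cmod (\<xi> 0) * cmod (\<Sum>j<J. a j x * \<eta> j)"
        by (simp add: norm_mult[symmetric] sum_distrib_left mult_ac)
      also have "\<dots> \<le> cmod (\<xi> 0) * (L2_set (\<lambda>j. cmod (a j x)) {..<J} * L2_set (\<lambda>j. cmod (\<eta> j)) {..<J})"
      proof (rule mult_left_mono)
        have "cmod (\<Sum>j<J. a j x * \<eta> j) \<le> (\<Sum>j<J. \<bar>cmod (a j x)\<bar> * \<bar>cmod (\<eta> j)\<bar>)"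
          by (rule sum_norm_le) (simp add: norm_mult)
        also have "\<dots> \<le> L2_set (\<lambda>j. cmod (a j x)) {..<J} * L2_set (\<lambda>j. cmod (\<eta> j)) {..<J}"
          by (rule L2_set_mult_ineq)
        finally show "cmod (\<Sum>j<J. a j x * \<eta> j)
          \<le> L2_set (\<lambda>j. cmod (a j x)) {..<J} * L2_set (\<lambda>j. cmod (\<eta> j)) {..<J}" .
      qed simp
      also have "\<dots> \<le> cmod (\<xi> 0) * (C * L2_set (\<lambda>j. cmod (\<eta> j)) {..<J})"
        using x \<open>0 \<le> C\<close> by (intro mult_left_mono mult_right_mono L2_set_nonneg) (auto simp: L2_set_def intro!: real_le_lsqrt sum_nonneg)
      finally show "cmod (\<Sum>j<J. \<Sum>k<1. a j x * (\<xi> k * \<eta> j))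
        \<le> C * (sqrt (\<Sum>k<1. (cmod (\<xi> k))\<^sup>2) * sqrt (\<Sum>j<J. (cmod (\<eta> j))\<^sup>2))"
        by (simp add: L2_set_def mult_ac)
    qed
  qed
  show "bounded_op (spec_integral M E (a j))"
    using spec_integral_matrix(1)[of M E "Suc j" 1 "\<lambda>j k. a j", OF sm a \<open>0 \<le> C\<close> bil, of j 0]
    by (simp add: is_spec_integral_def)
  show "AE_spec M E (\<lambda>x. cmod (a j x) \<le> C)"
    by (rule AE_spec_mono[OF sm bil[of "Suc j"]]) (rule bil_bound_entry[of "Suc j" 1 C _ j 0], simp_all)
  define S where "S = (\<Sum>j<J. (norm (spec_integral M E (a j) u))\<^sup>2)"
  have "S \<ge> 0" unfolding S_def by (intro sum_nonneg) simp
  have "(\<Sum>j<J. cinner (spec_integral M E (a j) u) (spec_integral M E (a j) u)) = complex_of_real S"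
    by (simp add: S_def cinner_self)
  then have "cmod (complex_of_real S) \<le> C * (sqrt (\<Sum>k<(1::nat). (norm u)\<^sup>2) * sqrt S)"
    using spec_integral_matrix(2)[of M E J 1 "\<lambda>j k. a j", OF sm a \<open>0 \<le> C\<close> bil, of "\<lambda>_. u"
        "\<lambda>j. spec_integral M E (a j) u"] by (simp add: S_def)
  then have le: "S \<le> C * norm u * sqrt S" using \<open>S \<ge> 0\<close> by (simp add: mult.assoc)
  have "sqrt S \<le> C * norm u"
    by (rule sqrt_le_if_le_mult_sqrt[OF le \<open>S \<ge> 0\<close>]) (use \<open>0 \<le> C\<close> in simp)
  then have "(sqrt S)\<^sup>2 \<le> (C * norm u)\<^sup>2" using \<open>S \<ge> 0\<close> by (intro power_mono) auto
  then show "(\<Sum>j<J. (norm (spec_integral M E (a j) u))\<^sup>2) \<le> (C * norm u)\<^sup>2"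
    using \<open>S \<ge> 0\<close> by (simp add: S_def)
qed

text \<open>The adjoint of the integral of \<open>a j\<close> is the integral of the conjugate,
  which has the same modulus; so the column of adjoints obeys the same estimate.\<close>

lemma Linf_ell2_column_bound:
  assumes a: "a \<in> Linf_ell2 M E" and C: "Linf_ell2_norm M E a < C"
  shows "column_bound (\<lambda>j. spec_integral M E (a j)) C"
proof -
  note AE = Linf_ell2_AE[OF a C]
  have am: "a j \<in> borel_measurable M" for j using a by (simp add: Linf_ell2_def)
  have "0 \<le> C" using AE(2) by simp
  note sq = spec_integral_square_sum[of a C, OF am \<open>0 \<le> C\<close> AE(1)]
  have cm: "(\<lambda>x. cnj (a j x)) \<in> borel_measurable M" for j
    by (rule borel_measurable_continuous_on[OF _ am]) (intro continuous_intros)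
  have adj: "adj (spec_integral M E (a j)) = spec_integral M E (\<lambda>x. cnj (a j x))" for j
    by (rule adj_spec_integral[OF sm am sq(3)])
  have AE': "AE_spec M E (\<lambda>x. \<forall>J. (\<Sum>j<J. (cmod (cnj (a j x)))\<^sup>2) \<le> C\<^sup>2)"
    using AE(1) by (simp only: complex_mod_cnj)
  note sq' = spec_integral_square_sum(1)[of "\<lambda>j x. cnj (a j x)" C, OF cm \<open>0 \<le> C\<close> AE']
  show ?thesis unfolding column_bound_def adj
    using sq(1,2) sq' \<open>0 \<le> C\<close> by (intro conjI allI)
qed

end


section \<open>Triple operator integrals with integrand in the Haagerup tensor product\<close>

subsection \<open>Bilinear series of vectors\<close>

abbreviation l2seq :: "(nat \<Rightarrow> 'h::chilbert_space) \<Rightarrow> bool" where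
  "l2seq y \<equiv> summable (\<lambda>k. (norm (y k))\<^sup>2)"

definition l2norm :: "(nat \<Rightarrow> 'h::chilbert_space) \<Rightarrow> real" where
  "l2norm y = sqrt (\<Sum>k. (norm (y k))\<^sup>2)"

definition series_part :: "(nat \<Rightarrow> nat \<Rightarrow> 'h::chilbert_space \<Rightarrow> 'h) \<Rightarrow> (nat \<Rightarrow> 'h) \<Rightarrow> (nat \<Rightarrow> 'h) \<Rightarrow> nat \<Rightarrow> nat \<Rightarrow> complex" where
  "series_part B y x m n = (\<Sum>j<m. \<Sum>k<n. cinner (B j k (y k)) (x j))"

text \<open>The limit is taken along squares to have a function; for square summable
  \<open>x\<close> and \<open>y\<close> all rectangular partial sums converge to it as well.\<close>

definition series_lim :: "(nat \<Rightarrow> nat \<Rightarrow> 'h::chilbert_space \<Rightarrow> 'h) \<Rightarrow> (nat \<Rightarrow> 'h) \<Rightarrow> (nat \<Rightarrow> 'h) \<Rightarrow> complex" where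
  "series_lim B y x = lim (\<lambda>N. series_part B y x N N)"

lemma l2norm_nonneg: "l2seq y \<Longrightarrow> 0 \<le> l2norm y"
  by (simp add: l2norm_def suminf_nonneg)

lemma double_sums_diag:
  assumes "double_sums f s"
  shows "(\<lambda>N. \<Sum>j<N. \<Sum>k<N. f j k) \<longlonglongrightarrow> s"
proof -
  have "filterlim (\<lambda>N::nat. (N, N)) (sequentially \<times>\<^sub>F sequentially) sequentially"
    by (intro filterlim_Pair filterlim_ident)
  from filterlim_compose[OF assms[unfolded double_sums_def] this] show ?thesis by simp
qed

lemma double_sums_swap:
  assumes "double_sums f s"
  shows "double_sums (\<lambda>j k. f k j) s"
proof -
  have "((\<lambda>(m, n). \<Sum>j<m. \<Sum>k<n. f j k) \<longlongrightarrow> s) (sequentially \<times>\<^sub>F sequentially)"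
    using assms by (simp add: double_sums_def)
  moreover have "filterlim (\<lambda>(m, n). (n, m)) (sequentially \<times>\<^sub>F sequentially) (sequentially \<times>\<^sub>F sequentially)"
    unfolding case_prod_unfold by (intro filterlim_Pair filterlim_fst filterlim_snd)
  ultimately have "((\<lambda>p. (\<lambda>(m, n). \<Sum>j<m. \<Sum>k<n. f j k) (case p of (m, n) \<Rightarrow> (n, m))) \<longlongrightarrow> s)
      (sequentially \<times>\<^sub>F sequentially)"
    by (rule filterlim_compose)
  moreover have "(\<lambda>p. (\<lambda>(m, n). \<Sum>j<m. \<Sum>k<n. f j k) (case p of (m, n) \<Rightarrow> (n, m)))
    = (\<lambda>(m, n). \<Sum>j<m. \<Sum>k<n. f k j)"
    by (rule ext) (auto simp: case_prod_unfold intro: sum.swap)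
  ultimately show ?thesis by (simp add: double_sums_def)
qed

lemma double_sums_unique: "double_sums f s \<Longrightarrow> double_sums f t \<Longrightarrow> s = t"
  using double_sums_diag LIMSEQ_unique by blast

lemma l2seq_tail:
  assumes y: "l2seq y"
  obtains t where "t \<longlonglongrightarrow> 0" "\<And>N. 0 \<le> t N"
    "\<And>N n. sqrt (\<Sum>k<n. (norm (if k < N then 0 else y k))\<^sup>2) \<le> t N"
proof
  let ?r = "\<lambda>N. (\<Sum>k. (norm (y k))\<^sup>2) - (\<Sum>k<N. (norm (y k))\<^sup>2)"
  have "?r \<longlonglongrightarrow> (\<Sum>k. (norm (y k))\<^sup>2) - (\<Sum>k. (norm (y k))\<^sup>2)"
    by (intro tendsto_intros summable_LIMSEQ y)
  from tendsto_real_sqrt[OF this] show "(\<lambda>N. sqrt (?r N)) \<longlonglongrightarrow> 0" by simp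
  have *: "(\<Sum>k<n. (norm (if k < N then 0 else y k))\<^sup>2) \<le> ?r N" for n N
  proof -
    have "(\<Sum>k<n. (norm (if k < N then 0 else y k))\<^sup>2) = (\<Sum>k\<in>{N..<n}. (norm (y k))\<^sup>2)"
      by (rule sum.mono_neutral_cong_right) auto
    moreover have "(\<Sum>k\<in>{N..<n}. (norm (y k))\<^sup>2) + (\<Sum>k\<in>{..<N}. (norm (y k))\<^sup>2)
      = (\<Sum>k\<in>{N..<n} \<union> {..<N}. (norm (y k))\<^sup>2)"
      by (rule sum.union_disjoint[symmetric]) auto
    moreover have "\<dots> \<le> (\<Sum>k. (norm (y k))\<^sup>2)" by (intro sum_le_suminf y) auto
    ultimately show ?thesis by linarith
  qed
  show "sqrt (\<Sum>k<n. (norm (if k < N then 0 else y k))\<^sup>2) \<le> sqrt (?r N)" for n N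
    by (rule real_sqrt_le_mono[OF *])
  show "0 \<le> sqrt (?r N)" for N using *[of 0 N] by simp
qed

lemma l2seq_diff:
  assumes "l2seq y" "l2seq y'"
  shows "l2seq (\<lambda>k. y k - y' k)"
proof (rule summable_comparison_test')
  show "summable (\<lambda>k. 2 * (norm (y k))\<^sup>2 + 2 * (norm (y' k))\<^sup>2)"
    using assms by (intro summable_add summable_mult)
  show "norm ((norm (y k - y' k))\<^sup>2) \<le> 2 * (norm (y k))\<^sup>2 + 2 * (norm (y' k))\<^sup>2" if "k \<ge> 0" for k
  proof -
    have "(norm (y k - y' k))\<^sup>2 + (norm (y k + y' k))\<^sup>2 = 2 * (norm (y k))\<^sup>2 + 2 * (norm (y' k))\<^sup>2"
      by (simp add: power2_norm_eq_inner inner_diff_left inner_diff_right inner_add_left inner_add_right inner_commute)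
    moreover have "0 \<le> (norm (y k + y' k))\<^sup>2" by simp
    ultimately have "(norm (y k - y' k))\<^sup>2 \<le> 2 * (norm (y k))\<^sup>2 + 2 * (norm (y' k))\<^sup>2" by linarith
    then show ?thesis by simp
  qed
qed

context
  fixes B :: "nat \<Rightarrow> nat \<Rightarrow> 'h::chilbert_space \<Rightarrow> 'h" and b :: real
  assumes B: "opmat_bound B b"
begin

lemma opmat_bounded: "bounded_op (B j k)"
  using B by (simp add: opmat_bound_def)

lemma opmat_nonneg: "0 \<le> b"
  using B by (simp add: opmat_bound_def)

lemma series_part_bound:
  "cmod (series_part B y x m n) \<le> b * (sqrt (\<Sum>k<n. (norm (y k))\<^sup>2) * sqrt (\<Sum>j<m. (norm (x j))\<^sup>2))"
  using B by (simp add: opmat_bound_def series_part_def)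

lemma series_part_bound_l2:
  assumes "l2seq y" "l2seq x"
  shows "cmod (series_part B y x m n) \<le> b * (l2norm y * l2norm x)"
proof -
  have "b * (sqrt (\<Sum>k<n. (norm (y k))\<^sup>2) * sqrt (\<Sum>j<m. (norm (x j))\<^sup>2)) \<le> b * (l2norm y * l2norm x)"
    unfolding l2norm_def using assms
    by (intro mult_left_mono mult_mono real_sqrt_le_mono sum_le_suminf opmat_nonneg)
       (auto intro: suminf_nonneg sum_nonneg)
  then show ?thesis using series_part_bound[of y x m n] by linarith
qed

lemma series_part_add_left: "series_part B (\<lambda>k. y k + y' k) x m n = series_part B y x m n + series_part B y' x m n"
  by (simp add: series_part_def bounded_op_simps[OF opmat_bounded] cinner_add_left sum.distrib)

lemma series_part_diff_left: "series_part B (\<lambda>k. y k - y' k) x m n = series_part B y x m n - series_part B y' x m n"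
  by (simp add: series_part_def bounded_op_simps[OF opmat_bounded] cinner_diff_left sum_subtractf)

lemma series_part_diff_right: "series_part B y (\<lambda>k. x k - x' k) m n = series_part B y x m n - series_part B y x' m n"
  by (simp add: series_part_def cinner_diff_right sum_subtractf)

text \<open>A rectangle minus the inner square of size \<open>N\<close> consists of two strips, one
  with \<open>k \<ge> N\<close> and one with \<open>j \<ge> N\<close>; each is controlled by the
  tail of \<open>y\<close> or of \<open>x\<close>, uniformly in the size of the rectangle.\<close>

lemma series_part_tail:
  assumes y: "l2seq y" and x: "l2seq x"
  obtains \<epsilon> where "\<epsilon> \<longlonglongrightarrow> 0"
    "\<And>N m n. N \<le> m \<Longrightarrow> N \<le> n \<Longrightarrow> cmod (series_part B y x m n - series_part B y x N N) \<le> \<epsilon> N"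
proof -
  obtain t where t: "t \<longlonglongrightarrow> 0" "\<And>N. 0 \<le> t N"
    "\<And>N n. sqrt (\<Sum>k<n. (norm (if k < N then 0 else y k))\<^sup>2) \<le> t N" using l2seq_tail[OF y] by blast
  obtain t' where t': "t' \<longlonglongrightarrow> 0" "\<And>N. 0 \<le> t' N"
    "\<And>N n. sqrt (\<Sum>k<n. (norm (if k < N then 0 else x k))\<^sup>2) \<le> t' N" using l2seq_tail[OF x] by blast
  have ln: "sqrt (\<Sum>j<m. (norm (z j))\<^sup>2) \<le> l2norm z" if "l2seq z" for z m
    unfolding l2norm_def using that by (intro real_sqrt_le_mono sum_le_suminf) auto
  have le: "cmod (series_part B y x m n - series_part B y x N N) \<le> b * (t N * l2norm x) + b * (l2norm y * t' N)"
    if "N \<le> m" "N \<le> n" for N m n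
  proof -
    have 1: "series_part B y x m n - series_part B y x m N = series_part B (\<lambda>k. if k < N then 0 else y k) x m n"
    proof -
      have "(\<Sum>k<n. cinner (B j k (if k < N then 0 else y k)) (x j))
        = (\<Sum>k<n. cinner (B j k (y k)) (x j)) - (\<Sum>k<N. cinner (B j k (y k)) (x j))" for j
      proof -
        have "(\<Sum>k<n. cinner (B j k (y k)) (x j)) = (\<Sum>k\<in>{..<N} \<union> {N..<n}. cinner (B j k (y k)) (x j))"
          using that by (intro sum.cong) auto
        also have "\<dots> = (\<Sum>k<N. cinner (B j k (y k)) (x j)) + (\<Sum>k\<in>{N..<n}. cinner (B j k (y k)) (x j))"
          by (rule sum.union_disjoint) auto
        also have "(\<Sum>k\<in>{N..<n}. cinner (B j k (y k)) (x j)) = (\<Sum>k<n. cinner (B j k (if k < N then 0 else y k)) (x j))"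
          by (rule sum.mono_neutral_cong_left) (auto simp: bounded_op_simps[OF opmat_bounded])
        finally show ?thesis by simp
      qed
      then show ?thesis by (simp only: series_part_def sum_subtractf)
    qed
    have 2: "series_part B y x m N - series_part B y x N N = series_part B y (\<lambda>j. if j < N then 0 else x j) m N"
    proof -
      have "(\<Sum>j<m. \<Sum>k<N. cinner (B j k (y k)) (x j)) = (\<Sum>j\<in>{..<N} \<union> {N..<m}. \<Sum>k<N. cinner (B j k (y k)) (x j))"
        using that by (intro sum.cong) auto
      also have "\<dots> = (\<Sum>j<N. \<Sum>k<N. cinner (B j k (y k)) (x j)) + (\<Sum>j\<in>{N..<m}. \<Sum>k<N. cinner (B j k (y k)) (x j))"
        by (rule sum.union_disjoint) auto
      also have "(\<Sum>j\<in>{N..<m}. \<Sum>k<N. cinner (B j k (y k)) (x j))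
        = (\<Sum>j<m. \<Sum>k<N. cinner (B j k (y k)) (if j < N then 0 else x j))"
        by (rule sum.mono_neutral_cong_left) auto
      finally show ?thesis by (simp only: series_part_def add_diff_cancel_left')
    qed
    have "cmod (series_part B (\<lambda>k. if k < N then 0 else y k) x m n) \<le> b * (t N * l2norm x)"
      by (rule order_trans[OF series_part_bound])
         (intro mult_left_mono mult_mono t ln x opmat_nonneg, auto intro!: sum_nonneg)
    moreover have "cmod (series_part B y (\<lambda>j. if j < N then 0 else x j) m N) \<le> b * (l2norm y * t' N)"
      by (rule order_trans[OF series_part_bound])
         (intro mult_left_mono mult_mono t' ln y opmat_nonneg l2norm_nonneg, auto intro!: sum_nonneg)
    moreover have "series_part B y x m n - series_part B y x N N
      = series_part B (\<lambda>k. if k < N then 0 else y k) x m n + series_part B y (\<lambda>j. if j < N then 0 else x j) m N"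
      using 1 2 by (simp add: algebra_simps)
    ultimately show ?thesis by (simp only: norm_triangle_mono)
  qed
  have "(\<lambda>N. b * (t N * l2norm x) + b * (l2norm y * t' N)) \<longlonglongrightarrow> b * (0 * l2norm x) + b * (l2norm y * 0)"
    by (intro tendsto_intros t t')
  then show thesis using that[of "\<lambda>N. b * (t N * l2norm x) + b * (l2norm y * t' N)"] le by simp
qed

lemma series_lim:
  assumes y: "l2seq y" and x: "l2seq x"
  shows "double_sums (\<lambda>j k. cinner (B j k (y k)) (x j)) (series_lim B y x)"
    and "cmod (series_lim B y x) \<le> b * (l2norm y * l2norm x)"
    and "(\<lambda>N. series_part B y x N N) \<longlonglongrightarrow> series_lim B y x"
proof -
  obtain \<epsilon> where \<epsilon>: "\<epsilon> \<longlonglongrightarrow> 0"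
    "\<And>N m n. N \<le> m \<Longrightarrow> N \<le> n \<Longrightarrow> cmod (series_part B y x m n - series_part B y x N N) \<le> \<epsilon> N"
    by (rule series_part_tail[OF assms], rule that)
  have ev: "\<exists>N. \<epsilon> N < r" if "r > 0" for r
    using eventually_happens'[OF sequentially_bot order_tendstoD(2)[OF \<epsilon>(1) that]] .
  have "Cauchy (\<lambda>N. series_part B y x N N)"
  proof (rule CauchyI)
    fix r :: real assume "r > 0"
    then obtain N where N: "\<epsilon> N < r / 2" using ev[of "r/2"] by auto
    have "norm (series_part B y x m m - series_part B y x n n) < r" if "m \<ge> N" "n \<ge> N" for m n
      using \<epsilon>(2)[OF that(1) that(1)] \<epsilon>(2)[OF that(2) that(2)] N
        norm_triangle_ineq4[of "series_part B y x m m - series_part B y x N N" "series_part B y x n n - series_part B y x N N"]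
      by simp
    then show "\<exists>M. \<forall>m\<ge>M. \<forall>n\<ge>M. norm (series_part B y x m m - series_part B y x n n) < r" by blast
  qed
  then show lim: "(\<lambda>N. series_part B y x N N) \<longlonglongrightarrow> series_lim B y x"
    unfolding series_lim_def by (simp add: Cauchy_convergent convergent_LIMSEQ_iff[symmetric])
  show "cmod (series_lim B y x) \<le> b * (l2norm y * l2norm x)"
    by (rule LIMSEQ_le_const2[OF tendsto_norm[OF lim]]) (use series_part_bound_l2[OF y x] in blast)
  show "double_sums (\<lambda>j k. cinner (B j k (y k)) (x j)) (series_lim B y x)"
    unfolding double_sums_def tendsto_iff
  proof (intro allI impI)
    fix r :: real assume "r > 0"
    then obtain N where N: "\<epsilon> N < r / 2" using ev[of "r/2"] by auto
    have "cmod (series_lim B y x - series_part B y x N N) \<le> \<epsilon> N"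
    proof (rule LIMSEQ_le_const2)
      show "(\<lambda>M. cmod (series_part B y x M M - series_part B y x N N)) \<longlonglongrightarrow> cmod (series_lim B y x - series_part B y x N N)"
        by (intro tendsto_intros lim)
      show "\<exists>M0. \<forall>M\<ge>M0. cmod (series_part B y x M M - series_part B y x N N) \<le> \<epsilon> N"
        using \<epsilon>(2) by blast
    qed
    then have "dist (series_part B y x m n) (series_lim B y x) < r" if "m \<ge> N" "n \<ge> N" for m n
      using \<epsilon>(2)[OF that] N
        norm_triangle_ineq4[of "series_part B y x m n - series_part B y x N N" "series_lim B y x - series_part B y x N N"]
      by (simp add: dist_norm)
    then show "\<forall>\<^sub>F p in sequentially \<times>\<^sub>F sequentially.
        dist (case p of (m, n) \<Rightarrow> \<Sum>j<m. \<Sum>k<n. cinner (B j k (y k)) (x j)) (series_lim B y x) < r"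
      unfolding eventually_prod_sequentially by (intro exI[of _ N]) (simp add: series_part_def)
  qed
qed

lemma series_lim_perturb:
  assumes y: "l2seq y" and y': "l2seq y'" and x: "l2seq x" and x': "l2seq x'"
  shows "cmod (series_lim B y' x' - series_lim B y x)
    \<le> b * (l2norm (\<lambda>k. y k - y' k) * l2norm x) + b * (l2norm y' * l2norm (\<lambda>k. x k - x' k))"
proof -
  have eq1: "series_lim B (\<lambda>k. y k - y' k) x = series_lim B y x - series_lim B y' x"
    using LIMSEQ_unique[OF series_lim(3)[OF l2seq_diff[OF y y'] x]
        tendsto_diff[OF series_lim(3)[OF y x] series_lim(3)[OF y' x], folded series_part_diff_left]] .
  have eq2: "series_lim B y' (\<lambda>k. x k - x' k) = series_lim B y' x - series_lim B y' x'"
    using LIMSEQ_unique[OF series_lim(3)[OF y' l2seq_diff[OF x x']]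
        tendsto_diff[OF series_lim(3)[OF y' x] series_lim(3)[OF y' x'], folded series_part_diff_right]] .
  have "cmod (series_lim B y' x' - series_lim B y x)
    = cmod (series_lim B (\<lambda>k. y k - y' k) x + series_lim B y' (\<lambda>k. x k - x' k))"
    unfolding eq1 eq2 by (subst norm_minus_cancel[symmetric]) (simp add: algebra_simps)
  also have "\<dots> \<le> b * (l2norm (\<lambda>k. y k - y' k) * l2norm x) + b * (l2norm y' * l2norm (\<lambda>k. x k - x' k))"
    by (intro norm_triangle_mono series_lim(2) l2seq_diff y y' x x')
  finally show ?thesis .
qed

end


subsection \<open>Projections onto finite parts of a basis\<close>

lemma orthonormal_subset: "orthonormal C \<Longrightarrow> F \<subseteq> C \<Longrightarrow> orthonormal F"
  unfolding orthonormal_def by (meson subsetD)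

definition basis_proj :: "'h::chilbert_space set \<Rightarrow> 'h \<Rightarrow> 'h" where
  "basis_proj F y = (\<Sum>e\<in>F. cinner y e *\<^sub>C e)"

lemma basis_proj_norm:
  assumes "orthonormal F" "finite F"
  shows "norm (basis_proj F y) \<le> norm y" "norm (y - basis_proj F y) \<le> norm y"
proof -
  note os = orthonormal_osys[OF assms(1)]
  have n1: "\<And>e. e \<in> F \<Longrightarrow> norm e = 1" using orthonormal_norm[OF assms(1)] .
  have "(norm (basis_proj F y))\<^sup>2 \<le> (\<Sum>e\<in>F. (cmod (cinner y e))\<^sup>2)"
    unfolding basis_proj_def by (rule osys_norm_sum_le[OF os assms(2)])
  also have "\<dots> \<le> (norm y)\<^sup>2" by (rule bessel[OF os assms(2)])
  finally show "norm (basis_proj F y) \<le> norm y" by (rule power2_le_imp_le) simp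
  have "(norm (y - basis_proj F y))\<^sup>2 = (norm y)\<^sup>2 - (\<Sum>e\<in>F. (cmod (cinner y e))\<^sup>2 * (2 - (norm e)\<^sup>2))"
    unfolding basis_proj_def by (rule bessel_identity[OF os assms(2)])
  moreover have "0 \<le> (\<Sum>e\<in>F. (cmod (cinner y e))\<^sup>2 * (2 - (norm e)\<^sup>2))"
    by (intro sum_nonneg) (simp add: n1)
  ultimately have "(norm (y - basis_proj F y))\<^sup>2 \<le> (norm y)\<^sup>2" by linarith
  then show "norm (y - basis_proj F y) \<le> norm y" by (rule power2_le_imp_le) simp
qed

lemma l2seq_basis_proj:
  assumes "orthonormal F" "finite F" "l2seq y"
  shows "l2seq (\<lambda>k. basis_proj F (y k))" "l2norm (\<lambda>k. basis_proj F (y k)) \<le> l2norm y"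
proof -
  have le: "(norm (basis_proj F (y k)))\<^sup>2 \<le> (norm (y k))\<^sup>2" for k
    by (intro power_mono basis_proj_norm assms) simp
  show s: "l2seq (\<lambda>k. basis_proj F (y k))"
    by (rule summable_comparison_test'[OF assms(3), of 0]) (use le in simp)
  show "l2norm (\<lambda>k. basis_proj F (y k)) \<le> l2norm y"
    unfolding l2norm_def by (intro real_sqrt_le_mono suminf_le le s assms(3))
qed

text \<open>Tannery's theorem with majorant \<open>(norm (y k))\<^sup>2\<close>. The limit runs over
  finite subsets of the basis, so separability does not enter.\<close>

lemma l2norm_basis_proj_tendsto:
  assumes C: "orthonormal_basis C" and y: "l2seq y"
  shows "((\<lambda>F. l2norm (\<lambda>k. y k - basis_proj F (y k))) \<longlongrightarrow> 0) (finite_subsets_at_top C)"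
proof -
  let ?F = "finite_subsets_at_top C"
  note on = orthonormal_basis_orthonormal[OF C]
  have "((\<lambda>F. \<Sum>k. (norm (y k - basis_proj F (y k)))\<^sup>2) \<longlongrightarrow> (\<Sum>k. 0)) ?F"
  proof (rule tannerys_theorem[THEN conjunct2, THEN conjunct2])
    show "((\<lambda>F. (norm (y k - basis_proj F (y k)))\<^sup>2) \<longlongrightarrow> 0) ?F" for k
    proof -
      have "((\<lambda>F. basis_proj F (y k)) \<longlongrightarrow> y k) ?F"
        using basis_expansion[OF C, of "y k"] unfolding has_sum_def basis_proj_def .
      then have "((\<lambda>F. (norm (y k - basis_proj F (y k)))\<^sup>2) \<longlongrightarrow> (norm (y k - y k))\<^sup>2) ?F"
        by (intro tendsto_intros)
      then show ?thesis by simp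
    qed
    show "\<forall>\<^sub>F (k, F) in at_top \<times>\<^sub>F ?F. norm ((norm (y k - basis_proj F (y k)))\<^sup>2) \<le> (norm (y k))\<^sup>2"
    proof -
      have "\<forall>\<^sub>F F in ?F. \<forall>k. norm ((norm (y k - basis_proj F (y k)))\<^sup>2) \<le> (norm (y k))\<^sup>2"
      proof (rule eventually_finite_subsets_at_top_weakI, intro allI)
        fix F k assume F: "finite F" "F \<subseteq> C"
        then have "orthonormal F" using orthonormal_subset[OF on] by simp
        then show "norm ((norm (y k - basis_proj F (y k)))\<^sup>2) \<le> (norm (y k))\<^sup>2"
          using basis_proj_norm(2)[of F "y k"] F by (simp add: power_mono)
      qed
      from eventually_prodI[OF eventually_True[of at_top] this]
      show ?thesis by (rule eventually_mono) (simp add: case_prod_unfold)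
    qed
    show "summable (\<lambda>k. (norm (y k))\<^sup>2)" by (rule y)
  qed simp
  from tendsto_real_sqrt[OF this] show ?thesis by (simp add: l2norm_def)
qed

lemma series_lim_basis_proj_tendsto:
  assumes B: "opmat_bound B b" and C: "orthonormal_basis C" and y: "l2seq y" and x: "l2seq x"
  shows "((\<lambda>F. series_lim B (\<lambda>k. basis_proj F (y k)) (\<lambda>k. basis_proj F (x k))) \<longlongrightarrow> series_lim B y x)
    (finite_subsets_at_top C)"
proof (rule LIM_zero_cancel, rule tendsto_0_le[where K=1])
  let ?F = "finite_subsets_at_top C"
  let ?b = "\<lambda>F. b * (l2norm (\<lambda>k. y k - basis_proj F (y k)) * l2norm x) + b * (l2norm y * l2norm (\<lambda>k. x k - basis_proj F (x k)))"
  have "(?b \<longlongrightarrow> b * (0 * l2norm x) + b * (l2norm y * 0)) ?F"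
    by (intro tendsto_intros l2norm_basis_proj_tendsto C y x)
  then show "(?b \<longlongrightarrow> 0) ?F" by simp
  show "\<forall>\<^sub>F F in ?F. norm (series_lim B (\<lambda>k. basis_proj F (y k)) (\<lambda>k. basis_proj F (x k)) - series_lim B y x)
      \<le> norm (?b F) * 1"
  proof (rule eventually_finite_subsets_at_top_weakI)
    fix F assume F: "finite F" "F \<subseteq> C"
    then have oF: "orthonormal F"
      using orthonormal_subset[OF orthonormal_basis_orthonormal[OF C]] by simp
    note py = l2seq_basis_proj[OF oF F(1) y] and px = l2seq_basis_proj[OF oF F(1) x]
    have "norm (series_lim B (\<lambda>k. basis_proj F (y k)) (\<lambda>k. basis_proj F (x k)) - series_lim B y x)
      \<le> b * (l2norm (\<lambda>k. y k - basis_proj F (y k)) * l2norm x) +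
        b * (l2norm (\<lambda>k. basis_proj F (y k)) * l2norm (\<lambda>k. x k - basis_proj F (x k)))"
      by (rule series_lim_perturb[OF B y py(1) x px(1)])
    also have "\<dots> \<le> ?b F"
      by (intro add_left_mono mult_left_mono mult_right_mono py(2) opmat_nonneg[OF B]
          l2norm_nonneg[OF l2seq_diff[OF x px(1)]])
    finally show "norm (series_lim B (\<lambda>k. basis_proj F (y k)) (\<lambda>k. basis_proj F (x k)) - series_lim B y x)
      \<le> norm (?b F) * 1" by simp
  qed
qed


subsection \<open>Existence\<close>

lemma adj_adj:
  assumes "bounded_op A"
  shows "adj (adj A) = A"
proof
  show "adj (adj A) u = A u" for u
    by (rule cinner_ext_left)
       (simp add: adj_props(2)[OF adj_props(1)[OF assms]] cinner_adj_right[OF assms])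
qed

lemma column_bound_adj: "column_bound A a \<Longrightarrow> column_bound (\<lambda>j. adj (A j)) a"
  by (simp add: column_bound_def adj_adj adj_props(1))

lemma l2norm_column: "l2norm (\<lambda>k. Y (C k u)) = column_norm Y C u"
  by (simp add: l2norm_def column_norm_def)

text \<open>Moving \<open>A\<close> and \<open>X\<close> to the other side turns the triple product
  into the operator matrix paired with two sequences of vectors, square summable by the column
  bounds.\<close>

lemma haagerup_term:
  assumes "bounded_op X" "bounded_op A"
  shows "cinner (A (X z)) v = cinner z (adj X (adj A v))"
  by (simp add: cinner_adj_right[OF assms(1)] cinner_adj_right[OF assms(2)])

lemma haagerup_operator:
  fixes A C :: "nat \<Rightarrow> 'h::chilbert_space \<Rightarrow> 'h"
  assumes A: "column_bound A a" and B: "opmat_bound B b" and C: "column_bound C c"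
    and X: "bounded_op X" and Y: "bounded_op Y"
  shows "\<exists>J. bounded_op J \<and>
    (\<forall>u v. cinner (J u) v = series_lim B (\<lambda>k. Y (C k u)) (\<lambda>j. adj X (adj (A j) v)))"
proof -
  note bA = A[unfolded column_bound_def, THEN conjunct1, rule_format]
  note bC = C[unfolded column_bound_def, THEN conjunct1, rule_format]
  note lC = column_summable[OF C Y] and lA = column_summable[OF column_bound_adj[OF A] adj_props(1)[OF X]]
  define S where "S N u = (\<Sum>j<N. \<Sum>k<N. A j (X (B j k (Y (C k u)))))" for N :: nat and u
  have bS: "bounded_op (S N)" for N
    unfolding S_def
    by (intro bounded_op_sum) (rule bounded_op_comp[OF bA bounded_op_comp[OF X
        bounded_op_comp[OF opmat_bounded[OF B] bounded_op_comp[OF Y bC]]]])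
  have S_eq: "cinner (S N u) v = series_part B (\<lambda>k. Y (C k u)) (\<lambda>j. adj X (adj (A j) v)) N N" for N u v
    by (simp add: S_def series_part_def cinner_sum_left haagerup_term[OF X bA])
  have lim: "(\<lambda>N. cinner (S N u) v) \<longlonglongrightarrow> series_lim B (\<lambda>k. Y (C k u)) (\<lambda>j. adj X (adj (A j) v))" for u v
    unfolding S_eq by (rule series_lim(3)[OF B lC(1) lA(1)])
  let ?K = "b * (onorm Y * c * (onorm (adj X) * a))"
  have nonneg: "0 \<le> b" "0 \<le> c" "0 \<le> a" "0 \<le> onorm Y" "0 \<le> onorm (adj X)"
    using opmat_nonneg[OF B] A C X Y by (auto simp: column_bound_def intro!: bounded_op_onorm_nonneg adj_props(1))
  have bd: "cmod (series_lim B (\<lambda>k. Y (C k u)) (\<lambda>j. adj X (adj (A j) v))) \<le> ?K * norm u * norm v" for u v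
  proof -
    have "cmod (series_lim B (\<lambda>k. Y (C k u)) (\<lambda>j. adj X (adj (A j) v)))
      \<le> b * (column_norm Y C u * column_norm (adj X) (\<lambda>j. adj (A j)) v)"
      using series_lim(2)[OF B lC(1)[of u] lA(1)[of v]]
      unfolding l2norm_column[of Y C u] l2norm_column[of "adj X" "\<lambda>j. adj (A j)" v] .
    also have "\<dots> \<le> b * ((onorm Y * (c * norm u)) * (onorm (adj X) * (a * norm v)))"
      using nonneg by (intro mult_left_mono mult_mono lC(2) lA(2) lA(3)) auto
    finally show ?thesis by (simp add: mult_ac)
  qed
  have "0 \<le> ?K" using nonneg by simp
  obtain J where "bounded_op J"
    "\<And>u v. cinner (J u) v = series_lim B (\<lambda>k. Y (C k u)) (\<lambda>j. adj X (adj (A j) v))"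
    "\<And>u. norm (J u) \<le> ?K * norm u"
    by (rule wot_limit_op[OF bS lim sequentially_bot bd \<open>0 \<le> ?K\<close>], rule that)
  then show ?thesis by blast
qed


subsection \<open>Independence of the representation\<close>

lemma spec_integral_pair_bound:
  assumes sm: "spectral_measure M E" and f: "f \<in> borel_measurable M"
    and C: "AE_spec M E (\<lambda>x. cmod (f x) \<le> C)" and "0 \<le> C"
  shows "cmod (cinner (spec_integral M E f u) v) \<le> C * (norm u * norm v)"
proof -
  have "AE_spec M E (\<lambda>x. bil_bound 1 1 C (\<lambda>j k. f x))"
  proof (rule AE_spec_mono[OF sm C])
    fix x assume "cmod (f x) \<le> C"
    then show "bil_bound 1 1 C (\<lambda>j k. f x)"
      by (auto simp: bil_bound_def norm_mult intro!: mult_right_mono)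
  qed
  from spec_integral_matrix(2)[of M E 1 1 "\<lambda>_ _. f" C "\<lambda>_. u" "\<lambda>_. v", OF sm f \<open>0 \<le> C\<close> this]
  show ?thesis by simp
qed

text \<open>One step of an iterated bounded convergence. The coefficients \<open>\<kappa>\<close>
  hold everything that does not depend on the current variable, and the second conclusion provides
  the dominating constant for the next variable.\<close>

lemma spec_sum_tendsto_0:
  assumes sm: "spectral_measure M E"
    and f: "\<And>i. f i \<in> borel_measurable M" "\<And>i. AE_spec M E (\<lambda>x. cmod (f i x) \<le> c i)"
    and "0 \<le> K" and fin: "\<And>N. finite (I N)"
    and bd: "AE_spec M E (\<lambda>x. \<forall>N. cmod (\<Sum>i\<in>I N. \<kappa> i * f i x) \<le> K)"
    and lim: "AE_spec M E (\<lambda>x. (\<lambda>N::nat. \<Sum>i\<in>I N. \<kappa> i * f i x) \<longlonglongrightarrow> 0)"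
  shows "(\<lambda>N. \<Sum>i\<in>I N. \<kappa> i * cinner (spec_integral M E (f i) u) v) \<longlonglongrightarrow> 0"
    and "cmod (\<Sum>i\<in>I N. \<kappa> i * cinner (spec_integral M E (f i) u) v) \<le> K * (norm u * norm v)"
proof -
  have eq: "cinner (spec_integral M E (\<lambda>x. \<Sum>i\<in>I N. \<kappa> i * f i x) u) v
    = (\<Sum>i\<in>I N. \<kappa> i * cinner (spec_integral M E (f i) u) v)" for N
    unfolding spec_integral_sum[OF sm f] by (simp add: cinner_sum_left cinner_scaleC_left)
  have m: "(\<lambda>x. \<Sum>i\<in>I N. \<kappa> i * f i x) \<in> borel_measurable M" for N
    by (intro borel_measurable_sum borel_measurable_times f(1) borel_measurable_const)
  have bdN: "AE_spec M E (\<lambda>x. cmod (\<Sum>i\<in>I N. \<kappa> i * f i x) \<le> K)" for N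
    by (rule AE_spec_mono[OF sm bd]) blast
  show "(\<lambda>N. \<Sum>i\<in>I N. \<kappa> i * cinner (spec_integral M E (f i) u) v) \<longlonglongrightarrow> 0"
    using spec_integral_tendsto_0[OF sm m bdN lim, of u v] unfolding eq .
  show "cmod (\<Sum>i\<in>I N. \<kappa> i * cinner (spec_integral M E (f i) u) v) \<le> K * (norm u * norm v)"
    using spec_integral_pair_bound[OF sm m bdN \<open>0 \<le> K\<close>, of _ u v] unfolding eq .
qed

lemma AE_spec_all_bool:
  assumes "spectral_measure M E" "\<And>s::bool. AE_spec M E (P s)"
  shows "AE_spec M E (\<lambda>x. \<forall>s. P s x)"
  by (rule AE_spec_mono[OF assms(1) AE_spec_conj[OF assms(1) assms(2)[of True] assms(2)[of False]]])
     (metis (full_types))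

lemma cmod_double_sum_bound:
  assumes "bil_bound N N cb b" "(\<Sum>j<N. (cmod (a j))\<^sup>2) \<le> ca\<^sup>2" "(\<Sum>k<N. (cmod (c k))\<^sup>2) \<le> cc\<^sup>2"
    and "0 \<le> ca" "0 \<le> cb" "0 \<le> cc"
  shows "cmod (\<Sum>j<N. \<Sum>k<N. a j * b j k * c k) \<le> cb * (cc * ca)"
proof -
  have "cmod (\<Sum>j<N. \<Sum>k<N. a j * b j k * c k) = cmod (\<Sum>j<N. \<Sum>k<N. b j k * (c k * a j))"
    by (simp only: mult_ac)
  also have "\<dots> \<le> cb * (sqrt (\<Sum>k<N. (cmod (c k))\<^sup>2) * sqrt (\<Sum>j<N. (cmod (a j))\<^sup>2))"
    using assms(1) by (simp add: bil_bound_def)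
  also have "\<dots> \<le> cb * (cc * ca)"
    using assms(2-) by (intro mult_left_mono mult_mono real_le_lsqrt) (auto intro!: sum_nonneg)
  finally show ?thesis .
qed

context
  fixes M1 :: "'a measure" and F1 :: "'a set \<Rightarrow> 'h::chilbert_space \<Rightarrow> 'h"
    and M2 :: "'b measure" and F2 :: "'b set \<Rightarrow> 'h \<Rightarrow> 'h"
    and M3 :: "'c measure" and F3 :: "'c set \<Rightarrow> 'h \<Rightarrow> 'h"
  assumes sm1: "spectral_measure M1 F1" and sm2: "spectral_measure M2 F2" and sm3: "spectral_measure M3 F3"
begin

text \<open>Two representations, indexed by a boolean, are compared through their difference, which is a
  representation of \<open>0\<close>. For rank one operators \<open>X\<close> and \<open>Y\<close> bounded convergence applies in one
  variable at a time.\<close>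

lemma rank1_difference_tendsto_0:
  fixes a :: "bool \<Rightarrow> nat \<Rightarrow> 'a \<Rightarrow> complex" and b :: "bool \<Rightarrow> nat \<Rightarrow> nat \<Rightarrow> 'b \<Rightarrow> complex"
    and c :: "bool \<Rightarrow> nat \<Rightarrow> 'c \<Rightarrow> complex"
  assumes rep: "\<And>s. haagerup_rep M1 F1 M2 F2 M3 F3 \<Phi> (a s) (b s) (c s)"
  shows "(\<lambda>N. \<Sum>(s, j, k)\<in>UNIV \<times> ({..<N} \<times> {..<N}). (if s then 1 else -1) *
      cinner (spec_integral M3 F3 (c s k) u) p * cinner (spec_integral M2 F2 (b s j k) e) e' *
      cinner (spec_integral M1 F1 (a s j) w) v) \<longlonglongrightarrow> 0"
proof -
  let ?\<sigma> = "\<lambda>s. if s then 1 else -1 :: complex"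
  let ?I = "\<lambda>N::nat. (UNIV :: bool set) \<times> ({..<N} \<times> {..<N})"
  let ?C = "\<lambda>s k. cinner (spec_integral M3 F3 (c s k) u) p"
  let ?B = "\<lambda>s j k. cinner (spec_integral M2 F2 (b s j k) e) e'"
  have L: "a s \<in> Linf_ell2 M1 F1" "b s \<in> Linf_mat M2 F2" "c s \<in> Linf_ell2 M3 F3" for s
    using rep[of s] by (simp_all add: haagerup_rep_def)
  have meas: "a s j \<in> borel_measurable M1" "b s j k \<in> borel_measurable M2" "c s k \<in> borel_measurable M3" for s j k
    using L[of s] by (simp_all add: Linf_ell2_def Linf_mat_def)
  define ca where "ca s = Linf_ell2_norm M1 F1 (a s) + 1" for s
  define cb where "cb s = Linf_mat_norm M2 F2 (b s) + 1" for s
  define cc where "cc s = Linf_ell2_norm M3 F3 (c s) + 1" for s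
  have AE1: "AE_spec M1 F1 (\<lambda>x. \<forall>J. (\<Sum>j<J. (cmod (a s j x))\<^sup>2) \<le> (ca s)\<^sup>2)" "0 < ca s" for s
    using Linf_ell2_AE[OF sm1 L(1)[of s], of "ca s"] by (auto simp: ca_def)
  have AE2: "AE_spec M2 F2 (\<lambda>x. mat_bound (\<lambda>j k. b s j k x) (cb s))" "0 < cb s" for s
    using Linf_mat_AE[OF sm2 L(2)[of s], of "cb s"] by (auto simp: cb_def)
  have AE3: "AE_spec M3 F3 (\<lambda>x. \<forall>J. (\<Sum>j<J. (cmod (c s j x))\<^sup>2) \<le> (cc s)\<^sup>2)" "0 < cc s" for s
    using Linf_ell2_AE[OF sm3 L(3)[of s], of "cc s"] by (auto simp: cc_def)
  have ent1: "AE_spec M1 F1 (\<lambda>x. cmod (a s j x) \<le> ca s)" for s j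
    using spec_integral_square_sum(3)[of M1 F1 "a s", OF sm1 meas(1) _ AE1(1)] AE1(2) less_imp_le by blast
  have ent2: "AE_spec M2 F2 (\<lambda>x. cmod (b s j k x) \<le> cb s)" for s j k
  proof (rule AE_spec_mono[OF sm2 AE2(1)])
    fix x assume "mat_bound (\<lambda>j k. b s j k x) (cb s)"
    from bil_bound_entry[OF mat_bound_imp_bil_bound[OF this, of "Suc j" "Suc k"], of j k]
    show "cmod (b s j k x) \<le> cb s" by simp
  qed
  have ent3: "AE_spec M3 F3 (\<lambda>x. cmod (c s k x) \<le> cc s)" for s k
    using spec_integral_square_sum(3)[of M3 F3 "c s", OF sm3 meas(3) _ AE3(1)] AE3(2) less_imp_le by blast
  have "\<forall>s. \<exists>N. fst N \<in> null_sets_spec M1 F1 \<and> fst (snd N) \<in> null_sets_spec M2 F2 \<and> snd (snd N) \<in> null_sets_spec M3 F3 \<and>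
    (\<forall>y1\<in>space M1 - fst N. \<forall>y2\<in>space M2 - fst (snd N). \<forall>y3\<in>space M3 - snd (snd N).
          double_sums (\<lambda>j k. a s j y1 * b s j k y2 * c s k y3) (\<Phi> y1 y2 y3))"
    using rep unfolding haagerup_rep_def by fastforce
  from choice[OF this] obtain Z where
    Z: "\<And>s. fst (Z s) \<in> null_sets_spec M1 F1" "\<And>s. fst (snd (Z s)) \<in> null_sets_spec M2 F2"
      "\<And>s. snd (snd (Z s)) \<in> null_sets_spec M3 F3"
    and Zd: "\<And>s y1 y2 y3. y1 \<in> space M1 - fst (Z s) \<Longrightarrow> y2 \<in> space M2 - fst (snd (Z s)) \<Longrightarrow>
      y3 \<in> space M3 - snd (snd (Z s)) \<Longrightarrow> double_sums (\<lambda>j k. a s j y1 * b s j k y2 * c s k y3) (\<Phi> y1 y2 y3)"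
    by blast
  define G1 where "G1 y \<longleftrightarrow> (\<forall>s. y \<notin> fst (Z s) \<and> (\<forall>J. (\<Sum>j<J. (cmod (a s j y))\<^sup>2) \<le> (ca s)\<^sup>2))" for y
  define G2 where "G2 y \<longleftrightarrow> (\<forall>s. y \<notin> fst (snd (Z s)) \<and> mat_bound (\<lambda>j k. b s j k y) (cb s))" for y
  define G3 where "G3 y \<longleftrightarrow> (\<forall>s. y \<notin> snd (snd (Z s)) \<and> (\<forall>J. (\<Sum>j<J. (cmod (c s j y))\<^sup>2) \<le> (cc s)\<^sup>2))" for y
  have notin: "AE_spec M' E' (\<lambda>y. y \<notin> N)" if "N \<in> null_sets_spec M' E'" for M' E' N
    unfolding AE_spec_def using that by blast
  have G1: "AE_spec M1 F1 G1" unfolding G1_def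
    by (intro AE_spec_all_bool[OF sm1] AE_spec_conj[OF sm1] notin Z AE1)
  have G2: "AE_spec M2 F2 G2" unfolding G2_def
    by (intro AE_spec_all_bool[OF sm2] AE_spec_conj[OF sm2] notin Z AE2)
  have G3: "AE_spec M3 F3 G3" unfolding G3_def
    by (intro AE_spec_all_bool[OF sm3] AE_spec_conj[OF sm3] notin Z AE3)
  define K where "K = (\<Sum>s\<in>UNIV. cb s * (cc s * ca s))"
  have "0 \<le> K" unfolding K_def using AE1(2) AE2(2) AE3(2) by (intro sum_nonneg mult_nonneg_nonneg less_imp_le) auto
  have D_eq: "(\<Sum>(s, j, k)\<in>?I N. ?\<sigma> s * a s j y1 * b s j k y2 * c s k y3)
      = (\<Sum>s\<in>UNIV. ?\<sigma> s * (\<Sum>j<N. \<Sum>k<N. a s j y1 * b s j k y2 * c s k y3))" for N y1 y2 y3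
    by (simp add: sum.cartesian_product[symmetric] sum_distrib_left mult.assoc)
  have D_bd: "cmod (\<Sum>(s, j, k)\<in>?I N. ?\<sigma> s * a s j y1 * b s j k y2 * c s k y3) \<le> K"
    if "G1 y1" "G2 y2" "G3 y3" for N y1 y2 y3
    unfolding D_eq K_def
  proof (rule sum_norm_le)
    fix s :: bool
    have "cmod (?\<sigma> s * (\<Sum>j<N. \<Sum>k<N. a s j y1 * b s j k y2 * c s k y3))
      = cmod (\<Sum>j<N. \<Sum>k<N. a s j y1 * b s j k y2 * c s k y3)" by (simp add: norm_mult)
    also have "\<dots> \<le> cb s * (cc s * ca s)"
    proof (rule cmod_double_sum_bound)
      show "bil_bound N N (cb s) (\<lambda>j k. b s j k y2)"
        using that(2) unfolding G2_def by (intro mat_bound_imp_bil_bound) simp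
    qed (use that AE1(2)[of s] AE2(2)[of s] AE3(2)[of s] in \<open>auto simp: G1_def G3_def\<close>)
    finally show "cmod (?\<sigma> s * (\<Sum>j<N. \<Sum>k<N. a s j y1 * b s j k y2 * c s k y3)) \<le> cb s * (cc s * ca s)" .
  qed
  have D_lim: "(\<lambda>N. \<Sum>(s, j, k)\<in>?I N. ?\<sigma> s * a s j y1 * b s j k y2 * c s k y3) \<longlonglongrightarrow> 0"
    if "y1 \<in> space M1" "y2 \<in> space M2" "y3 \<in> space M3" "G1 y1" "G2 y2" "G3 y3" for y1 y2 y3
  proof -
    have "(\<lambda>N. \<Sum>j<N. \<Sum>k<N. a s j y1 * b s j k y2 * c s k y3) \<longlonglongrightarrow> \<Phi> y1 y2 y3" for s
      by (intro double_sums_diag Zd) (use that in \<open>auto simp: G1_def G2_def G3_def\<close>)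
    then have "(\<lambda>N. \<Sum>s\<in>UNIV. ?\<sigma> s * (\<Sum>j<N. \<Sum>k<N. a s j y1 * b s j k y2 * c s k y3))
      \<longlonglongrightarrow> (\<Sum>s\<in>UNIV. ?\<sigma> s * \<Phi> y1 y2 y3)" by (intro tendsto_intros)
    then show ?thesis unfolding D_eq by (simp add: UNIV_bool)
  qed
  \<comment> \<open>The variables are integrated in the order third, second, first; the dominating
    constant grows each time by the norms of the two vectors between which the integral is
    taken.\<close>
  have step3: "(\<lambda>N. \<Sum>(s, j, k)\<in>?I N. ?\<sigma> s * a s j y1 * b s j k y2 * ?C s k) \<longlonglongrightarrow> 0 \<and>
    (\<forall>N. cmod (\<Sum>(s, j, k)\<in>?I N. ?\<sigma> s * a s j y1 * b s j k y2 * ?C s k) \<le> K * (norm u * norm p))"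
    if y: "y1 \<in> space M1" "y2 \<in> space M2" "G1 y1" "G2 y2" for y1 y2
  proof -
    note T = spec_sum_tendsto_0[of M3 F3 "\<lambda>(s, j, k). c s k" "\<lambda>(s, j, k). cc s" K ?I
        "\<lambda>(s, j, k). ?\<sigma> s * a s j y1 * b s j k y2" u p, OF sm3]
    have A: "AE_spec M3 F3 (\<lambda>x. \<forall>N. cmod (\<Sum>i\<in>?I N. (case i of (s, j, k) \<Rightarrow> ?\<sigma> s * a s j y1 * b s j k y2) * (case i of (s, j, k) \<Rightarrow> c s k) x) \<le> K)"
      by (rule AE_spec_mono[OF sm3 G3]) (use D_bd y in \<open>simp add: case_prod_unfold\<close>)
    have A': "AE_spec M3 F3 (\<lambda>x. (\<lambda>N. \<Sum>i\<in>?I N. (case i of (s, j, k) \<Rightarrow> ?\<sigma> s * a s j y1 * b s j k y2) * (case i of (s, j, k) \<Rightarrow> c s k) x) \<longlonglongrightarrow> 0)"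
      by (rule AE_spec_mono[OF sm3 G3]) (use D_lim y in \<open>simp add: case_prod_unfold\<close>)
    show ?thesis
      using T(1)[OF _ _ \<open>0 \<le> K\<close> _ A A'] T(2)[OF _ _ \<open>0 \<le> K\<close> _ A A'] meas(3) ent3
      by (simp add: case_prod_unfold)
  qed
  have step2: "(\<lambda>N. \<Sum>(s, j, k)\<in>?I N. ?\<sigma> s * a s j y1 * ?C s k * ?B s j k) \<longlonglongrightarrow> 0 \<and>
    (\<forall>N. cmod (\<Sum>(s, j, k)\<in>?I N. ?\<sigma> s * a s j y1 * ?C s k * ?B s j k) \<le> K * (norm u * norm p) * (norm e * norm e'))"
    if y: "y1 \<in> space M1" "G1 y1" for y1
  proof -
    let ?K = "K * (norm u * norm p)"
    have "0 \<le> ?K" using \<open>0 \<le> K\<close> by simp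
    note T = spec_sum_tendsto_0[of M2 F2 "\<lambda>(s, j, k). b s j k" "\<lambda>(s, j, k). cb s" ?K ?I
        "\<lambda>(s, j, k). ?\<sigma> s * a s j y1 * ?C s k" e e', OF sm2]
    have A: "AE_spec M2 F2 (\<lambda>x. \<forall>N. cmod (\<Sum>i\<in>?I N. (case i of (s, j, k) \<Rightarrow> ?\<sigma> s * a s j y1 * ?C s k) * (case i of (s, j, k) \<Rightarrow> b s j k) x) \<le> ?K)"
      by (rule AE_spec_mono[OF sm2 G2]) (use step3[OF y(1) _ y(2)] in \<open>simp add: case_prod_unfold mult_ac\<close>)
    have A': "AE_spec M2 F2 (\<lambda>x. (\<lambda>N. \<Sum>i\<in>?I N. (case i of (s, j, k) \<Rightarrow> ?\<sigma> s * a s j y1 * ?C s k) * (case i of (s, j, k) \<Rightarrow> b s j k) x) \<longlonglongrightarrow> 0)"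
      by (rule AE_spec_mono[OF sm2 G2]) (use step3[OF y(1) _ y(2)] in \<open>simp add: case_prod_unfold mult_ac\<close>)
    show ?thesis
      using T(1)[OF _ _ \<open>0 \<le> ?K\<close> _ A A'] T(2)[OF _ _ \<open>0 \<le> ?K\<close> _ A A'] meas(2) ent2
      by (simp add: case_prod_unfold)
  qed
  let ?K = "K * (norm u * norm p) * (norm e * norm e')"
  have "0 \<le> ?K" using \<open>0 \<le> K\<close> by simp
  note T = spec_sum_tendsto_0[of M1 F1 "\<lambda>(s, j, k). a s j" "\<lambda>(s, j, k). ca s" ?K ?I
      "\<lambda>(s, j, k). ?\<sigma> s * ?C s k * ?B s j k" w v, OF sm1]
  have A: "AE_spec M1 F1 (\<lambda>x. \<forall>N. cmod (\<Sum>i\<in>?I N. (case i of (s, j, k) \<Rightarrow> ?\<sigma> s * ?C s k * ?B s j k) * (case i of (s, j, k) \<Rightarrow> a s j) x) \<le> ?K)"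
    by (rule AE_spec_mono[OF sm1 G1]) (use step2 in \<open>simp add: case_prod_unfold mult_ac\<close>)
  have A': "AE_spec M1 F1 (\<lambda>x. (\<lambda>N. \<Sum>i\<in>?I N. (case i of (s, j, k) \<Rightarrow> ?\<sigma> s * ?C s k * ?B s j k) * (case i of (s, j, k) \<Rightarrow> a s j) x) \<longlonglongrightarrow> 0)"
    by (rule AE_spec_mono[OF sm1 G1]) (use step2 in \<open>simp add: case_prod_unfold mult_ac\<close>)
  show ?thesis
    using T(1)[OF _ _ \<open>0 \<le> ?K\<close> _ A A'] meas(1) ent1 by (simp add: case_prod_unfold)
qed

text \<open>Projecting both vector sequences onto a finite part \<open>F\<close> of a basis reduces
  the comparison to finitely many rank one problems, for which the two limits agree. Each limit
  depends continuously on the two sequences, so \<open>F\<close> can grow to the whole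
  basis.\<close>

lemma series_lim_representation_independent:
  fixes a :: "bool \<Rightarrow> nat \<Rightarrow> 'a \<Rightarrow> complex" and b :: "bool \<Rightarrow> nat \<Rightarrow> nat \<Rightarrow> 'b \<Rightarrow> complex"
    and c :: "bool \<Rightarrow> nat \<Rightarrow> 'c \<Rightarrow> complex"
  assumes rep: "\<And>s. haagerup_rep M1 F1 M2 F2 M3 F3 \<Phi> (a s) (b s) (c s)"
    and X: "bounded_op X" and Y: "bounded_op Y"
  defines "A \<equiv> \<lambda>s j. spec_integral M1 F1 (a s j)" and "B \<equiv> \<lambda>s j k. spec_integral M2 F2 (b s j k)"
    and "C \<equiv> \<lambda>s k. spec_integral M3 F3 (c s k)"
  shows "series_lim (B True) (\<lambda>k. Y (C True k u)) (\<lambda>j. adj X (adj (A True j) v))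
    = series_lim (B False) (\<lambda>k. Y (C False k u)) (\<lambda>j. adj X (adj (A False j) v))"
proof -
  have L: "a s \<in> Linf_ell2 M1 F1" "b s \<in> Linf_mat M2 F2" "c s \<in> Linf_ell2 M3 F3" for s
    using rep[of s] by (simp_all add: haagerup_rep_def)
  have cA: "column_bound (A s) (Linf_ell2_norm M1 F1 (a s) + 1)" for s
    unfolding A_def by (rule Linf_ell2_column_bound[OF sm1 L(1)]) simp
  have cB: "opmat_bound (B s) (Linf_mat_norm M2 F2 (b s) + 1)" for s
    unfolding B_def by (rule Linf_mat_opmat_bound[OF sm2 L(2)]) simp
  have cC: "column_bound (C s) (Linf_ell2_norm M3 F3 (c s) + 1)" for s
    unfolding C_def by (rule Linf_ell2_column_bound[OF sm3 L(3)]) simp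
  have bA: "bounded_op (A s j)" and bC: "bounded_op (C s k)" for s j k
    using cA cC by (simp_all add: column_bound_def)
  note bB = opmat_bounded[OF cB]
  define y where "y s k = Y (C s k u)" for s k
  define x where "x s j = adj X (adj (A s j) v)" for s j
  have y: "l2seq (y s)" for s unfolding y_def by (rule column_summable(1)[OF cC Y])
  have x: "l2seq (x s)" for s
    unfolding x_def by (rule column_summable(1)[OF column_bound_adj[OF cA] adj_props(1)[OF X]])
  obtain Q :: "'h set" where Q: "orthonormal_basis Q"
    using orthonormal_basis_extension[OF orthonormal_empty] by blast
  let ?y = "\<lambda>F s k. basis_proj F (y s k)" and ?x = "\<lambda>F s j. basis_proj F (x s j)"
  let ?\<sigma> = "\<lambda>s. if s then 1 else -1 :: complex"
  have eq: "series_lim (B True) (?y F True) (?x F True) = series_lim (B False) (?y F False) (?x F False)"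
    if F: "finite F" "F \<subseteq> Q" for F
  proof -
    have oF: "orthonormal F" by (rule orthonormal_subset[OF orthonormal_basis_orthonormal[OF Q] F(2)])
    \<comment> \<open>Each pair \<open>e\<close>, \<open>e'\<close> in \<open>F\<close> yields one
      sum of the kind treated in \<open>rank1_difference_tendsto_0\<close>, with
      \<open>adj Y e\<close> and \<open>X e'\<close> as the outer vectors.\<close>
    have sp: "series_part (B s) (?y F s) (?x F s) N N = (\<Sum>e\<in>F. \<Sum>e'\<in>F. \<Sum>j<N. \<Sum>k<N.
        cinner (C s k u) (adj Y e) * cinner (B s j k e) e' * cinner (A s j (X e')) v)" for s N
    proof -
      have "cinner (B s j k (?y F s k)) (?x F s j) = (\<Sum>e\<in>F. \<Sum>e'\<in>F.
        cinner (C s k u) (adj Y e) * cinner (B s j k e) e' * cinner (A s j (X e')) v)" for j k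
      proof -
        have 1: "cinner (C s k u) (adj Y e) = cinner (y s k) e" for e
          by (simp add: y_def cinner_adj_right[OF Y])
        have 2: "cinner (A s j (X e')) v = cnj (cinner (x s j) e')" for e'
          unfolding x_def haagerup_term[OF X bA] by (rule cinner_commute)
        show ?thesis unfolding 1 2
          by (subst sum.swap) (simp add: basis_proj_def bounded_op_simps[OF bB] cinner_sum_left
              cinner_sum_right cinner_scaleC_left cinner_scaleC_right sum_distrib_left mult_ac)
      qed
      then show ?thesis unfolding series_part_def
        by (simp only: sum.swap[of _ F "{..<N}"])
    qed
    have "(\<lambda>N. \<Sum>e\<in>F. \<Sum>e'\<in>F. \<Sum>(s, j, k)\<in>UNIV \<times> ({..<N} \<times> {..<N}). ?\<sigma> s *
      cinner (C s k u) (adj Y e) * cinner (B s j k e) e' * cinner (A s j (X e')) v) \<longlonglongrightarrow> (\<Sum>e\<in>F. \<Sum>e'\<in>F. 0)"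
      unfolding A_def B_def C_def by (intro tendsto_sum rank1_difference_tendsto_0[OF rep])
    moreover have "(\<Sum>e\<in>F. \<Sum>e'\<in>F. \<Sum>(s, j, k)\<in>UNIV \<times> ({..<N} \<times> {..<N}). ?\<sigma> s *
      cinner (C s k u) (adj Y e) * cinner (B s j k e) e' * cinner (A s j (X e')) v)
      = (\<Sum>s\<in>UNIV. ?\<sigma> s * series_part (B s) (?y F s) (?x F s) N N)" for N
      unfolding sp
      by (simp add: sum.cartesian_product[symmetric] UNIV_bool sum_negf sum_subtractf mult.assoc)
    ultimately have 0: "(\<lambda>N. \<Sum>s\<in>UNIV. ?\<sigma> s * series_part (B s) (?y F s) (?x F s) N N) \<longlonglongrightarrow> 0" by simp
    have "(\<lambda>N. \<Sum>s\<in>UNIV. ?\<sigma> s * series_part (B s) (?y F s) (?x F s) N N)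
      \<longlonglongrightarrow> (\<Sum>s\<in>UNIV. ?\<sigma> s * series_lim (B s) (?y F s) (?x F s))"
      by (intro tendsto_sum tendsto_mult tendsto_const series_lim(3)[OF cB] l2seq_basis_proj(1)[OF oF F(1)] x y)
    from LIMSEQ_unique[OF this 0] show ?thesis by (simp add: UNIV_bool)
  qed
  have "((\<lambda>F. series_lim (B s) (?y F s) (?x F s)) \<longlongrightarrow> series_lim (B s) (y s) (x s)) (finite_subsets_at_top Q)" for s
    by (rule series_lim_basis_proj_tendsto[OF cB Q y x])
  note lims = this
  have "((\<lambda>F. series_lim (B True) (?y F True) (?x F True)) \<longlongrightarrow> series_lim (B False) (y False) (x False)) (finite_subsets_at_top Q)"
  proof (rule Lim_transform_eventually[OF lims[of False]])
    show "\<forall>\<^sub>F F in finite_subsets_at_top Q. series_lim (B False) (?y F False) (?x F False) = series_lim (B True) (?y F True) (?x F True)"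
      by (rule eventually_finite_subsets_at_top_weakI) (simp add: eq)
  qed
  from tendsto_unique[OF finite_subsets_at_top_neq_bot lims[of True] this]
  show ?thesis unfolding y_def x_def .
qed

lemma has_haagerup_integral_series:
  assumes rep: "haagerup_rep M1 F1 M2 F2 M3 F3 \<Phi> a b c" and X: "bounded_op X" and Y: "bounded_op Y"
  defines "A \<equiv> \<lambda>j. spec_integral M1 F1 (a j)" and "B \<equiv> \<lambda>j k. spec_integral M2 F2 (b j k)"
    and "C \<equiv> \<lambda>k. spec_integral M3 F3 (c k)"
  shows "\<exists>J. has_haagerup_integral M1 F1 M2 F2 M3 F3 \<Phi> X Y J \<and>
    (\<forall>u v. cinner (J u) v = series_lim B (\<lambda>k. Y (C k u)) (\<lambda>j. adj X (adj (A j) v)))"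
proof -
  have bounds: "column_bound (\<lambda>j. spec_integral M1 F1 (a j)) (Linf_ell2_norm M1 F1 a + 1)"
    "opmat_bound (\<lambda>j k. spec_integral M2 F2 (b j k)) (Linf_mat_norm M2 F2 b + 1)"
    "column_bound (\<lambda>k. spec_integral M3 F3 (c k)) (Linf_ell2_norm M3 F3 c + 1)"
    if "haagerup_rep M1 F1 M2 F2 M3 F3 \<Phi> a b c" for a b c
    using that unfolding haagerup_rep_def
    by (auto intro!: Linf_ell2_column_bound[OF sm1] Linf_mat_opmat_bound[OF sm2] Linf_ell2_column_bound[OF sm3])
  obtain J where J: "bounded_op J"
    "\<And>u v. cinner (J u) v = series_lim B (\<lambda>k. Y (C k u)) (\<lambda>j. adj X (adj (A j) v))"
    using haagerup_operator[OF bounds[OF rep] X Y] unfolding A_def B_def C_def by blast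
  have "double_sums (\<lambda>j k. cinner (spec_integral M1 F1 (a' j) (X (spec_integral M2 F2 (b' j k)
                            (Y (spec_integral M3 F3 (c' k) u))))) v) (cinner (J u) v)"
    if rep': "haagerup_rep M1 F1 M2 F2 M3 F3 \<Phi> a' b' c'" for a' b' c' u v
  proof -
    let ?B = "\<lambda>j k. spec_integral M2 F2 (b' j k)"
    let ?y = "\<lambda>k. Y (spec_integral M3 F3 (c' k) u)"
    let ?x = "\<lambda>j. adj X (adj (spec_integral M1 F1 (a' j)) v)"
    note bd = bounds[OF rep']
    have bA: "bounded_op (spec_integral M1 F1 (a' j))" for j using bd(1) by (simp add: column_bound_def)
    have "double_sums (\<lambda>j k. cinner (?B j k (?y k)) (?x j)) (series_lim ?B ?y ?x)"
      by (rule series_lim(1)[OF bd(2) column_summable(1)[OF bd(3) Y]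
            column_summable(1)[OF column_bound_adj[OF bd(1)] adj_props(1)[OF X]]])
    moreover have "series_lim ?B ?y ?x = cinner (J u) v"
      using series_lim_representation_independent[of \<Phi> "\<lambda>s. if s then a' else a" "\<lambda>s. if s then b' else b"
          "\<lambda>s. if s then c' else c" X Y u v] rep rep' X Y
      by (simp add: J(2) A_def B_def C_def split: if_splits)
    ultimately show ?thesis by (simp add: haagerup_term[OF X bA])
  qed
  then show ?thesis using J rep unfolding has_haagerup_integral_def by (intro exI[of _ J]) blast
qed

end


section \<open>Schatten classes through singular values\<close>

definition sclass :: "real \<Rightarrow> ('h::chilbert_space \<Rightarrow> 'h) \<Rightarrow> real \<Rightarrow> bool" where
  "sclass \<theta> A K \<longleftrightarrow> bounded_op A \<and> lbd \<theta> UNIV (singular_value A) K \<and> (\<theta> = 0 \<longrightarrow> onorm A \<le> K)"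

lemma lbd_summable:
  assumes "lbd \<theta> UNIV q K" "\<theta> \<noteq> 0"
  shows "summable (\<lambda>n::nat. q n powr (1 / \<theta>))" "(\<Sum>n. q n powr (1 / \<theta>)) \<le> K powr (1 / \<theta>)"
proof -
  have le: "(\<Sum>n<N. q n powr (1 / \<theta>)) \<le> K powr (1 / \<theta>)" for N
    using lbd_sum[OF assms] by simp
  show "summable (\<lambda>n. q n powr (1 / \<theta>))" by (rule summableI_nonneg_bounded[OF _ le]) simp
  then show "(\<Sum>n. q n powr (1 / \<theta>)) \<le> K powr (1 / \<theta>)" by (intro suminf_le_const le)
qed

lemma lbd_tendsto_0:
  assumes "lbd \<theta> UNIV q K" "0 < \<theta>"
  shows "q \<longlonglongrightarrow> (0::real)"
proof -
  have "(\<lambda>n. (q n powr (1 / \<theta>)) powr \<theta>) \<longlonglongrightarrow> 0 powr \<theta>"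
    by (intro tendsto_powr' tendsto_const summable_LIMSEQ_zero lbd_summable(1)[OF assms(1)])
       (use assms(2) in auto)
  moreover have "(q n powr (1 / \<theta>)) powr \<theta> = q n" for n
    using assms(2) lbd_nonneg(2)[OF assms(1), of n] by (simp add: powr_powr)
  ultimately show ?thesis using assms(2) by simp
qed

lemma sclass_compact: "sclass \<theta> A K \<Longrightarrow> 0 < \<theta> \<Longrightarrow> compact_op A"
  unfolding sclass_def by (elim conjE) (rule compact_op_singular_values, assumption, rule lbd_tendsto_0)

lemma diag_op_opb:
  assumes A: "bounded_op A" and d: "diag_op A q e f" and q: "lbd \<theta> UNIV q K" and "0 \<le> \<theta>"
  shows "opb \<theta> A K" "opb \<theta> (adj A) K"
proof -
  have q0: "0 \<le> q n" "q n \<le> K" for n using lbd_nonneg(2)[OF q] lbd_elem[OF q \<open>0 \<le> \<theta>\<close>] by auto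
  have K: "0 \<le> K" by (rule lbd_nonneg(1)[OF q])
  have os: "osys UNIV e" "osys UNIV f" using d by (simp_all add: diag_op_def)
  have le0: "norm (Q x) \<le> K * norm x"
    if "osys UNIV g" "\<And>x. (norm (Q x))\<^sup>2 \<le> (\<Sum>n. (q n)\<^sup>2 * (cmod (cinner x (g n)))\<^sup>2)"
    for Q :: "'a \<Rightarrow> 'a" and g :: "nat \<Rightarrow> 'a" and x
  proof -
    have "(q n)\<^sup>2 * (cmod (cinner x (g n)))\<^sup>2 \<le> K\<^sup>2 * (cmod (cinner x (g n)))\<^sup>2" for n
      using q0[of n] by (simp add: mult_right_mono power_mono)
    then have "(\<Sum>n. (q n)\<^sup>2 * (cmod (cinner x (g n)))\<^sup>2) \<le> (\<Sum>n. K\<^sup>2 * (cmod (cinner x (g n)))\<^sup>2)"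
      by (intro suminf_le osys_weighted_summable[OF that(1) q0] summable_mult bessel_summable(1)[OF that(1)])
    with that(2)[of x] have "(norm (Q x))\<^sup>2 \<le> (\<Sum>n. K\<^sup>2 * (cmod (cinner x (g n)))\<^sup>2)" by linarith
    also have "\<dots> \<le> K\<^sup>2 * (norm x)\<^sup>2"
      unfolding suminf_mult[OF bessel_summable(1)[OF that(1)]]
      by (intro mult_left_mono bessel_summable(2)[OF that(1)]) simp
    finally have "(norm (Q x))\<^sup>2 \<le> (K * norm x)\<^sup>2" by (simp add: power_mult_distrib)
    then show ?thesis by (rule power2_le_imp_le) (simp add: K)
  qed
  have n1: "(norm (A x))\<^sup>2 \<le> (\<Sum>n. (q n)\<^sup>2 * (cmod (cinner x (e n)))\<^sup>2)" for x
    by (rule diag_op_norm_le[OF d q0(2)])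
  have n2: "(norm (adj A x))\<^sup>2 \<le> (\<Sum>n. (q n)\<^sup>2 * (cmod (cinner x (f n)))\<^sup>2)" for x
    by (rule diag_op_adj_norm_le[OF A d q0(2)])
  have opbI: "opb \<theta> Q K" if "bounded_op Q" "osys UNIV g"
    "\<And>x. (norm (Q x))\<^sup>2 \<le> (\<Sum>n. (q n)\<^sup>2 * (cmod (cinner x (g n)))\<^sup>2)"
    for Q :: "'a \<Rightarrow> 'a" and g :: "nat \<Rightarrow> 'a"
  proof (cases "\<theta> = 0")
    case True
    then show ?thesis using that(1) K le0[OF that(2,3)] by (simp add: opb_def)
  next
    case False
    then show ?thesis unfolding opb_def using that(1) K
      by (simp, intro exI[of _ q] exI[of _ g] conjI allI that(2,3) q)
  qed
  show "opb \<theta> A K" by (rule opbI[OF A os(1) n1])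
  show "opb \<theta> (adj A) K" by (rule opbI[OF adj_props(1)[OF A] os(2) n2])
qed

lemma sclass_opb:
  assumes "sclass \<theta> A K" "0 \<le> \<theta>"
  shows "opb \<theta> A K" "opb \<theta> (adj A) K"
proof -
  have A: "bounded_op A" using assms by (simp add: sclass_def)
  have "opb \<theta> A K \<and> opb \<theta> (adj A) K"
  proof (cases "\<theta> = 0")
    case True
    then have K: "onorm A \<le> K" using assms by (simp add: sclass_def)
    have "norm (A x) \<le> K * norm x" "norm (adj A x) \<le> K * norm x" for x
      using bounded_op_onorm[OF A, of x] adj_props(3)[OF A, of x] mult_right_mono[OF K norm_ge_zero[of x]]
      by linarith+
    moreover have "0 \<le> K" using K bounded_op_onorm_nonneg[OF A] by simp
    ultimately show ?thesis using True A adj_props(1)[OF A] by (simp add: opb_def)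
  next
    case False
    then have "0 < \<theta>" using assms(2) by simp
    then have "compact_op A" by (rule sclass_compact[OF assms(1)])
    then obtain e f where d: "diag_op A (singular_value A) e f" by (rule compact_op_svd)
    have "lbd \<theta> UNIV (singular_value A) K" using assms(1) by (simp add: sclass_def)
    from diag_op_opb[OF A d this assms(2)] show ?thesis by simp
  qed
  then show "opb \<theta> A K" "opb \<theta> (adj A) K" by simp_all
qed

lemma sclass_mono: "sclass \<theta> A K \<Longrightarrow> 0 \<le> \<theta> \<Longrightarrow> K \<le> L \<Longrightarrow> sclass \<theta> A L"
  unfolding sclass_def using lbd_mono[of \<theta> UNIV "singular_value A" K L UNIV "singular_value A"]
    singular_value_nonneg by auto

lemma lbd_0_singular_value:
  "bounded_op A \<Longrightarrow> lbd 0 UNIV (singular_value A) (onorm A)"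
  by (simp add: lbd_def bounded_op_onorm_nonneg singular_value_nonneg singular_value_le_onorm)

lemma ennreal_inverse_cases:
  fixes p :: ennreal
  assumes "0 < p"
  obtains "p = \<infinity>" "enn2real (1 / p) = 0" | "p < \<infinity>" "0 < enn2real p" "enn2real (1 / p) = 1 / enn2real p"
proof (cases p rule: ennreal_cases)
  case (real a)
  then have "a > 0" using assms by simp
  then have "1 / p = ennreal (1 / a)"
    using real divide_ennreal[of 1 a] by simp
  then show thesis using that(2) real \<open>a > 0\<close> by simp
next
  case top
  then show thesis using that(1) by simp
qed

lemma schatten_sclass:
  assumes "T \<in> schatten p" "0 < p"
  shows "sclass (enn2real (1 / p)) T (schatten_norm p T)"
  using assms(2)
proof (cases rule: ennreal_inverse_cases)
  case 1
  then show ?thesis using assms(1) lbd_0_singular_value[of T]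
    by (simp add: sclass_def schatten_def schatten_norm_def)
next
  case 2
  let ?a = "enn2real p"
  have T: "bounded_op T" "summable (\<lambda>n. singular_value T n powr ?a)"
    using assms(1) 2(1) by (simp_all add: schatten_def)
  have S: "0 \<le> (\<Sum>n. singular_value T n powr ?a)" by (intro suminf_nonneg T) simp
  have "(\<Sum>n\<in>F. singular_value T n powr ?a) \<le> (schatten_norm p T) powr ?a" if "finite F" for F
  proof -
    have "(\<Sum>n\<in>F. singular_value T n powr ?a) \<le> (\<Sum>n. singular_value T n powr ?a)"
      using that by (intro sum_le_suminf T) auto
    also have "\<dots> = (schatten_norm p T) powr ?a"
      using 2 S by (simp add: schatten_norm_def powr_powr)
    finally show ?thesis .
  qed
  moreover have "0 \<le> schatten_norm p T" using 2 by (simp add: schatten_norm_def)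
  ultimately show ?thesis using 2 T(1) singular_value_nonneg[OF T(1)] by (simp add: sclass_def lbd_def)
qed

lemma lbd_schatten:
  assumes "bounded_op W" "lbd (enn2real (1 / p)) UNIV (singular_value W) K" "0 < p" "p < \<infinity>"
  shows "W \<in> schatten p" "schatten_norm p W \<le> K"
proof -
  have p: "0 < enn2real p" "enn2real (1 / p) = 1 / enn2real p"
    using assms(3,4) by (cases rule: ennreal_inverse_cases; simp)+
  note s = lbd_summable[OF assms(2), unfolded p(2)]
  have s': "summable (\<lambda>n. singular_value W n powr enn2real p)"
    "(\<Sum>n. singular_value W n powr enn2real p) \<le> K powr enn2real p"
    using s p(1) by simp_all
  show "W \<in> schatten p" using assms(1) s'(1) by (simp add: schatten_def)
  have "(\<Sum>n. singular_value W n powr enn2real p) powr (1 / enn2real p) \<le> (K powr enn2real p) powr (1 / enn2real p)"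
    using p(1) by (intro powr_mono2 s' suminf_nonneg) auto
  then show "schatten_norm p W \<le> K"
    using p(1) assms(4) lbd_nonneg(1)[OF assms(2)] by (auto simp: schatten_norm_def powr_powr)
qed

section \<open>Trace class products, and a test for Schatten classes on orthogonal systems\<close>

lemma schatten_1_iff: "A \<in> schatten 1 \<longleftrightarrow> bounded_op A \<and> summable (singular_value A)"
proof -
  have "(\<lambda>n. singular_value A n powr 1) = singular_value A" if "bounded_op A"
    using singular_value_nonneg[OF that] by auto
  then show ?thesis by (auto simp: schatten_def)
qed

text \<open>Hoelder's inequality is applied to
  \<open>s (2 * n) \<le> singular_value A n * singular_value B n\<close>; since \<open>s\<close>
  decreases, the odd indices at most double the sum. The factor 2 is harmless because only
  membership is claimed.\<close>

lemma comp_schatten_1: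
  assumes A: "bounded_op A" "lbd \<theta> UNIV (singular_value A) a"
    and B: "bounded_op B" "lbd (1 - \<theta>) UNIV (singular_value B) b" and "0 \<le> \<theta>" "\<theta> \<le> 1"
  shows "A \<circ> B \<in> schatten 1"
proof -
  have AB: "bounded_op (A \<circ> B)" using bounded_op_comp[OF A(1) B(1)] by (simp add: comp_def)
  have "lbd 1 UNIV (\<lambda>n. singular_value A n * singular_value B n) (a * b)"
    using lbd_mult[OF A(2) B(2)] assms(5,6) by simp
  note l1 = lbd_1[OF this]
  define s where "s = singular_value (A \<circ> B)"
  have s0: "0 \<le> s n" for n unfolding s_def by (rule singular_value_nonneg[OF AB])
  have anti: "s (Suc n) \<le> s n" for n unfolding s_def by (rule singular_value_antimono[OF AB]) simp
  have le: "s (2 * n) \<le> singular_value A n * singular_value B n" for n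
    using singular_value_comp[OF A(1) B(1), of n n] by (simp add: mult_2 s_def)
  have "(\<Sum>n<N. s n) \<le> 2 * (a * b)" for N
  proof -
    have "(\<Sum>n<2 * N. s n) \<le> (\<Sum>n<N. 2 * s (2 * n))"
    proof (induction N)
      case (Suc N)
      then show ?case using anti[of "2 * N"] by simp
    qed simp
    also have "\<dots> \<le> 2 * (\<Sum>n<N. singular_value A n * singular_value B n)"
      unfolding sum_distrib_left by (intro sum_mono) (use le in simp)
    also have "\<dots> \<le> 2 * (a * b)" using l1[of "{..<N}"] by simp
    finally have "(\<Sum>n<2 * N. s n) \<le> 2 * (a * b)" .
    moreover have "(\<Sum>n<N. s n) \<le> (\<Sum>n<2 * N. s n)"
      by (intro sum_mono2) (auto simp: s0)
    ultimately show ?thesis by linarith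
  qed
  then have "summable s" by (intro summableI_nonneg_bounded[of s] s0)
  then show ?thesis using AB by (simp add: schatten_1_iff s_def)
qed

text \<open>If the singular values stayed above \<open>r > 0\<close>, \<open>greedy_systems\<close>
  would give \<open>N\<close> diagonal entries of size at least \<open>r / 2\<close> for every
  \<open>N\<close>, against the bound \<open>K\<close>. So \<open>A\<close> is compact, and its own
  singular vectors are then the systems to test.\<close>

lemma singular_value_criterion:
  fixes A :: "'h::chilbert_space \<Rightarrow> 'h"
  assumes A: "bounded_op A" and "0 < \<theta>" "0 \<le> K"
    and test: "\<And>(N::nat) x y. osys {..<N} x \<Longrightarrow> osys {..<N} y \<Longrightarrow> lbd \<theta> {..<N} (\<lambda>i. cmod (cinner (A (x i)) (y i))) K"
  shows "lbd \<theta> UNIV (singular_value A) K"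
proof -
  have "singular_value A \<longlonglongrightarrow> 0"
  proof (rule ccontr)
    assume nlim: "\<not> singular_value A \<longlonglongrightarrow> 0"
    have "\<exists>r>0. \<forall>n. r \<le> singular_value A n"
    proof (rule ccontr)
      assume "\<not> ?thesis"
      then have small: "\<exists>n. singular_value A n < r" if "r > 0" for r using that by (meson not_le)
      have "singular_value A \<longlonglongrightarrow> 0"
      proof (rule LIMSEQ_I)
        fix r :: real assume "r > 0"
        then obtain N where N: "singular_value A N < r" using small by blast
        have "norm (singular_value A n - 0) < r" if "n \<ge> N" for n
          using singular_value_antimono[OF A that] singular_value_nonneg[OF A, of n] N by simp
        then show "\<exists>N. \<forall>n\<ge>N. norm (singular_value A n - 0) < r" by blast
      qed
      then show False using nlim by simp
    qed
    then obtain r where r: "r > 0" "\<And>n. r \<le> singular_value A n" by blast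
    define c where "c = (r / 2) powr (1 / \<theta>)"
    have "c > 0" using r(1) by (simp add: c_def)
    have "real N * c \<le> K powr (1 / \<theta>)" for N
    proof -
      obtain x y where xy: "osys {..<N} x" "osys {..<N} y"
        "\<And>i. i < N \<Longrightarrow> r / 2 \<le> cmod (cinner (A (x i)) (y i))"
        using greedy_systems[OF A r, of N] by blast
      have "real N * c = (\<Sum>i<N. c)" by simp
      also have "\<dots> \<le> (\<Sum>i<N. cmod (cinner (A (x i)) (y i)) powr (1 / \<theta>))"
        unfolding c_def using xy(3) r(1) \<open>0 < \<theta>\<close> by (intro sum_mono powr_mono2) auto
      also have "\<dots> \<le> K powr (1 / \<theta>)"
        using lbd_sum[OF test[OF xy(1,2)]] \<open>0 < \<theta>\<close> by simp
      finally show ?thesis .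
    qed
    moreover obtain N :: nat where "K powr (1 / \<theta>) / c < real N" using reals_Archimedean2 by blast
    ultimately show False using \<open>c > 0\<close> by (simp add: pos_divide_less_eq) (meson not_le)
  qed
  then have cA: "compact_op A" by (rule compact_op_singular_values[OF A])
  obtain e f where svd: "diag_op A (singular_value A) e f" "singular_value A \<longlonglongrightarrow> 0"
    "\<And>n. A (e n) = complex_of_real (singular_value A n) *\<^sub>C f n"
    "\<And>n. singular_value A n \<noteq> 0 \<Longrightarrow> norm (e n) = 1 \<and> norm (f n) = 1"
    "\<And>n. singular_value A n = 0 \<Longrightarrow> e n = 0"
    by (rule compact_op_svd[OF cA], rule that)
  have sv: "cmod (cinner (A (e n)) (f n)) = singular_value A n" for n
    using svd(4)[of n] singular_value_nonneg[OF A, of n]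
    by (cases "singular_value A n = 0") (auto simp: svd(3) cinner_scaleC_left cinner_self norm_mult)
  have "(\<Sum>n\<in>F. singular_value A n powr (1 / \<theta>)) \<le> K powr (1 / \<theta>)" if F: "finite F" for F
  proof -
    obtain N where N: "F \<subseteq> {..<N}" using finite_nat_iff_bounded[of F] F by blast
    have "lbd \<theta> {..<N} (\<lambda>i. cmod (cinner (A (e i)) (f i))) K"
      using svd(1) by (intro test; auto simp: diag_op_def intro: osys_subset[of UNIV])
    from lbd_sum[OF this _ F N] \<open>0 < \<theta>\<close> show ?thesis by (simp add: sv)
  qed
  then show ?thesis using assms singular_value_nonneg[OF A] by (simp add: lbd_def)
qed

lemma rank1_compact: "compact_op (\<lambda>x. cinner x v *\<^sub>C u)" and rank1_summable: "summable (\<lambda>n. singular_value (\<lambda>x. cinner x v *\<^sub>C u) n powr a)"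
proof -
  let ?Q = "\<lambda>x. cinner x v *\<^sub>C u"
  have "rank_le ?Q 1" unfolding rank_le_def
    by (intro exI[of _ "{u}"]) (auto intro: cvec.span_scale cvec.span_base)
  then have "singular_value ?Q 1 \<le> onorm (\<lambda>x. ?Q x - ?Q x)"
    by (rule singular_value_le[OF bounded_op_rank1 bounded_op_rank1])
  then have "singular_value ?Q 1 \<le> 0" by (simp add: onorm_zero)
  then have z: "singular_value ?Q n = 0" if "n \<ge> 1" for n
    using singular_value_antimono[OF bounded_op_rank1 that, of v u] singular_value_nonneg[OF bounded_op_rank1, of v u n]
    by linarith
  show "summable (\<lambda>n. singular_value ?Q n powr a)"
    by (rule summable_finite[of "{0}"]) (use z in auto)
  have "\<forall>\<^sub>F n in sequentially. singular_value ?Q n = 0"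
    using z by (auto simp: eventually_sequentially)
  then show "compact_op ?Q"
    by (intro compact_op_singular_values bounded_op_rank1 tendsto_eventually)
qed

text \<open>Right singular vectors for nonzero singular values form an orthonormal set; extended to
  a basis, they carry all of \<open>A\<close>, since the expansion of \<open>A\<close> vanishes on
  the added vectors. Traces are evaluated in such bases.\<close>

lemma svd_basis:
  fixes A :: "'h::chilbert_space \<Rightarrow> 'h"
  assumes "compact_op A"
  obtains B e f where "orthonormal_basis B" "diag_op A (singular_value A) e f" "singular_value A \<longlonglongrightarrow> 0"
    "\<And>n. A (e n) = complex_of_real (singular_value A n) *\<^sub>C f n"
    "\<And>n. singular_value A n \<noteq> 0 \<Longrightarrow> e n \<in> B" "inj_on e {n. singular_value A n \<noteq> 0}"
    "\<And>x. x \<in> B \<Longrightarrow> x \<notin> e ` {n. singular_value A n \<noteq> 0} \<Longrightarrow> A x = 0"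
proof -
  obtain e f where svd: "diag_op A (singular_value A) e f" "singular_value A \<longlonglongrightarrow> 0"
    "\<And>n. A (e n) = complex_of_real (singular_value A n) *\<^sub>C f n"
    "\<And>n. singular_value A n \<noteq> 0 \<Longrightarrow> norm (e n) = 1 \<and> norm (f n) = 1"
    "\<And>n. singular_value A n = 0 \<Longrightarrow> e n = 0"
    by (rule compact_op_svd[OF assms], rule that)
  let ?I = "{n. singular_value A n \<noteq> 0}"
  have os: "osys UNIV e" using svd(1) by (simp add: diag_op_def)
  have inj: "inj_on e ?I"
  proof (rule inj_onI)
    fix m n assume mn: "m \<in> ?I" "n \<in> ?I" "e m = e n"
    show "m = n"
    proof (rule ccontr)
      assume "m \<noteq> n"
      then have "cinner (e m) (e n) = 0" using osys_orth[OF os] by simp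
      then show False using mn svd(4)[of m] cinner_self[of "e m"] by auto
    qed
  qed
  have "orthonormal (e ` ?I)"
    unfolding orthonormal_def
  proof (clarify)
    fix m n assume mn: "singular_value A m \<noteq> 0" "singular_value A n \<noteq> 0"
    show "cinner (e m) (e n) = (if e m = e n then 1 else 0)"
    proof (cases "m = n")
      case True
      then show ?thesis using svd(4)[OF mn(1)] by (simp add: cinner_self)
    next
      case False
      then have "e m \<noteq> e n" using inj mn by (auto simp: inj_on_def)
      then show ?thesis using osys_orth[OF os, of m n] False by simp
    qed
  qed
  then obtain B where B: "orthonormal_basis B" "e ` ?I \<subseteq> B" by (rule orthonormal_basis_extension)
  have zero: "A x = 0" if "x \<in> B" "x \<notin> e ` ?I" for x
  proof -
    have z: "(complex_of_real (singular_value A n) * cinner x (e n)) *\<^sub>C f n = 0" for n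
    proof (cases "n \<in> ?I")
      case True
      then have "e n \<in> B" "x \<noteq> e n" using B(2) that(2) by auto
      then have "cinner x (e n) = 0" using that(1) B(1) by (simp add: orthonormal_basis_def)
      then show ?thesis by simp
    qed simp
    have "(\<lambda>n. (complex_of_real (singular_value A n) * cinner x (e n)) *\<^sub>C f n) sums A x"
      using svd(1) by (simp add: diag_op_def)
    then have "(\<lambda>n. 0) sums A x" by (simp only: z)
    from sums_unique2[OF this sums_zero] show ?thesis .
  qed
  have "e n \<in> B" if "singular_value A n \<noteq> 0" for n using B(2) that by blast
  then show thesis using zero by (rule that[OF B(1) svd(1-3) _ inj])
qed


section \<open>The trace functional\<close>

text \<open>The sesquilinear form of the sum of \<open>B k R (G k j) Q (A j)\<close>: the first
  index of \<open>G\<close> belongs to \<open>B\<close>, the second to \<open>A\<close>. Working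
  with the form makes linearity in \<open>Q\<close> a matter of limits of numbers.\<close>

definition jform :: "(nat \<Rightarrow> 'h::chilbert_space \<Rightarrow> 'h) \<Rightarrow> (nat \<Rightarrow> 'h \<Rightarrow> 'h) \<Rightarrow> (nat \<Rightarrow> nat \<Rightarrow> 'h \<Rightarrow> 'h) \<Rightarrow>
    ('h \<Rightarrow> 'h) \<Rightarrow> ('h \<Rightarrow> 'h) \<Rightarrow> 'h \<Rightarrow> 'h \<Rightarrow> complex" where
  "jform A B G R Q u v = series_lim G (\<lambda>j. Q (A j u)) (\<lambda>k. adj R (adj (B k) v))"

text \<open>The reciprocal exponents \<open>\<theta>p\<close>, \<open>\<theta>q\<close> belong to
  \<open>T\<close> and \<open>R\<close>, and \<open>\<theta> = 1 - 1 / r\<close> belongs to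
  \<open>Q\<close>; the bounds by \<open>1 / 2\<close> express \<open>q \<ge> 2\<close> and
  \<open>1 / r \<ge> 1 / 2\<close>. The strict positivity of constants is secured by the added
  \<open>\<epsilon>\<close>.\<close>

locale trace_functional =
  fixes A B :: "nat \<Rightarrow> 'h::chilbert_space \<Rightarrow> 'h" and G :: "nat \<Rightarrow> nat \<Rightarrow> 'h \<Rightarrow> 'h"
    and R T :: "'h \<Rightarrow> 'h" and ca cb cc \<theta>p \<theta>q \<theta> KT KR :: real
  assumes A: "column_bound A ca" "0 < ca" and B: "column_bound B cb" "0 < cb"
    and G: "opmat_bound G cc"
    and T: "sclass \<theta>p T KT" "0 < KT" and R: "sclass \<theta>q R KR"
    and \<theta>: "0 \<le> \<theta>p" "0 \<le> \<theta>q" "\<theta>q \<le> 1 / 2" "0 \<le> \<theta>" "\<theta> \<le> 1 / 2" "\<theta>p + \<theta>q + \<theta> = 1"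
begin

abbreviation J :: "('h \<Rightarrow> 'h) \<Rightarrow> 'h \<Rightarrow> 'h \<Rightarrow> complex" where "J \<equiv> jform A B G R"

abbreviation row :: "'h \<Rightarrow> real" where "row \<equiv> column_norm (adj R) (\<lambda>k. adj (B k))"

section \<open>The form of the Haagerup integral, its bound and its linearity in
  \<open>Q\<close>\<close>

lemma bounded_T: "bounded_op T" and bounded_R: "bounded_op R"
  using T R by (simp_all add: sclass_def)

lemma bounded_A: "bounded_op (A j)"
  using A by (simp add: column_bound_def)

lemma cc_nonneg: "0 \<le> cc"
  using G by (simp add: opmat_bound_def)

lemmas row_summable = column_summable[OF column_bound_adj[OF B(1)] adj_props(1)[OF bounded_R]]

lemma J_bound: "bounded_op Q \<Longrightarrow> cmod (J Q u v) \<le> cc * (column_norm Q A u * row v)"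
  using series_lim(2)[OF G column_summable(1)[OF A(1)] row_summable(1), of Q u v]
  by (simp add: jform_def l2norm_def column_norm_def)

lemma J_limit: "bounded_op Q \<Longrightarrow> (\<lambda>N. series_part G (\<lambda>j. Q (A j u)) (\<lambda>k. adj R (adj (B k) v)) N N) \<longlonglongrightarrow> J Q u v"
  unfolding jform_def by (rule series_lim(3)[OF G column_summable(1)[OF A(1)] row_summable(1)])

lemma J_add:
  assumes "bounded_op Q" "bounded_op Q'"
  shows "J (\<lambda>x. Q x + Q' x) u v = J Q u v + J Q' u v"
  by (rule LIMSEQ_unique[OF J_limit[OF bounded_op_add[OF assms], unfolded series_part_add_left[OF G]]
        tendsto_add[OF J_limit[OF assms(1)] J_limit[OF assms(2)]]])

lemma J_scale:
  assumes "bounded_op Q"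
  shows "J (\<lambda>x. c *\<^sub>C Q x) u v = c * J Q u v"
proof -
  have sc: "series_part G (\<lambda>j. c *\<^sub>C y j) x m n = c * series_part G y x m n" for y x m n
    by (simp add: series_part_def bounded_op_simps[OF opmat_bounded[OF G]] cinner_scaleC_left sum_distrib_left)
  show ?thesis
    by (rule LIMSEQ_unique[OF J_limit[OF bounded_op_scaleC[OF assms, of c], unfolded sc]
      tendsto_mult[OF tendsto_const J_limit[OF assms]]])
qed

lemma opb_bounded: "opb t Q K \<Longrightarrow> bounded_op Q" "opb t Q K \<Longrightarrow> 0 \<le> K"
  by (simp_all add: opb_def)

lemma lbd_row: "osys I y \<Longrightarrow> lbd \<theta>q I (\<lambda>i. row (y i)) (cb * KR)"
  by (rule lbd_column_norm[OF column_bound_adj[OF B(1)] B(2) sclass_opb(2)[OF R \<theta>(2)] \<theta>(2,3)])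

text \<open>The order of quantifiers matters: one basis serves all \<open>Q\<close>, which makes the
  sum over it linear in \<open>Q\<close>. The estimate is Hoelder's inequality for three factors,
  coming from \<open>T\<close>, from \<open>Q\<close> with the \<open>A j\<close>, and from
  \<open>R\<close> with the \<open>B k\<close>.\<close>

lemma adapted_basis:
  "\<exists>D. orthonormal_basis D \<and>
    (\<forall>Q K. opb \<theta> Q K \<longrightarrow> lbd 1 D (\<lambda>e. column_norm Q A (T e) * row e) (KT * (ca * K) * (cb * KR)))"
proof (cases "\<theta>p = 0")
  case True
  obtain D :: "'h set" where D: "orthonormal_basis D"
    using orthonormal_basis_extension[OF orthonormal_empty] by blast
  note os = orthonormal_osys[OF orthonormal_basis_orthonormal[OF D]]
  have KT: "norm (T x) \<le> KT * norm x" "norm (adj T x) \<le> KT * norm x" for x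
    using sclass_opb[OF T(1) \<theta>(1)] True by (simp_all add: opb_def)
  \<comment> \<open>With \<open>p = \<infinity>\<close> any basis will do: \<open>T\<close> is
    absorbed into the columns, at the price of the factor \<open>KT\<close>, and two factors with
    \<open>\<theta> + \<theta>q = 1\<close> remain.\<close>
  have col: "column_bound (\<lambda>j u. A j (T u)) (ca * KT)"
    unfolding column_bound_def
  proof (intro conjI allI)
    show bAT: "bounded_op (\<lambda>u. A j (T u))" for j by (rule bounded_op_comp[OF bounded_A bounded_T])
    show "0 \<le> ca * KT" using A(2) T(2) by simp
    have mono: "(ca * norm x)\<^sup>2 \<le> (ca * KT * norm u)\<^sup>2" if "norm x \<le> KT * norm u" for x u :: 'h
      using that A(2) by (intro power_mono) (simp_all add: mult.assoc)
    show "(\<Sum>j<J. (norm (A j (T u)))\<^sup>2) \<le> (ca * KT * norm u)\<^sup>2" for u J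
    proof -
      have "(\<Sum>j<J. (norm (A j (T u)))\<^sup>2) \<le> (ca * norm (T u))\<^sup>2"
        using A(1) by (simp add: column_bound_def)
      then show ?thesis using mono[OF KT(1)[of u]] by linarith
    qed
    show "(\<Sum>j<J. (norm (adj (\<lambda>u. A j (T u)) u))\<^sup>2) \<le> (ca * KT * norm u)\<^sup>2" for u J
    proof -
      have "adj (\<lambda>u. A j (T u)) u = adj T (adj (A j) u)" for j
        by (rule cinner_ext_left) (simp add: adj_props(2)[OF bAT] adj_props(2)[OF bounded_T] adj_props(2)[OF bounded_A])
      then have "(\<Sum>j<J. (norm (adj (\<lambda>u. A j (T u)) u))\<^sup>2) \<le> (\<Sum>j<J. (KT * norm (adj (A j) u))\<^sup>2)"
        using KT(2) by (intro sum_mono power_mono) auto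
      also have "\<dots> = KT\<^sup>2 * (\<Sum>j<J. (norm (adj (A j) u))\<^sup>2)"
        by (simp add: power_mult_distrib sum_distrib_left)
      also have "\<dots> \<le> KT\<^sup>2 * (ca * norm u)\<^sup>2"
        using A(1) by (intro mult_left_mono) (simp_all add: column_bound_def)
      finally show ?thesis by (simp add: power_mult_distrib mult_ac)
    qed
  qed
  have "lbd 1 D (\<lambda>e. column_norm Q A (T e) * row e) (KT * (ca * K) * (cb * KR))" if Q: "opb \<theta> Q K" for Q K
  proof -
    have "lbd \<theta> D (\<lambda>e. column_norm Q (\<lambda>j u. A j (T u)) e) (ca * KT * K)"
      using A(2) T(2) by (intro lbd_column_norm[OF col _ Q \<theta>(4,5) os]) simp
    from lbd_mult[OF this lbd_row[OF os] \<theta>(4,2)]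
    show ?thesis using \<theta>(6) True by (simp add: column_norm_def mult_ac add.commute)
  qed
  then show ?thesis using D by blast
next
  case False
  then have "0 < \<theta>p" using \<theta>(1) by simp
  have "compact_op T" by (rule sclass_compact[OF T(1) \<open>0 < \<theta>p\<close>])
  let ?s = "singular_value T"
  let ?I = "{n. ?s n \<noteq> 0}"
  obtain D e f where D: "orthonormal_basis D" "diag_op T ?s e f" "?s \<longlonglongrightarrow> 0"
    "\<And>n. T (e n) = complex_of_real (?s n) *\<^sub>C f n"
    "\<And>n. ?s n \<noteq> 0 \<Longrightarrow> e n \<in> D" "inj_on e ?I" "\<And>x. x \<in> D \<Longrightarrow> x \<notin> e ` ?I \<Longrightarrow> T x = 0"
    by (rule svd_basis[OF \<open>compact_op T\<close>], rule that)
  note os = orthonormal_osys[OF orthonormal_basis_orthonormal[OF D(1)]]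
  have osf: "osys UNIV f" using D(2) by (simp add: diag_op_def)
  have s0: "0 \<le> ?s n" for n by (rule singular_value_nonneg[OF bounded_T])
  have lT: "lbd \<theta>p UNIV ?s KT" using T(1) by (simp add: sclass_def)
  \<comment> \<open>The singular values and left singular vectors are reindexed by the basis and
    extended by 0 to the vectors that \<open>T\<close> annihilates; the result is still an
    orthogonal system of short vectors.\<close>
  define idx where "idx = the_inv_into ?I e"
  have idx: "idx x \<in> ?I" "e (idx x) = x" if "x \<in> e ` ?I" for x
    using that the_inv_into_into[OF D(6) that order_refl] f_the_inv_into_f[OF D(6) that]
    by (simp_all add: idx_def)
  define \<tau> where "\<tau> x = (if x \<in> e ` ?I then ?s (idx x) else 0)" for x
  define \<phi> where "\<phi> x = (if x \<in> e ` ?I then f (idx x) else 0)" for x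
  have inj_idx: "inj_on idx (e ` ?I)" by (rule inj_onI) (metis idx(2))
  have T\<phi>: "T x = complex_of_real (\<tau> x) *\<^sub>C \<phi> x" if "x \<in> D" for x
  proof (cases "x \<in> e ` ?I")
    case True
    then show ?thesis using D(4)[of "idx x"] idx(2)[OF True] by (simp add: \<tau>_def \<phi>_def)
  next
    case False
    then show ?thesis using D(7)[OF that False] by (simp add: \<tau>_def)
  qed
  have \<phi>: "osys D \<phi>" unfolding osys_def
  proof (intro conjI ballI impI)
    fix x y assume "x \<in> D" "y \<in> D" "x \<noteq> y"
    show "cinner (\<phi> x) (\<phi> y) = 0"
    proof (cases "x \<in> e ` ?I \<and> y \<in> e ` ?I")
      case True
      then have "idx x \<noteq> idx y" using inj_idx \<open>x \<noteq> y\<close> by (auto simp: inj_on_def)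
      then show ?thesis using osys_orth[OF osf, of "idx x" "idx y"] True by (simp add: \<phi>_def)
    qed (auto simp: \<phi>_def)
  next
    show "norm (\<phi> x) \<le> 1" for x using osys_norm[OF osf] by (simp add: \<phi>_def)
  qed
  have l\<tau>: "lbd \<theta>p D \<tau> KT"
  proof -
    have "(\<Sum>x\<in>F. \<tau> x powr (1 / \<theta>p)) \<le> KT powr (1 / \<theta>p)" if "finite F" "F \<subseteq> D" for F
    proof -
      have "(\<Sum>x\<in>F. \<tau> x powr (1 / \<theta>p)) = (\<Sum>x\<in>F \<inter> e ` ?I. ?s (idx x) powr (1 / \<theta>p))"
        using that by (intro sum.mono_neutral_cong_right) (auto simp: \<tau>_def)
      also have "\<dots> = (\<Sum>n\<in>idx ` (F \<inter> e ` ?I). ?s n powr (1 / \<theta>p))"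
        using inj_on_subset[OF inj_idx] by (subst sum.reindex) auto
      also have "\<dots> \<le> KT powr (1 / \<theta>p)" using that by (intro lbd_sum[OF lT False]) auto
      finally show ?thesis .
    qed
    then show ?thesis using False s0 T(2) by (simp add: lbd_def \<tau>_def)
  qed
  have "lbd 1 D (\<lambda>e. column_norm Q A (T e) * row e) (KT * (ca * K) * (cb * KR))" if Q: "opb \<theta> Q K" for Q K
  proof -
    note bQ = opb_bounded(1)[OF Q]
    have eq: "column_norm Q A (T x) = \<tau> x * column_norm Q A (\<phi> x)" if "x \<in> D" for x
    proof -
      have "(norm (Q (A j (T x))))\<^sup>2 = (\<tau> x)\<^sup>2 * (norm (Q (A j (\<phi> x))))\<^sup>2" for j
        unfolding T\<phi>[OF that]
        by (simp add: bounded_op_simps[OF bounded_A] bounded_op_simps[OF bQ] norm_scaleC power_mult_distrib)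
      then show ?thesis
        using suminf_mult[OF column_summable(1)[OF A(1) bQ, of "\<phi> x"], of "(\<tau> x)\<^sup>2"] s0
        by (simp add: column_norm_def real_sqrt_mult \<tau>_def)
    qed
    have "lbd \<theta> D (\<lambda>x. column_norm Q A (\<phi> x)) (ca * K)"
      by (rule lbd_column_norm[OF A(1,2) Q \<theta>(4,5) \<phi>])
    from lbd_mult[OF lbd_mult[OF l\<tau> this \<theta>(1,4)] lbd_row[OF os] _ \<theta>(2)]
    have l: "lbd 1 D (\<lambda>x. \<tau> x * column_norm Q A (\<phi> x) * row x) (KT * (ca * K) * (cb * KR))"
      using \<theta> by (simp add: algebra_simps)
    show ?thesis
    proof (rule lbd_mono[OF l])
      fix x assume "x \<in> D"
      show "0 \<le> column_norm Q A (T x) * row x"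
        by (intro mult_nonneg_nonneg column_summable(3)[OF A(1) bQ] row_summable(3))
      show "column_norm Q A (T x) * row x \<le> \<tau> x * column_norm Q A (\<phi> x) * row x"
        using eq[OF \<open>x \<in> D\<close>] by simp
    qed simp_all
  qed
  then show ?thesis using D(1) by blast
qed

section \<open>The trace of \<open>J Q\<close> composed with \<open>T\<close> as a functional of
  \<open>Q\<close>\<close>

definition basis :: "'h set" where
  "basis = (SOME D. orthonormal_basis D \<and>
    (\<forall>Q K. opb \<theta> Q K \<longrightarrow> lbd 1 D (\<lambda>e. column_norm Q A (T e) * row e) (KT * (ca * K) * (cb * KR))))"

lemma basis: "orthonormal_basis basis"
  and basis_lbd: "opb \<theta> Q K \<Longrightarrow> lbd 1 basis (\<lambda>e. column_norm Q A (T e) * row e) (KT * (ca * K) * (cb * KR))"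
  using someI_ex[OF adapted_basis, folded basis_def] by simp_all

definition \<tau> :: "('h \<Rightarrow> 'h) \<Rightarrow> complex" where
  "\<tau> Q = infsum (\<lambda>e. J Q (T e) e) basis"

text \<open>\<open>infsum\<close> has the default value 0 for families that are not summable, so
  additivity of \<open>\<tau>\<close> has to be accompanied by summability.\<close>

definition nice :: "('h \<Rightarrow> 'h) \<Rightarrow> bool" where
  "nice Q \<longleftrightarrow> bounded_op Q \<and> (\<lambda>e. J Q (T e) e) summable_on basis"

definition C0 :: real where "C0 = cc * (KT * ca * (cb * KR))"

lemma C0_nonneg: "0 \<le> C0"
proof -
  have "0 \<le> KR" using R lbd_nonneg(1) by (auto simp: sclass_def)
  then show ?thesis unfolding C0_def using cc_nonneg T(2) A(2) B(2) by simp
qed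

text \<open>The diagonal entries are dominated in modulus by \<open>cc\<close> times the products in
  \<open>basis_lbd\<close>, whose sum Hoelder's inequality controls; this gives summability and the
  constant \<open>C0\<close> at once.\<close>

lemma \<tau>_bound:
  assumes Q: "opb \<theta> Q K"
  shows "nice Q" "cmod (\<tau> Q) \<le> C0 * K"
proof -
  note bQ = opb_bounded(1)[OF Q]
  let ?h = "\<lambda>e. cc * (column_norm Q A (T e) * row e)"
  have fin: "(\<Sum>e\<in>F. ?h e) \<le> C0 * K" if "finite F" "F \<subseteq> basis" for F
  proof -
    have "(\<Sum>e\<in>F. ?h e) \<le> cc * (KT * (ca * K) * (cb * KR))"
      unfolding sum_distrib_left[symmetric] by (intro mult_left_mono lbd_1[OF basis_lbd[OF Q]] that cc_nonneg)
    then show ?thesis by (simp add: C0_def mult_ac)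
  qed
  have h0: "0 \<le> ?h e" for e
    using cc_nonneg column_summable(3)[OF A(1) bQ] row_summable(3) by simp
  have sh: "?h summable_on basis"
    by (rule nonneg_bdd_above_summable_on) (auto intro!: bdd_aboveI2 fin h0)
  have abs: "(\<lambda>e. cmod (J Q (T e) e)) summable_on basis"
    by (rule summable_on_comparison_test[OF sh]) (use J_bound[OF bQ] in auto)
  then show "nice Q" unfolding nice_def using bQ abs_summable_summable[OF abs] by blast
  have "cmod (\<tau> Q) \<le> infsum (\<lambda>e. cmod (J Q (T e) e)) basis"
    unfolding \<tau>_def by (rule norm_infsum_bound[OF abs])
  also have "\<dots> \<le> C0 * K"
  proof (rule infsum_le_finite_sums[OF abs])
    fix F assume F: "finite F" "F \<subseteq> basis"
    have "(\<Sum>e\<in>F. cmod (J Q (T e) e)) \<le> (\<Sum>e\<in>F. ?h e)" by (intro sum_mono J_bound bQ)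
    then show "(\<Sum>e\<in>F. cmod (J Q (T e) e)) \<le> C0 * K" using fin[OF F] by linarith
  qed
  finally show "cmod (\<tau> Q) \<le> C0 * K" .
qed

lemma \<tau>_add:
  assumes "nice Q" "nice Q'"
  shows "nice (\<lambda>x. Q x + Q' x)" "\<tau> (\<lambda>x. Q x + Q' x) = \<tau> Q + \<tau> Q'"
  using assms unfolding nice_def \<tau>_def by (simp_all add: J_add bounded_op_add summable_on_add infsum_add)

lemma \<tau>_scale:
  assumes "nice Q"
  shows "nice (\<lambda>x. c *\<^sub>C Q x)" "\<tau> (\<lambda>x. c *\<^sub>C Q x) = c * \<tau> Q"
  using assms unfolding nice_def \<tau>_def
  by (simp_all add: J_scale bounded_op_scaleC summable_on_cmult_right infsum_cmult_right)

lemma opb_0: "opb \<theta> (\<lambda>x :: 'h. 0) 0"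
proof -
  have "osys UNIV (\<lambda>n::nat. 0 :: 'h)" by (simp add: osys_def)
  moreover have "lbd \<theta> UNIV (\<lambda>n::nat. 0) 0" by (simp add: lbd_def)
  ultimately have ex: "\<exists>q e. osys UNIV e \<and> lbd \<theta> UNIV q 0 \<and>
      (\<forall>x::'h. (norm (0::'h))\<^sup>2 \<le> (\<Sum>n::nat. (q n)\<^sup>2 * (cmod (cinner x (e n)))\<^sup>2))"
    by (intro exI[of _ "\<lambda>n. 0"] conjI) simp_all
  show ?thesis
  proof (cases "\<theta> = 0")
    case False
    then show ?thesis unfolding opb_def if_not_P[OF False] using ex by (intro conjI bounded_op_zero order_refl)
  qed (simp add: opb_def bounded_op_zero)
qed

lemma \<tau>_sum:
  assumes "\<And>i. i \<in> F \<Longrightarrow> nice (Q i)"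
  shows "nice (\<lambda>x. \<Sum>i\<in>F. c i *\<^sub>C Q i x) \<and> \<tau> (\<lambda>x. \<Sum>i\<in>F. c i *\<^sub>C Q i x) = (\<Sum>i\<in>F. c i * \<tau> (Q i))"
  using assms
proof (induction F rule: infinite_finite_induct)
  case (insert i F)
  then show ?case using \<tau>_add[OF \<tau>_scale(1)[of "Q i" "c i"], of "\<lambda>x. \<Sum>i\<in>F. c i *\<^sub>C Q i x"]
    \<tau>_scale(2)[of "Q i" "c i"] by simp
qed (use \<tau>_bound[OF opb_0] in simp_all)

lemma opb_rank1: "opb \<theta> (\<lambda>x. cinner x v *\<^sub>C u) (norm u * norm v)"
proof -
  let ?q = "\<lambda>n::nat. if n = 0 then norm u * norm v else 0"
  \<comment> \<open>For \<open>v = 0\<close> the quotient is 0 by convention, and both sides of the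
    domination vanish.\<close>
  let ?e = "\<lambda>n::nat. if n = 0 then complex_of_real (1 / norm v) *\<^sub>C v else 0"
  have ne: "norm (complex_of_real (1 / norm v) *\<^sub>C v) \<le> 1"
    unfolding norm_scaleC norm_of_real by simp
  have "osys UNIV ?e" unfolding osys_def using ne by auto
  moreover have "lbd \<theta> UNIV ?q (norm u * norm v)"
  proof -
    have "(\<Sum>n\<in>F. ?q n powr (1 / \<theta>)) \<le> (norm u * norm v) powr (1 / \<theta>)" if "finite F" for F
    proof -
      have "(\<Sum>n\<in>F. ?q n powr (1 / \<theta>)) \<le> (\<Sum>n\<in>insert 0 F. ?q n powr (1 / \<theta>))"
        using that by (intro sum_mono2) auto
      also have "\<dots> = (\<Sum>n\<in>{0}. ?q n powr (1 / \<theta>))" using that by (intro sum.mono_neutral_right) auto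
      finally show ?thesis by simp
    qed
    then show ?thesis by (simp add: lbd_def)
  qed
  moreover have "(norm (cinner x v *\<^sub>C u))\<^sup>2 \<le> (\<Sum>n. (?q n)\<^sup>2 * (cmod (cinner x (?e n)))\<^sup>2)" for x
  proof -
    have "(\<Sum>n. (?q n)\<^sup>2 * (cmod (cinner x (?e n)))\<^sup>2) = (?q 0)\<^sup>2 * (cmod (cinner x (?e 0)))\<^sup>2"
      by (subst suminf_finite[of "{0}"]) auto
    also have "\<dots> = (norm (cinner x v *\<^sub>C u))\<^sup>2"
      by (cases "v = 0") (simp_all add: cinner_scaleC_right norm_mult norm_divide norm_scaleC
          power_mult_distrib power_divide)
    finally show ?thesis by simp
  qed
  moreover have "norm (cinner x v *\<^sub>C u) \<le> norm u * norm v * norm x" for x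
    using mult_right_mono[OF cinner_bound[of x v] norm_ge_zero[of u]] by (simp add: norm_scaleC mult_ac)
  ultimately show ?thesis unfolding opb_def by (simp add: bounded_op_rank1) blast
qed

lemma nice_rank1: "nice (\<lambda>x. cinner x v *\<^sub>C u)"
  by (rule \<tau>_bound(1)[OF opb_rank1])

text \<open>For \<open>Q\<close> of the form \<open>x \<mapsto> (x, v) u\<close> the trace of
  \<open>W Q\<close> is \<open>(W u, v)\<close>, so the values of \<open>\<tau>\<close> on rank one
  operators prescribe the form of \<open>W\<close>. They are antilinear in \<open>v\<close> because
  these operators are.\<close>

lemma W_exists: "\<exists>W. bounded_op W \<and> (\<forall>u v. cinner (W u) v = \<tau> (\<lambda>x. cinner x v *\<^sub>C u))"
proof -
  let ?w = "\<lambda>u v. \<tau> (\<lambda>x. cinner x v *\<^sub>C u)"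
  obtain W where "bounded_op W" "\<And>u v. cinner (W u) v = ?w u v" "\<And>u. norm (W u) \<le> C0 * norm u"
  proof (rule bounded_form_op[of ?w C0])
    show "?w (u + u') v = ?w u v + ?w u' v" for u u' v
      using \<tau>_add(2)[OF nice_rank1 nice_rank1, of v u v u'] by (simp add: scaleC_add_right)
    show "?w (c *\<^sub>C u) v = c * ?w u v" for c u v
      using \<tau>_scale(2)[OF nice_rank1, of c v u] by (simp add: scaleC_scaleC mult.commute)
    show "?w u (v + v') = ?w u v + ?w u v'" for u v v'
      using \<tau>_add(2)[OF nice_rank1 nice_rank1, of v u v' u] by (simp add: cinner_add_right scaleC_add_left)
    show "?w u (c *\<^sub>C v) = cnj c * ?w u v" for c u v
      using \<tau>_scale(2)[OF nice_rank1, of "cnj c" v u] by (simp add: cinner_scaleC_right scaleC_scaleC)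
    show "cmod (?w u v) \<le> C0 * norm u * norm v" for u v
      using \<tau>_bound(2)[OF opb_rank1, of v u] by (simp add: mult.assoc)
    show "0 \<le> C0" by (rule C0_nonneg)
  qed (rule that)
  then show ?thesis by blast
qed

section \<open>The representing operator and its singular values\<close>

definition W :: "'h \<Rightarrow> 'h" where
  "W = (SOME W. bounded_op W \<and> (\<forall>u v. cinner (W u) v = \<tau> (\<lambda>x. cinner x v *\<^sub>C u)))"

lemma bounded_W: "bounded_op W" and cinner_W: "cinner (W u) v = \<tau> (\<lambda>x. cinner x v *\<^sub>C u)"
  using someI_ex[OF W_exists, folded W_def] by simp_all

lemma \<tau>_finite_diag:
  "nice (\<lambda>x. \<Sum>i\<in>F. c i *\<^sub>C (cinner x (y i) *\<^sub>C z i)) \<and>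
   \<tau> (\<lambda>x. \<Sum>i\<in>F. c i *\<^sub>C (cinner x (y i) *\<^sub>C z i)) = (\<Sum>i\<in>F. c i * cinner (W (z i)) (y i))"
  unfolding cinner_W by (rule \<tau>_sum[OF nice_rank1])

text \<open>Duality: for orthogonal systems \<open>x\<close>, \<open>y\<close> and weights
  \<open>b\<close> the finite sum of rank one operators from \<open>y i\<close> to
  \<open>x i\<close> satisfies the domination for \<open>\<theta>\<close> with the constant of
  \<open>b\<close>, and \<open>\<tau>\<close> of it is the pairing of \<open>b\<close> with the
  tested entries of \<open>W\<close>. Since \<open>\<theta>\<close> and \<open>1 - \<theta>\<close>
  are conjugate, the bound on \<open>\<tau>\<close> is the claim.\<close>

lemma lbd_W: "lbd (1 - \<theta>) UNIV (singular_value W) C0"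
proof (rule singular_value_criterion[OF bounded_W _ C0_nonneg])
  show "0 < 1 - \<theta>" using \<theta>(5) by simp
  fix N :: nat and x y :: "nat \<Rightarrow> 'h" assume xy: "osys {..<N} x" "osys {..<N} y"
  show "lbd (1 - \<theta>) {..<N} (\<lambda>i. cmod (cinner (W (x i)) (y i))) C0"
  proof (rule lbd_dual)
    show "0 < 1 - \<theta>" "1 - \<theta> \<le> 1" "0 \<le> C0" using \<theta> C0_nonneg by simp_all
    fix b D F assume F: "finite F" "F \<subseteq> {..<N}" and "lbd (1 - (1 - \<theta>)) UNIV b D" and b0: "\<And>i. i \<notin> F \<Longrightarrow> b i = 0"
    then have b: "lbd \<theta> UNIV b D" by simp
    note bn = lbd_nonneg[OF b] and be = lbd_elem[OF b \<theta>(4)]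
    \<comment> \<open>The unimodular factor rotates each entry of \<open>W\<close> to its modulus,
      so that no cancellation occurs in the pairing; it does not affect the domination.\<close>
    define c where "c i = complex_of_real (b i) * cnj (sgn (cinner (W (x i)) (y i)))" for i
    let ?Q = "\<lambda>z. \<Sum>i\<in>F. c i *\<^sub>C (cinner z (y i) *\<^sub>C x i)"
    let ?e = "\<lambda>n. if n \<in> F then y n else 0"
    have c_le: "cmod (c i) \<le> b i" for i
      using bn(2)[of i] by (simp add: c_def norm_mult norm_sgn)
    have ose: "osys UNIV ?e"
      using osys_orth[OF xy(2)] osys_norm[OF xy(2)] F(2) by (auto simp: osys_def subset_iff)
    have Qle: "(norm (?Q z))\<^sup>2 \<le> (\<Sum>n. (b n)\<^sup>2 * (cmod (cinner z (?e n)))\<^sup>2)" for z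
    proof -
      have "(norm (\<Sum>i\<in>F. (c i * cinner z (y i)) *\<^sub>C x i))\<^sup>2 \<le> (\<Sum>i\<in>F. (cmod (c i * cinner z (y i)))\<^sup>2)"
        by (rule osys_norm_sum_le[OF osys_subset[OF xy(1) F(2)] F(1)])
      also have "\<dots> \<le> (\<Sum>i\<in>F. (b i)\<^sup>2 * (cmod (cinner z (?e i)))\<^sup>2)"
        unfolding norm_mult power_mult_distrib
        by (intro sum_mono) (simp add: c_le mult_right_mono power_mono)
      also have "\<dots> = (\<Sum>n. (b n)\<^sup>2 * (cmod (cinner z (?e n)))\<^sup>2)"
        by (rule suminf_finite[symmetric]) (use F b0 in auto)
      finally show ?thesis by (simp add: scaleC_scaleC)
    qed
    have bQ: "bounded_op ?Q" by (intro bounded_op_sum bounded_op_scaleC bounded_op_rank1)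
    have "opb \<theta> ?Q D"
    proof (cases "\<theta> = 0")
      case False
      have "\<exists>q e. osys UNIV e \<and> lbd \<theta> UNIV q D \<and>
          (\<forall>z. (norm (?Q z))\<^sup>2 \<le> (\<Sum>n. (q n)\<^sup>2 * (cmod (cinner z (e n)))\<^sup>2))"
        by (intro exI[of _ b] exI[of _ ?e] conjI allI Qle ose b)
      then show ?thesis unfolding opb_def if_not_P[OF False] using bQ bn(1) by (intro conjI)
    next
      case True
      have "norm (?Q z) \<le> D * norm z" for z
      proof -
        have "(b n)\<^sup>2 * (cmod (cinner z (?e n)))\<^sup>2 \<le> D\<^sup>2 * (cmod (cinner z (?e n)))\<^sup>2" for n
          using bn(2)[of n] be[of n] by (simp add: mult_right_mono power_mono)
        then have "(\<Sum>n. (b n)\<^sup>2 * (cmod (cinner z (?e n)))\<^sup>2) \<le> (\<Sum>n. D\<^sup>2 * (cmod (cinner z (?e n)))\<^sup>2)"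
          using bn(2) be by (intro suminf_le osys_weighted_summable[OF ose, of b D] summable_mult bessel_summable(1)[OF ose]) auto
        also have "\<dots> \<le> D\<^sup>2 * (norm z)\<^sup>2"
          unfolding suminf_mult[OF bessel_summable(1)[OF ose]]
          by (intro mult_left_mono bessel_summable(2)[OF ose]) simp
        finally have "(norm (?Q z))\<^sup>2 \<le> (D * norm z)\<^sup>2" using Qle[of z] by (simp add: power_mult_distrib)
        then show ?thesis by (rule power2_le_imp_le) (simp add: bn(1))
      qed
      then show ?thesis using True bQ bn(1) by (simp add: opb_def)
    qed
    from \<tau>_bound(2)[OF this]
    have le: "cmod (\<Sum>i\<in>F. c i * cinner (W (x i)) (y i)) \<le> C0 * D"
      using \<tau>_finite_diag[where F=F and c=c and y=y and z=x] by simp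
    have "c i * cinner (W (x i)) (y i) = complex_of_real (b i * cmod (cinner (W (x i)) (y i)))" for i
    proof -
      have "cnj (sgn z) * z = complex_of_real (cmod z)" for z
        by (cases "z = 0") (simp_all add: sgn_eq complex_norm_square[symmetric] power2_eq_square field_simps)
      then show ?thesis by (simp add: c_def mult.assoc)
    qed
    then have "(\<Sum>i\<in>F. c i * cinner (W (x i)) (y i)) = complex_of_real (\<Sum>i\<in>F. b i * cmod (cinner (W (x i)) (y i)))"
      by simp
    then show "(\<Sum>i\<in>F. b i * cmod (cinner (W (x i)) (y i))) \<le> C0 * D"
      using le bn(2) by (simp add: sum_nonneg del: of_real_sum)
  qed simp
qed

text \<open>On finite sections of \<open>Q\<close> the functional is the partial sum of the series,
  by linearity. The remainder is diagonal with the tail weights \<open>r N\<close>, so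
  \<open>\<tau>_bound\<close> makes its contribution tend to 0.\<close>

lemma \<tau>_diag_sums:
  assumes Q: "bounded_op Q" and d: "diag_op Q q e f" and K: "lbd \<theta> UNIV q K" and lim: "q \<longlonglongrightarrow> 0"
    and anti: "\<And>m n. m \<le> n \<Longrightarrow> q n \<le> q m"
  shows "(\<lambda>n. complex_of_real (q n) * cinner (W (f n)) (e n)) sums \<tau> Q"
proof -
  have os: "osys UNIV e" "osys UNIV f" and q0: "0 \<le> q n" for n using d by (simp_all add: diag_op_def)
  define r where "r N n = (if n < N then 0 else q n)" for N n
  let ?P = "\<lambda>N x. \<Sum>n<N. complex_of_real (q n) *\<^sub>C (cinner x (e n) *\<^sub>C f n)"
  \<comment> \<open>The norm of the tail weights: for \<open>\<theta> = 0\<close> their supremum,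
    which is \<open>q N\<close> by monotonicity, and otherwise the tail of the convergent power
    series sum raised to the power \<open>\<theta>\<close>.\<close>
  define \<epsilon> where "\<epsilon> N = (if \<theta> = 0 then q N else ((\<Sum>n. q n powr (1 / \<theta>)) - (\<Sum>n<N. q n powr (1 / \<theta>))) powr \<theta>)" for N
  have \<epsilon>_lim: "\<epsilon> \<longlonglongrightarrow> 0"
  proof (cases "\<theta> = 0")
    case True
    then show ?thesis using lim by (simp add: \<epsilon>_def[abs_def])
  next
    case False
    have "(\<lambda>N. ((\<Sum>n. q n powr (1 / \<theta>)) - (\<Sum>n<N. q n powr (1 / \<theta>))) powr \<theta>)
      \<longlonglongrightarrow> ((\<Sum>n. q n powr (1 / \<theta>)) - (\<Sum>n. q n powr (1 / \<theta>))) powr \<theta>"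
      using lbd_summable(1)[OF K False] False \<theta>(4)
      by (intro tendsto_powr' tendsto_intros summable_LIMSEQ)
         (auto intro!: always_eventually sum_le_suminf)
    then show ?thesis using False \<theta>(4) by (simp add: \<epsilon>_def[abs_def])
  qed
  have lr: "lbd \<theta> UNIV (r N) (\<epsilon> N)" for N
  proof (cases "\<theta> = 0")
    case True
    then show ?thesis using anti q0 by (simp add: lbd_def r_def \<epsilon>_def)
  next
    case False
    note sq = lbd_summable(1)[OF K False]
    have "(\<Sum>n\<in>F. r N n powr (1 / \<theta>)) \<le> (\<epsilon> N) powr (1 / \<theta>)" if F: "finite F" for F
    proof -
      have "(\<Sum>n\<in>F. r N n powr (1 / \<theta>)) = (\<Sum>n\<in>F - {..<N}. q n powr (1 / \<theta>))"
        using F by (intro sum.mono_neutral_cong_right) (auto simp: r_def)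
      moreover have "(\<Sum>n\<in>F - {..<N}. q n powr (1 / \<theta>)) + (\<Sum>n\<in>{..<N}. q n powr (1 / \<theta>))
        = (\<Sum>n\<in>(F - {..<N}) \<union> {..<N}. q n powr (1 / \<theta>))"
        using F by (intro sum.union_disjoint[symmetric]) auto
      moreover have "\<dots> \<le> (\<Sum>n. q n powr (1 / \<theta>))" using F by (intro sum_le_suminf sq) auto
      ultimately have "(\<Sum>n\<in>F. r N n powr (1 / \<theta>)) \<le> (\<Sum>n. q n powr (1 / \<theta>)) - (\<Sum>n<N. q n powr (1 / \<theta>))"
        by linarith
      moreover have "0 \<le> (\<Sum>n\<in>F. r N n powr (1 / \<theta>))" by (intro sum_nonneg) simp
      ultimately show ?thesis using False by (simp add: \<epsilon>_def powr_powr)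
    qed
    then show ?thesis using False q0 by (simp add: lbd_def r_def \<epsilon>_def)
  qed
  have nP: "nice (?P N)" and tP: "\<tau> (?P N) = (\<Sum>n<N. complex_of_real (q n) * cinner (W (f n)) (e n))" for N
    using \<tau>_finite_diag[where F="{..<N}" and c="\<lambda>n. complex_of_real (q n)" and y=e and z=f] by simp_all
  have bP: "bounded_op (?P N)" for N using nP[of N] by (simp add: nice_def)
  have dr: "diag_op (\<lambda>x. Q x - ?P N x) (r N) e f" for N
    unfolding diag_op_def
  proof (intro conjI allI os)
    show "0 \<le> r N n" for n using q0 by (simp add: r_def)
    fix x
    let ?g = "\<lambda>n. (complex_of_real (q n) * cinner x (e n)) *\<^sub>C f n"
    have "?g sums Q x" using d by (simp add: diag_op_def)
    moreover have "(\<lambda>n. if n \<in> {..<N} then ?g n else 0) sums (\<Sum>n<N. ?g n)"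
      by (rule sums_If_finite_set) simp
    ultimately have "(\<lambda>n. ?g n - (if n \<in> {..<N} then ?g n else 0)) sums (Q x - (\<Sum>n<N. ?g n))"
      by (rule sums_diff)
    moreover have "?g n - (if n \<in> {..<N} then ?g n else 0) = (complex_of_real (r N n) * cinner x (e n)) *\<^sub>C f n" for n
      by (simp add: r_def)
    ultimately show "(\<lambda>n. (complex_of_real (r N n) * cinner x (e n)) *\<^sub>C f n) sums (Q x - ?P N x)"
      by (simp add: scaleC_scaleC)
  qed
  have opr: "opb \<theta> (\<lambda>x. Q x - ?P N x) (\<epsilon> N)" for N
    by (rule diag_op_opb(1)[OF bounded_op_diff[OF Q bP] dr lr \<theta>(4)])
  have split: "\<tau> Q = \<tau> (\<lambda>x. Q x - ?P N x) + \<tau> (?P N)" for N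
    using \<tau>_add(2)[OF \<tau>_bound(1)[OF opr] nP, of N N] by simp
  have "(\<lambda>N. \<tau> (\<lambda>x. Q x - ?P N x)) \<longlonglongrightarrow> 0"
  proof (rule tendsto_0_le[where K=1])
    show "(\<lambda>N. C0 * \<epsilon> N) \<longlonglongrightarrow> 0" using tendsto_mult_right_zero[OF \<epsilon>_lim] .
    show "\<forall>\<^sub>F N in sequentially. norm (\<tau> (\<lambda>x. Q x - ?P N x)) \<le> norm (C0 * \<epsilon> N) * 1"
      using \<tau>_bound(2)[OF opr] by (intro always_eventually) (auto intro: order_trans[OF _ abs_ge_self])
  qed
  then have "(\<lambda>N. \<tau> Q - \<tau> (\<lambda>x. Q x - ?P N x)) \<longlonglongrightarrow> \<tau> Q - 0" by (intro tendsto_intros)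
  moreover have "\<tau> Q - \<tau> (\<lambda>x. Q x - ?P N x) = (\<Sum>n<N. complex_of_real (q n) * cinner (W (f n)) (e n))" for N
    using split[of N] tP[of N] by simp
  ultimately show ?thesis by (simp add: sums_def)
qed

text \<open>Both traces equal \<open>\<tau> Q\<close>: the first is evaluated in the fixed
  \<open>basis\<close>, the second in a basis of right singular vectors of \<open>Q\<close>. The
  trace class claims pair conjugate reciprocals, \<open>1 - \<theta>p\<close> with
  \<open>\<theta>p\<close> for \<open>I\<close> and \<open>T\<close>, and
  \<open>1 - \<theta>\<close> with \<open>\<theta>\<close> for \<open>W\<close> and
  \<open>Q\<close>.\<close>

lemma trace_identity:
  assumes Q: "compact_op Q" "lbd \<theta> UNIV (singular_value Q) K"
    and I: "bounded_op I" "\<And>u v. cinner (I u) v = J Q u v"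
  shows "I \<circ> T \<in> schatten 1" "W \<circ> Q \<in> schatten 1" "op_trace (I \<circ> T) = op_trace (W \<circ> Q)"
proof -
  have bQ: "bounded_op Q" using Q(1) by (simp add: compact_op_def)
  let ?s = "singular_value Q"
  let ?I = "{n. ?s n \<noteq> 0}"
  obtain D e f where D: "orthonormal_basis D" "diag_op Q ?s e f" "?s \<longlonglongrightarrow> 0"
    "\<And>n. Q (e n) = complex_of_real (?s n) *\<^sub>C f n"
    "\<And>n. ?s n \<noteq> 0 \<Longrightarrow> e n \<in> D" "inj_on e ?I" "\<And>x. x \<in> D \<Longrightarrow> x \<notin> e ` ?I \<Longrightarrow> Q x = 0"
    by (rule svd_basis[OF Q(1)], rule that)
  have oQ: "opb \<theta> Q K" by (rule diag_op_opb(1)[OF bQ D(2) Q(2) \<theta>(4)])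
  have "0 \<le> KR" using R lbd_nonneg(1) by (auto simp: sclass_def)
  have "0 \<le> K" by (rule opb_bounded(2)[OF oQ])
  show WQ: "W \<circ> Q \<in> schatten 1"
    by (rule comp_schatten_1[OF bounded_W lbd_W bQ, of K]) (use Q(2) \<theta> in simp_all)
  have sI: "\<exists>L. lbd (1 - \<theta>p) UNIV (singular_value I) L"
  \<comment> \<open>For \<open>\<theta>p = 1\<close> the conjugate reciprocal is 0 and boundedness
    of \<open>I\<close> is enough; the criterion applies to positive reciprocals only.\<close>
  proof (cases "\<theta>p = 1")
    case True
    then show ?thesis using lbd_0_singular_value[OF I(1)] by auto
  next
    case False
    then have pos: "0 < 1 - \<theta>p" using \<theta> by simp
    have "lbd (1 - \<theta>p) UNIV (singular_value I) (cc * ((ca * K) * (cb * KR)))"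
    proof (rule singular_value_criterion[OF I(1) pos])
      show "0 \<le> cc * ((ca * K) * (cb * KR))"
        using cc_nonneg A(2) B(2) \<open>0 \<le> K\<close> \<open>0 \<le> KR\<close> by simp
      fix N :: nat and x y :: "nat \<Rightarrow> 'h" assume xy: "osys {..<N} x" "osys {..<N} y"
      have "lbd (0 + (\<theta> + \<theta>q)) {..<N} (\<lambda>i. cc * (column_norm Q A (x i) * row (y i))) (cc * ((ca * K) * (cb * KR)))"
        by (intro lbd_mult lbd_const lbd_row xy lbd_column_norm[OF A oQ \<theta>(4,5)] cc_nonneg \<theta> add_nonneg_nonneg order_refl)
      moreover have "0 + (\<theta> + \<theta>q) = 1 - \<theta>p" using \<theta>(6) by simp
      ultimately have "lbd (1 - \<theta>p) {..<N} (\<lambda>i. cc * (column_norm Q A (x i) * row (y i))) (cc * ((ca * K) * (cb * KR)))"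
        by simp
      then show "lbd (1 - \<theta>p) {..<N} (\<lambda>i. cmod (cinner (I (x i)) (y i))) (cc * ((ca * K) * (cb * KR)))"
        by (rule lbd_mono) (use pos J_bound[OF bQ] I(2) in simp_all)
    qed
    then show ?thesis by blast
  qed
  then obtain L where L: "lbd (1 - \<theta>p) UNIV (singular_value I) L" by blast
  show IT: "I \<circ> T \<in> schatten 1"
    by (rule comp_schatten_1[OF I(1) L bounded_T, of KT]) (use T(1) \<theta> in \<open>simp_all add: sclass_def\<close>)
  have "((\<lambda>e. cinner ((I \<circ> T) e) e) has_sum op_trace (I \<circ> T)) basis"
    using IT unfolding schatten_1_iff by (intro op_trace_has_sum basis) (elim conjE, assumption)+
  then have tI: "op_trace (I \<circ> T) = \<tau> Q"
    unfolding \<tau>_def by (simp add: I(2) infsumI)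
  \<comment> \<open>In the basis adapted to \<open>Q\<close> only the right singular vectors
    contribute, and the sum becomes the series that \<open>\<tau>_diag_sums\<close> identifies with
    \<open>\<tau> Q\<close>.\<close>
  have "((\<lambda>x. cinner ((W \<circ> Q) x) x) has_sum op_trace (W \<circ> Q)) D"
    using WQ unfolding schatten_1_iff by (intro op_trace_has_sum D(1)) (elim conjE, assumption)+
  moreover have "cinner ((W \<circ> Q) x) x = 0" if "x \<in> D - e ` ?I" for x
    using that D(7)[of x] by (simp add: bounded_op_simps[OF bounded_W])
  ultimately have "((\<lambda>x. cinner ((W \<circ> Q) x) x) has_sum op_trace (W \<circ> Q)) (e ` ?I)"
    using D(5) by (subst has_sum_cong_neutral[where T=D and g="\<lambda>x. cinner ((W \<circ> Q) x) x"]) auto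
  then have "((\<lambda>n. cinner (W (Q (e n))) (e n)) has_sum op_trace (W \<circ> Q)) ?I"
    by (subst (asm) has_sum_reindex[OF D(6)]) (simp add: comp_def)
  then have "((\<lambda>n. cinner (W (Q (e n))) (e n)) has_sum op_trace (W \<circ> Q)) UNIV"
    by (subst has_sum_cong_neutral[where T="?I" and g="\<lambda>n. cinner (W (Q (e n))) (e n)"])
       (auto simp: D(4) bounded_op_simps[OF bounded_W])
  then have "(\<lambda>n. complex_of_real (?s n) * cinner (W (f n)) (e n)) sums op_trace (W \<circ> Q)"
    using has_sum_imp_sums by (simp add: D(4) bounded_op_simps[OF bounded_W] cinner_scaleC_left)
  moreover have "(\<lambda>n. complex_of_real (?s n) * cinner (W (f n)) (e n)) sums \<tau> Q"
    by (rule \<tau>_diag_sums[OF bQ D(2) Q(2) D(3) singular_value_antimono[OF bQ]])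
  ultimately show "op_trace (I \<circ> T) = op_trace (W \<circ> Q)"
    using tI sums_unique2 by metis
qed

end


section \<open>Triple operator integrals of the first kind\<close>

text \<open>The cyclic change of variables moves the matrix factor to the middle and exchanges the
  roles of \<open>j\<close> and \<open>k\<close>; rectangular convergence is symmetric in the two
  indices, so only the matrix has to be transposed.\<close>

lemma haagerup_first_rep_rotate:
  assumes sm3: "spectral_measure M3 E3" and rep: "haagerup_first_rep M1 E1 M2 E2 M3 E3 \<Psi> \<alpha> \<beta> \<gamma>"
  shows "haagerup_rep M2 E2 M3 E3 M1 E1 (\<lambda>x2 x3 x1. \<Psi> x1 x2 x3) \<beta> (\<lambda>k j. \<gamma> j k) \<alpha>"
proof -
  obtain N1 N2 N3 where N: "N1 \<in> null_sets_spec M1 E1" "N2 \<in> null_sets_spec M2 E2" "N3 \<in> null_sets_spec M3 E3"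
    and ds: "\<And>x1 x2 x3. x1 \<in> space M1 - N1 \<Longrightarrow> x2 \<in> space M2 - N2 \<Longrightarrow> x3 \<in> space M3 - N3 \<Longrightarrow>
      double_sums (\<lambda>j k. \<alpha> j x1 * \<beta> k x2 * \<gamma> j k x3) (\<Psi> x1 x2 x3)"
    using rep unfolding haagerup_first_rep_def by blast
  have "double_sums (\<lambda>k j. \<beta> k x2 * \<gamma> j k x3 * \<alpha> j x1) (\<Psi> x1 x2 x3)"
    if "x1 \<in> space M1 - N1" "x2 \<in> space M2 - N2" "x3 \<in> space M3 - N3" for x1 x2 x3
    using double_sums_swap[OF ds[OF that]] by (simp only: mult_ac)
  then show ?thesis
    using rep N Linf_mat_transpose[OF sm3] unfolding haagerup_rep_def haagerup_first_rep_def
    by (intro conjI bexI[of _ N1] bexI[of _ N2] bexI[of _ N3] ballI) auto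
qed

lemma Linf_mat_norm_transpose_le:
  assumes sm: "spectral_measure M E" and b: "b \<in> Linf_mat M E"
  shows "Linf_mat_norm M E (\<lambda>j k. b k j) \<le> Linf_mat_norm M E b"
proof (rule field_le_epsilon)
  fix e :: real assume "0 < e"
  let ?C = "Linf_mat_norm M E b + e"
  have AE: "AE_spec M E (\<lambda>x. mat_bound (\<lambda>j k. b j k x) ?C)" and "0 < ?C"
    using Linf_mat_AE[OF sm b, of ?C] \<open>0 < e\<close> by simp_all
  have "AE_spec M E (\<lambda>x. mat_norm (\<lambda>j k. b k j x) \<le> ?C)"
  proof (rule AE_spec_mono[OF sm AE])
    fix x assume m: "mat_bound (\<lambda>j k. b j k x) ?C"
    show "mat_norm (\<lambda>j k. b k j x) \<le> ?C"
      by (rule mat_norm_le[OF bil_bound_imp_mat_bound[OF bil_bound_transpose[OF mat_bound_imp_bil_bound[OF m]]]])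
         (use \<open>0 < ?C\<close> in simp)
  qed
  then show "Linf_mat_norm M E (\<lambda>j k. b k j) \<le> ?C"
    unfolding Linf_mat_norm_def[of M E "\<lambda>j k. b k j"] esssup_spec_def
    using \<open>0 < ?C\<close> by (intro cInf_lower) (auto intro!: bdd_belowI[of _ 0])
qed

section \<open>Uniqueness of the representing operator\<close>

lemma rank1_predual: "(\<lambda>x. cinner x v *\<^sub>C u) \<in> schatten_predual r"
  using rank1_compact rank1_summable bounded_op_rank1
  by (auto simp: schatten_predual_def schatten_def)

lemma has_haagerup_integral_unique:
  assumes "has_haagerup_integral M1 F1 M2 F2 M3 F3 \<Phi> X Y J" "has_haagerup_integral M1 F1 M2 F2 M3 F3 \<Phi> X Y J'"
  shows "J = J'"
proof
  fix u
  obtain a b c where rep: "haagerup_rep M1 F1 M2 F2 M3 F3 \<Phi> a b c"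
    using assms(1) unfolding has_haagerup_integral_def by blast
  have "cinner (J u) v = cinner (J' u) v" for v
    by (rule double_sums_unique)
       (use assms rep in \<open>unfold has_haagerup_integral_def, blast\<close>)+
  then show "J u = J' u" by (rule cinner_ext_left)
qed

text \<open>Rank one operators lie in the predual for every \<open>r\<close>, and their traces
  against \<open>W\<close> are the values \<open>cinner (W u) v\<close>. The Haagerup integral on
  the other side is unique, so these values are determined.\<close>

lemma has_first_kind_integral_unique:
  assumes W: "has_first_kind_integral M1 E1 M2 E2 M3 E3 \<Psi> r T R W"
    and W': "has_first_kind_integral M1 E1 M2 E2 M3 E3 \<Psi> r T R W'"
  shows "W = W'"
proof
  fix u
  have "cinner (W u) v = cinner (W' u) v" for v
  proof -
    let ?Q = "\<lambda>x. cinner x v *\<^sub>C u"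
    obtain J where J: "has_haagerup_integral M2 E2 M3 E3 M1 E1 (\<lambda>x2 x3 x1. \<Psi> x1 x2 x3) R ?Q J"
      "op_trace (J \<circ> T) = op_trace (W \<circ> ?Q)"
      using W rank1_predual[of v u r] unfolding has_first_kind_integral_def by blast
    obtain J' where J': "has_haagerup_integral M2 E2 M3 E3 M1 E1 (\<lambda>x2 x3 x1. \<Psi> x1 x2 x3) R ?Q J'"
      "op_trace (J' \<circ> T) = op_trace (W' \<circ> ?Q)"
      using W' rank1_predual[of v u r] unfolding has_first_kind_integral_def by blast
    have "J = J'" by (rule has_haagerup_integral_unique[OF J(1) J'(1)])
    then have "op_trace (W \<circ> ?Q) = op_trace (W' \<circ> ?Q)" using J(2) J'(2) by simp
    moreover have "A \<circ> ?Q = (\<lambda>x. cinner x v *\<^sub>C A u)" if "bounded_op A" for A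
      by (rule ext) (simp add: bounded_op_simps[OF that])
    moreover have "bounded_op W" "bounded_op W'" using W W' by (simp_all add: has_first_kind_integral_def)
    ultimately show ?thesis by (simp only: op_trace_rank1)
  qed
  then show "W u = W' u" by (rule cinner_ext_left)
qed

section \<open>Conversion of exponents, existence and the norm estimate\<close>

lemma enn2real_one_minus:
  assumes "x < 1"
  shows "enn2real (1 - x) = 1 - enn2real x"
proof (cases x rule: ennreal_cases)
  case (real a)
  then have "a < 1" using assms by simp
  have "1 - x = ennreal (1 - a)"
    using ennreal_minus[OF real(1), of 1] real(2) by simp
  then show ?thesis using real \<open>a < 1\<close> by simp
qed (use assms in simp)

text \<open>For \<open>r = 1\<close> the reciprocal is 0 and the bound carries no decay, so
  compactness comes from the definition of the predual. Otherwise \<open>1 - 1 / r > 0\<close>, and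
  a positive reciprocal forces compactness.\<close>

lemma schatten_predual_lbd:
  assumes "Q \<in> schatten_predual r" and r: "enn2real (1 / r) \<le> 1" "1 / r \<le> 1" "r \<noteq> \<infinity>"
  shows "compact_op Q \<and> (\<exists>K. lbd (1 - enn2real (1 / r)) UNIV (singular_value Q) K)"
proof (cases "r = 1")
  case True
  then have "compact_op Q" using assms(1) by (simp add: schatten_predual_def)
  moreover from this have "lbd 0 UNIV (singular_value Q) (onorm Q)"
    by (intro lbd_0_singular_value) (simp add: compact_op_def)
  ultimately show ?thesis using True by auto
next
  case False
  let ?s = "1 / (1 - 1 / r)"
  have Q: "Q \<in> schatten ?s" using assms(1) False by (simp add: schatten_predual_def)
  have "1 / r \<noteq> 1"
  proof
    assume "1 / r = 1"
    then have "1 / (1 / r) = 1" by simp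
    then show False using False by (simp only: one_divide_one_divide_ennreal)
  qed
  then have lt: "1 / r < 1" using r(2) by simp
  have eq: "1 / ?s = 1 - 1 / r" by (rule one_divide_one_divide_ennreal)
  have \<theta>: "enn2real (1 / ?s) = 1 - enn2real (1 / r)"
    unfolding eq by (rule enn2real_one_minus[OF lt])
  have "0 < ?s" by (simp add: diff_less_top_ennreal ennreal_zero_less_divide)
  have s: "sclass (1 - enn2real (1 / r)) Q (schatten_norm ?s Q)"
    using schatten_sclass[OF Q \<open>0 < ?s\<close>] unfolding \<theta> .
  have "enn2real (1 / r) < 1"
    using lt enn2real_less_iff[of "1 / r" 1] less_trans[OF lt ennreal_one_less_top] by simp
  then have "compact_op Q" by (intro sclass_compact[OF s]) simp
  then show ?thesis using s by (auto simp: sclass_def)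
qed

text \<open>The summand \<open>e\<close> serves two ends: a constant strictly above an essential
  supremum is a bound almost everywhere, and the constants of the locale become positive even if a
  norm vanishes.\<close>

lemma first_kind_integral_representation:
  fixes M1 :: "'x1 measure" and E1 :: "'x1 set \<Rightarrow> 'h::chilbert_space \<Rightarrow> 'h"
    and M2 :: "'x2 measure" and E2 :: "'x2 set \<Rightarrow> 'h \<Rightarrow> 'h"
    and M3 :: "'x3 measure" and E3 :: "'x3 set \<Rightarrow> 'h \<Rightarrow> 'h"
    and \<Psi> :: "'x1 \<Rightarrow> 'x2 \<Rightarrow> 'x3 \<Rightarrow> complex" and T R :: "'h \<Rightarrow> 'h" and p q r :: ennreal
  assumes sm: "spectral_measure M1 E1" "spectral_measure M2 E2" "spectral_measure M3 E3"
    and rep: "haagerup_first_rep M1 E1 M2 E2 M3 E3 \<Psi> \<alpha> \<beta> \<gamma>"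
    and exps: "0 < p" "2 \<le> q" "1 / r = 1 / p + 1 / q" "1 / 2 \<le> 1 / r" "1 / r \<le> 1"
    and T: "T \<in> schatten p" and R: "R \<in> schatten q" and "0 < e"
  shows "\<exists>W. has_first_kind_integral M1 E1 M2 E2 M3 E3 \<Psi> r T R W \<and> W \<in> schatten r \<and>
    schatten_norm r W \<le> (Linf_ell2_norm M1 E1 \<alpha> + e) * (Linf_ell2_norm M2 E2 \<beta> + e) *
      (Linf_mat_norm M3 E3 \<gamma> + e) * (schatten_norm p T + e) * (schatten_norm q R + e)"
proof -
  define \<theta>p where "\<theta>p = enn2real (1 / p)"
  define \<theta>q where "\<theta>q = enn2real (1 / q)"
  define \<theta>r where "\<theta>r = enn2real (1 / r)"
  have fin: "1 / r < top" using exps(5) ennreal_one_less_top by (rule le_less_trans)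
  then have fin': "1 / p < top" "1 / q < top" unfolding exps(3) by simp_all
  have sum: "\<theta>r = \<theta>p + \<theta>q"
    unfolding \<theta>r_def \<theta>p_def \<theta>q_def exps(3) by (rule enn2real_plus[OF fin'])
  have \<theta>r1: "\<theta>r \<le> 1" unfolding \<theta>r_def using enn2real_mono[OF exps(5)] by simp
  have half': "1 / 2 = ennreal (1 / 2)"
    using divide_ennreal[of 1 2] by simp
  have half: "enn2real (1 / 2) = 1 / 2" unfolding half' by (rule enn2real_ennreal) simp
  have \<theta>r2: "1 / 2 \<le> \<theta>r"
    unfolding \<theta>r_def half[symmetric] by (rule enn2real_mono[OF exps(4) fin])
  have \<theta>q2: "\<theta>q \<le> 1 / 2"
  proof (cases q rule: ennreal_cases)
    case (real a)
    then have "2 \<le> a" using exps(2) by (simp flip: ennreal_numeral)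
    then have "1 / q = ennreal (1 / a)" using divide_ennreal[of 1 a] real by simp
    then show ?thesis using \<open>2 \<le> a\<close> by (simp add: \<theta>q_def field_simps)
  qed (simp add: \<theta>q_def)
  have r0: "0 < r"
  proof (rule ccontr)
    assume "\<not> 0 < r"
    then have "1 / r = top" by simp
    then show False using fin by simp
  qed
  have r_fin: "r < \<infinity>"
  proof (rule ccontr)
    assume "\<not> r < \<infinity>"
    then have "r = top" by (cases r rule: ennreal_cases) auto
    then have "\<theta>r = 0" by (simp add: \<theta>r_def)
    then show False using \<theta>r2 by simp
  qed
  have q0: "0 < q" using exps(2) by (rule less_le_trans[rotated]) simp
  let ?ca = "Linf_ell2_norm M1 E1 \<alpha> + e" and ?cb = "Linf_ell2_norm M2 E2 \<beta> + e"
    and ?cc = "Linf_mat_norm M3 E3 \<gamma> + e" and ?KT = "schatten_norm p T + e" and ?KR = "schatten_norm q R + e"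
  let ?A = "\<lambda>j. spec_integral M1 E1 (\<alpha> j)" and ?B = "\<lambda>k. spec_integral M2 E2 (\<beta> k)"
    \<comment> \<open>The indices are transposed to match the rotated representation.\<close>
    and ?G = "\<lambda>k j. spec_integral M3 E3 (\<gamma> j k)"
  have L: "\<alpha> \<in> Linf_ell2 M1 E1" "\<beta> \<in> Linf_ell2 M2 E2" "\<gamma> \<in> Linf_mat M3 E3"
    using rep by (simp_all add: haagerup_first_rep_def)
  have sT: "sclass \<theta>p T (schatten_norm p T)" unfolding \<theta>p_def by (rule schatten_sclass[OF T exps(1)])
  have sR: "sclass \<theta>q R (schatten_norm q R)" unfolding \<theta>q_def by (rule schatten_sclass[OF R q0])
  have \<theta>0: "0 \<le> \<theta>p" "0 \<le> \<theta>q" by (simp_all add: \<theta>p_def \<theta>q_def)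
  interpret tf: trace_functional ?A ?B ?G R T ?ca ?cb ?cc \<theta>p \<theta>q "1 - \<theta>r" ?KT ?KR
  proof
    show "column_bound ?A ?ca" "column_bound ?B ?cb"
      using \<open>0 < e\<close> by (simp_all add: Linf_ell2_column_bound sm L)
    show "0 < ?ca" "0 < ?cb"
      using Linf_ell2_norm_nonneg[OF sm(1) L(1)] Linf_ell2_norm_nonneg[OF sm(2) L(2)] \<open>0 < e\<close> by simp_all
    show "opmat_bound ?G ?cc"
      using Linf_mat_norm_transpose_le[OF sm(3) L(3)] \<open>0 < e\<close>
      by (intro Linf_mat_opmat_bound[OF sm(3) Linf_mat_transpose[OF sm(3) L(3)]]) simp
    show "sclass \<theta>p T ?KT" by (rule sclass_mono[OF sT \<theta>0(1)]) (use \<open>0 < e\<close> in simp)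
    show "sclass \<theta>q R ?KR" by (rule sclass_mono[OF sR \<theta>0(2)]) (use \<open>0 < e\<close> in simp)
    show "0 < ?KT" using sT lbd_nonneg(1) \<open>0 < e\<close> unfolding sclass_def by (metis add_nonneg_pos)
  qed (use \<theta>0 \<theta>q2 \<theta>r1 \<theta>r2 sum in simp_all)
  note repT = haagerup_first_rep_rotate[OF sm(3) rep]
  have "has_first_kind_integral M1 E1 M2 E2 M3 E3 \<Psi> r T R tf.W"
    unfolding has_first_kind_integral_def
  proof (intro conjI ballI tf.bounded_W)
    fix Q :: "'h \<Rightarrow> 'h" assume Q: "Q \<in> schatten_predual r"
    obtain K where K: "compact_op Q" "lbd (1 - \<theta>r) UNIV (singular_value Q) K"
      using schatten_predual_lbd[OF Q] \<theta>r1 exps(5) r_fin unfolding \<theta>r_def by auto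
    then have bQ: "bounded_op Q" by (simp add: compact_op_def)
    obtain J where J: "has_haagerup_integral M2 E2 M3 E3 M1 E1 (\<lambda>x2 x3 x1. \<Psi> x1 x2 x3) R Q J"
      and "\<forall>u v. cinner (J u) v = jform ?A ?B ?G R Q u v"
      using has_haagerup_integral_series[OF sm(2,3,1) repT tf.bounded_R bQ] unfolding jform_def by (elim exE conjE)
    then have Jv: "cinner (J u) v = jform ?A ?B ?G R Q u v" for u v by simp
    have "bounded_op J" using J by (simp add: has_haagerup_integral_def)
    from tf.trace_identity[OF K this Jv] J
    show "\<exists>J. has_haagerup_integral M2 E2 M3 E3 M1 E1 (\<lambda>x2 x3 x1. \<Psi> x1 x2 x3) R Q J \<and>
      J \<circ> T \<in> schatten 1 \<and> tf.W \<circ> Q \<in> schatten 1 \<and> op_trace (J \<circ> T) = op_trace (tf.W \<circ> Q)"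
      by (intro exI[of _ J] conjI)
  qed
  moreover have "lbd (enn2real (1 / r)) UNIV (singular_value tf.W) tf.C0"
    using tf.lbd_W by (simp add: \<theta>r_def)
  note lbd_schatten[OF tf.bounded_W this r0 r_fin]
  moreover have "tf.C0 = ?ca * ?cb * ?cc * ?KT * ?KR" by (simp only: tf.C0_def mult_ac)
  ultimately show ?thesis by (intro exI[of _ tf.W] conjI) simp_all
qed

theorem theorem5p1:
  fixes M1 :: "'x1 measure" and E1 :: "'x1 set \<Rightarrow> 'h::chilbert_space \<Rightarrow> 'h"
    and M2 :: "'x2 measure" and E2 :: "'x2 set \<Rightarrow> 'h \<Rightarrow> 'h"
    and M3 :: "'x3 measure" and E3 :: "'x3 set \<Rightarrow> 'h \<Rightarrow> 'h"
    and \<Psi> :: "'x1 \<Rightarrow> 'x2 \<Rightarrow> 'x3 \<Rightarrow> complex"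
    and T R :: "'h \<Rightarrow> 'h" and p q r :: ennreal
  assumes "spectral_measure M1 E1" and "spectral_measure M2 E2" and "spectral_measure M3 E3"
    and "\<Psi> \<in> haagerup_first M1 E1 M2 E2 M3 E3"
    and "0 < p" and "2 \<le> q" and "1 / r = 1 / p + 1 / q" and "1 / 2 \<le> 1 / r" and "1 / r \<le> 1"
    and "T \<in> schatten p" and "R \<in> schatten q"
  shows "(\<exists>!W. has_first_kind_integral M1 E1 M2 E2 M3 E3 \<Psi> r T R W) \<and>
    first_kind_integral M1 E1 M2 E2 M3 E3 \<Psi> r T R \<in> schatten r \<and>
    schatten_norm r (first_kind_integral M1 E1 M2 E2 M3 E3 \<Psi> r T R)
      \<le> haagerup_first_norm M1 E1 M2 E2 M3 E3 \<Psi> * schatten_norm p T * schatten_norm q R"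
proof -
  let ?I = "has_first_kind_integral M1 E1 M2 E2 M3 E3 \<Psi> r T R"
  let ?n = "\<lambda>\<alpha> \<beta> \<gamma>. Linf_ell2_norm M1 E1 \<alpha> * Linf_ell2_norm M2 E2 \<beta> * Linf_mat_norm M3 E3 \<gamma>"
  let ?t = "schatten_norm p T * schatten_norm q R"
  note main = first_kind_integral_representation[OF assms(1-3) _ assms(5-11)]
  obtain \<alpha>0 \<beta>0 \<gamma>0 where rep0: "haagerup_first_rep M1 E1 M2 E2 M3 E3 \<Psi> \<alpha>0 \<beta>0 \<gamma>0"
    using assms(4) by (auto simp: haagerup_first_def)
  obtain W where W: "?I W" "W \<in> schatten r" using main[OF rep0 zero_less_one] by blast
  have uniq: "W' = W" if "?I W'" for W' by (rule has_first_kind_integral_unique[OF that W(1)])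
  have fk: "first_kind_integral M1 E1 M2 E2 M3 E3 \<Psi> r T R = W"
    unfolding first_kind_integral_def by (intro the_equality W(1)) (rule uniq)
  \<comment> \<open>By uniqueness every representation of \<open>\<Psi>\<close> and every
    \<open>e\<close> produce the same \<open>W\<close>, so all the resulting bounds hold for
    it.\<close>
  have le: "schatten_norm r W \<le> ?n \<alpha> \<beta> \<gamma> * ?t"
    if rep: "haagerup_first_rep M1 E1 M2 E2 M3 E3 \<Psi> \<alpha> \<beta> \<gamma>" for \<alpha> \<beta> \<gamma>
  proof (rule le_at_right_0_limit)
    let ?f = "\<lambda>e. (Linf_ell2_norm M1 E1 \<alpha> + e) * (Linf_ell2_norm M2 E2 \<beta> + e) *
      (Linf_mat_norm M3 E3 \<gamma> + e) * (schatten_norm p T + e) * (schatten_norm q R + e)"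
    have "(?f \<longlongrightarrow> (Linf_ell2_norm M1 E1 \<alpha> + 0) * (Linf_ell2_norm M2 E2 \<beta> + 0) *
      (Linf_mat_norm M3 E3 \<gamma> + 0) * (schatten_norm p T + 0) * (schatten_norm q R + 0)) (at_right 0)"
      by (intro tendsto_intros)
    then show "(?f \<longlongrightarrow> ?n \<alpha> \<beta> \<gamma> * ?t) (at_right 0)" by (simp add: mult.assoc)
    show "schatten_norm r W \<le> ?f e" if "0 < e" for e
      using main[OF rep that] uniq by blast
  qed
  have "0 < q" using assms(6) by (rule less_le_trans[rotated]) simp
  have t0: "0 \<le> ?t"
    using schatten_sclass[OF assms(10,5)] schatten_sclass[OF assms(11) \<open>0 < q\<close>]
    by (intro mult_nonneg_nonneg) (auto simp: sclass_def dest: lbd_nonneg(1))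
  let ?S = "{?n \<alpha> \<beta> \<gamma> | \<alpha> \<beta> \<gamma>. haagerup_first_rep M1 E1 M2 E2 M3 E3 \<Psi> \<alpha> \<beta> \<gamma>}"
  have "schatten_norm r W \<le> haagerup_first_norm M1 E1 M2 E2 M3 E3 \<Psi> * ?t"
  \<comment> \<open>Dividing by \<open>?t\<close> allows passing to the infimum over
    representations; for \<open>?t = 0\<close> a single representation already gives the bound
    0.\<close>
  proof (cases "?t = 0")
    case True
    then show ?thesis using le[OF rep0] by (simp only: mult_zero_right)
  next
    case False
    with t0 have "0 < ?t" by (metis order_le_less)
    have "schatten_norm r W / ?t \<le> haagerup_first_norm M1 E1 M2 E2 M3 E3 \<Psi>"
      unfolding haagerup_first_norm_def
    proof (rule cInf_greatest)
      show "?S \<noteq> {}" using rep0 by blast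
      fix s assume "s \<in> ?S"
      then obtain \<alpha> \<beta> \<gamma> where s: "s = ?n \<alpha> \<beta> \<gamma>" "haagerup_first_rep M1 E1 M2 E2 M3 E3 \<Psi> \<alpha> \<beta> \<gamma>" by blast
      show "schatten_norm r W / ?t \<le> s"
        using le[OF s(2)] \<open>0 < ?t\<close> unfolding s(1) by (simp only: pos_divide_le_eq)
    qed
    then show ?thesis using \<open>0 < ?t\<close> by (simp only: pos_divide_le_eq)
  qed
  then show ?thesis
    unfolding fk mult.assoc[of _ "schatten_norm p T"] using W(2) ex1I[of ?I, OF W(1) uniq] by (intro conjI)
qed

end
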